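(* Let $G$ be a compact Lie group, let $X$ be a normalized left-invariant vector field on $G$, and let $\mathbb{T}=\mathbb{R}/2\pi\mathbb{Z}$. Let $p_0,\delta\in\mathbb{R}$, $\alpha\in\mathbb{C}\setminus\{0\}$, and $q,s\in C^\infty(\mathbb{T};\mathbb{R})$ with $q\ge 0$ and $q\not\equiv 0$. Let $P:C^\infty(\mathbb{T}\times G)\to C^\infty(\mathbb{T}\times G)$ be the operator $$Pu=\partial_t u-p_0Xu-(s(t)+i\delta q(t))u-\alpha q(t)\overline{u}.$$ Put $$s_0=\int_0^{2\pi}s(\tau)\,d\tau,\quad q_0=\int_0^{2\pi}q(\tau)\,d\tau,\quad A_0=s_0+i\delta q_0,\quad B_0=\alpha q_0.$$ For $[\xi]\in\widehat{G}$, $1\le m\le d_\xi$ and $k\in\mathbb{Z}$, say that $([\xi],m,k)$ is resonant if $$\operatorname{Re}\bigl(A_0(k+\mu_m(\xi)p_0)\bigr)=0\quad\text{and}\quad 4\pi^2|k+\mu_m(\xi)p_0|^2=|A_0|^2-|B_0|^2.$$ Suppose that one of the following conditions holds: (1) $|B_0|>|A_0|$; (2) $|B_0|\le|A_0|$, $|\alpha|>|\delta|$, and for all $[\xi]\in\widehat{G}$ and $1\le m\le d_\xi$ there is no $k\in\mathbb{Z}$ such that $([\xi],m,k)$ is resonant; (3) $|\alpha|<|\delta|$ and $s_0\neq 0$; (4) $|\alpha|<|\delta|$, $s_0=0$, for all $[\xi]\in\widehat{G}$ and $1\le m\le d_\xi$ there is no $k\in\mathbb{Z}$ such that $([\xi],m,k)$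 is resonant, and the following Diophantine condition holds: there exists $M>0$ such that for all $[\xi]\in\widehat{G}$ with $\langle\xi\rangle\ge M$, all $1\le m\le d_\xi$ and all $k\in\mathbb{Z}$, $$\left|2\pi k+2\pi\mu_m(\xi)p_0-q_0\sqrt{\delta^2-|\alpha|^2}\right|\ge\langle\xi\rangle^{-M}.$$ Then, for every $f\in C^\infty(\mathbb{T}\times G)$, there exists $u\in C^\infty(\mathbb{T}\times G)$ such that $Pu=f$.
   Context: Functions are complex valued unless indicated otherwise. $\widehat{G}$ is the unitary dual of $G$, i.e. the set of equivalence classes $[\xi]$ of continuous irreducible unitary representations $\xi:G\to\mathbb{C}^{d_\xi\times d_\xi}$, where $d_\xi=\dim\xi$. For $X$ in the Lie algebra $\mathfrak{g}$ of $G$, the left-invariant vector field acts by $(Xf)(x)=\frac{d}{dt}\big|_{t=0}f(x\exp(tX))$, and on $\mathbb{T}\times G$ it acts in the $G$-variable. Its symbol is the matrix $\sigma_X(\xi)=\xi(x)^*(X\xi)(x)$ (independent of $x$), with $X$ applied entrywise. In each class $[\xi]$ a representative is fixed for which $\sigma_X(\xi)=\operatorname{diag}(i\mu_1(\xi),\dots,i\mu_{d_\xi}(\xi))$ with $\mu_m(\xi)\in\mathbb{R}$; the numbers $\mu_m(\xi)$ depend only on the class $[\xi]$. The vector field is normalized: $\|X\|=1$, where $\|\cdot\|$ is the norm induced by the Killing form; one has the standard estimate $|\mu_m(\xi)|\le\|X\|\langle\xi\rangle$. Let $\mathcal{L}_G$ be the Laplace–Beltrami operator of $G$; all matrix coefficients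 of $\xi$ satisfy $-\mathcal{L}_G\xi_{ij}=\nu_{[\xi]}\xi_{ij}$ with a common $\nu_{[\xi]}\ge 0$, and $\langle\xi\rangle:=(1+\nu_{[\xi]})^{1/2}$. *)

theory Defs
  imports
    "HOL-Analysis.Analysis"
    "HOL-Algebra.Group"
    "HOL-Library.Function_Algebras"
    "Jordan_Normal_Form.Schur_Decomposition"
begin

instantiation "fun" :: (type, real_vector) real_vector
begin

definition scaleR_fun :: "real \<Rightarrow> ('a \<Rightarrow> 'b) \<Rightarrow> 'a \<Rightarrow> 'b"
  where "scaleR_fun r f = (\<lambda>x. r *\<^sub>R f x)"

instance
  by standard (auto simp: scaleR_fun_def fun_eq_iff algebra_simps)

end


section \<open>Smooth maps between manifolds\<close>

text \<open>The set \<^term>\<open>S\<close> is meant to be open.\<close>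

primrec Ck_on :: "nat \<Rightarrow> 'a::real_normed_vector set \<Rightarrow> ('a \<Rightarrow> 'b::real_normed_vector) \<Rightarrow> bool" where
  "Ck_on 0 S f \<longleftrightarrow> continuous_on S f"
| "Ck_on (Suc n) S f \<longleftrightarrow> (\<forall>x\<in>S. f differentiable (at x)) \<and>
     (\<forall>v. Ck_on n S (\<lambda>x. frechet_derivative f (at x) v))"

definition smooth_on :: "'a::real_normed_vector set \<Rightarrow> ('a \<Rightarrow> 'b::real_normed_vector) \<Rightarrow> bool"
  where "smooth_on S f \<longleftrightarrow> (\<forall>n. Ck_on n S f)"

text \<open>A chart is a pair of an open domain and a coordinate map, of which only the values on the
  domain matter.\<close>

type_synonym ('g, 'e) atlas = "('g set \<times> ('g \<Rightarrow> 'e)) set"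

definition smooth_atlas :: "('g::topological_space, 'e::euclidean_space) atlas \<Rightarrow> bool" where
  "smooth_atlas A \<longleftrightarrow>
     (\<Union>(U, \<phi>)\<in>A. U) = UNIV \<and>
     (\<forall>(U, \<phi>)\<in>A. open U \<and> open (\<phi> ` U) \<and> homeomorphism U (\<phi> ` U) \<phi> (inv_into U \<phi>)) \<and>
     (\<forall>(U, \<phi>)\<in>A. \<forall>(V, \<psi>)\<in>A. smooth_on (\<phi> ` (U \<inter> V)) (\<psi> \<circ> inv_into U \<phi>))"

definition std_atlas :: "('e, 'e::euclidean_space) atlas"
  where "std_atlas = {(UNIV, id)}"

definition prod_atlas :: "('g, 'e) atlas \<Rightarrow> ('h, 'f) atlas \<Rightarrow> ('g \<times> 'h, 'e \<times> 'f) atlas"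
  where "prod_atlas A B = {(U \<times> V, map_prod \<phi> \<psi>) | U \<phi> V \<psi>. (U, \<phi>) \<in> A \<and> (V, \<psi>) \<in> B}"

definition smooth_map ::
  "('g::topological_space, 'e::euclidean_space) atlas \<Rightarrow>
   ('h::topological_space, 'f::euclidean_space) atlas \<Rightarrow> ('g \<Rightarrow> 'h) \<Rightarrow> bool" where
  "smooth_map A B f \<longleftrightarrow> continuous_on UNIV f \<and>
     (\<forall>(U, \<phi>)\<in>A. \<forall>(V, \<psi>)\<in>B. smooth_on (\<phi> ` (U \<inter> f -` V)) (\<psi> \<circ> f \<circ> inv_into U \<phi>))"

definition smooth_functions ::
  "('g::topological_space, 'e::euclidean_space) atlas \<Rightarrow> ('g \<Rightarrow> complex) set"
  where "smooth_functions A = {f. smooth_map A std_atlas f}"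

text \<open>Functions on the circle \<open>\<real>/2\<pi>\<int>\<close> are \<open>2\<pi>\<close>-periodic functions of a real variable.\<close>

definition smooth_circle :: "(real \<Rightarrow> real) set"
  where "smooth_circle = {f. smooth_on UNIV f \<and> (\<forall>t. f (t + 2 * pi) = f t)}"

definition smooth_circle_times ::
  "('g::topological_space, 'e::euclidean_space) atlas \<Rightarrow> (real \<times> 'g \<Rightarrow> complex) set" where
  "smooth_circle_times A =
     {u. smooth_map (prod_atlas (std_atlas :: (real, real) atlas) A) std_atlas u \<and>
         (\<forall>t x. u (t + 2 * pi, x) = u (t, x))}"


section \<open>Compact Lie groups and their Lie algebra\<close>

text \<open>A Lie group of dimension zero is not covered, the model space being a Euclidean space; it has
  no unit vector field.\<close>

locale compact_lie_group = group G
  for G :: "'g::t2_space monoid" (structure) +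
  fixes A :: "('g, 'e::euclidean_space) atlas"
  assumes carrier_UNIV: "carrier G = UNIV"
    and compact_UNIV: "compact (UNIV :: 'g set)"
    and atlas: "smooth_atlas A"
    and smooth_mult: "smooth_map (prod_atlas A A) A (\<lambda>(x, y). x \<otimes> y)"
    and smooth_inv: "smooth_map A A (\<lambda>x. inv x)"

definition one_parameter_subgroup ::
  "'g::topological_space monoid \<Rightarrow> ('g, 'e::euclidean_space) atlas \<Rightarrow> (real \<Rightarrow> 'g) \<Rightarrow> bool" where
  "one_parameter_subgroup G A \<gamma> \<longleftrightarrow>
     smooth_map (std_atlas :: (real, real) atlas) A \<gamma> \<and> (\<forall>s t. \<gamma> (s + t) = \<gamma> s \<otimes>\<^bsub>G\<^esub> \<gamma> t)"

text \<open>Vector fields are operators on smooth functions, extended by zero to all functions so that they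
  are equal as soon as they agree on smooth functions.\<close>

type_synonym 'g vf = "('g \<Rightarrow> complex) \<Rightarrow> 'g \<Rightarrow> complex"

text \<open>For \<open>\<gamma> t = exp (t X)\<close> this is the action of \<open>X\<close>. Every one-parameter subgroup is of this
  form for exactly one \<open>X\<close>.\<close>

definition left_invariant_vf ::
  "'g::topological_space monoid \<Rightarrow> ('g, 'e::euclidean_space) atlas \<Rightarrow> (real \<Rightarrow> 'g) \<Rightarrow> 'g vf" where
  "left_invariant_vf G A \<gamma> f x =
     (if f \<in> smooth_functions A then vector_derivative (\<lambda>t. f (x \<otimes>\<^bsub>G\<^esub> \<gamma> t)) (at 0) else 0)"

definition lie_algebra ::
  "'g::topological_space monoid \<Rightarrow> ('g, 'e::euclidean_space) atlas \<Rightarrow> 'g vf set"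
  where "lie_algebra G A = {left_invariant_vf G A \<gamma> | \<gamma>. one_parameter_subgroup G A \<gamma>}"

definition bracket :: "'g vf \<Rightarrow> 'g vf \<Rightarrow> 'g vf"
  where "bracket X Y f x = X (Y f) x - Y (X f) x"

text \<open>For \<open>X\<close> generating \<open>\<gamma>\<close>, the adjoint action yields the generator of \<open>g \<gamma> g\<^sup>-\<^sup>1\<close>.\<close>

definition Ad :: "'g monoid \<Rightarrow> 'g \<Rightarrow> 'g vf \<Rightarrow> 'g vf"
  where "Ad G g X f x = X (\<lambda>y. f (y \<otimes>\<^bsub>G\<^esub> inv\<^bsub>G\<^esub> g)) (x \<otimes>\<^bsub>G\<^esub> g)"

definition is_basis :: "'v::real_vector set \<Rightarrow> 'v set \<Rightarrow> bool"
  where "is_basis V B \<longleftrightarrow> B \<subseteq> V \<and> independent B \<and> V \<subseteq> span B"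

text \<open>Trace of an endomorphism of a finite-dimensional subspace \<^term>\<open>V\<close>; the choice of basis is
  immaterial.\<close>

definition trace_on :: "'v::real_vector set \<Rightarrow> ('v \<Rightarrow> 'v) \<Rightarrow> real" where
  "trace_on V T = (let B = (SOME B. is_basis V B) in \<Sum>b\<in>B. representation B (T b) b)"

definition killing_form ::
  "'g::topological_space monoid \<Rightarrow> ('g, 'e::euclidean_space) atlas \<Rightarrow> 'g vf \<Rightarrow> 'g vf \<Rightarrow> real"
  where "killing_form G A X Y = trace_on (lie_algebra G A) (\<lambda>Z. bracket X (bracket Y Z))"

text \<open>The inner product on the Lie algebra induced by the Killing form. If the Lie algebra is
  semisimple, the last condition forces it to be the negative of the Killing form. In general the
  Killing form vanishes on the centre, where the inner product is an arbitrary invariant one.\<close>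

definition killing_inner_product ::
  "'g::topological_space monoid \<Rightarrow> ('g, 'e::euclidean_space) atlas \<Rightarrow>
   ('g vf \<Rightarrow> 'g vf \<Rightarrow> real) \<Rightarrow> bool" where
  "killing_inner_product G A ip \<longleftrightarrow>
     (\<forall>X\<in>lie_algebra G A. \<forall>Y\<in>lie_algebra G A. ip X Y = ip Y X) \<and>
     (\<forall>X\<in>lie_algebra G A. \<forall>Y\<in>lie_algebra G A. \<forall>Z\<in>lie_algebra G A.
        ip (X + Y) Z = ip X Z + ip Y Z) \<and>
     (\<forall>r. \<forall>X\<in>lie_algebra G A. \<forall>Y\<in>lie_algebra G A. ip (r *\<^sub>R X) Y = r * ip X Y) \<and>
     (\<forall>X\<in>lie_algebra G A. X \<noteq> 0 \<longrightarrow> ip X X > 0) \<and>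
     (\<forall>g\<in>carrier G. \<forall>X\<in>lie_algebra G A. \<forall>Y\<in>lie_algebra G A.
        ip (Ad G g X) (Ad G g Y) = ip X Y) \<and>
     (\<forall>X\<in>lie_algebra G A. \<forall>Y\<in>lie_algebra G A. \<forall>Z\<in>lie_algebra G A.
        ip X (bracket Y Z) = - killing_form G A X (bracket Y Z))"

definition vf_norm :: "('g vf \<Rightarrow> 'g vf \<Rightarrow> real) \<Rightarrow> 'g vf \<Rightarrow> real"
  where "vf_norm ip X = sqrt (ip X X)"

text \<open>The Laplace-Beltrami operator of the bi-invariant Riemannian metric given by \<^term>\<open>ip\<close>. The
  gradient is \<open>\<Sum>E. (E f) E\<close> over an orthonormal basis of left-invariant fields; these are free of
  divergence because the Riemannian measure is a Haar measure, and so the divergence of the gradient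
  is \<open>\<Sum>E. E (E f)\<close>. It does not depend on the basis.\<close>

definition orthonormal_basis ::
  "('v::real_vector \<Rightarrow> 'v \<Rightarrow> real) \<Rightarrow> 'v set \<Rightarrow> 'v set \<Rightarrow> bool" where
  "orthonormal_basis ip V B \<longleftrightarrow> is_basis V B \<and>
     (\<forall>E\<in>B. \<forall>F\<in>B. ip E F = (if E = F then 1 else 0))"

definition laplace_beltrami ::
  "'g::topological_space monoid \<Rightarrow> ('g, 'e::euclidean_space) atlas \<Rightarrow>
   ('g vf \<Rightarrow> 'g vf \<Rightarrow> real) \<Rightarrow> ('g \<Rightarrow> complex) \<Rightarrow> 'g \<Rightarrow> complex" where
  "laplace_beltrami G A ip f x =
     (let B = (SOME B. orthonormal_basis ip (lie_algebra G A) B) in \<Sum>E\<in>B. E (E f) x)"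


section \<open>The unitary dual\<close>

type_synonym 'g rep = "'g \<Rightarrow> complex mat"

definition unitary_rep :: "'g::topological_space monoid \<Rightarrow> nat \<Rightarrow> 'g rep \<Rightarrow> bool" where
  "unitary_rep G d \<xi> \<longleftrightarrow>
     (\<forall>x\<in>carrier G. \<xi> x \<in> carrier_mat d d \<and> mat_adjoint (\<xi> x) * \<xi> x = 1\<^sub>m d) \<and>
     (\<forall>x\<in>carrier G. \<forall>y\<in>carrier G. \<xi> (x \<otimes>\<^bsub>G\<^esub> y) = \<xi> x * \<xi> y) \<and>
     (\<forall>i<d. \<forall>j<d. continuous_on (carrier G) (\<lambda>x. \<xi> x $$ (i, j)))"

definition invariant_subspace :: "'g monoid \<Rightarrow> nat \<Rightarrow> 'g rep \<Rightarrow> complex Matrix.vec set \<Rightarrow> bool" where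
  "invariant_subspace G d \<xi> W \<longleftrightarrow>
     W \<subseteq> carrier_vec d \<and> 0\<^sub>v d \<in> W \<and>
     (\<forall>v\<in>W. \<forall>w\<in>W. v + w \<in> W) \<and> (\<forall>c. \<forall>w\<in>W. c \<cdot>\<^sub>v w \<in> W) \<and>
     (\<forall>x\<in>carrier G. \<forall>w\<in>W. \<xi> x *\<^sub>v w \<in> W)"

definition irreducible_unitary_rep :: "'g::topological_space monoid \<Rightarrow> nat \<Rightarrow> 'g rep \<Rightarrow> bool" where
  "irreducible_unitary_rep G d \<xi> \<longleftrightarrow> d \<ge> 1 \<and> unitary_rep G d \<xi> \<and>
     (\<forall>W. invariant_subspace G d \<xi> W \<longrightarrow> W = {0\<^sub>v d} \<or> W = carrier_vec d)"

definition irreps :: "'g::topological_space monoid \<Rightarrow> 'g rep set"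
  where "irreps G = {\<xi>. \<exists>d. irreducible_unitary_rep G d \<xi>}"

definition rep_dim :: "'g monoid \<Rightarrow> 'g rep \<Rightarrow> nat"
  where "rep_dim G \<xi> = dim_row (\<xi> \<one>\<^bsub>G\<^esub>)"

definition rep_equiv :: "'g::topological_space monoid \<Rightarrow> ('g rep \<times> 'g rep) set" where
  "rep_equiv G = {(\<xi>, \<eta>). \<xi> \<in> irreps G \<and> \<eta> \<in> irreps G \<and> rep_dim G \<xi> = rep_dim G \<eta> \<and>
     (\<exists>T\<in>carrier_mat (rep_dim G \<xi>) (rep_dim G \<xi>). invertible_mat T \<and>
        (\<forall>x\<in>carrier G. T * \<xi> x = \<eta> x * T))}"

definition unitary_dual :: "'g::topological_space monoid \<Rightarrow> 'g rep set set"
  where "unitary_dual G = irreps G // rep_equiv G"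

text \<open>The symbol \<open>\<xi>(x)\<^sup>* (X \<xi>)(x)\<close> does not depend on \<open>x\<close> and is evaluated at the unit. Indices of
  matrices start at \<open>0\<close>.\<close>

definition vf_symbol :: "'g monoid \<Rightarrow> 'g vf \<Rightarrow> 'g rep \<Rightarrow> complex mat" where
  "vf_symbol G X \<xi> = mat_adjoint (\<xi> \<one>\<^bsub>G\<^esub>) *
     Matrix.mat (rep_dim G \<xi>) (rep_dim G \<xi>) (\<lambda>(i, j). X (\<lambda>y. \<xi> y $$ (i, j)) \<one>\<^bsub>G\<^esub>)"

definition symbol_freq :: "'g monoid \<Rightarrow> 'g vf \<Rightarrow> 'g rep \<Rightarrow> nat \<Rightarrow> real"
  where "symbol_freq G X \<xi> m = Im (vf_symbol G X \<xi> $$ (m, m))"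

text \<open>A choice, in every class of the unitary dual, of a representative for which the symbol of
  \<^term>\<open>X\<close> is diagonal with purely imaginary entries.\<close>

definition diagonalizing_choice ::
  "'g::topological_space monoid \<Rightarrow> 'g vf \<Rightarrow> ('g rep set \<Rightarrow> 'g rep) \<Rightarrow> bool" where
  "diagonalizing_choice G X \<rho> \<longleftrightarrow> (\<forall>c\<in>unitary_dual G. \<rho> c \<in> c \<and>
     vf_symbol G X (\<rho> c) = Matrix.mat (rep_dim G (\<rho> c)) (rep_dim G (\<rho> c))
       (\<lambda>(i, j). if i = j then \<i> * of_real (symbol_freq G X (\<rho> c) i) else 0))"

definition laplace_eigenvalue ::
  "'g::topological_space monoid \<Rightarrow> ('g, 'e::euclidean_space) atlas \<Rightarrow>
   ('g vf \<Rightarrow> 'g vf \<Rightarrow> real) \<Rightarrow> 'g rep \<Rightarrow> real" where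
  "laplace_eigenvalue G A ip \<xi> = (THE \<nu>. \<forall>i<rep_dim G \<xi>. \<forall>j<rep_dim G \<xi>. \<forall>x\<in>carrier G.
     - laplace_beltrami G A ip (\<lambda>y. \<xi> y $$ (i, j)) x = of_real \<nu> * \<xi> x $$ (i, j))"

definition weight ::
  "'g::topological_space monoid \<Rightarrow> ('g, 'e::euclidean_space) atlas \<Rightarrow>
   ('g vf \<Rightarrow> 'g vf \<Rightarrow> real) \<Rightarrow> 'g rep \<Rightarrow> real"
  where "weight G A ip \<xi> = sqrt (1 + laplace_eigenvalue G A ip \<xi>)"


section \<open>The operator\<close>

definition vekua_op ::
  "'g vf \<Rightarrow> real \<Rightarrow> (real \<Rightarrow> real) \<Rightarrow> real \<Rightarrow> (real \<Rightarrow> real) \<Rightarrow> complex \<Rightarrow>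
   (real \<times> 'g \<Rightarrow> complex) \<Rightarrow> real \<times> 'g \<Rightarrow> complex" where
  "vekua_op X p0 s \<delta> q \<alpha> u = (\<lambda>(t, x).
     vector_derivative (\<lambda>\<tau>. u (\<tau>, x)) (at t)
     - of_real p0 * X (\<lambda>y. u (t, y)) x
     - (of_real (s t) + \<i> * of_real \<delta> * of_real (q t)) * u (t, x)
     - \<alpha> * of_real (q t) * cnj (u (t, x)))"

text \<open>The argument \<open>\<mu>\<close> stands for \<open>\<mu>\<^sub>m(\<xi>)\<close>.\<close>

definition resonant :: "complex \<Rightarrow> complex \<Rightarrow> real \<Rightarrow> real \<Rightarrow> int \<Rightarrow> bool" where
  "resonant A0 B0 p0 \<mu> k \<longleftrightarrow>
     Re (A0 * of_real (of_int k + \<mu> * p0)) = 0 \<and>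
     4 * pi\<^sup>2 * \<bar>of_int k + \<mu> * p0\<bar>\<^sup>2 = (cmod A0)\<^sup>2 - (cmod B0)\<^sup>2"

end

(* Multiplication N z = i delta z + alpha cnj z is real-linear with N^2 = |alpha|^2 - delta^2, so
   u = b1 y1 + b2 cnj y1 + b3 y2 + b4 cnj y2 turns P u = f into complex-linear equations
   (d/dt - p0 X - s - kappa q) y = g. Along the characteristics these reduce to the cohomological
   equation v(x h) - a v(x) = F(x) on G, with h in the one-parameter subgroup of X and a the
   exponential of the integral of s + kappa q. For |a| different from 1 a geometric series solves it.
   For |a| = 1 it is solved by Fourier series over the unitary dual: v(x) = Lambda(((1 - L)^k F)(x .))
   with a functional Lambda that is bounded on continuous functions, by the Diophantine condition and
   the polynomial growth of the sum of the d_xi^2 (Bessel's inequality against small bumps); hence v is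
   smooth. Haar measure is replaced by the mean obtained from averages of translates (von Neumann), and
   one-parameter subgroups are limits of c(t/n)^n for curves c through the identity. *)
theory Submission
 imports Defs "Jordan_Normal_Form.Spectral_Radius"
begin

text \<open>The term with cnj u couples each frequency with its negative; diagonalizing N first
  removes this coupling before any Fourier expansion. For |\<alpha>| > |\<delta>| the eigenvalues
  kappa are +-Omega with Omega = sqrt (|\<alpha>|^2 - \<delta>^2), so log |a| = s0 +- Omega q0,
  which vanishes for one of the signs exactly if |A0| = |B0|. Condition (1) excludes this, and so
  does (2), because constants produce a frequency 0 that would be resonant for k = 0. For |\<alpha>|
  < |\<delta>| the eigenvalues are +- i omega, so |a| = exp s0: (3) is again a contracting or
  expanding case, while (4) has small divisors. The functional Lambda is there for smoothness: v
  depends on x only through the smooth family F(x .), and derivatives in x pass through a functional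
  that is bounded in the sup norm. Decay of Fourier coefficients thus never has to be turned into
  smoothness; the coefficients of v only serve to verify the equation, by completeness.\<close>

abbreviation "irrep \<equiv> irreducible_unitary_rep"
abbreviation "Lap \<equiv> laplace_beltrami"
abbreviation "real_atlas \<equiv> (std_atlas :: (real, real) atlas)"

abbreviation cont :: "('a::topological_space => 'b::topological_space) => bool" where
 "cont f \<equiv> continuous_on UNIV f"

abbreviation coef :: "('g => complex mat) => nat => nat => 'g => complex" where
 "coef \<xi> i j \<equiv> %x. \<xi> x $$ (i, j)"

subsection \<open>Smooth functions on open sets\<close>

lemma frechet_derivative_cong_open:
 assumes "open S" "x \<in> S" "\<And>y. y \<in> S ==> f y = g y"
 shows "frechet_derivative f (at x) = frechet_derivative g (at x)"
proof -
 have "(f has_derivative F) (at x) \<longleftrightarrow> (g has_derivative F) (at x)" for F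
  using has_derivative_transform_within_open[of f F x UNIV S g]
   has_derivative_transform_within_open[of g F x UNIV S f] assms by auto
 thus ?thesis
  unfolding frechet_derivative_def by simp
qed

lemma Ck_on_subset: "Ck_on n S f ==> T \<subseteq> S ==> Ck_on n T f"
 by (induction n arbitrary: f) (auto intro: continuous_on_subset)

lemma Ck_on_cong:
 assumes "open S" "\<And>x. x \<in> S ==> f x = g x"
 shows "Ck_on n S f \<longleftrightarrow> Ck_on n S g"
 using assms(2)
proof (induction n arbitrary: f g)
 case 0
 thus ?case by (simp cong: continuous_on_cong)
next
 case (Suc n)
 have "f differentiable at x \<longleftrightarrow> g differentiable at x" if "x \<in> S" for x
  unfolding differentiable_def
  using has_derivative_transform_within_open[of f _ x UNIV S g]
   has_derivative_transform_within_open[of g _ x UNIV S f] Suc.prems assms(1) that by (metis (no_types, lifting))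
 moreover have "Ck_on n S (%x. frechet_derivative f (at x) v)
   \<longleftrightarrow> Ck_on n S (%x. frechet_derivative g (at x) v)" for v
  using frechet_derivative_cong_open[OF assms(1) _ Suc.prems] by (intro Suc.IH) auto
 ultimately show ?case by simp
qed

lemma Ck_on_SucI:
 assumes "open S" "\<And>x. x \<in> S ==> (f has_derivative f' x) (at x)"
  and "\<And>v. Ck_on n S (%x. f' x v)"
 shows "Ck_on (Suc n) S f"
proof -
 have "frechet_derivative f (at x) = f' x" if "x \<in> S" for x
  using frechet_derivative_at[OF assms(2)[OF that]] by simp
 hence "Ck_on n S (%x. frechet_derivative f (at x) v)" for v
  using Ck_on_cong[OF assms(1), of "%x. frechet_derivative f (at x) v" "%x. f' x v"] assms(3) by simp
 thus ?thesis
  using assms(2) by (auto simp: differentiable_def)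
qed

lemma Ck_on_SucD: "Ck_on (Suc n) S f ==> Ck_on n S f"
proof (induction n arbitrary: f)
 case 0
 thus ?case
  using differentiable_imp_continuous_on[of f S]
  by (auto simp: differentiable_on_def intro: differentiable_at_withinI)
next
 case (Suc n)
 thus ?case by (metis Ck_on.simps(2))
qed

lemma Ck_on_derivI:
 assumes "Ck_on (Suc n) S f" shows "Ck_on n S (%x. frechet_derivative f (at x) v)"
 using assms by simp

lemma Ck_on_has_derivative:
 assumes "Ck_on (Suc n) S f" "x \<in> S"
 shows "(f has_derivative frechet_derivative f (at x)) (at x)"
 using assms by (simp add: frechet_derivative_works)

lemma Ck_on_local:
 assumes "\<And>x. x \<in> S ==> \<exists>T. open T \<and> x \<in> T \<and> Ck_on n T f"
 shows "Ck_on n S f"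
 using assms
proof (induction n arbitrary: f)
 case 0
 thus ?case
  using continuous_on_eq_continuous_at continuous_at_imp_continuous_on by (metis Ck_on.simps(1))
next
 case (Suc n)
 thus ?case
  by (metis Ck_on.simps(2))
qed

lemma Ck_on_const: "open S ==> Ck_on n S (%x. c)"
proof (induction n arbitrary: c)
 case (Suc n)
 show ?case
  by (rule Ck_on_SucI[where f' = "%_ _. 0"]) (use Suc in auto)
qed simp

lemma Ck_on_bounded_linear_compose:
 assumes "bounded_linear L" "open S" "Ck_on n S f"
 shows "Ck_on n S (%x. L (f x))"
 using assms(3)
proof (induction n arbitrary: f)
 case 0
 thus ?case
  using assms(1) by (auto intro: bounded_linear.continuous_on)
next
 case (Suc n)
 show ?case
 proof (rule Ck_on_SucI[where f' = "%x v. L (frechet_derivative f (at x) v)"])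
  show "((%x. L (f x)) has_derivative (%v. L (frechet_derivative f (at x) v))) (at x)" if "x \<in> S" for x
   using bounded_linear.has_derivative[OF assms(1) Ck_on_has_derivative[OF Suc.prems that]] .
 qed (use Suc assms in auto)
qed

lemma Ck_on_bounded_linear:
 assumes "bounded_linear L" "open S"
 shows "Ck_on n S L"
proof (cases n)
 case 0
 thus ?thesis using assms by (simp add: linear_continuous_on)
next
 case (Suc m)
 show ?thesis unfolding Suc
  by (rule Ck_on_SucI[where f' = "%_. L"])
   (use assms in \<open>auto intro: bounded_linear_imp_has_derivative Ck_on_const\<close>)
qed

lemma Ck_on_add:
 assumes "open S" "Ck_on n S f" "Ck_on n S g"
 shows "Ck_on n S (%x. f x + g x)"
 using assms(2,3)
proof (induction n arbitrary: f g)
 case 0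
 thus ?case by (auto intro: continuous_on_add)
next
 case (Suc n)
 show ?case
 proof (rule Ck_on_SucI[where f' = "%x v. frechet_derivative f (at x) v + frechet_derivative g (at x) v"])
  show "((%x. f x + g x) has_derivative
    (%v. frechet_derivative f (at x) v + frechet_derivative g (at x) v)) (at x)" if "x \<in> S" for x
   using Suc.prems that by (intro has_derivative_add Ck_on_has_derivative)
 qed (use Suc assms(1) in auto)
qed

lemma Ck_on_sum:
 assumes "open S" "\<And>i. i \<in> I ==> Ck_on n S (f i)"
 shows "Ck_on n S (%x. \<Sum>i\<in>I. f i x)"
proof (cases "finite I")
 case True
 thus ?thesis
  using assms(2)
 proof (induction I)
  case empty
  thus ?case using Ck_on_const[OF assms(1)] by simp
 next
  case (insert i I)
  thus ?case using Ck_on_add[OF assms(1), of n "f i" "%x. \<Sum>i\<in>I. f i x"] by simp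
 qed
qed (simp add: Ck_on_const[OF assms(1)])

lemma Ck_on_bounded_bilinear:
 assumes "bounded_bilinear B" "open S" "Ck_on n S f" "Ck_on n S g"
 shows "Ck_on n S (%x. B (f x) (g x))"
 using assms(3,4)
proof (induction n arbitrary: f g)
 case 0
 thus ?case
  using bounded_bilinear.continuous_on[OF assms(1)] by auto
next
 case (Suc n)
 show ?case
 proof (rule Ck_on_SucI[where f' = "%x v. B (f x) (frechet_derivative g (at x) v)
   + B (frechet_derivative f (at x) v) (g x)"])
  show "((%x. B (f x) (g x)) has_derivative
    (%v. B (f x) (frechet_derivative g (at x) v) + B (frechet_derivative f (at x) v) (g x))) (at x)"
   if "x \<in> S" for x
   using Suc.prems that by (intro bounded_bilinear.FDERIV[OF assms(1)] Ck_on_has_derivative)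
  show "Ck_on n S (%x. B (f x) (frechet_derivative g (at x) v)
    + B (frechet_derivative f (at x) v) (g x))" for v
   using Suc.prems[THEN Ck_on_SucD] Suc.prems[THEN Ck_on_derivI]
   by (intro Ck_on_add[OF assms(2)] Suc.IH)
 qed (use assms in auto)
qed

text \<open>\<open>Ck_on\<close> speaks about derivatives in fixed directions, whereas the chain
  rule feeds the moving vector \<open>?f x v\<close> to the derivative of g. Expanding this vector
  in the basis leaves a finite sum of products of a coordinate with a function to which the
  induction hypothesis applies.\<close>

lemma Ck_on_compose:
 fixes f :: "'a::real_normed_vector => 'b::euclidean_space"
  and g :: "'b => 'c::real_normed_vector"
 assumes "open S" "open T" "Ck_on n S f" "Ck_on n T g" "f ` S \<subseteq> T"
 shows "Ck_on n S (%x. g (f x))"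
 using assms(3,4)
proof (induction n arbitrary: g)
 case 0
 thus ?case
  using assms(5) by (auto intro: continuous_on_compose2)
next
 case (Suc n)
 note f = Suc.prems(1) and g = Suc.prems(2)
 let ?f = "%x. frechet_derivative f (at x)" and ?g = "%x. frechet_derivative g (at x)"
 show ?case
 proof (rule Ck_on_SucI[where f' = "%x v. \<Sum>b\<in>Basis. inner (?f x v) b *\<^sub>R ?g (f x) b"])
  fix x assume "x \<in> S"
  hence gx: "(g has_derivative ?g (f x)) (at (f x))"
   using Ck_on_has_derivative[OF g] assms(5) by blast
  have lin: "linear (?g (f x))" using has_derivative_linear[OF gx] .
  have "?g (f x) w = (\<Sum>b\<in>Basis. inner w b *\<^sub>R ?g (f x) b)" for w
  proof -
   have "?g (f x) w = ?g (f x) (\<Sum>b\<in>Basis. inner w b *\<^sub>R b)"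
    by (simp only: euclidean_representation)
   thus ?thesis by (simp only: linear_sum[OF lin] linear_cmul[OF lin] o_def)
  qed
  hence "(%v. ?g (f x) (?f x v)) = (%v. \<Sum>b\<in>Basis. inner (?f x v) b *\<^sub>R ?g (f x) b)"
   by (rule ext)
  with has_derivative_compose[OF Ck_on_has_derivative[OF f \<open>x \<in> S\<close>] gx]
  show "((%x. g (f x)) has_derivative (%v. \<Sum>b\<in>Basis. inner (?f x v) b *\<^sub>R ?g (f x) b)) (at x)"
   by (simp only:)
 next
  fix v
  have "Ck_on n S (%x. ?g (f x) b)" for b
   using Suc.IH[OF Ck_on_SucD[OF f], of "%y. ?g y b"] Ck_on_derivI[OF g] by simp
  moreover have "Ck_on n S (%x. inner (?f x v) b)" for b
   using Ck_on_bounded_linear_compose[OF bounded_linear_inner_left assms(1) Ck_on_derivI[OF f]] .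
  ultimately show "Ck_on n S (%x. \<Sum>b\<in>Basis. inner (?f x v) b *\<^sub>R ?g (f x) b)"
   by (intro Ck_on_sum assms(1) Ck_on_bounded_bilinear[OF bounded_bilinear_scaleR])
 qed (use assms in auto)
qed

lemma smooth_on_subset: "smooth_on S f ==> T \<subseteq> S ==> smooth_on T f"
 by (auto simp: smooth_on_def intro: Ck_on_subset)

lemma smooth_on_cong:
 "open S ==> (\<And>x. x \<in> S ==> f x = g x) ==> smooth_on S f \<longleftrightarrow> smooth_on S g"
 using Ck_on_cong[of S f g] by (auto simp: smooth_on_def)

lemma smooth_on_continuous: "smooth_on S f ==> continuous_on S f"
 unfolding smooth_on_def by (metis Ck_on.simps(1))

lemma smooth_on_local:
 assumes "\<And>x. x \<in> S ==> \<exists>T. open T \<and> x \<in> T \<and> smooth_on T f"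
 shows "smooth_on S f"
 using assms unfolding smooth_on_def by (meson Ck_on_local)

lemma smooth_on_has_derivative:
 "smooth_on S f ==> x \<in> S ==> (f has_derivative frechet_derivative f (at x)) (at x)"
 unfolding smooth_on_def using Ck_on_has_derivative by blast

lemma smooth_on_frechet_derivative:
 "smooth_on S f ==> smooth_on S (%x. frechet_derivative f (at x) v)"
 unfolding smooth_on_def using Ck_on_derivI by blast

lemma smooth_on_const: "open S ==> smooth_on S (%x. c)"
 by (simp add: smooth_on_def Ck_on_const)

lemma smooth_on_bounded_linear: "bounded_linear L ==> open S ==> smooth_on S L"
 by (simp add: smooth_on_def Ck_on_bounded_linear)

lemma smooth_on_id: "open S ==> smooth_on S (%x. x)"
 using smooth_on_bounded_linear[OF bounded_linear_ident] .

lemma smooth_on_bounded_linear_compose: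
 "bounded_linear L ==> open S ==> smooth_on S f ==> smooth_on S (%x. L (f x))"
 by (simp add: smooth_on_def Ck_on_bounded_linear_compose)

lemma smooth_on_add:
 "open S ==> smooth_on S f ==> smooth_on S g ==> smooth_on S (%x. f x + g x)"
 by (simp add: smooth_on_def Ck_on_add)

lemma smooth_on_sum:
 "open S ==> (\<And>i. i \<in> I ==> smooth_on S (f i)) ==> smooth_on S (%x. \<Sum>i\<in>I. f i x)"
 by (simp add: smooth_on_def Ck_on_sum)

lemma smooth_on_bounded_bilinear:
 "bounded_bilinear B ==> open S ==> smooth_on S f ==> smooth_on S g ==> smooth_on S (%x. B (f x) (g x))"
 by (simp add: smooth_on_def Ck_on_bounded_bilinear)

lemmas smooth_on_mult = smooth_on_bounded_bilinear[OF bounded_bilinear_mult]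
lemmas smooth_on_scaleR = smooth_on_bounded_bilinear[OF bounded_bilinear_scaleR]

lemma smooth_on_compose:
 fixes f :: "'a::real_normed_vector => 'b::euclidean_space"
 assumes "open S" "open T" "smooth_on S f" "smooth_on T g" "f ` S \<subseteq> T"
 shows "smooth_on S (%x. g (f x))"
 using assms by (simp add: smooth_on_def Ck_on_compose)

lemma smooth_on_Pair:
 assumes "open S" "smooth_on S f" "smooth_on S g"
 shows "smooth_on S (%x. (f x, g x))"
proof -
 have "bounded_linear (%y. (y, 0))" "bounded_linear (%y. (0, y))"
  by (auto intro!: bounded_linear_Pair bounded_linear_ident bounded_linear_zero)
 from smooth_on_add[OF assms(1) smooth_on_bounded_linear_compose[OF this(1) assms(1,2)]
   smooth_on_bounded_linear_compose[OF this(2) assms(1,3)]]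
 show ?thesis by simp
qed

text \<open>Smoothness is the largest property of continuous functions that is inherited by all
  directional derivatives. Functions given by a formula with parameters are handled by taking P to
  be the whole parametrized class, so that no induction over the order is needed later.\<close>

lemma smooth_on_coinduct:
 assumes "P f"
  and "\<And>f. P f ==> continuous_on S f"
  and "\<And>f. P f ==> \<exists>f'. (\<forall>x\<in>S. (f has_derivative f' x) (at x)) \<and> (\<forall>v. P (%x. f' x v))"
  and "open S"
 shows "smooth_on S f"
proof -
 have "Ck_on n S g" if "P g" for n g
  using that
 proof (induction n arbitrary: g)
  case 0
  thus ?case using assms(2) by simp
 next
  case (Suc n)
  thus ?case using assms(3)[OF Suc.prems] Ck_on_SucI[OF assms(4)] by blast
 qed
 thus ?thesis using assms(1) by (simp add: smooth_on_def)
qed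

text \<open>On the line the derivative in direction v is \<open>v *\<^sub>R f' x\<close>; hence the
  closure of P under real multiples.\<close>

lemma smooth_on_real_coinduct:
 fixes f :: "real => 'b::real_normed_vector"
 assumes "P f" "open S"
  and "\<And>f. P f ==> \<exists>f'. (\<forall>x\<in>S. (f has_vector_derivative f' x) (at x)) \<and> P f'"
  and "\<And>f c. P f ==> P (%x. c *\<^sub>R f x)"
 shows "smooth_on S f"
proof (rule smooth_on_coinduct[where P = P])
 fix f assume "P f"
 then obtain f' where f': "\<forall>x\<in>S. (f has_vector_derivative f' x) (at x)" "P f'"
  using assms(3) by blast
 thus "continuous_on S f"
  by (meson continuous_at_imp_continuous_on has_vector_derivative_continuous)
 show "\<exists>f'. (\<forall>x\<in>S. (f has_derivative f' x) (at x)) \<and> (\<forall>v. P (%x. f' x v))"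
  by (rule exI[of _ "%x v. v *\<^sub>R f' x"])
   (use f' assms(4) in \<open>auto simp: has_vector_derivative_def\<close>)
qed (use assms in auto)

section \<open>Explicit smooth functions and bumps\<close>

lemma smooth_on_exp: "smooth_on UNIV (exp :: complex => complex)"
proof -
 have "smooth_on UNIV (%z::complex. c * exp z)" for c
 proof (rule smooth_on_coinduct[where P = "%f. \<exists>c::complex. f = (%z. c * exp z)"])
  fix f assume "\<exists>c::complex. f = (%z. c * exp z)"
  then obtain c :: complex where f: "f = (%z. c * exp z)" by blast
  show "cont f" unfolding f by (intro continuous_intros)
  have "(f has_derivative (%v. c * (exp z * v))) (at z)" for z
   unfolding f using DERIV_exp[of z]
   by (intro has_derivative_mult_right) (simp add: has_field_derivative_def)
  thus "\<exists>f'. (\<forall>x\<in>UNIV. (f has_derivative f' x) (at x))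
    \<and> (\<forall>v. \<exists>c. (%x. f' x v) = (%z. c * exp z))"
   by (intro exI[of _ "%z v. c * (exp z * v)"]) (auto simp: mult.assoc mult.commute mult.left_commute fun_eq_iff intro!: exI[of _ "c * _"])
 qed auto
 from this[of 1] show ?thesis by simp
qed

lemma smooth_on_sin: "smooth_on UNIV (%x::real. sin (k * x))"
proof (rule smooth_on_real_coinduct[where P = "%f. \<exists>a b. f = (%x. a * sin (k * x) + b * cos (k * x))"])
 show "\<exists>a b. (%x. sin (k * x)) = (%x. a * sin (k * x) + b * cos (k * x))"
  by (rule exI[of _ 1], rule exI[of _ 0]) simp
 fix f :: "real => real" assume "\<exists>a b. f = (%x. a * sin (k * x) + b * cos (k * x))"
 then obtain a b where f: "f = (%x. a * sin (k * x) + b * cos (k * x))" by blast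
 have "(f has_vector_derivative (- b * k) * sin (k * x) + (a * k) * cos (k * x)) (at x)" for x
  unfolding f has_real_derivative_iff_has_vector_derivative[symmetric]
  by (auto intro!: derivative_eq_intros simp: algebra_simps)
 thus "\<exists>f'. (\<forall>x\<in>UNIV. (f has_vector_derivative f' x) (at x))
   \<and> (\<exists>a b. f' = (%x. a * sin (k * x) + b * cos (k * x)))"
  by (intro exI[of _ "%x. (- b * k) * sin (k * x) + (a * k) * cos (k * x)"]) blast
 show "\<exists>a b. (%x. c *\<^sub>R f x) = (%x. a * sin (k * x) + b * cos (k * x))" for c
  unfolding f by (rule exI[of _ "c * a"], rule exI[of _ "c * b"]) (simp add: algebra_simps)
qed auto

lemma smooth_on_inverse: "smooth_on {0<..} (inverse :: real => real)"
proof (rule smooth_on_real_coinduct[where P = "%f. \<exists>c n. f = (%x::real. c * inverse x ^ n)"])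
 show "\<exists>c n. inverse = (%x::real. c * inverse x ^ n)"
  by (intro exI[of _ 1]) auto
 fix f :: "real => real" assume "\<exists>c n. f = (%x. c * inverse x ^ n)"
 then obtain c n where f: "f = (%x. c * inverse x ^ n)" by blast
 have "(f has_real_derivative (- c * n) * inverse x ^ Suc n) (at x)" if "x > 0" for x
 proof (cases n)
  case (Suc k)
  show ?thesis unfolding f
   by (rule DERIV_cong[OF DERIV_cmult[OF DERIV_power[OF DERIV_inverse]]])
    (use that in \<open>simp_all add: Suc\<close>)
 qed (simp add: f)
 hence "(f has_vector_derivative (- c * n) * inverse x ^ Suc n) (at x)" if "x > 0" for x
  using that by (simp add: has_real_derivative_iff_has_vector_derivative)
 thus "\<exists>f'. (\<forall>x\<in>{0<..}. (f has_vector_derivative f' x) (at x))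
   \<and> (\<exists>c n. f' = (%x. c * inverse x ^ n))"
  by (intro exI[of _ "%x. (- c * n) * inverse x ^ Suc n"] conjI exI[of _ "- c * n"] exI[of _ "Suc n"])
   simp_all
 show "\<exists>d n. (%x. b *\<^sub>R f x) = (%x. d * inverse x ^ n)" for b
  unfolding f by (intro exI[of _ "b * c"] exI[of _ n]) (simp add: algebra_simps)
qed auto

text \<open>The polynomial parameter makes the family closed under differentiation: the derivative
  of p(1/t) exp(-1/t) has the same form with p replaced by x^2 (p - p').\<close>

definition flat_bump :: "real poly => real => real"
 where "flat_bump p t = (if t > 0 then poly p (1 / t) * exp (- (1 / t)) else 0)"

lemma flat_bump_at_0: "(flat_bump p \<longlongrightarrow> 0) (at_right 0)"
proof -
 have "((%x. poly p x / exp x) \<longlongrightarrow> 0) at_top"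
 proof -
  have "((%x::real. \<Sum>i\<le>degree p. coeff p i * (x ^ i / exp x)) \<longlongrightarrow> (\<Sum>i\<le>degree p. coeff p i * 0)) at_top"
   by (intro tendsto_intros tendsto_power_div_exp_0)
  thus ?thesis by (simp add: poly_altdef sum_divide_distrib)
 qed
 hence "((%t. poly p (inverse t) / exp (inverse t)) \<longlongrightarrow> 0) (at_right 0)"
  by (rule filterlim_compose[OF _ filterlim_inverse_at_top_right])
 thus ?thesis
  by (rule Lim_transform_eventually)
   (auto simp: flat_bump_def exp_minus field_simps intro: eventually_at_right_less[THEN eventually_mono])
qed

lemma has_vector_derivative_flat_bump:
 "(flat_bump p has_vector_derivative flat_bump (monom 1 2 * (p - pderiv p)) t) (at t)"
proof -
 consider "t < 0" | "t = 0" | "t > 0" by linarith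
 thus ?thesis
 proof cases
  case 1
  have "((%_. 0) has_vector_derivative 0) (at t)" by simp
  hence "(flat_bump p has_vector_derivative 0) (at t)"
   by (rule has_vector_derivative_transform_within_open[where S = "{..<0}"])
    (use 1 in \<open>auto simp: flat_bump_def\<close>)
  thus ?thesis using 1 by (simp add: flat_bump_def)
 next
  case 3
  have "((%t. poly p (1 / t) * exp (- (1 / t))) has_real_derivative
    (poly (pderiv p) (1 / t) * (- 1 / t\<^sup>2)) * exp (- (1 / t)) + poly p (1 / t) * (exp (- (1 / t)) * (1 / t\<^sup>2))) (at t)"
   using 3 by (auto intro!: derivative_eq_intros DERIV_chain2[OF poly_DERIV] simp: power2_eq_square)
  hence "((%t. poly p (1 / t) * exp (- (1 / t))) has_vector_derivative flat_bump (monom 1 2 * (p - pderiv p)) t) (at t)"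
   unfolding has_real_derivative_iff_has_vector_derivative[symmetric]
   by (rule DERIV_cong) (use 3 in \<open>simp add: flat_bump_def poly_monom field_simps power2_eq_square\<close>)
  thus ?thesis
   by (rule has_vector_derivative_transform_within_open[where S = "{0<..}"])
    (use 3 in \<open>auto simp: flat_bump_def\<close>)
 next
  case 2
  have "((%y. (flat_bump p y - flat_bump p 0) / (y - 0)) \<longlongrightarrow> 0) (at_left 0)"
   by (rule Lim_transform_eventually[of "%_. 0"])
    (auto simp: flat_bump_def eventually_at_filter)
  \<comment> \<open>To the right of 0 the difference quotient is again a flat bump, with the
    polynomial x p.\<close>
  moreover have "((%y. (flat_bump p y - flat_bump p 0) / (y - 0)) \<longlongrightarrow> 0) (at_right 0)"
   using flat_bump_at_0[of "monom 1 1 * p"]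
   by (rule Lim_transform_eventually)
    (auto simp: flat_bump_def poly_monom eventually_at_filter)
  ultimately have "(flat_bump p has_real_derivative 0) (at 0)"
   unfolding has_field_derivative_iff using filterlim_split_at by blast
  thus ?thesis using 2
   by (simp add: flat_bump_def has_real_derivative_iff_has_vector_derivative[symmetric])
 qed
qed

lemma smooth_on_flat_bump: "smooth_on UNIV (flat_bump p)"
proof (rule smooth_on_real_coinduct[where P = "%f. \<exists>p. f = flat_bump p"])
 show "\<exists>p. f = flat_bump p ==>
   \<exists>f'. (\<forall>x\<in>UNIV. (f has_vector_derivative f' x) (at x)) \<and> (\<exists>p. f' = flat_bump p)" for f
  using has_vector_derivative_flat_bump by blast
 fix f c assume "\<exists>p. f = flat_bump p"
 then obtain p where "f = flat_bump p" by blast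
 hence "(%x. c *\<^sub>R f x) = flat_bump ([:c:] * p)"
  by (auto simp: flat_bump_def)
 thus "\<exists>p. (%x. c *\<^sub>R f x) = flat_bump p" by blast
qed auto

text \<open>The squared distance, and not the distance, enters: it is smooth at the centre as
  well.\<close>

definition ball_bump :: "'a::euclidean_space => real => 'a => real"
 where "ball_bump a r y = flat_bump 1 (r\<^sup>2 - inner (y - a) (y - a))"

lemma ball_bump_pos: "r > 0 ==> ball_bump a r y > 0 \<longleftrightarrow> y \<in> ball a r"
proof -
 assume "r > 0"
 have "inner (y - a) (y - a) = (dist a y)\<^sup>2"
  by (simp add: dist_norm power2_norm_eq_inner norm_minus_commute[of a])
 thus ?thesis
  using \<open>r > 0\<close> by (auto simp: ball_bump_def flat_bump_def power_strict_mono intro: power2_less_imp_less)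
qed

lemma ball_bump_nonneg: "ball_bump a r y \<ge> 0"
 by (simp add: ball_bump_def flat_bump_def)

lemma smooth_on_ball_bump: "smooth_on UNIV (ball_bump a r)"
proof -
 have id: "smooth_on UNIV (%y. y - a)"
  using smooth_on_add[OF open_UNIV smooth_on_id[OF open_UNIV] smooth_on_const[OF open_UNIV, of "- a"]] by simp
 have "smooth_on UNIV (%y. inner (y - a) (y - a))"
  by (rule smooth_on_bounded_bilinear[OF bounded_bilinear_inner open_UNIV id id])
 from smooth_on_add[OF open_UNIV smooth_on_const[OF open_UNIV, of "r\<^sup>2"]
   smooth_on_bounded_linear_compose[OF bounded_linear_minus[OF bounded_linear_ident] open_UNIV this]]
 have "smooth_on UNIV (%y. r\<^sup>2 - inner (y - a) (y - a))" by simp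
 from smooth_on_compose[OF open_UNIV open_UNIV this smooth_on_flat_bump[of 1]]
 show ?thesis by (simp add: ball_bump_def[abs_def])
qed

subsection \<open>Smooth maps\<close>

lemma smooth_atlas_chart:
 assumes "smooth_atlas A" "(U, \<phi>) \<in> A"
 shows "open U" "open (\<phi> ` U)" "inj_on \<phi> U" "continuous_on U \<phi>"
  "continuous_on (\<phi> ` U) (inv_into U \<phi>)"
proof -
 have *: "open U \<and> open (\<phi> ` U) \<and> homeomorphism U (\<phi> ` U) \<phi> (inv_into U \<phi>)"
  using assms unfolding smooth_atlas_def by fast
 thus "open U" "open (\<phi> ` U)" "continuous_on U \<phi>" "continuous_on (\<phi> ` U) (inv_into U \<phi>)"
  by (auto simp: homeomorphism_def)
 from * show "inj_on \<phi> U"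
  by (metis homeomorphism_def inj_on_inverseI)
qed

lemma smooth_atlas_transition:
 "smooth_atlas A ==> (U, \<phi>) \<in> A ==> (V, \<psi>) \<in> A ==> smooth_on (\<phi> ` (U \<inter> V)) (\<psi> \<circ> inv_into U \<phi>)"
 unfolding smooth_atlas_def by fast

lemma smooth_atlas_cover:
 assumes "smooth_atlas A" obtains U \<phi> where "(U, \<phi>) \<in> A" "x \<in> U"
 using assms unfolding smooth_atlas_def by fast

lemma open_chart_image:
 assumes "smooth_atlas A" "(U, \<phi>) \<in> A" "open W"
 shows "open (\<phi> ` (U \<inter> W))"
proof -
 note c = smooth_atlas_chart[OF assms(1,2)]
 have "\<phi> ` (U \<inter> W) = \<phi> ` U \<inter> inv_into U \<phi> -` W"
  using c(3) by (auto simp: inj_on_def inv_into_f_f[OF c(3)])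
 thus ?thesis
  using continuous_open_preimage[OF c(5,2) assms(3)] by simp
qed

lemma smooth_mapI:
 assumes A: "smooth_atlas A" and B: "smooth_atlas B" and cont: "cont f"
  and loc: "\<And>U \<phi> V \<psi> x. (U, \<phi>) \<in> A ==> (V, \<psi>) \<in> B ==> x \<in> U ==> f x \<in> V ==>
   \<exists>W. open W \<and> x \<in> W \<and> smooth_on (\<phi> ` (U \<inter> (f -` V \<inter> W))) (\<psi> \<circ> f \<circ> inv_into U \<phi>)"
 shows "smooth_map A B f"
 unfolding smooth_map_def
proof (intro conjI cont ballI, clarify)
 fix U \<phi> V \<psi> assume U: "(U, \<phi>) \<in> A" and V: "(V, \<psi>) \<in> B"
 show "smooth_on (\<phi> ` (U \<inter> f -` V)) (\<psi> \<circ> f \<circ> inv_into U \<phi>)"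
 proof (rule smooth_on_local)
  fix y assume "y \<in> \<phi> ` (U \<inter> f -` V)"
  then obtain x where x: "x \<in> U" "f x \<in> V" "y = \<phi> x" by blast
  from loc[OF U V x(1,2)] obtain W where W: "open W" "x \<in> W"
   "smooth_on (\<phi> ` (U \<inter> (f -` V \<inter> W))) (\<psi> \<circ> f \<circ> inv_into U \<phi>)" by blast
  have "open (f -` V \<inter> W)"
   using cont smooth_atlas_chart(1)[OF B V] W(1) by (auto intro: open_vimage)
  from open_chart_image[OF A U this] W x
  show "\<exists>T. open T \<and> y \<in> T \<and> smooth_on T (\<psi> \<circ> f \<circ> inv_into U \<phi>)"
   by (intro exI[of _ "\<phi> ` (U \<inter> (f -` V \<inter> W))"]) auto
 qed
qed

lemma smooth_map_continuous: "smooth_map A B f ==> continuous_on S f"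
 unfolding smooth_map_def by (metis continuous_on_subset subset_UNIV)

lemma smooth_mapD:
 "smooth_map A B f ==> (U, \<phi>) \<in> A ==> (V, \<psi>) \<in> B
  ==> smooth_on (\<phi> ` (U \<inter> f -` V)) (\<psi> \<circ> f \<circ> inv_into U \<phi>)"
 unfolding smooth_map_def by fast

lemma smooth_map_compose:
 assumes A: "smooth_atlas A" and B: "smooth_atlas B" and C: "smooth_atlas C"
  and f: "smooth_map A B f" and g: "smooth_map B C g"
 shows "smooth_map A C (%x. g (f x))"
proof (rule smooth_mapI[OF A C])
 have cf: "cont f" and cg: "cont g"
  using f g smooth_map_continuous by blast+
 thus cgf: "cont (%x. g (f x))"
  using continuous_on_compose2[OF cg cf] by simp
 fix U \<phi> W \<theta> x assume U: "(U, \<phi>) \<in> A" and W: "(W, \<theta>) \<in> C" "g (f x) \<in> W"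
 obtain V \<psi> where V: "(V, \<psi>) \<in> B" "f x \<in> V" using smooth_atlas_cover[OF B] .
 note a = smooth_atlas_chart[OF A U] and b = smooth_atlas_chart[OF B V(1)]
  and c = smooth_atlas_chart[OF C W(1)]
 define N where "N = (%x. g (f x)) -` W \<inter> f -` V"
 have "open N" unfolding N_def
  using cgf cf c(1) b(1) by (auto intro: open_vimage)
 hence oT: "open (\<phi> ` (U \<inter> N))" by (rule open_chart_image[OF A U])
 have "open (g -` W)" using cg c(1) by (auto intro: open_vimage)
 hence "smooth_on (\<phi> ` (U \<inter> N)) (%y. (\<theta> \<circ> g \<circ> inv_into V \<psi>) ((\<psi> \<circ> f \<circ> inv_into U \<phi>) y))"
 proof (rule smooth_on_compose[OF oT open_chart_image[OF B V(1)] _ smooth_mapD[OF g V(1) W(1)]])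
  show "smooth_on (\<phi> ` (U \<inter> N)) (\<psi> \<circ> f \<circ> inv_into U \<phi>)"
   using smooth_mapD[OF f U V(1)] by (rule smooth_on_subset) (auto simp: N_def)
  show "(\<psi> \<circ> f \<circ> inv_into U \<phi>) ` \<phi> ` (U \<inter> N) \<subseteq> \<psi> ` (V \<inter> g -` W)"
   by (auto simp: N_def inv_into_f_f[OF a(3)])
 qed
 hence "smooth_on (\<phi> ` (U \<inter> N)) (\<theta> \<circ> (%x. g (f x)) \<circ> inv_into U \<phi>)"
  by (rule smooth_on_cong[OF oT, THEN iffD1, rotated])
   (auto simp: N_def inv_into_f_f[OF a(3)] inv_into_f_f[OF b(3)])
 thus "\<exists>N. open N \<and> x \<in> N
   \<and> smooth_on (\<phi> ` (U \<inter> ((%x. g (f x)) -` W \<inter> N))) (\<theta> \<circ> (%x. g (f x)) \<circ> inv_into U \<phi>)"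
  using V b(1) cf open_vimage unfolding N_def by (intro exI[of _ "f -` V"]) auto
qed

lemma inv_id_eq: "inv_into UNIV id = (%x. x)"
 by (auto simp: inv_into_def)

lemma smooth_atlas_std: "smooth_atlas std_atlas"
proof -
 have "smooth_on UNIV (id :: 'a => 'a)" using smooth_on_id[OF open_UNIV] by (simp add: id_def)
 thus ?thesis
  by (auto simp: smooth_atlas_def std_atlas_def inv_id_eq homeomorphism_def continuous_on_id comp_def id_def)
qed

lemma inv_into_map_prod:
 assumes "inj_on \<phi> U" "inj_on \<psi> V" "y \<in> \<phi> ` U" "z \<in> \<psi> ` V"
 shows "inv_into (U \<times> V) (map_prod \<phi> \<psi>) (y, z) = (inv_into U \<phi> y, inv_into V \<psi> z)"
proof -
 have "inj_on (map_prod \<phi> \<psi>) (U \<times> V)" using assms by (auto simp: inj_on_def)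
 thus ?thesis
  by (rule inv_into_f_eq) (use assms in \<open>auto simp: f_inv_into_f inv_into_into\<close>)
qed

lemma image_map_prod_Int:
 "map_prod \<phi> \<psi> ` ((U \<times> V) \<inter> (U' \<times> V')) = \<phi> ` (U \<inter> U') \<times> \<psi> ` (V \<inter> V')"
 by (auto simp: map_prod_def image_iff split: prod.split)

lemma smooth_on_fst_compose:
 fixes f :: "'a::euclidean_space => 'c::real_normed_vector"
 assumes "open S" "open (T :: 'b::euclidean_space set)" "smooth_on S f"
 shows "smooth_on (S \<times> T) (%p. f (fst p))"
 by (rule smooth_on_compose[OF open_Times[OF assms(1,2)] assms(1)
   smooth_on_bounded_linear[OF bounded_linear_fst open_Times[OF assms(1,2)]] assms(3)]) auto

lemma smooth_on_snd_compose:
 fixes f :: "'b::euclidean_space => 'c::real_normed_vector"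
 assumes "open (S :: 'a::euclidean_space set)" "open T" "smooth_on T f"
 shows "smooth_on (S \<times> T) (%p. f (snd p))"
 by (rule smooth_on_compose[OF open_Times[OF assms(1,2)] assms(2)
   smooth_on_bounded_linear[OF bounded_linear_snd open_Times[OF assms(1,2)]] assms(3)]) auto

lemma smooth_atlas_prod:
 fixes A :: "('g::topological_space, 'e::euclidean_space) atlas"
  and B :: "('h::topological_space, 'f::euclidean_space) atlas"
 assumes A: "smooth_atlas A" and B: "smooth_atlas B"
 shows "smooth_atlas (prod_atlas A B)"
 unfolding smooth_atlas_def
proof (intro conjI)
 show "(\<Union>(U, \<phi>)\<in>prod_atlas A B. U) = UNIV"
 proof -
  have "(x, y) \<in> (\<Union>(U, \<phi>)\<in>prod_atlas A B. U)" for x y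
  proof -
   obtain U \<phi> where U: "(U, \<phi>) \<in> A" "x \<in> U" using smooth_atlas_cover[OF A] .
   obtain V \<psi> where V: "(V, \<psi>) \<in> B" "y \<in> V" using smooth_atlas_cover[OF B] .
   have "(U \<times> V, map_prod \<phi> \<psi>) \<in> prod_atlas A B"
    using U V unfolding prod_atlas_def by blast
   thus ?thesis using U V by blast
  qed
  thus ?thesis by auto
 qed
 show "\<forall>(U, \<phi>)\<in>prod_atlas A B. open U \<and> open (\<phi> ` U) \<and> homeomorphism U (\<phi> ` U) \<phi> (inv_into U \<phi>)"
 proof (clarsimp simp: prod_atlas_def)
  fix U \<phi> V \<psi> assume U: "(U, \<phi>) \<in> A" and V: "(V, \<psi>) \<in> B"
  note a = smooth_atlas_chart[OF A U] and b = smooth_atlas_chart[OF B V]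
  have im: "map_prod \<phi> \<psi> ` (U \<times> V) = \<phi> ` U \<times> \<psi> ` V"
   using image_map_prod_Int[of \<phi> \<psi> U V U V] by simp
  have "continuous_on (\<phi> ` U \<times> \<psi> ` V) (%p. (inv_into U \<phi> (fst p), inv_into V \<psi> (snd p)))"
   by (intro continuous_on_Pair continuous_on_compose2[OF a(5)] continuous_on_compose2[OF b(5)]
     continuous_intros) auto
  hence "continuous_on (\<phi> ` U \<times> \<psi> ` V) (inv_into (U \<times> V) (map_prod \<phi> \<psi>))"
   by (rule continuous_on_eq) (auto simp: inv_into_map_prod[OF a(3) b(3)])
  moreover have "continuous_on (U \<times> V) (map_prod \<phi> \<psi>)"
   unfolding map_prod_def case_prod_beta
   by (intro continuous_on_Pair continuous_on_compose2[OF a(4)] continuous_on_compose2[OF b(4)]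
     continuous_intros) auto
  moreover have "inv_into (U \<times> V) (map_prod \<phi> \<psi>) (\<phi> x, \<psi> y) = (x, y)" if "x \<in> U" "y \<in> V" for x y
   using that inv_into_map_prod[OF a(3) b(3)] by (simp add: inv_into_f_f[OF a(3)] inv_into_f_f[OF b(3)])
  ultimately have "homeomorphism (U \<times> V) (map_prod \<phi> \<psi> ` (U \<times> V)) (map_prod \<phi> \<psi>)
    (inv_into (U \<times> V) (map_prod \<phi> \<psi>))"
   unfolding im by (intro homeomorphismI) auto
  thus "open (U \<times> V) \<and> open (map_prod \<phi> \<psi> ` (U \<times> V)) \<and>
    homeomorphism (U \<times> V) (map_prod \<phi> \<psi> ` (U \<times> V)) (map_prod \<phi> \<psi>) (inv_into (U \<times> V) (map_prod \<phi> \<psi>))"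
   using a b im by (simp add: open_Times)
 qed
 show "\<forall>(U, \<phi>)\<in>prod_atlas A B. \<forall>(V, \<psi>)\<in>prod_atlas A B. smooth_on (\<phi> ` (U \<inter> V)) (\<psi> \<circ> inv_into U \<phi>)"
 proof (clarsimp simp: prod_atlas_def)
  fix U \<phi> V \<psi> U' \<phi>' V' \<psi>'
  assume U: "(U, \<phi>) \<in> A" and V: "(V, \<psi>) \<in> B" and U': "(U', \<phi>') \<in> A" and V': "(V', \<psi>') \<in> B"
  note a = smooth_atlas_chart[OF A U] and b = smooth_atlas_chart[OF B V]
  let ?S = "\<phi> ` (U \<inter> U')" and ?T = "\<psi> ` (V \<inter> V')"
  have oS: "open ?S" and oT: "open ?T"
   using open_chart_image[OF A U] open_chart_image[OF B V] smooth_atlas_chart(1)[OF A U']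
    smooth_atlas_chart(1)[OF B V'] by blast+
  have "smooth_on (?S \<times> ?T) (%p. ((\<phi>' \<circ> inv_into U \<phi>) (fst p), (\<psi>' \<circ> inv_into V \<psi>) (snd p)))"
   by (intro smooth_on_Pair open_Times oS oT smooth_on_fst_compose smooth_on_snd_compose
     smooth_atlas_transition[OF A U U'] smooth_atlas_transition[OF B V V'])
  moreover have "((\<phi>' \<circ> inv_into U \<phi>) (fst p), (\<psi>' \<circ> inv_into V \<psi>) (snd p))
    = (map_prod \<phi>' \<psi>' \<circ> inv_into (U \<times> V) (map_prod \<phi> \<psi>)) p" if "p \<in> ?S \<times> ?T" for p
   using that by (auto simp: inv_into_map_prod[OF a(3) b(3)])
  ultimately show "smooth_on (map_prod \<phi> \<psi> ` (U \<times> V \<inter> U' \<times> V'))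
    (map_prod \<phi>' \<psi>' \<circ> inv_into (U \<times> V) (map_prod \<phi> \<psi>))"
   unfolding image_map_prod_Int using smooth_on_cong[OF open_Times[OF oS oT]] by (metis (no_types, lifting))
 qed
qed

lemma prod_atlas_std: "prod_atlas std_atlas std_atlas = std_atlas"
 by (auto simp: prod_atlas_def std_atlas_def map_prod.id)

lemma smooth_map_id:
 assumes A: "smooth_atlas A" shows "smooth_map A A (%x. x)"
proof (rule smooth_mapI[OF A A continuous_on_id])
 fix U \<phi> V \<psi> x assume UV: "(U, \<phi>) \<in> A" "(V, \<psi>) \<in> A"
 have "\<psi> \<circ> (%x. x) \<circ> inv_into U \<phi> = \<psi> \<circ> inv_into U \<phi>" by auto
 thus "\<exists>W. open W \<and> x \<in> W \<and> smooth_on (\<phi> ` (U \<inter> ((%x. x) -` V \<inter> W))) (\<psi> \<circ> (%x. x) \<circ> inv_into U \<phi>)"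
  using smooth_atlas_transition[OF A UV] by (intro exI[of _ UNIV]) simp
qed

lemma smooth_map_const:
 assumes A: "smooth_atlas A" and B: "smooth_atlas B"
 shows "smooth_map A B (%x. c)"
proof (rule smooth_mapI[OF A B continuous_on_const])
 fix U \<phi> V \<psi> x assume U: "(U, \<phi>) \<in> A" and c: "c \<in> V"
 thus "\<exists>W. open W \<and> x \<in> W \<and> smooth_on (\<phi> ` (U \<inter> ((%x. c) -` V \<inter> W))) (\<psi> \<circ> (%x. c) \<circ> inv_into U \<phi>)"
  using smooth_atlas_chart(2)[OF A U] by (intro exI[of _ UNIV]) (simp add: comp_def smooth_on_const)
qed

lemma smooth_map_Pair:
 assumes A: "smooth_atlas A" and B: "smooth_atlas B" and C: "smooth_atlas C"
  and f: "smooth_map A B f" and g: "smooth_map A C g"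
 shows "smooth_map A (prod_atlas B C) (%x. (f x, g x))"
proof (rule smooth_mapI[OF A smooth_atlas_prod[OF B C]])
 have cf: "cont f" and cg: "cont g"
  using f g smooth_map_continuous by blast+
 thus "cont (%x. (f x, g x))" by (intro continuous_intros)
 fix U \<phi> D \<kappa> x assume U: "(U, \<phi>) \<in> A" and "(D, \<kappa>) \<in> prod_atlas B C"
 then obtain V \<psi> W \<theta> where V: "(V, \<psi>) \<in> B" and W: "(W, \<theta>) \<in> C" and D: "D = V \<times> W" "\<kappa> = map_prod \<psi> \<theta>"
  unfolding prod_atlas_def by blast
 have o: "open (f -` V \<inter> g -` W)"
  using cf cg smooth_atlas_chart(1)[OF B V] smooth_atlas_chart(1)[OF C W]
  by (auto intro: open_vimage)
 have "smooth_on (\<phi> ` (U \<inter> (f -` V \<inter> g -` W))) (%y. ((\<psi> \<circ> f \<circ> inv_into U \<phi>) y, (\<theta> \<circ> g \<circ> inv_into U \<phi>) y))"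
  by (intro smooth_on_Pair open_chart_image[OF A U o]
    smooth_on_subset[OF smooth_mapD[OF f U V]] smooth_on_subset[OF smooth_mapD[OF g U W]]) auto
 moreover have "\<kappa> \<circ> (%x. (f x, g x)) \<circ> inv_into U \<phi>
   = (%y. ((\<psi> \<circ> f \<circ> inv_into U \<phi>) y, (\<theta> \<circ> g \<circ> inv_into U \<phi>) y))" by (auto simp: D)
 moreover have "(%x. (f x, g x)) -` D \<inter> UNIV = f -` V \<inter> g -` W" by (auto simp: D)
 ultimately show "\<exists>N. open N \<and> x \<in> N \<and> smooth_on (\<phi> ` (U \<inter> ((%x. (f x, g x)) -` D \<inter> N))) (\<kappa> \<circ> (%x. (f x, g x)) \<circ> inv_into U \<phi>)"
  by (intro exI[of _ UNIV]) simp
qed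

lemma smooth_map_fst:
 assumes A: "smooth_atlas A" and B: "smooth_atlas B"
 shows "smooth_map (prod_atlas A B) A fst"
proof (rule smooth_mapI[OF smooth_atlas_prod[OF A B] A continuous_on_fst[OF continuous_on_id]])
 fix D \<kappa> W \<theta> p assume "(D, \<kappa>) \<in> prod_atlas A B" and W: "(W, \<theta>) \<in> A"
 then obtain U \<phi> V \<psi> where U: "(U, \<phi>) \<in> A" and V: "(V, \<psi>) \<in> B" and D: "D = U \<times> V" "\<kappa> = map_prod \<phi> \<psi>"
  unfolding prod_atlas_def by blast
 note a = smooth_atlas_chart[OF A U] and b = smooth_atlas_chart[OF B V]
 have o: "open (\<phi> ` (U \<inter> W))" by (rule open_chart_image[OF A U smooth_atlas_chart(1)[OF A W]])
 have im: "\<kappa> ` (D \<inter> fst -` W) = \<phi> ` (U \<inter> W) \<times> \<psi> ` V"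
  using image_map_prod_Int[of \<phi> \<psi> U V W UNIV] by (simp add: D vimage_fst)
 have "smooth_on (\<phi> ` (U \<inter> W) \<times> \<psi> ` V) (\<theta> \<circ> fst \<circ> inv_into D \<kappa>)"
  by (rule smooth_on_cong[THEN iffD1, OF _ _ smooth_on_fst_compose[OF o b(2) smooth_atlas_transition[OF A U W]]])
   (auto simp: D inv_into_map_prod[OF a(3) b(3)] intro!: open_Times o b(2))
 thus "\<exists>N. open N \<and> p \<in> N \<and> smooth_on (\<kappa> ` (D \<inter> (fst -` W \<inter> N))) (\<theta> \<circ> fst \<circ> inv_into D \<kappa>)"
  by (intro exI[of _ UNIV]) (simp add: im)
qed

lemma smooth_map_snd:
 assumes A: "smooth_atlas A" and B: "smooth_atlas B"
 shows "smooth_map (prod_atlas A B) B snd"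
proof (rule smooth_mapI[OF smooth_atlas_prod[OF A B] B continuous_on_snd[OF continuous_on_id]])
 fix D \<kappa> W \<theta> p assume "(D, \<kappa>) \<in> prod_atlas A B" and W: "(W, \<theta>) \<in> B"
 then obtain U \<phi> V \<psi> where U: "(U, \<phi>) \<in> A" and V: "(V, \<psi>) \<in> B" and D: "D = U \<times> V" "\<kappa> = map_prod \<phi> \<psi>"
  unfolding prod_atlas_def by blast
 note a = smooth_atlas_chart[OF A U] and b = smooth_atlas_chart[OF B V]
 have o: "open (\<psi> ` (V \<inter> W))" by (rule open_chart_image[OF B V smooth_atlas_chart(1)[OF B W]])
 have im: "\<kappa> ` (D \<inter> snd -` W) = \<phi> ` U \<times> \<psi> ` (V \<inter> W)"
  using image_map_prod_Int[of \<phi> \<psi> U V UNIV W] by (simp add: D vimage_snd)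
 have "smooth_on (\<phi> ` U \<times> \<psi> ` (V \<inter> W)) (\<theta> \<circ> snd \<circ> inv_into D \<kappa>)"
  by (rule smooth_on_cong[THEN iffD1, OF _ _ smooth_on_snd_compose[OF a(2) o smooth_atlas_transition[OF B V W]]])
   (auto simp: D inv_into_map_prod[OF a(3) b(3)] intro!: open_Times a(2) o)
 thus "\<exists>N. open N \<and> p \<in> N \<and> smooth_on (\<kappa> ` (D \<inter> (snd -` W \<inter> N))) (\<theta> \<circ> snd \<circ> inv_into D \<kappa>)"
  by (intro exI[of _ UNIV]) (simp add: im)
qed

lemma smooth_map_std_iff:
 assumes A: "smooth_atlas A"
 shows "smooth_map A std_atlas f \<longleftrightarrow> (\<forall>(U, \<phi>)\<in>A. smooth_on (\<phi> ` U) (f \<circ> inv_into U \<phi>))"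
proof
 assume f: "smooth_map A std_atlas f"
 show "\<forall>(U, \<phi>)\<in>A. smooth_on (\<phi> ` U) (f \<circ> inv_into U \<phi>)"
  using smooth_mapD[OF f, of _ _ UNIV id] by (auto simp: std_atlas_def)
next
 assume f: "\<forall>(U, \<phi>)\<in>A. smooth_on (\<phi> ` U) (f \<circ> inv_into U \<phi>)"
 have "continuous_on U f" if U: "(U, \<phi>) \<in> A" for U \<phi>
 proof -
  note a = smooth_atlas_chart[OF A U]
  have "continuous_on (\<phi> ` U) (f \<circ> inv_into U \<phi>)" using f U smooth_on_continuous by fast
  hence "continuous_on U ((f \<circ> inv_into U \<phi>) \<circ> \<phi>)"
   by (rule continuous_on_compose[OF a(4)])
  thus ?thesis
   by (rule continuous_on_eq) (simp add: inv_into_f_f[OF a(3)])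
 qed
 hence "continuous_on (\<Union>(U, \<phi>)\<in>A. U) f"
  using smooth_atlas_chart(1)[OF A] by (intro continuous_on_open_UN) auto
 hence "cont f" using A by (simp add: smooth_atlas_def)
 thus "smooth_map A std_atlas f"
  using f by (auto simp: smooth_map_def std_atlas_def)
qed

lemma smooth_map_prod_chart:
 assumes A: "smooth_atlas A" and B: "smooth_atlas B" and H: "smooth_map (prod_atlas A B) std_atlas H"
  and U: "(U, \<phi>) \<in> A" and V: "(V, \<psi>) \<in> B"
 shows "smooth_on (\<phi> ` U \<times> \<psi> ` V) (%z. H (inv_into U \<phi> (fst z), inv_into V \<psi> (snd z)))"
proof -
 note a = smooth_atlas_chart[OF A U] and b = smooth_atlas_chart[OF B V]
 have "(U \<times> V, map_prod \<phi> \<psi>) \<in> prod_atlas A B"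
  using U V unfolding prod_atlas_def by blast
 hence "smooth_on (\<phi> ` U \<times> \<psi> ` V) (H \<circ> inv_into (U \<times> V) (map_prod \<phi> \<psi>))"
  using H image_map_prod_Int[of \<phi> \<psi> U V U V] unfolding smooth_map_std_iff[OF smooth_atlas_prod[OF A B]] by auto
 thus ?thesis
  by (rule smooth_on_cong[OF open_Times[OF a(2) b(2)], THEN iffD1, rotated])
   (auto simp: inv_into_map_prod[OF a(3) b(3)])
qed

lemma smooth_map_std_std: "smooth_map std_atlas std_atlas f \<longleftrightarrow> smooth_on UNIV f"
 unfolding smooth_map_std_iff[OF smooth_atlas_std] by (auto simp: std_atlas_def inv_id_eq comp_def)

lemma smooth_map_bilinear:
 fixes f :: "'g::topological_space => 'a::euclidean_space" and g :: "'g => 'b::euclidean_space"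
  and B :: "'a => 'b => 'c::euclidean_space"
 assumes A: "smooth_atlas A" and f: "smooth_map A std_atlas f" and g: "smooth_map A std_atlas g"
  and B: "bounded_bilinear B"
 shows "smooth_map A std_atlas (%x. B (f x) (g x))"
proof -
 have "smooth_on UNIV (%p. B (fst p) (snd p))"
  by (intro smooth_on_bounded_bilinear[OF B] open_UNIV
    smooth_on_bounded_linear[OF bounded_linear_fst] smooth_on_bounded_linear[OF bounded_linear_snd])
 hence "smooth_map (prod_atlas std_atlas std_atlas) std_atlas (%p. B (fst p) (snd p))"
  by (simp add: prod_atlas_std smooth_map_std_std)
 from smooth_map_compose[OF A smooth_atlas_prod[OF smooth_atlas_std smooth_atlas_std] smooth_atlas_std
   smooth_map_Pair[OF A smooth_atlas_std smooth_atlas_std f g] this]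
 show ?thesis by simp
qed

lemmas smooth_map_mult = smooth_map_bilinear[OF _ _ _ bounded_bilinear_mult]
lemmas smooth_map_scaleR = smooth_map_bilinear[OF _ _ _ bounded_bilinear_scaleR]

lemma smooth_map_smooth_on:
 assumes A: "smooth_atlas A" and f: "smooth_map A std_atlas f" and g: "smooth_on UNIV g"
 shows "smooth_map A std_atlas (%x. g (f x))"
 using smooth_map_compose[OF A smooth_atlas_std smooth_atlas_std f] g by (simp add: smooth_map_std_std)

lemma smooth_map_linear:
 "smooth_atlas A ==> smooth_map A std_atlas f ==> bounded_linear L ==> smooth_map A std_atlas (%x. L (f x))"
 using smooth_map_smooth_on smooth_on_bounded_linear open_UNIV by blast

lemma smooth_map_add:
 fixes f g :: "'g::topological_space => 'a::euclidean_space"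
 assumes A: "smooth_atlas A" and f: "smooth_map A std_atlas f" and g: "smooth_map A std_atlas g"
 shows "smooth_map A std_atlas (%x. f x + g x)"
proof -
 have "smooth_on UNIV (%p::'a \<times> 'a. fst p + snd p)"
  by (intro smooth_on_add open_UNIV
    smooth_on_bounded_linear[OF bounded_linear_fst] smooth_on_bounded_linear[OF bounded_linear_snd])
 hence "smooth_map (prod_atlas std_atlas std_atlas) std_atlas (%p::'a \<times> 'a. fst p + snd p)"
  by (simp add: prod_atlas_std smooth_map_std_std)
 from smooth_map_compose[OF A smooth_atlas_prod[OF smooth_atlas_std smooth_atlas_std] smooth_atlas_std
   smooth_map_Pair[OF A smooth_atlas_std smooth_atlas_std f g] this]
 show ?thesis by simp
qed

lemma smooth_map_sum:
 fixes f :: "'i => 'g::topological_space => 'a::euclidean_space"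
 assumes A: "smooth_atlas A" and "\<And>i. i \<in> I ==> smooth_map A std_atlas (f i)"
 shows "smooth_map A std_atlas (%x. \<Sum>i\<in>I. f i x)"
 using assms(2)
proof (induction I rule: infinite_finite_induct)
 case (insert i I)
 thus ?case using smooth_map_add[OF A, of "f i" "%x. \<Sum>i\<in>I. f i x"] by simp
qed (simp_all add: smooth_map_const[OF A smooth_atlas_std])

section \<open>Cutoffs in a chart, and smoothness detected by test functions\<close>

lemma chart_cutoff:
 fixes A :: "('g::t2_space, 'e::euclidean_space) atlas" and h :: "'e => 'a::euclidean_space"
 assumes A: "smooth_atlas A" and U: "(U, \<phi>) \<in> A" and r: "r > 0" "cball a r \<subseteq> \<phi> ` U"
  and h: "smooth_on (\<phi> ` U) h"
 shows "smooth_map A std_atlas (%x. if x \<in> U then ball_bump a r (\<phi> x) *\<^sub>R h (\<phi> x) else 0)" (is "smooth_map _ _ ?f")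
 unfolding smooth_map_std_iff[OF A]
proof clarify
 fix U' \<phi>' assume U': "(U', \<phi>') \<in> A"
 note a = smooth_atlas_chart[OF A U] and a' = smooth_atlas_chart[OF A U']
 \<comment> \<open>The function vanishes off K, which is compact and hence closed in a Hausdorff
   space. So U and the complement of K are two open sets covering the group, and the extension by
   zero is smooth on each.\<close>
 define K where "K = inv_into U \<phi> ` cball a r"
 have "compact K" unfolding K_def
  by (intro compact_continuous_image continuous_on_subset[OF a(5) r(2)] compact_cball)
 hence cK: "closed K" by (rule compact_imp_closed)
 have KU: "K \<subseteq> U" using r(2) by (auto simp: K_def intro: inv_into_into)
 have zero: "?f x = 0" if "x \<notin> K" for x
 proof -
  have "\<phi> x \<notin> ball a r" if "x \<in> U"
  proof
   assume "\<phi> x \<in> ball a r"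
   hence "inv_into U \<phi> (\<phi> x) \<in> K" unfolding K_def using ball_subset_cball by blast
   with \<open>x \<in> U\<close> \<open>x \<notin> K\<close> show False by (simp add: inv_into_f_f[OF a(3)])
  qed
  thus ?thesis using ball_bump_pos[OF r(1), of a "\<phi> x"] ball_bump_nonneg[of a r "\<phi> x"] by auto
 qed
 show "smooth_on (\<phi>' ` U') (?f \<circ> inv_into U' \<phi>')"
 proof (rule smooth_on_local)
  fix y assume "y \<in> \<phi>' ` U'"
  then obtain x where x: "x \<in> U'" "y = \<phi>' x" by blast
  show "\<exists>T. open T \<and> y \<in> T \<and> smooth_on T (?f \<circ> inv_into U' \<phi>')"
  proof (cases "x \<in> U")
   case True
   let ?T = "\<phi>' ` (U' \<inter> U)"
   have oT: "open ?T" using open_chart_image[OF A U' a(1)] .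
   have 1: "smooth_on (\<phi> ` U) (%y. ball_bump a r y *\<^sub>R h y)"
    by (intro smooth_on_scaleR a(2) smooth_on_subset[OF smooth_on_ball_bump] h) auto
   have 2: "(\<phi> \<circ> inv_into U' \<phi>') ` ?T \<subseteq> \<phi> ` U"
    by (auto simp: inv_into_f_f[OF a'(3)])
   have "smooth_on ?T (%y. ball_bump a r ((\<phi> \<circ> inv_into U' \<phi>') y) *\<^sub>R h ((\<phi> \<circ> inv_into U' \<phi>') y))"
    using smooth_on_compose[OF oT a(2) smooth_atlas_transition[OF A U' U] 1 2] .
   hence "smooth_on ?T (?f \<circ> inv_into U' \<phi>')"
    by (subst smooth_on_cong[OF oT, of _ "%y. ball_bump a r ((\<phi> \<circ> inv_into U' \<phi>') y) *\<^sub>R h ((\<phi> \<circ> inv_into U' \<phi>') y)"])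
     (auto simp: inv_into_f_f[OF a'(3)])
   thus ?thesis using oT x True by blast
  next
   case False
   let ?T = "\<phi>' ` (U' \<inter> - K)"
   have oT: "open ?T" using open_chart_image[OF A U'] cK by (simp add: open_Compl)
   have "smooth_on ?T (?f \<circ> inv_into U' \<phi>')"
   proof (subst smooth_on_cong[OF oT, of _ "%_. 0"])
    fix y assume "y \<in> ?T"
    then obtain z where z: "z \<in> U'" "z \<notin> K" "y = \<phi>' z" by blast
    show "(?f \<circ> inv_into U' \<phi>') y = 0"
     unfolding comp_apply z(3) inv_into_f_f[OF a'(3) z(1)] by (rule zero[OF z(2)])
   qed (rule smooth_on_const[OF oT])
   moreover have "y \<in> ?T" using x False KU by blast
   ultimately show ?thesis using oT by blast
  qed
 qed
qed

lemma chart_cball: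
 assumes "smooth_atlas A" "(U, \<phi>) \<in> A" "x \<in> U" "open W" "x \<in> W"
 obtains r where "r > 0" "cball (\<phi> x) r \<subseteq> \<phi> ` (U \<inter> W)"
 using open_chart_image[OF assms(1,2,4)] assms(3,5) by (metis IntI imageI open_contains_cball)

text \<open>Near a point every coordinate of g is the quotient of two test functions composed with
  g: bump times coordinate, divided by the bump, which is positive there. This is how the
  exponential curves are shown to be smooth, since only their effect on smooth functions is
  known.\<close>

lemma smooth_map_if_test_functions:
 fixes B :: "('g::t2_space, 'e::euclidean_space) atlas"
  and A :: "('h::topological_space, 'f::euclidean_space) atlas"
 assumes A: "smooth_atlas A" and B: "smooth_atlas B" and cont: "cont g"
  and test: "\<And>f. f \<in> smooth_functions B ==> smooth_map A std_atlas (%x. f (g x))"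
 shows "smooth_map A B g"
proof (rule smooth_mapI[OF A B cont])
 fix U \<phi> V \<psi> x assume U: "(U, \<phi>) \<in> A" and V: "(V, \<psi>) \<in> B" "g x \<in> V"
 note a = smooth_atlas_chart[OF A U] and b = smooth_atlas_chart[OF B V(1)]
 obtain r where r: "r > 0" "cball (\<psi> (g x)) r \<subseteq> \<psi> ` (V \<inter> UNIV)"
  using chart_cball[OF B V open_UNIV] by blast
 hence r2: "cball (\<psi> (g x)) r \<subseteq> \<psi> ` V" by simp
 define F where "F h = (%z. if z \<in> V then ball_bump (\<psi> (g x)) r (\<psi> z) *\<^sub>R complex_of_real (h (\<psi> z)) else 0)" for h
 have F: "smooth_map A std_atlas (%z. Re (F h (g z)))" if "smooth_on (\<psi> ` V) h" for h
 proof -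
  have "smooth_on (\<psi> ` V) (%z. complex_of_real (h z))"
   by (rule smooth_on_bounded_linear_compose[OF bounded_linear_of_real b(2) that])
  from chart_cutoff[OF B V(1) r(1) r2 this] have "F h \<in> smooth_functions B"
   by (simp add: smooth_functions_def F_def)
  from smooth_map_linear[OF A test[OF this] bounded_linear_Re] show ?thesis .
 qed
 define W where "W = g -` (V \<inter> \<psi> -` ball (\<psi> (g x)) r)"
 have oW: "open W"
  unfolding W_def using continuous_open_preimage[OF b(4,1) open_ball, of "\<psi> (g x)" r] cont
  by (intro open_vimage) auto
 have xW: "x \<in> W" using V(2) r(1) by (simp add: W_def)
 let ?T = "\<phi> ` (U \<inter> W)"
 have oT: "open ?T" using open_chart_image[OF A U oW] .
 have loc: "smooth_on ?T (%y. Re (F h (g (inv_into U \<phi> y))))" if "smooth_on (\<psi> ` V) h" for h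
 proof -
  have "smooth_on (\<phi> ` U) ((%z. Re (F h (g z))) \<circ> inv_into U \<phi>)"
   using F[OF that] U unfolding smooth_map_std_iff[OF A] by fast
  thus ?thesis by (auto simp: comp_def intro: smooth_on_subset)
 qed
 have pos: "Re (F (%_. 1) (g (inv_into U \<phi> y))) > 0" if y: "y \<in> ?T" for y
 proof -
  obtain z where z: "z \<in> U" "z \<in> W" "y = \<phi> z" using y by blast
  hence "g z \<in> V" "ball_bump (\<psi> (g x)) r (\<psi> (g z)) > 0"
   by (simp_all add: W_def ball_bump_pos[OF r(1)])
  thus ?thesis using z by (simp add: F_def inv_into_f_f[OF a(3)])
 qed
 have "smooth_on ?T (%y. inverse (Re (F (%_. 1) (g (inv_into U \<phi> y)))))"
  by (rule smooth_on_compose[OF oT _ loc smooth_on_inverse])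
   (use pos in \<open>auto intro: smooth_on_const b(2)\<close>)
 hence s1: "smooth_on ?T (%y. \<Sum>i\<in>Basis. (inverse (Re (F (%_. 1) (g (inv_into U \<phi> y))))
   * Re (F (%z. inner z i) (g (inv_into U \<phi> y)))) *\<^sub>R i)"
  by (intro smooth_on_sum smooth_on_scaleR smooth_on_mult smooth_on_const loc oT
    smooth_on_bounded_linear[OF bounded_linear_inner_left b(2)])
 have s2: "(\<Sum>i\<in>Basis. (inverse (Re (F (%_. 1) (g (inv_into U \<phi> y))))
   * Re (F (%z. inner z i) (g (inv_into U \<phi> y)))) *\<^sub>R i) = (\<psi> \<circ> g \<circ> inv_into U \<phi>) y" if "y \<in> ?T" for y
 proof -
  have "g (inv_into U \<phi> y) \<in> V" using that by (auto simp: W_def inv_into_f_f[OF a(3)])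
  hence "inverse (Re (F (%_. 1) (g (inv_into U \<phi> y)))) * Re (F (%z. inner z i) (g (inv_into U \<phi> y)))
    = inner (\<psi> (g (inv_into U \<phi> y))) i" for i
   using pos[OF that] by (simp add: F_def field_simps)
  thus ?thesis by (simp add: euclidean_representation)
 qed
 have "smooth_on ?T (\<psi> \<circ> g \<circ> inv_into U \<phi>)"
  by (rule smooth_on_cong[OF oT, THEN iffD1, OF _ s1]) (rule s2)
 moreover have "g -` V \<inter> W = W" by (auto simp: W_def)
 ultimately show "\<exists>W. open W \<and> x \<in> W \<and> smooth_on (\<phi> ` (U \<inter> (g -` V \<inter> W))) (\<psi> \<circ> g \<circ> inv_into U \<phi>)"
  using oW xW by (intro exI[of _ W]) simp
qed

subsection \<open>Bounded functionals applied to smooth families\<close>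

text \<open>The common hypothesis for all operations under which derivatives are taken: means with a
  continuous density, convergent series of functionals, and the integral over [0,1]. The last one
  lives on the noncompact line, which is why K is a separate compact set.\<close>

definition compact_functional :: "(('p::topological_space => complex) => complex) => bool" where
 "compact_functional L \<longleftrightarrow> (\<exists>K C. compact K \<and> C \<ge> 0 \<and>
   (\<forall>f g. cont f \<longrightarrow> cont g \<longrightarrow> L (%p. f p + g p) = L f + L g) \<and>
   (\<forall>c f. cont f \<longrightarrow> L (%p. c * f p) = c * L f) \<and>
   (\<forall>f b. cont f \<longrightarrow> (\<forall>p\<in>K. norm (f p) \<le> b) \<longrightarrow> norm (L f) \<le> C * b))"

context
 fixes S :: "'e::euclidean_space set" and B :: "('p::topological_space, 'f::euclidean_space) atlas"
 assumes S: "open S" and B: "smooth_atlas B"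
begin

definition smooth_family :: "('e \<times> 'p => complex) => bool" where
 "smooth_family h \<longleftrightarrow> (\<forall>(V, \<psi>)\<in>B. smooth_on (S \<times> \<psi> ` V) (%z. h (fst z, inv_into V \<psi> (snd z))))"

definition family_derivative :: "('e \<times> 'p => complex) => 'e => 'e \<times> 'p => complex" where
 "family_derivative h v = (%(y, p). frechet_derivative (%y. h (y, p)) (at y) v)"

lemma smooth_family_chart:
 assumes "smooth_family h" "(V, \<psi>) \<in> B"
 shows "smooth_on (S \<times> \<psi> ` V) (%z. h (fst z, inv_into V \<psi> (snd z)))"
 using assms unfolding smooth_family_def by fast

lemma smooth_family_continuous:
 assumes h: "smooth_family h" shows "continuous_on (S \<times> UNIV) h"
proof -
 have "continuous_on (S \<times> V) h" if V: "(V, \<psi>) \<in> B" for V \<psi>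
 proof -
  note b = smooth_atlas_chart[OF B V]
  have "continuous_on (S \<times> V) (%z. (%z. h (fst z, inv_into V \<psi> (snd z))) (fst z, \<psi> (snd z)))"
   by (rule continuous_on_compose2[OF smooth_on_continuous[OF smooth_family_chart[OF h V]]])
    (auto intro!: continuous_intros continuous_on_compose2[OF b(4)])
  thus ?thesis
   by (rule continuous_on_eq) (auto simp: inv_into_f_f[OF b(3)])
 qed
 hence "continuous_on (\<Union>c\<in>B. S \<times> fst c) h"
  using S smooth_atlas_chart(1)[OF B]
  by (intro continuous_on_open_UN open_Times) auto
 moreover have "(\<Union>c\<in>B. S \<times> fst c) = S \<times> UNIV"
  using B unfolding smooth_atlas_def by (auto simp: case_prod_beta)
 ultimately show ?thesis by simp
qed

lemma smooth_family_has_derivative_chart: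
 assumes h: "smooth_family h" and V: "(V, \<psi>) \<in> B" "p \<in> V" and y: "y \<in> S"
 shows "((%y. h (y, p)) has_derivative
  (%v. frechet_derivative (%z. h (fst z, inv_into V \<psi> (snd z))) (at (y, \<psi> p)) (v, 0))) (at y)"
proof -
 note b = smooth_atlas_chart[OF B V(1)]
 let ?h = "%z. h (fst z, inv_into V \<psi> (snd z))"
 have 1: "((%y. (y, \<psi> p)) has_derivative (%v. (v, 0))) (at y)"
  by (auto intro!: derivative_eq_intros)
 have 2: "(?h has_derivative frechet_derivative ?h (at (y, \<psi> p))) (at (y, \<psi> p))"
  using smooth_on_has_derivative[OF smooth_family_chart[OF h V(1)]] V y by auto
 from has_derivative_compose[OF 1 2] show ?thesis
  using V(2) by (simp add: inv_into_f_f[OF b(3)])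
qed

lemma smooth_family_has_derivative:
 assumes h: "smooth_family h" and y: "y \<in> S"
 shows "((%y. h (y, p)) has_derivative (%v. family_derivative h v (y, p))) (at y)"
proof -
 obtain V \<psi> where V: "(V, \<psi>) \<in> B" "p \<in> V" using smooth_atlas_cover[OF B] .
 have "(%y. h (y, p)) differentiable (at y)"
  using smooth_family_has_derivative_chart[OF h V y] by (auto simp: differentiable_def)
 thus ?thesis
  by (simp add: family_derivative_def frechet_derivative_works)
qed

lemma smooth_family_derivative:
 assumes h: "smooth_family h" shows "smooth_family (family_derivative h v)"
 unfolding smooth_family_def
proof clarify
 fix V \<psi> assume V: "(V, \<psi>) \<in> B"
 note b = smooth_atlas_chart[OF B V]
 let ?h = "%z. h (fst z, inv_into V \<psi> (snd z))"
 have "smooth_on (S \<times> \<psi> ` V) (%z. frechet_derivative ?h (at z) (v, 0))"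
  using smooth_on_frechet_derivative[OF smooth_family_chart[OF h V]] .
 thus "smooth_on (S \<times> \<psi> ` V) (%z. family_derivative h v (fst z, inv_into V \<psi> (snd z)))"
 proof (rule smooth_on_cong[OF open_Times[OF S b(2)], THEN iffD1, rotated])
  fix z assume "z \<in> S \<times> \<psi> ` V"
  then obtain y p where z: "z = (y, \<psi> p)" "y \<in> S" "p \<in> V" by blast
  from has_derivative_unique[OF smooth_family_has_derivative_chart[OF h V z(3,2)]
    smooth_family_has_derivative[OF h z(2)]]
  show "frechet_derivative ?h (at z) (v, 0) = family_derivative h v (fst z, inv_into V \<psi> (snd z))"
   using z by (auto simp: inv_into_f_f[OF b(3)] dest: fun_cong)
 qed
qed

text \<open>L sees only the supremum over the compact K, so it suffices that the first-order
  remainder of y -> h (y, p) is o(|y' - y|) uniformly in p from K. This follows from the mean value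
  inequality and the uniform closeness over K of the derivatives at nearby y.\<close>

lemma has_derivative_functional:
 fixes L :: "('p => complex) => complex"
 assumes h: "smooth_family h" and y: "y \<in> S" and L: "compact_functional L"
 shows "((%y. L (%p. h (y, p))) has_derivative (%v. L (%p. family_derivative h v (y, p)))) (at y)"
proof -
 from L obtain K C where K: "compact K" "C \<ge> 0"
  and L3: "\<forall>f g. cont f \<longrightarrow> cont g \<longrightarrow> L (%p. f p + g p) = L f + L g"
  "\<forall>c f. cont f \<longrightarrow> L (%p. c * f p) = c * L f"
  "\<forall>f b. cont f \<longrightarrow> (\<forall>p\<in>K. norm (f p) \<le> b) \<longrightarrow> norm (L f) \<le> C * b"
  unfolding compact_functional_def by (elim exE conjE) (rule that)
 note add = L3(1)[rule_format] and scale = L3(2)[rule_format] and bound = L3(3)[rule_format]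
 let ?D = "family_derivative h"
 have cont: "cont (%p. k (y, p))" if "smooth_family k" "y \<in> S" for k y
  by (rule continuous_on_compose2[OF smooth_family_continuous[OF that(1)]])
   (use that(2) in \<open>auto intro!: continuous_intros\<close>)
 note cD = cont[OF smooth_family_derivative[OF h]]
 have lin: "linear (%v. ?D v (y, p))" if "y \<in> S" for y p
  using has_derivative_linear[OF smooth_family_has_derivative[OF h that]] .
 have linL: "linear (%v. L (%p. ?D v (y, p)))"
 proof (rule linearI)
  fix v w and r :: real
  show "L (%p. ?D (v + w) (y, p)) = L (%p. ?D v (y, p)) + L (%p. ?D w (y, p))"
   using add[OF cD[OF y, of v] cD[OF y, of w]] by (simp only: linear_add[OF lin[OF y]])
  show "L (%p. ?D (r *\<^sub>R v) (y, p)) = r *\<^sub>R L (%p. ?D v (y, p))"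
   using scale[OF cD[OF y, of v], of "of_real r"]
   by (simp only: linear_cmul[OF lin[OF y]] scaleR_conv_of_real)
 qed
 have "\<exists>d>0. \<forall>y'. norm (y' - y) < d \<longrightarrow>
   norm (L (%p. h (y', p)) - L (%p. h (y, p)) - L (%p. ?D (y' - y) (y, p))) \<le> e * norm (y' - y)"
  if e: "e > 0" for e
 proof -
  \<comment> \<open>The factor DIM('e) is lost when the derivative is estimated by its values on the
    basis, the factor C when L is applied; C + 1 keeps the divisor positive.\<close>
  define e' where "e' = e / (DIM('e) * (C + 1))"
  have e': "e' > 0" using e K(2) by (simp add: e'_def)
  have "\<exists>d>0. \<forall>y'\<in>S. dist y' y < d \<longrightarrow> (\<forall>p\<in>K. norm (?D b (y', p) - ?D b (y, p)) \<le> e')" for b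
  proof -
   have "continuous_on (S \<times> K) (?D b)"
    by (rule continuous_on_subset[OF smooth_family_continuous[OF smooth_family_derivative[OF h]]]) auto
   from continuous_on_prod_compactE[OF this K(1) y e']
   obtain X0 where X0: "y \<in> X0" "open X0" "\<forall>x\<in>X0 \<inter> S. \<forall>t\<in>K. dist (?D b (x, t)) (?D b (y, t)) \<le> e'"
    by blast
   then obtain d where "d > 0" "ball y d \<subseteq> X0" by (meson openE)
   thus ?thesis using X0(3)
    by (intro exI[of _ d]) (auto simp: dist_norm dist_commute subset_iff norm_minus_commute)
  qed
  then obtain d where d: "\<And>b. d b > 0"
   "\<And>b y' p. y' \<in> S ==> dist y' y < d b ==> p \<in> K ==> norm (?D b (y', p) - ?D b (y, p)) \<le> e'"
   by metis
  obtain d0 where d0: "d0 > 0" "ball y d0 \<subseteq> S" using S y by (meson openE)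
  define r where "r = Min (insert d0 (d ` Basis))"
  have r: "r > 0" "r \<le> d0" "\<And>b. b \<in> Basis ==> r \<le> d b"
   using d(1) d0(1) unfolding r_def
   by (subst Min_gr_iff; force) (rule Min_le; force)+
  have rS: "ball y r \<subseteq> S" using d0 r by (auto simp: subset_iff)
  have main: "norm (h (y', p) - h (y, p) - ?D (y' - y) (y, p)) \<le> norm (y' - y) * (DIM('e) * e')"
   if y': "norm (y' - y) < r" and p: "p \<in> K" for y' p
  proof (rule differentiable_bound_linearization[where S = "ball y r" and f = "%y. h (y, p)"
     and f' = "%x v. ?D v (x, p)"])
   fix t :: real assume "t \<in> {0..1}"
   hence "norm (t *\<^sub>R (y' - y)) \<le> 1 * norm (y' - y)"
    unfolding norm_scaleR by (intro mult_right_mono) auto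
   thus "y + t *\<^sub>R (y' - y) \<in> ball y r"
    using y' by (simp add: dist_norm)
  next
   fix x assume x: "x \<in> ball y r"
   hence "x \<in> S" using rS by blast
   thus "((%y. h (y, p)) has_derivative (%v. ?D v (x, p))) (at x within ball y r)"
    using smooth_family_has_derivative[OF h] has_derivative_at_withinI by blast
   show "onorm ((%v. ?D v (x, p)) - (%v. ?D v (y, p))) \<le> DIM('e) * e'"
   proof (rule onorm_le)
    fix v
    have l: "linear (%v. ?D v (x, p) - ?D v (y, p))"
     using lin[OF \<open>x \<in> S\<close>] lin[OF y] by (rule linear_compose_sub)
    have "?D v (x, p) - ?D v (y, p) = (%v. ?D v (x, p) - ?D v (y, p)) (\<Sum>b\<in>Basis. inner v b *\<^sub>R b)"
     by (simp only: euclidean_representation)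
    also have "... = (\<Sum>b\<in>Basis. inner v b *\<^sub>R (?D b (x, p) - ?D b (y, p)))"
     unfolding linear_sum[OF l] linear_cmul[OF l] ..
    also have "norm ... \<le> (\<Sum>b\<in>(Basis::'e set). norm v * e')"
    proof (rule sum_norm_le)
     fix b :: 'e assume b: "b \<in> Basis"
     have "norm (?D b (x, p) - ?D b (y, p)) \<le> e'"
      using d(2)[OF \<open>x \<in> S\<close> _ p] x r(3)[OF b] by (simp add: dist_commute)
     moreover have "\<bar>inner v b\<bar> \<le> norm v" using Basis_le_norm[OF b] .
     ultimately show "norm (inner v b *\<^sub>R (?D b (x, p) - ?D b (y, p))) \<le> norm v * e'"
      unfolding norm_scaleR by (intro mult_mono) auto
    qed
    finally show "norm (((%v. ?D v (x, p)) - (%v. ?D v (y, p))) v) \<le> DIM('e) * e' * norm v"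
     by (simp add: algebra_simps)
   qed
  qed (use r in auto)
  have "norm (L (%p. h (y', p)) - L (%p. h (y, p)) - L (%p. ?D (y' - y) (y, p))) \<le> e * norm (y' - y)"
   if y': "norm (y' - y) < r" for y'
  proof -
   have y'S: "y' \<in> S" using rS y' by (auto simp: dist_norm norm_minus_commute)
   note c1 = cont[OF h y'S] and c2 = cont[OF h y] and c3 = cD[OF y, of "y' - y"]
   have c2': "cont (%p. - 1 * h (y, p))" and c3': "cont (%p. - 1 * ?D (y' - y) (y, p))"
    using c2 c3 by (auto intro!: continuous_intros)
   have "L (%p. (h (y', p) + - 1 * h (y, p)) + - 1 * ?D (y' - y) (y, p))
     = L (%p. h (y', p)) - L (%p. h (y, p)) - L (%p. ?D (y' - y) (y, p))"
    using add[OF continuous_on_add[OF c1 c2'] c3'] add[OF c1 c2'] scale[OF c2, of "- 1"] scale[OF c3, of "- 1"]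
    by simp
   moreover have "norm (L (%p. (h (y', p) + - 1 * h (y, p)) + - 1 * ?D (y' - y) (y, p)))
     \<le> C * (norm (y' - y) * (DIM('e) * e'))"
   proof (rule bound)
    show "cont (%p. (h (y', p) + - 1 * h (y, p)) + - 1 * ?D (y' - y) (y, p))"
     by (rule continuous_on_add[OF continuous_on_add[OF c1 c2'] c3'])
    show "norm ((h (y', p) + - 1 * h (y, p)) + - 1 * ?D (y' - y) (y, p)) \<le> norm (y' - y) * (DIM('e) * e')"
     if "p \<in> K" for p
     using main[OF y' that] by simp
   qed
   moreover have "C * (norm (y' - y) * (DIM('e) * e')) \<le> e * norm (y' - y)"
   proof -
    have "DIM('e) * e' = e / (C + 1)" unfolding e'_def by simp
    moreover have "C * (norm (y' - y) * (e / (C + 1))) = (C / (C + 1)) * (e * norm (y' - y))" by simp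
    moreover have "(C / (C + 1)) * (e * norm (y' - y)) \<le> 1 * (e * norm (y' - y))"
     using K(2) e by (intro mult_right_mono) auto
    ultimately show ?thesis by (simp add: ac_simps)
   qed
   ultimately show ?thesis by simp
  qed
  thus ?thesis using r(1) by blast
 qed
 with linL show ?thesis
  unfolding has_derivative_at_alt linear_conv_bounded_linear by blast
qed

text \<open>The functions y -> L (h (y, .)) with h a smooth family form a class closed under
  derivatives, because the derivative falls on h and leaves a smooth family.\<close>

lemma smooth_on_functional:
 fixes L :: "('p => complex) => complex"
 assumes h: "smooth_family h" and L: "compact_functional L"
 shows "smooth_on S (%y. L (%p. h (y, p)))"
proof (rule smooth_on_coinduct[where P = "%F. \<exists>h. smooth_family h \<and> F = (%y. L (%p. h (y, p)))"])
 show "\<exists>k. smooth_family k \<and> (%y. L (%p. h (y, p))) = (%y. L (%p. k (y, p)))"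
  using h by blast
 fix F assume "\<exists>h. smooth_family h \<and> F = (%y. L (%p. h (y, p)))"
 then obtain k where k: "smooth_family k" and F: "F = (%y. L (%p. k (y, p)))" by blast
 have d: "(F has_derivative (%v. L (%p. family_derivative k v (y, p)))) (at y)" if "y \<in> S" for y
  unfolding F using has_derivative_functional[OF k that L] .
 show "continuous_on S F"
  using d has_derivative_continuous continuous_at_imp_continuous_on by blast
 show "\<exists>f'. (\<forall>x\<in>S. (F has_derivative f' x) (at x)) \<and>
   (\<forall>v. \<exists>h. smooth_family h \<and> (%x. f' x v) = (%y. L (%p. h (y, p))))"
  using d smooth_family_derivative[OF k]
  by (intro exI[of _ "%y v. L (%p. family_derivative k v (y, p))"] conjI ballI allI) blast+
qed (rule S)

end

lemma smooth_family_chart_map: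
 assumes A: "smooth_atlas A" and B: "smooth_atlas B"
  and H: "smooth_map (prod_atlas A B) std_atlas H" and U: "(U, \<phi>) \<in> A"
 shows "smooth_family (\<phi> ` U) B (%z. H (inv_into U \<phi> (fst z), snd z))"
 unfolding smooth_family_def[OF smooth_atlas_chart(2)[OF A U] B]
 using smooth_map_prod_chart[OF A B H U] by auto

lemma smooth_map_functional:
 assumes A: "smooth_atlas A" and B: "smooth_atlas B"
  and H: "smooth_map (prod_atlas A B) std_atlas H" and L: "compact_functional L"
 shows "smooth_map A std_atlas (%x. L (%p. H (x, p)))"
 unfolding smooth_map_std_iff[OF A]
proof clarify
 fix U \<phi> assume U: "(U, \<phi>) \<in> A"
 from smooth_on_functional[OF smooth_atlas_chart(2)[OF A U] B smooth_family_chart_map[OF A B H U] L]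
 show "smooth_on (\<phi> ` U) ((%x. L (%p. H (x, p))) \<circ> inv_into U \<phi>)"
  by (simp add: comp_def)
qed

subsection \<open>The invariant mean of a compact group\<close>

locale compact_topological_group = group G
 for G :: "'g::topological_space monoid" (structure) +
 assumes carrier_eq_UNIV [simp]: "carrier G = UNIV"
  and compact_space: "compact (UNIV :: 'g set)"
  and continuous_mult: "cont (%p. fst p \<otimes> snd p)"
  and continuous_inv: "cont (%x. inv x)"
begin

lemma continuous_on_group_mult [continuous_intros]:
 assumes "continuous_on S f" "continuous_on S g"
 shows "continuous_on S (%x. f x \<otimes> g x)"
 using continuous_on_compose2[OF continuous_mult continuous_on_Pair[OF assms]] by simp

lemma continuous_on_group_inv [continuous_intros]:
 assumes "continuous_on S f" shows "continuous_on S (%x. inv (f x))"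
 using continuous_on_compose2[OF continuous_inv assms] by simp

lemma mult_inv_cancel [simp]: "inv a \<otimes> (a \<otimes> b) = b" "a \<otimes> (inv a \<otimes> b) = b"
 "a \<otimes> inv a = \<one>" "inv a \<otimes> a = \<one>"
 by (simp_all add: m_assoc[symmetric])

lemma bounded_continuous:
 assumes "cont (f :: 'g => 'b::real_normed_vector)"
 obtains b where "b > 0" "\<And>x. norm (f x) \<le> b"
proof -
 have "bounded (range f)"
  using compact_continuous_image[OF assms compact_space] compact_imp_bounded by blast
 thus ?thesis using that by (auto simp: bounded_pos)
qed

lemma uniform_continuity:
 assumes "cont (f :: 'g => 'b::metric_space)" "e > 0"
 obtains W where "open W" "\<one> \<in> W" "\<And>x w. w \<in> W ==> dist (f (x \<otimes> w)) (f x) \<le> e"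
proof -
 have "continuous_on (UNIV \<times> UNIV) (%p. f (snd p \<otimes> fst p))"
  by (intro continuous_on_compose2[OF assms(1)] continuous_intros) auto
 from continuous_on_prod_compactE[OF this compact_space UNIV_I assms(2), of "\<one>"]
 obtain X0 where "\<one> \<in> X0" "open X0" "\<forall>w\<in>X0 \<inter> UNIV. \<forall>t\<in>UNIV. dist (f (t \<otimes> w)) (f (t \<otimes> \<one>)) \<le> e"
  by (metis fst_conv snd_conv)
 thus ?thesis using that by simp
qed

lemma finite_translate_cover:
 assumes "open W" "w0 \<in> W"
 obtains B where "finite B" "B \<noteq> {}" "\<And>x. \<exists>b\<in>B. b \<otimes> x \<in> W"
proof -
 have "open {x. b \<otimes> x \<in> W}" for b
 proof -
  have "cont (%x. b \<otimes> x)" by (intro continuous_intros)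
  from open_vimage[OF assms(1) this] show ?thesis by (simp add: vimage_def)
 qed
 moreover have "UNIV \<subseteq> (\<Union>b\<in>UNIV. {x. b \<otimes> x \<in> W})"
 proof
  fix x
  have "(w0 \<otimes> inv x) \<otimes> x \<in> W" using assms(2) by (simp add: m_assoc)
  thus "x \<in> (\<Union>b\<in>UNIV. {x. b \<otimes> x \<in> W})" by blast
 qed
 ultimately obtain B where "finite B" "UNIV \<subseteq> (\<Union>b\<in>B. {x. b \<otimes> x \<in> W})"
  using compactE_image[OF compact_space, of UNIV "%b. {x. b \<otimes> x \<in> W}"] by (metis (no_types, lifting))
 hence *: "\<exists>b\<in>B. b \<otimes> x \<in> W" for x by blast
 hence "B \<noteq> {}" by blast
 thus ?thesis using that[OF \<open>finite B\<close>] * by blast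
qed

text \<open>Lists count translates with multiplicity, so that an average of averages is again an
  average (\<open>lavg_lavg\<close>).\<close>

definition lavg :: "'g list => ('g => real) => 'g => real"
 where "lavg gs f x = (\<Sum>g\<leftarrow>gs. f (g \<otimes> x)) / length gs"

definition ravg :: "'g list => ('g => real) => 'g => real"
 where "ravg gs f x = (\<Sum>g\<leftarrow>gs. f (x \<otimes> g)) / length gs"

lemma avg_bounds:
 assumes "gs \<noteq> []" "\<And>g. g \<in> set gs ==> lo \<le> F g \<and> F g \<le> hi"
 shows "lo \<le> (\<Sum>g\<leftarrow>gs. F g) / length gs" "(\<Sum>g\<leftarrow>gs. F g) / length gs \<le> (hi :: real)"
proof -
 have "length gs * lo \<le> (\<Sum>g\<leftarrow>gs. F g) \<and> (\<Sum>g\<leftarrow>gs. F g) \<le> length gs * hi"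
  using assms(2) by (induction gs) (auto simp: algebra_simps add_mono)
 thus "lo \<le> (\<Sum>g\<leftarrow>gs. F g) / length gs" "(\<Sum>g\<leftarrow>gs. F g) / length gs \<le> hi"
  using assms(1) by (auto simp: field_simps)
qed

lemma avg_dist:
 assumes "gs \<noteq> []" "\<And>g. g \<in> set gs ==> \<bar>F g - c\<bar> \<le> e"
 shows "\<bar>(\<Sum>g\<leftarrow>gs. F g) / length gs - c\<bar> \<le> (e :: real)"
 using avg_bounds[OF assms(1), of "c - e" F "c + e"] assms(2) by (force simp: abs_le_iff)

lemma lavg_lavg:
 "lavg gs (lavg hs f) = lavg (concat (map (%g. map (%h. h \<otimes> g) hs) gs)) f"
proof
 fix x
 have "(\<Sum>g\<leftarrow>gs. lavg hs f (g \<otimes> x)) = (\<Sum>k\<leftarrow>concat (map (%g. map (%h. h \<otimes> g) hs) gs). f (k \<otimes> x)) / length hs"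
  by (induction gs) (simp_all add: lavg_def m_assoc comp_def add_divide_distrib)
 moreover have "length (concat (map (%g. map (%h. h \<otimes> g) hs) gs)) = length gs * length hs"
  by (induction gs) simp_all
 ultimately show "lavg gs (lavg hs f) x = lavg (concat (map (%g. map (%h. h \<otimes> g) hs) gs)) f x"
  by (simp add: lavg_def[of _ "lavg hs f"] lavg_def[of "concat _"] mult.commute)
qed

lemma lavg_ravg: "lavg gs (ravg hs f) x = ravg hs (lavg gs f) x"
proof -
 have "(\<Sum>g\<leftarrow>gs. \<Sum>h\<leftarrow>hs. f (g \<otimes> (x \<otimes> h))) = (\<Sum>h\<leftarrow>hs. \<Sum>g\<leftarrow>gs. f (g \<otimes> (x \<otimes> h)))"
  by (induction gs) (simp_all add: sum_list_addf)
 moreover have "(\<Sum>g\<leftarrow>gs. F g / c) = (\<Sum>g\<leftarrow>gs. F g) / c" for F :: "'g => real" and c and gs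
  by (induction gs) (simp_all add: add_divide_distrib)
 ultimately show ?thesis by (simp add: lavg_def ravg_def m_assoc)
qed

lemma continuous_on_avg:
 assumes "cont f"
 shows "cont (lavg gs f)" "cont (ravg gs f)"
proof -
 have "cont (%x. f (g \<otimes> x))" "cont (%x. f (x \<otimes> g))" for g
  by (intro continuous_on_compose2[OF assms] continuous_intros; simp)+
 hence "cont (%x. \<Sum>g\<leftarrow>gs. f (g \<otimes> x))" "cont (%x. \<Sum>g\<leftarrow>gs. f (x \<otimes> g))"
  by (induction gs) (auto intro!: continuous_intros)
 thus "cont (lavg gs f)" "cont (ravg gs f)"
  unfolding lavg_def[abs_def] ravg_def[abs_def] divide_inverse
  by (intro continuous_on_mult continuous_on_const; simp)+
qed

text \<open>Averaging a function over translates that hit the set where it is small lowers its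
 oscillation by a fixed amount, because all averages share one modulus of continuity.\<close>

lemma lavg_nearly_constant:
 assumes f: "cont f" and e: "e > 0"
 obtains gs c where "gs \<noteq> []" "\<And>x. \<bar>lavg gs f x - c\<bar> \<le> e"
proof -
 obtain W where W: "open W" "\<one> \<in> W" "\<And>x w. w \<in> W ==> dist (f (x \<otimes> w)) (f x) \<le> e / 4"
  using uniform_continuity[OF f, of "e / 4"] e by (metis divide_pos_pos zero_less_numeral)
 obtain B where B: "finite B" "B \<noteq> {}" "\<And>x. \<exists>b\<in>B. b \<otimes> x \<in> W"
  using finite_translate_cover[OF W(1,2)] by blast
 obtain bs where bs: "set bs = B" using finite_list[OF B(1)] by blast
 define n where "n = real (length bs)"
 have n: "n > 0" using bs B(2) by (auto simp: n_def)
 \<comment> \<open>Of the n translates, one contributes at most hi - e/4 instead of hi; the upper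
   bound of the average therefore drops by e / (4 n).\<close>
 define d where "d = e / (4 * n)"
 have d: "d > 0" "d \<le> e / 4" using e n bs B(2)
  by (auto simp: d_def n_def field_simps Suc_leI)
 have step: "\<exists>hs lo' hi'. hs \<noteq> [] \<and> hi' - lo' \<le> max e (hi - lo - d) \<and>
   (\<forall>x. lo' \<le> lavg hs f x \<and> lavg hs f x \<le> hi')"
  if gs: "gs \<noteq> []" and b: "\<forall>x. lo \<le> lavg gs f x \<and> lavg gs f x \<le> hi" for gs lo hi
 \<comment> \<open>If some value lies within e/2 of lo, averaging over translates of x0 lowers the
   upper bound by d. If not, lo itself can be raised by e/2 without changing the list, unless the
   oscillation is already below e.\<close>
 proof (cases "\<exists>x0. lavg gs f x0 \<le> lo + e / 2 \<and> hi - lo \<ge> e")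
  case True
  then obtain x0 where x0: "lavg gs f x0 \<le> lo + e / 2" "hi - lo \<ge> e" by blast
  have mod: "\<bar>lavg gs f (x \<otimes> w) - lavg gs f x\<bar> \<le> e / 4" if w: "w \<in> W" for x w
  proof -
   have "lavg gs f (x \<otimes> w) - lavg gs f x = (\<Sum>g\<leftarrow>gs. f (g \<otimes> (x \<otimes> w)) - f (g \<otimes> x)) / length gs"
    unfolding lavg_def by (simp add: sum_list_subtractf diff_divide_distrib)
   thus ?thesis
    using avg_dist[OF gs, of "%g. f (g \<otimes> (x \<otimes> w)) - f (g \<otimes> x)" 0 "e / 4"] W(3)[OF w]
    by (simp add: dist_real_def m_assoc[symmetric])
  qed
  define h where "h = lavg gs f"
  define cs where "cs = map (%b. x0 \<otimes> b) bs"
  have up: "(\<Sum>g\<leftarrow>cs. h (g \<otimes> x)) \<le> n * hi - e / 4" for x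
  proof -
   obtain b where b': "b \<in> set bs" "b \<otimes> x \<in> W" using B(3) bs by blast
   then obtain xs ys where xy: "bs = xs @ b # ys" by (meson split_list)
   have "h (x0 \<otimes> (b \<otimes> x)) \<le> h x0 + e / 4"
    using mod[OF b'(2), of x0] unfolding h_def abs_le_iff by linarith
   hence 1: "h (x0 \<otimes> (b \<otimes> x)) \<le> hi - e / 4" using x0 by (simp add: h_def)
   have 2: "(\<Sum>g\<leftarrow>map (%b. x0 \<otimes> b) zs. h (g \<otimes> x)) \<le> length zs * hi" for zs
    using b by (induction zs) (auto simp: h_def algebra_simps add_mono)
   show ?thesis
    using 1 2[of xs] 2[of ys] by (simp add: cs_def xy n_def m_assoc algebra_simps)
  qed
  have cs: "cs \<noteq> []" "real (length cs) = n" using bs B(2) by (auto simp: cs_def n_def)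
  have "lo \<le> lavg cs h x \<and> lavg cs h x \<le> hi - d" for x
   using up[of x] avg_bounds(1)[OF cs(1), of lo "%g. h (g \<otimes> x)" hi] b n
   by (auto simp: lavg_def[of cs] cs(2) d_def h_def field_simps)
  hence "hi - d - lo \<le> max e (hi - lo - d) \<and> (\<forall>x. lo \<le> lavg cs h x \<and> lavg cs h x \<le> hi - d)"
   by auto
  moreover have "lavg cs h = lavg (concat (map (%g. map (%h. h \<otimes> g) gs) cs)) f"
   unfolding h_def by (rule lavg_lavg)
  moreover have "concat (map (%g. map (%h. h \<otimes> g) gs) cs) \<noteq> []"
   using cs(1) gs by (cases cs) auto
  ultimately show ?thesis by metis
 next
  case False
  show ?thesis
  proof (cases "hi - lo \<ge> e")
   case True
   with False have "lo + e / 2 \<le> lavg gs f x" for x by (meson linear)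
   thus ?thesis
    using gs b d e by (intro exI[of _ gs] exI[of _ "lo + e / 2"] exI[of _ hi]) auto
  next
   case False
   thus ?thesis
    using gs b by (intro exI[of _ gs] exI[of _ lo] exI[of _ hi]) auto
  qed
 qed
 have "\<exists>hs lo' hi'. hs \<noteq> [] \<and> hi' - lo' \<le> e \<and> (\<forall>x. lo' \<le> lavg hs f x \<and> lavg hs f x \<le> hi')"
  if "gs \<noteq> []" "\<forall>x. lo \<le> lavg gs f x \<and> lavg gs f x \<le> hi" "hi - lo \<le> e + real k * d" for gs lo hi k
  using that
 proof (induction k arbitrary: gs lo hi)
  case 0
  thus ?case by (intro exI[of _ gs] exI[of _ lo] exI[of _ hi]) auto
 next
  case (Suc k)
  from step[OF Suc.prems(1,2)] obtain hs lo' hi' where h: "hs \<noteq> []" "hi' - lo' \<le> max e (hi - lo - d)"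
   "\<forall>x. lo' \<le> lavg hs f x \<and> lavg hs f x \<le> hi'"
   by (elim exE conjE) (rule that)
  have "max e (hi - lo - d) \<le> e + real k * d"
   using Suc.prems(3) d by (simp add: algebra_simps)
  with h(2) have "hi' - lo' \<le> e + real k * d" by linarith
  from Suc.IH[OF h(1,3) this] show ?case .
 qed
 note it = this
 obtain b where b: "b > 0" "\<And>x. norm (f x) \<le> b" using bounded_continuous[OF f] by blast
 obtain k :: nat where "2 * b / d \<le> real k" using real_arch_simple by blast
 hence k: "b - (- b) \<le> e + real k * d" using d e by (simp add: field_simps)
 have "\<forall>x. - b \<le> lavg [\<one>] f x \<and> lavg [\<one>] f x \<le> b"
  using b(2) by (simp add: lavg_def abs_le_iff minus_le_iff)
 from it[OF _ this k] obtain hs lo hi where h: "hs \<noteq> []" "hi - lo \<le> e"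
  "\<forall>x. lo \<le> lavg hs f x \<and> lavg hs f x \<le> hi" by auto
 have "\<bar>lavg hs f x - lo\<bar> \<le> e" for x
  using h(2) h(3)[rule_format, of x] by linarith
 thus ?thesis using that h(1) by blast
qed

lemma ravg_nearly_constant:
 assumes f: "cont f" and e: "e > 0"
 obtains gs c where "gs \<noteq> []" "\<And>x. \<bar>ravg gs f x - c\<bar> \<le> e"
proof -
 have "cont (%x. f (inv x))"
  by (intro continuous_on_compose2[OF f] continuous_intros) simp
 from lavg_nearly_constant[OF this e] obtain gs c
  where gs: "gs \<noteq> []" "\<And>x. \<bar>lavg gs (%x. f (inv x)) x - c\<bar> \<le> e" by blast
 have "ravg (map (%g. inv g) gs) f x = lavg gs (%x. f (inv x)) (inv x)" for x
  by (simp add: ravg_def lavg_def inv_mult_group comp_def)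
 thus ?thesis using that[of "map (%g. inv g) gs" c] gs by simp
qed

text \<open>Left and right averages commute, so averaging on both sides gives one function that is
  close to c and to c'. This yields the uniqueness of the mean.\<close>

lemma avg_constants_close:
 assumes "gs \<noteq> []" "hs \<noteq> []" "\<And>x. \<bar>lavg gs f x - c\<bar> \<le> e" "\<And>x. \<bar>ravg hs f x - c'\<bar> \<le> e'"
 shows "\<bar>c - c'\<bar> \<le> e + e'"
proof -
 have "\<bar>ravg hs (lavg gs f) \<one> - c\<bar> \<le> e"
  unfolding ravg_def[of hs "lavg gs f"] by (rule avg_dist[OF assms(2)]) (rule assms(3))
 moreover have "\<bar>lavg gs (ravg hs f) \<one> - c'\<bar> \<le> e'"
  unfolding lavg_def[of gs "ravg hs f"] by (rule avg_dist[OF assms(1)]) (rule assms(4))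
 ultimately show ?thesis unfolding lavg_ravg by linarith
qed

section \<open>The mean and its properties\<close>

definition mean :: "('g => real) => real" where
 "mean f = Sup {c. \<exists>gs. gs \<noteq> [] \<and> (\<forall>x. c \<le> lavg gs f x)}"

lemma mean_avg:
 assumes f: "cont f" and e: "e > 0"
 obtains gs hs where "gs \<noteq> []" "\<And>x. \<bar>lavg gs f x - mean f\<bar> \<le> e" "hs \<noteq> []" "\<And>x. \<bar>ravg hs f x - mean f\<bar> \<le> e"
proof -
 have e4: "e / 4 > 0" using e by simp
 obtain gs c where g: "gs \<noteq> []" "\<And>x. \<bar>lavg gs f x - c\<bar> \<le> e / 4"
  using lavg_nearly_constant[OF f e4] by metis
 obtain hs c' where h: "hs \<noteq> []" "\<And>x. \<bar>ravg hs f x - c'\<bar> \<le> e / 4"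
  using ravg_nearly_constant[OF f e4] by metis
 have cc: "\<bar>c - c'\<bar> \<le> e / 4 + e / 4" by (rule avg_constants_close[OF g(1) h(1) g(2) h(2)])
 let ?S = "{c. \<exists>gs. gs \<noteq> [] \<and> (\<forall>x. c \<le> lavg gs f x)}"
 have "c - e / 4 \<le> lavg gs f x" for x using g(2)[of x] by linarith
 hence S: "c - e / 4 \<in> ?S" using g(1) by blast
 have ub: "s \<le> c' + e / 4" if "s \<in> ?S" for s
 proof -
  from that obtain ks where k: "ks \<noteq> []" "\<And>x. s \<le> lavg ks f x" by blast
  have "s \<le> ravg hs (lavg ks f) \<one>"
   unfolding ravg_def by (rule avg_bounds(1)[OF h(1), of _ _ "Max ((%g. lavg ks f (\<one> \<otimes> g)) ` set hs)"]) (use k(2) in auto)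
  moreover have "\<bar>lavg ks (ravg hs f) \<one> - c'\<bar> \<le> e / 4"
   unfolding lavg_def[of ks "ravg hs f"] by (rule avg_dist[OF k(1)]) (rule h(2))
  ultimately show ?thesis unfolding lavg_ravg by linarith
 qed
 have "c - e / 4 \<le> mean f" unfolding mean_def by (rule cSup_upper[OF S bdd_aboveI[OF ub]])
 moreover have "mean f \<le> c' + e / 4" unfolding mean_def by (rule cSup_least[OF _ ub]) (use S in blast)
 ultimately have "\<bar>lavg gs f x - mean f\<bar> \<le> e" "\<bar>ravg hs f x - mean f\<bar> \<le> e" for x
  using g(2)[of x] h(2)[of x] cc by linarith+
 thus ?thesis using g(1) h(1) by (intro that)
qed

abbreviation near_const :: "('g => real) => real => real => bool" where
 "near_const f c e \<equiv> \<exists>gs. gs \<noteq> [] \<and> ((\<forall>x. \<bar>lavg gs f x - c\<bar> \<le> e) \<or> (\<forall>x. \<bar>ravg gs f x - c\<bar> \<le> e))"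

text \<open>The working characterization of the mean: any constant approximated by averages from
  either side is the mean, because by \<open>mean_avg\<close> the mean is approximated from both.
  The supremum in the definition only selects the constant.\<close>

lemma mean_eqI:
 assumes f: "cont f" and c: "\<And>e. e > 0 ==> near_const f c e"
 shows "mean f = c"
proof -
 have "\<bar>mean f - c\<bar> \<le> 0 + e" if "e > 0" for e
 proof -
  have e: "e / 2 > 0" using that by simp
  obtain gs hs where gh: "gs \<noteq> []" "\<And>x. \<bar>lavg gs f x - mean f\<bar> \<le> e / 2" "hs \<noteq> []" "\<And>x. \<bar>ravg hs f x - mean f\<bar> \<le> e / 2"
   by (rule mean_avg[OF f e]) (rule that)
  obtain ks where k: "ks \<noteq> []" "(\<forall>x. \<bar>lavg ks f x - c\<bar> \<le> e / 2) \<or> (\<forall>x. \<bar>ravg ks f x - c\<bar> \<le> e / 2)"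
   using c[OF e] by blast
  from k(2) show ?thesis
   using avg_constants_close[OF k(1) gh(3) _ gh(4)] avg_constants_close[OF gh(1) k(1) gh(2)]
   by (elim disjE) fastforce+
 qed
 hence "\<bar>mean f - c\<bar> \<le> 0" by (rule field_le_epsilon)
 thus ?thesis by simp
qed

lemma continuous_translate:
 assumes "cont f"
 shows "cont (%x. f (a \<otimes> x))" "cont (%x. f (x \<otimes> a))"
 by (intro continuous_on_compose2[OF assms] continuous_intros; simp)+

text \<open>Right averaging commutes with left translation, so right averages of the translate stay
  close to the mean of f; for right translation left averages do the same. This is why both kinds
  are kept in \<open>mean_avg\<close>.\<close>

lemma mean_left_invariant: "cont f ==> mean (%x. f (a \<otimes> x)) = mean f"
proof (rule mean_eqI[OF continuous_translate(1)])
 fix e :: real assume f: "cont f" and e: "e > 0"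
 show "near_const (%x. f (a \<otimes> x)) (mean f) e"
  by (rule mean_avg[OF f e]) (auto simp: ravg_def simp flip: m_assoc)
qed

lemma mean_right_invariant: "cont f ==> mean (%x. f (x \<otimes> a)) = mean f"
proof (rule mean_eqI[OF continuous_translate(2)])
 fix e :: real assume f: "cont f" and e: "e > 0"
 show "near_const (%x. f (x \<otimes> a)) (mean f) e"
  by (rule mean_avg[OF f e]) (auto simp: lavg_def m_assoc)
qed

lemma mean_lavg_eq: "cont f ==> gs \<noteq> [] ==> mean (lavg gs f) = mean f"
proof (rule mean_eqI[OF continuous_on_avg(1)])
 fix e :: real assume f: "cont f" and e: "e > 0" and gs: "gs \<noteq> []"
 obtain hs where hs: "hs \<noteq> []" "\<And>x. \<bar>ravg hs f x - mean f\<bar> \<le> e" by (rule mean_avg[OF f e]) (rule that)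
 have "\<bar>lavg gs (ravg hs f) x - mean f\<bar> \<le> e" for x
  unfolding lavg_def[of gs] by (rule avg_dist[OF gs]) (rule hs(2))
 thus "near_const (lavg gs f) (mean f) e"
  using hs(1) unfolding lavg_ravg by blast
qed

text \<open>Averaging once more does not spoil functions that are already nearly constant, and by
  \<open>mean_lavg_eq\<close> it does not change the mean of the next one. A common list is what
  additivity and the interchange of two means require.\<close>

lemma simultaneous_lavg:
 assumes "finite I" "\<And>i. i \<in> I ==> cont (f i)" and e: "e > 0"
 shows "\<exists>gs. gs \<noteq> [] \<and> (\<forall>i\<in>I. \<forall>x. \<bar>lavg gs (f i) x - mean (f i)\<bar> \<le> e)"
 using assms(1,2)
proof (induction I)
 case (insert i I)
 then obtain gs where gs: "gs \<noteq> []" "\<And>j x. j \<in> I ==> \<bar>lavg gs (f j) x - mean (f j)\<bar> \<le> e" by auto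
 have fi: "cont (f i)" using insert.prems by simp
 obtain hs where hs: "hs \<noteq> []" "\<And>x. \<bar>lavg hs (lavg gs (f i)) x - mean (f i)\<bar> \<le> e"
  by (rule mean_avg[OF continuous_on_avg(1)[OF fi, of gs] e, unfolded mean_lavg_eq[OF fi gs(1)]]) (rule that)
 have "\<bar>lavg hs (lavg gs (f j)) x - mean (f j)\<bar> \<le> e" if "j \<in> I" for j x
  unfolding lavg_def[of hs] by (rule avg_dist[OF hs(1)]) (rule gs(2)[OF that])
 moreover have "concat (map (%g. map (%h. h \<otimes> g) gs) hs) \<noteq> []" using gs(1) hs(1) by (cases hs) auto
 ultimately show ?case using hs(2) unfolding lavg_lavg by blast
qed auto

lemma mean_bounds:
 assumes f: "cont f" and b: "\<And>x. lo \<le> f x \<and> f x \<le> hi"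
 shows "lo \<le> mean f" "mean f \<le> hi"
proof -
 have "lo - e \<le> mean f \<and> mean f \<le> hi + e" if e: "e > 0" for e
 proof -
  obtain gs where gs: "gs \<noteq> []" "\<And>x. \<bar>lavg gs f x - mean f\<bar> \<le> e" by (rule mean_avg[OF f e]) (rule that)
  from avg_bounds[OF gs(1), of lo "%g. f (g \<otimes> \<one>)" hi] b gs(2)[of "\<one>"]
  show ?thesis unfolding lavg_def by (auto simp: abs_le_iff)
 qed
 hence "lo \<le> mean f + e" "mean f \<le> hi + e" if "e > 0" for e
  using that by fastforce+
 thus "lo \<le> mean f" "mean f \<le> hi"
  by (blast intro: field_le_epsilon)+
qed

lemma mean_const [simp]: "mean (%x. c) = c"
 using mean_bounds[of "%_. c" c c] by simp

lemma mean_scale: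
 assumes f: "cont f" shows "mean (%x. c * f x) = c * mean f"
proof (rule mean_eqI)
 show "cont (%x. c * f x)" using f by (intro continuous_intros)
 fix e :: real assume e: "e > 0"
 hence "e / (\<bar>c\<bar> + 1) > 0" by simp
 then obtain gs where gs: "gs \<noteq> []" "\<And>x. \<bar>lavg gs f x - mean f\<bar> \<le> e / (\<bar>c\<bar> + 1)"
  by (rule mean_avg[OF f]) (rule that)
 have "\<bar>lavg gs (%x. c * f x) x - c * mean f\<bar> \<le> e" for x
 proof -
  have "lavg gs (%x. c * f x) x - c * mean f = c * (lavg gs f x - mean f)"
   by (simp add: lavg_def sum_list_const_mult algebra_simps)
  also have "\<bar>...\<bar> \<le> (\<bar>c\<bar> + 1) * (e / (\<bar>c\<bar> + 1))"
   unfolding abs_mult using gs(2) e by (intro mult_mono) auto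
  also have "... = e" by (simp add: add_nonneg_eq_0_iff)
  finally show ?thesis .
 qed
 thus "near_const (%x. c * f x) (c * mean f) e"
  using gs(1) by blast
qed

lemma mean_add:
 assumes f: "cont f" and g: "cont g"
 shows "mean (%x. f x + g x) = mean f + mean g"
proof (rule mean_eqI)
 show "cont (%x. f x + g x)" using f g by (intro continuous_intros)
 fix e :: real assume e: "e > 0"
 obtain gs where gs: "gs \<noteq> []" "\<And>x. \<bar>lavg gs f x - mean f\<bar> \<le> e / 2" "\<And>x. \<bar>lavg gs g x - mean g\<bar> \<le> e / 2"
  using simultaneous_lavg[of "{f, g}" "%f. f" "e / 2"] f g e by auto
 have eq: "lavg gs (%x. f x + g x) x = lavg gs f x + lavg gs g x" for x
  by (simp add: lavg_def sum_list_addf add_divide_distrib)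
 have "\<bar>lavg gs (%x. f x + g x) x - (mean f + mean g)\<bar> \<le> e" for x
  unfolding eq using gs(2,3)[of x] by linarith
 thus "near_const (%x. f x + g x) (mean f + mean g) e"
  using gs(1) by blast
qed

lemma mean_mono:
 assumes "cont f" "cont g" "\<And>x. f x \<le> g x"
 shows "mean f \<le> mean g"
proof -
 have c: "cont (%x. g x + - 1 * f x)" using assms by (intro continuous_intros)
 obtain b where b: "\<And>x. norm (g x + - 1 * f x) \<le> b" using bounded_continuous[OF c] by blast
 have "0 \<le> mean (%x. g x + - 1 * f x)"
  using b assms(3) by (intro mean_bounds(1)[OF c, of 0 b]) (auto simp: abs_le_iff)
 moreover have "mean (%x. g x + - 1 * f x) = mean g + mean (%x. - 1 * f x)"
  using assms by (intro mean_add continuous_intros)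
 ultimately show ?thesis using mean_scale[OF assms(1), of "- 1"] by simp
qed

lemma mean_sum:
 assumes "\<And>i. i \<in> I ==> cont (f i)"
 shows "mean (%x. \<Sum>i\<in>I. f i x) = (\<Sum>i\<in>I. mean (f i))"
 using assms
proof (induction I rule: infinite_finite_induct)
 case (insert i I)
 have "cont (%x. \<Sum>i\<in>I. f i x)" using insert.prems by (intro continuous_intros) auto
 with mean_add[of "f i" "%x. \<Sum>i\<in>I. f i x"] insert show ?case by simp
qed simp_all

text \<open>By compactness finitely many translates of the set where f > f x0 / 2 cover the group,
  so the sum of the corresponding translates of f is bounded below by f x0 / 2, and each of them has
  the mean of f.\<close>

lemma mean_pos:
 assumes f: "cont f" "\<And>x. f x \<ge> 0" and x0: "f x0 > 0"
 shows "mean f > 0"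
proof -
 have o: "open (f -` {f x0 / 2<..})" using f(1) by (intro open_vimage) auto
 have x0': "x0 \<in> f -` {f x0 / 2<..}" using x0 by simp
 obtain B where B: "finite B" "B \<noteq> {}" "\<And>x. \<exists>b\<in>B. b \<otimes> x \<in> f -` {f x0 / 2<..}"
  by (rule finite_translate_cover[OF o x0']) (rule that)
 have c: "cont (%x. f (b \<otimes> x))" for b using continuous_translate(1)[OF f(1)] .
 have "f x0 / 2 \<le> (\<Sum>b\<in>B. f (b \<otimes> x))" for x
 proof -
  obtain b where "b \<in> B" "f (b \<otimes> x) > f x0 / 2" using B(3)[of x] by auto
  moreover have "f (b \<otimes> x) \<le> (\<Sum>b\<in>B. f (b \<otimes> x))"
   by (rule member_le_sum) (simp_all add: \<open>b \<in> B\<close> B(1) f(2))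
  ultimately show ?thesis by simp
 qed
 hence "f x0 / 2 \<le> mean (%x. \<Sum>b\<in>B. f (b \<otimes> x))"
  using mean_mono[of "%_. f x0 / 2" "%x. \<Sum>b\<in>B. f (b \<otimes> x)"] c
  by (simp add: continuous_on_sum)
 also have "... = (\<Sum>b\<in>B. mean f)"
  using mean_sum[of B "%b x. f (b \<otimes> x)"] c mean_left_invariant[OF f(1)] by simp
 finally have "0 < card B * mean f" using x0 by simp
 thus ?thesis by (simp add: zero_less_mult_iff)
qed

lemma mean_dist_le:
 assumes f: "cont f" and g: "cont g" and le: "\<And>x. \<bar>f x - g x\<bar> \<le> e"
 shows "\<bar>mean f - mean g\<bar> \<le> e"
proof -
 have "f x \<le> g x + e" "g x \<le> f x + e" for x using le[of x] by linarith+
 hence "mean f \<le> mean (%x. g x + e)" "mean g \<le> mean (%x. f x + e)"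
  using f g by (intro mean_mono continuous_intros; simp)+
 thus ?thesis unfolding mean_add[OF f continuous_on_const] mean_add[OF g continuous_on_const] by simp
qed

lemma uniformly_close_sections:
 fixes K :: "'a::topological_space \<times> 'g => real"
 assumes K: "cont K" and e: "e > 0"
 obtains X where "x \<in> X" "open X" "\<And>x' y. x' \<in> X ==> \<bar>K (x', y) - K (x, y)\<bar> \<le> e"
proof -
 have "continuous_on (UNIV \<times> UNIV) K" using K by simp
 from continuous_on_prod_compactE[OF this compact_space UNIV_I e] that show ?thesis
  by (simp add: dist_real_def) metis
qed

lemma continuous_on_mean_param:
 fixes K :: "'a::topological_space \<times> 'g => real"
 assumes K: "cont K"
 shows "cont (%x. mean (%y. K (x, y)))"
proof -
 have c: "cont (%y. K (x, y))" for x
  by (intro continuous_on_compose2[OF K] continuous_intros) simp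
 have "((%x. mean (%y. K (x, y))) \<longlongrightarrow> mean (%y. K (x0, y))) (at x0)" for x0
 proof (rule tendstoI)
  fix e :: real assume e: "e > 0"
  hence "e / 2 > 0" by simp
  then obtain X where X: "x0 \<in> X" "open X" "\<And>x' y. x' \<in> X ==> \<bar>K (x', y) - K (x0, y)\<bar> \<le> e / 2"
   by (rule uniformly_close_sections[OF K]) (rule that)
  have "dist (mean (%y. K (x, y))) (mean (%y. K (x0, y))) < e" if "x \<in> X" for x
   using mean_dist_le[OF c c X(3)[OF that]] e by (simp add: dist_real_def)
  thus "\<forall>\<^sub>F x in at x0. dist (mean (%y. K (x, y))) (mean (%y. K (x0, y))) < e"
   unfolding eventually_at_topological using X(1,2) by blast
 qed
 thus ?thesis
  by (simp add: continuous_on_def)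
qed

text \<open>Finitely many sections K(x, .) are uniformly close to all others, so one list averages
  every section to within e of its mean. Applied to \<open>?h\<close>, the same list gives the mean
  over x of these averaged sections, which is therefore within e of the iterated mean in the other
  order.\<close>

lemma mean_swap:
 assumes K: "cont K"
 shows "mean (%x. mean (%y. K (x, y))) = mean (%y. mean (%x. K (x, y)))"
proof (rule sym, rule mean_eqI)
 have c: "cont (%y. K (x, y))" "cont (%x. K (x, y))" for x y
  by (intro continuous_on_compose2[OF K] continuous_intros; simp)+
 have K': "cont (%p. K (snd p, fst p))"
  by (intro continuous_on_compose2[OF K] continuous_intros) simp
 let ?h = "%y. mean (%x. K (x, y))" and ?F = "%x. mean (%y. K (x, y))"
 show "cont ?h" using continuous_on_mean_param[OF K'] by simp
 fix e :: real assume "e > 0"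
 hence e: "e / 3 > 0" by simp
 have "\<exists>X. x \<in> X \<and> open X \<and> (\<forall>x'\<in>X. \<forall>y. \<bar>K (x', y) - K (x, y)\<bar> \<le> e / 3)" for x
  by (rule uniformly_close_sections[OF K e, of x]) blast
 then obtain X where X: "\<And>x. x \<in> X x" "\<And>x. open (X x)" "\<And>x x' y. x' \<in> X x ==> \<bar>K (x', y) - K (x, y)\<bar> \<le> e / 3"
  by metis
 obtain D where D: "finite D" "UNIV \<subseteq> (\<Union>x\<in>D. X x)"
 proof (rule compactE_image[OF compact_space, of UNIV X])
  show "UNIV \<subseteq> (\<Union>x\<in>UNIV. X x)" using X(1) by auto
 qed (use X(2) that in auto)
 obtain gs where gs: "gs \<noteq> []" "\<And>x y. x \<in> D ==> \<bar>lavg gs (%y. K (x, y)) y - ?F x\<bar> \<le> e / 3"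
  using simultaneous_lavg[of D "%x y. K (x, y)", OF D(1) c(1) e] by auto
 have *: "\<bar>lavg gs (%y. K (x, y)) y - ?F x\<bar> \<le> e" for x y
 proof -
  obtain d where d: "d \<in> D" "x \<in> X d" using D(2) by blast
  have "\<bar>(\<Sum>g\<leftarrow>gs. K (x, g \<otimes> y) - K (d, g \<otimes> y)) / length gs - 0\<bar> \<le> e / 3"
   by (rule avg_dist[OF gs(1)]) (use X(3)[OF d(2)] in simp)
  hence "\<bar>lavg gs (%y. K (x, y)) y - lavg gs (%y. K (d, y)) y\<bar> \<le> e / 3"
   by (simp add: lavg_def sum_list_subtractf diff_divide_distrib)
  with gs(2)[OF d(1), of y] mean_dist_le[OF c(1) c(1) X(3)[OF d(2)]] show ?thesis
   by linarith
 qed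
 have "cont (%x. \<Sum>g\<leftarrow>gs. K (x, g \<otimes> y)) \<and>
   mean (%x. \<Sum>g\<leftarrow>gs. K (x, g \<otimes> y)) = (\<Sum>g\<leftarrow>gs. ?h (g \<otimes> y))" for gs y
  by (induction gs) (auto simp: mean_add c intro!: continuous_intros c)
 hence cs: "cont (%x. \<Sum>g\<leftarrow>gs. K (x, g \<otimes> y))"
  and s: "mean (%x. \<Sum>g\<leftarrow>gs. K (x, g \<otimes> y)) = (\<Sum>g\<leftarrow>gs. ?h (g \<otimes> y))" for y by blast+
 have eq: "lavg gs ?h y = mean (%x. lavg gs (%y. K (x, y)) y)" for y
  using mean_scale[OF cs[of y], of "1 / length gs"] s by (simp add: lavg_def)
 have cl: "cont (%x. lavg gs (%y. K (x, y)) y)" for y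
  unfolding lavg_def divide_inverse by (intro continuous_on_mult continuous_on_const cs)
 have "\<bar>lavg gs ?h y - mean ?F\<bar> \<le> e" for y
  unfolding eq by (intro mean_dist_le cl continuous_on_mean_param[OF K] *)
 thus "near_const ?h (mean ?F) e"
  using gs(1) by blast
qed

end

section \<open>The mean of complex-valued functions\<close>

context compact_topological_group
begin

definition cmean :: "('g => complex) => complex" where
 "cmean f = Complex (mean (%x. Re (f x))) (mean (%x. Im (f x)))"

lemma cont_Re_Im: "cont f ==> cont (%x. Re (f x))" "cont f ==> cont (%x. Im (f x))"
 by (intro continuous_intros; simp)+

lemma cmean_add: "cont f ==> cont g ==> cmean (%x. f x + g x) = cmean f + cmean g"
 unfolding cmean_def by (simp add: complex_eq_iff mean_add cont_Re_Im)

lemma cmean_scale: "cont f ==> cmean (%x. c * f x) = c * cmean f"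
proof -
 assume f: "cont f"
 note c = cont_Re_Im[OF f]
 have cc: "cont (%x. r * Re (f x))" "cont (%x. r * Im (f x))" for r
  by (rule continuous_on_mult[OF continuous_on_const c(1)], rule continuous_on_mult[OF continuous_on_const c(2)])
 have "mean (%x. Re c * Re (f x) + (- Im c) * Im (f x)) = Re c * mean (%x. Re (f x)) + (- Im c) * mean (%x. Im (f x))"
  by (simp only: mean_add[OF cc(1) cc(2)] mean_scale[OF c(1)] mean_scale[OF c(2)])
 moreover have "mean (%x. Re c * Im (f x) + Im c * Re (f x)) = Re c * mean (%x. Im (f x)) + Im c * mean (%x. Re (f x))"
  by (simp only: mean_add[OF cc(2) cc(1)] mean_scale[OF c(1)] mean_scale[OF c(2)])
 ultimately show ?thesis unfolding cmean_def by (simp add: complex_eq_iff)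
qed

lemma cmean_const [simp]: "cmean (%x. c) = c"
 by (simp add: cmean_def)

lemma cmean_of_real: "cmean (%x. of_real (f x)) = of_real (mean f)"
 by (simp add: cmean_def complex_eq_iff)

lemma cmean_cnj: "cont f ==> cmean (%x. cnj (f x)) = cnj (cmean f)"
 using mean_scale[of "%x. Im (f x)" "- 1"] cont_Re_Im[of f] by (simp add: cmean_def complex_eq_iff)

lemma cmean_diff: "cont f ==> cont g ==> cmean (%x. f x - g x) = cmean f - cmean g"
 using cmean_add[of f "%x. - 1 * g x"] cmean_scale[of g "- 1"] by (simp add: continuous_on_minus)

lemma cmean_sum: "(\<And>i. i \<in> I ==> cont (f i)) ==> cmean (%x. \<Sum>i\<in>I. f i x) = (\<Sum>i\<in>I. cmean (f i))"
proof (induction I rule: infinite_finite_induct)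
 case (insert i I)
 have "cont (%x. \<Sum>i\<in>I. f i x)" using insert.prems by (intro continuous_intros) auto
 with cmean_add[of "f i" "%x. \<Sum>i\<in>I. f i x"] insert show ?case by simp
qed simp_all

lemma cmean_left_invariant: "cont f ==> cmean (%x. f (a \<otimes> x)) = cmean f"
 unfolding cmean_def using mean_left_invariant[OF cont_Re_Im(1)] mean_left_invariant[OF cont_Re_Im(2)] by simp

lemma cmean_right_invariant: "cont f ==> cmean (%x. f (x \<otimes> a)) = cmean f"
 unfolding cmean_def using mean_right_invariant[OF cont_Re_Im(1)] mean_right_invariant[OF cont_Re_Im(2)] by simp

lemma norm_cmean_le: assumes "cont f" shows "norm (cmean f) \<le> mean (%x. norm (f x))"
proof -
 define c where "c = (if cmean f = 0 then 0 else cnj (cmean f) / norm (cmean f))"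
 have nc: "norm c \<le> 1" by (simp add: c_def norm_divide)
 have "c * cmean f = of_real (norm (cmean f))"
  using complex_norm_square[of "cmean f"] by (auto simp: c_def power2_eq_square field_simps)
 hence "norm (cmean f) = Re (cmean (%x. c * f x))"
  by (simp add: cmean_scale[OF assms])
 also have "... = mean (%x. Re (c * f x))" by (simp add: cmean_def)
 also have "... \<le> mean (%x. norm (f x))"
 proof (rule mean_mono)
  show "cont (%x. Re (c * f x))" "cont (%x. norm (f x))"
   using assms by (intro continuous_intros; simp)+
  show "Re (c * f x) \<le> norm (f x)" for x
   using complex_Re_le_cmod[of "c * f x"] nc mult_right_mono[OF nc, of "norm (f x)"]
   by (simp add: norm_mult)
 qed
 finally show ?thesis .
qed

lemma norm_cmean_bound: "cont f ==> (\<And>x. norm (f x) \<le> b) ==> norm (cmean f) \<le> b"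
proof -
 assume f: "cont f" and b: "\<And>x. norm (f x) \<le> b"
 have "mean (%x. norm (f x)) \<le> b"
  using mean_bounds(2)[of "%x. norm (f x)" 0 b] b f continuous_on_norm by auto
 thus ?thesis using norm_cmean_le[OF f] by simp
qed

lemma continuous_on_cmean_param:
 fixes K :: "'a::topological_space \<times> 'g => complex"
 assumes K: "cont K"
 shows "cont (%x. cmean (%y. K (x, y)))"
proof -
 have "cont (%p. Re (K p))" "cont (%p. Im (K p))"
  using K by (intro continuous_intros; simp)+
 from continuous_on_mean_param[OF this(1)] continuous_on_mean_param[OF this(2)]
 have "cont (%x. of_real (mean (%y. Re (K (x, y)))) + \<i> * of_real (mean (%y. Im (K (x, y)))))"
  by (intro continuous_intros)
 thus ?thesis by (simp add: cmean_def[abs_def] Complex_eq)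
qed

lemma cmean_swap:
 assumes K: "cont K"
 shows "cmean (%x. cmean (%y. K (x, y))) = cmean (%y. cmean (%x. K (x, y)))"
proof -
 have "cont (%p. Re (K p))" "cont (%p. Im (K p))"
  using K by (intro continuous_intros; simp)+
 from mean_swap[OF this(1)] mean_swap[OF this(2)] show ?thesis by (simp add: cmean_def)
qed

subsection \<open>Square means\<close>

definition cip :: "('g => complex) => ('g => complex) => complex"
 where "cip f g = cmean (%x. f x * cnj (g x))"

definition nrm2 :: "('g => complex) => real"
 where "nrm2 f = mean (%x. (norm (f x))\<^sup>2)"

definition orthonormal :: "nat => (nat => 'g => complex) => bool" where
 "orthonormal n w \<longleftrightarrow> (\<forall>i<n. cont (w i)) \<and> (\<forall>i<n. \<forall>j<n. cip (w i) (w j) = (if i = j then 1 else 0))"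

lemma cont_mult_cnj: "cont f ==> cont g ==> cont (%x. f x * cnj (g x))"
 by (intro continuous_intros)

lemma cont_lincomb: "(\<And>i. i < n ==> cont (w i)) ==> cont (%x. \<Sum>i<n. c i * w i x)" for n :: nat and w :: "nat => 'g => complex"
 by (intro continuous_intros) auto

lemma cip_self: "cip f f = of_real (nrm2 f)"
 unfolding cip_def nrm2_def cmean_of_real[symmetric] by (simp only: complex_norm_square)

lemma cip_cnj: "cont f ==> cont g ==> cip g f = cnj (cip f g)"
 unfolding cip_def using cmean_cnj[OF cont_mult_cnj, of f g] by (simp add: mult.commute)

lemma cip_add_left: "cont f ==> cont g ==> cont h ==> cip (%x. f x + g x) h = cip f h + cip g h"
 unfolding cip_def using cmean_add[OF cont_mult_cnj cont_mult_cnj, of f h g h] by (simp add: algebra_simps)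

lemma cip_diff_left: "cont f ==> cont g ==> cont h ==> cip (%x. f x - g x) h = cip f h - cip g h"
 unfolding cip_def using cmean_diff[OF cont_mult_cnj cont_mult_cnj, of f h g h] by (simp add: algebra_simps)

lemma cip_scale_left: "cont f ==> cont h ==> cip (%x. c * f x) h = c * cip f h"
 unfolding cip_def using cmean_scale[OF cont_mult_cnj, of f h c] by (simp add: algebra_simps)

lemma cip_scale_right: "cont f ==> cont h ==> cip h (%x. c * f x) = cnj c * cip h f"
 unfolding cip_def using cmean_scale[OF cont_mult_cnj, of h f "cnj c"] by (simp add: algebra_simps)

lemma cip_sum_left:
 "(\<And>i. i \<in> I ==> cont (w i)) ==> cont h ==> cip (%x. \<Sum>i\<in>I. c i * w i x) h = (\<Sum>i\<in>I. c i * cip (w i) h)"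
proof -
 assume w: "\<And>i. i \<in> I ==> cont (w i)" and h: "cont h"
 have "cip (%x. \<Sum>i\<in>I. c i * w i x) h = cmean (%x. \<Sum>i\<in>I. c i * (w i x * cnj (h x)))"
  unfolding cip_def by (simp add: sum_distrib_right mult.assoc)
 also have "... = (\<Sum>i\<in>I. cmean (%x. c i * (w i x * cnj (h x))))"
  using w h by (intro cmean_sum continuous_intros) auto
 also have "... = (\<Sum>i\<in>I. c i * cip (w i) h)"
  unfolding cip_def using w h by (intro sum.cong refl cmean_scale cont_mult_cnj) auto
 finally show ?thesis .
qed

lemma cip_sum_right:
 "(\<And>i. i \<in> I ==> cont (w i)) ==> cont h ==> cip h (%x. \<Sum>i\<in>I. c i * w i x) = (\<Sum>i\<in>I. cnj (c i) * cip h (w i))"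
proof -
 assume w: "\<And>i. i \<in> I ==> cont (w i)" and h: "cont h"
 have c: "cont (%x. \<Sum>i\<in>I. c i * w i x)" using w by (intro continuous_intros) auto
 have "cip h (%x. \<Sum>i\<in>I. c i * w i x) = cnj (\<Sum>i\<in>I. c i * cip (w i) h)"
  using cip_cnj[OF c h] cip_sum_left[of I w h c] w h by simp
 also have "... = (\<Sum>i\<in>I. cnj (c i) * cip h (w i))"
  using w h by (simp add: cip_cnj[symmetric])
 finally show ?thesis .
qed

lemma cip_translate: "cont f ==> cont g ==> cip (%x. f (x \<otimes> a)) (%x. g (x \<otimes> a)) = cip f g"
 unfolding cip_def using cmean_right_invariant[OF cont_mult_cnj, of f g a] by simp

lemma nrm2_nonneg: "cont f ==> nrm2 f \<ge> 0"
proof -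
 assume f: "cont f"
 have "cont (%x. (norm (f x))\<^sup>2)" using f by (intro continuous_intros)
 from mean_mono[OF continuous_on_const this, of 0] show ?thesis by (simp add: nrm2_def)
qed

lemma nrm2_pos: "cont f ==> f x \<noteq> 0 ==> nrm2 f > 0"
 unfolding nrm2_def by (rule mean_pos[of _ x]) (auto intro!: continuous_intros)

lemma nrm2_eq_0: "cont f ==> nrm2 f = 0 ==> f x = 0"
 using nrm2_pos[of f x] by fastforce

lemma nrm2_le: "cont f ==> (\<And>x. norm (f x) \<le> b) ==> nrm2 f \<le> b\<^sup>2"
proof -
 assume f: "cont f" and b: "\<And>x. norm (f x) \<le> b"
 have "cont (%x. (norm (f x))\<^sup>2)" using f by (intro continuous_intros)
 from mean_mono[OF this continuous_on_const, of "b\<^sup>2"] b show ?thesis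
  by (simp add: nrm2_def power_mono)
qed

lemma nrm2_scale: "cont f ==> nrm2 (%x. c * f x) = (norm c)\<^sup>2 * nrm2 f"
proof -
 assume f: "cont f"
 have "cont (%x. (norm (f x))\<^sup>2)" using f by (intro continuous_intros)
 from mean_scale[OF this] show ?thesis by (simp add: nrm2_def norm_mult power_mult_distrib)
qed

lemma nrm2_diff: "cont f ==> cont g ==> nrm2 (%x. f x - g x) = nrm2 f - 2 * Re (cip f g) + nrm2 g"
proof -
 assume f: "cont f" and g: "cont g"
 note d = continuous_on_diff[OF f g]
 have "complex_of_real (nrm2 (%x. f x - g x)) = cip f (%x. f x - g x) - cip g (%x. f x - g x)"
  using cip_diff_left[OF f g d] by (simp add: cip_self[symmetric])
 also have "... = cnj (cip f f - cip g f) - cnj (cip f g - cip g g)"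
  using cip_diff_left[OF f g f] cip_diff_left[OF f g g] cip_cnj[OF d f] cip_cnj[OF d g] by simp
 finally have "nrm2 (%x. f x - g x) = Re (cnj (cip f f - cip g f) - cnj (cip f g - cip g g))"
  by (metis Re_complex_of_real)
 thus ?thesis using cip_cnj[OF f g] by (simp add: cip_self)
qed

lemma orthonormal_residual:
 assumes w: "orthonormal n w" and f: "cont f"
 shows "i < n ==> cip (%x. f x - (\<Sum>j<n. cip f (w j) * w j x)) (w i) = 0"
  and "nrm2 (%x. f x - (\<Sum>j<n. cip f (w j) * w j x)) = nrm2 f - (\<Sum>j<n. (norm (cip f (w j)))\<^sup>2)"
proof -
 have cw: "cont (w i)" if "i < n" for i using w that by (simp add: orthonormal_def)
 have cs: "cont (%x. \<Sum>j<n. cip f (w j) * w j x)" using cw by (rule cont_lincomb)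
 have s: "cip (%x. \<Sum>j<n. cip f (w j) * w j x) (w i) = cip f (w i)" if "i < n" for i
 proof -
  have "cip (%x. \<Sum>j<n. cip f (w j) * w j x) (w i) = (\<Sum>j<n. cip f (w j) * cip (w j) (w i))"
   using cw that by (intro cip_sum_left) auto
  also have "... = (\<Sum>j<n. if j = i then cip f (w j) else 0)"
   using w that by (intro sum.cong refl) (simp add: orthonormal_def)
  finally show ?thesis using that by simp
 qed
 thus "i < n ==> cip (%x. f x - (\<Sum>j<n. cip f (w j) * w j x)) (w i) = 0"
  using cip_diff_left[OF f cs cw] by simp
 have 1: "cip f (%x. \<Sum>j<n. cip f (w j) * w j x) = of_real (\<Sum>j<n. (norm (cip f (w j)))\<^sup>2)"
  unfolding of_real_sum complex_norm_square
  by (subst cip_sum_right) (use cw f in \<open>auto simp: mult.commute\<close>)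
 have "cip (%x. \<Sum>j<n. cip f (w j) * w j x) (%x. \<Sum>j<n. cip f (w j) * w j x)
   = (\<Sum>j<n. cnj (cip f (w j)) * cip (%x. \<Sum>j<n. cip f (w j) * w j x) (w j))"
  using cw cs by (intro cip_sum_right) auto
 also have "... = of_real (\<Sum>j<n. (norm (cip f (w j)))\<^sup>2)"
  unfolding of_real_sum complex_norm_square
  using s by (intro sum.cong refl) (simp add: mult.commute)
 finally have "nrm2 (%x. \<Sum>j<n. cip f (w j) * w j x) = (\<Sum>j<n. (norm (cip f (w j)))\<^sup>2)"
  unfolding cip_self of_real_eq_iff .
 thus "nrm2 (%x. f x - (\<Sum>j<n. cip f (w j) * w j x)) = nrm2 f - (\<Sum>j<n. (norm (cip f (w j)))\<^sup>2)"
  unfolding nrm2_diff[OF f cs] 1 by simp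
qed

lemma Bessel:
 assumes "orthonormal n w" "cont f" shows "(\<Sum>j<n. (norm (cip f (w j)))\<^sup>2) \<le> nrm2 f"
proof -
 have "cont (%x. f x - (\<Sum>j<n. cip f (w j) * w j x))"
  using assms by (intro continuous_on_diff cont_lincomb) (auto simp: orthonormal_def)
 from nrm2_nonneg[OF this] show ?thesis unfolding orthonormal_residual(2)[OF assms] by simp
qed

lemma cip_CauchySchwarz:
 assumes f: "cont f" and g: "cont g" shows "(norm (cip f g))\<^sup>2 \<le> nrm2 f * nrm2 g"
proof (cases "nrm2 g = 0")
 case True
 hence "g x = 0" for x using nrm2_eq_0[OF g] by blast
 thus ?thesis using True by (simp add: cip_def)
next
 case False
 hence p: "nrm2 g > 0" using nrm2_nonneg[OF g] by simp
 define c where "c = complex_of_real (1 / sqrt (nrm2 g))"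
 have "orthonormal 1 (%_ x. c * g x)"
  using g p cip_self[of "%x. c * g x"] nrm2_scale[OF g, of c]
  by (auto simp: orthonormal_def c_def power_divide norm_divide intro!: continuous_intros)
 from Bessel[OF this f] have "(norm (cip f (%x. c * g x)))\<^sup>2 \<le> nrm2 f" by simp
 thus ?thesis
  unfolding cip_scale_right[OF g f] using p
  by (simp add: c_def norm_mult norm_divide power_mult_distrib power_divide field_simps)
qed

end

context compact_topological_group
begin

subsection \<open>Compactness of equicontinuous sequences\<close>

lemma complete_bcontfun: "complete (UNIV :: ('g \<Rightarrow>\<^sub>C complex) set)"
proof (rule completeI)
 fix F :: "nat => 'g \<Rightarrow>\<^sub>C complex" assume F: "Cauchy F"
 have "Cauchy (%n. F n x)" for x
 proof (rule metric_CauchyI)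
  fix e :: real assume "e > 0"
  then obtain N where N: "\<forall>m\<ge>N. \<forall>n\<ge>N. dist (F m) (F n) < e" using F unfolding Cauchy_def by blast
  have "dist (F m x) (F n x) < e" if "m \<ge> N" "n \<ge> N" for m n
   using order.strict_trans1[OF dist_bounded[of "F m" x "F n"]] N that by blast
  thus "\<exists>M. \<forall>m\<ge>M. \<forall>n\<ge>M. dist (F m x) (F n x) < e" by blast
 qed
 hence "\<exists>g. \<forall>x. (%n. F n x) \<longlonglongrightarrow> g x"
  unfolding Cauchy_convergent_iff convergent_def by (rule choice[OF allI])
 then obtain g where g: "\<And>x. (%n. F n x) \<longlonglongrightarrow> g x" by blast
 have unif: "\<exists>N. \<forall>n\<ge>N. \<forall>x. dist (F n x) (g x) \<le> e" if "e > 0" for e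
 proof -
  obtain N where N: "\<forall>m\<ge>N. \<forall>n\<ge>N. dist (F m) (F n) < e"
   using F \<open>e > 0\<close> unfolding Cauchy_def by blast
  have "dist (F n x) (g x) \<le> e" if n: "n \<ge> N" for n x
  proof (rule LIMSEQ_le_const2[OF tendsto_dist[OF tendsto_const g]])
   show "\<exists>M. \<forall>m\<ge>M. dist (F n x) (F m x) \<le> e"
    using N n order.trans[OF dist_bounded[of "F n" x] less_imp_le] by blast
  qed
  thus ?thesis by blast
 qed
 have "uniform_limit UNIV (%n. apply_bcontfun (F n)) g sequentially"
 proof (rule uniform_limitI)
  fix e :: real assume "e > 0"
  hence "e / 2 > 0" by simp
  from unif[OF this] obtain N where N: "\<forall>n\<ge>N. \<forall>x. dist (F n x) (g x) \<le> e / 2" by blast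
  have "dist (F n x) (g x) < e" if "n \<ge> N" for n x
   using N[rule_format, OF that, of x] \<open>e > 0\<close> by linarith
  thus "\<forall>\<^sub>F n in sequentially. \<forall>x\<in>UNIV. dist (F n x) (g x) < e"
   unfolding eventually_sequentially by blast
 qed
 hence cg: "cont g"
  by (rule uniform_limit_theorem[rotated]) (auto intro!: always_eventually)
 then obtain b where "\<And>x. norm (g x) \<le> b" using bounded_continuous by blast
 hence "g \<in> bcontfun" unfolding bcontfun_def using cg by (auto simp: bounded_iff)
 hence gB: "apply_bcontfun (Bcontfun g) = g" by (rule Bcontfun_inverse)
 have "F \<longlonglongrightarrow> Bcontfun g"
 proof (rule metric_LIMSEQ_I)
  fix e :: real assume "e > 0"
  hence "e / 2 > 0" by simp
  from unif[OF this] obtain N where N: "\<forall>n\<ge>N. \<forall>x. dist (F n x) (g x) \<le> e / 2" by blast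
  have "dist (F n) (Bcontfun g) < e" if "n \<ge> N" for n
   using dist_bound[of "F n" "Bcontfun g" "e / 2"] N that \<open>e > 0\<close> by (simp add: gB)
  thus "\<exists>N. \<forall>n\<ge>N. dist (F n) (Bcontfun g) < e" by blast
 qed
 thus "\<exists>l\<in>UNIV. F \<longlonglongrightarrow> l" by blast
qed

text \<open>The Arzela-Ascoli theorem, by total boundedness: equicontinuity reduces each function to
  its values at finitely many points, and rounding these values to a finite net leaves finitely many
  classes of functions, each of small diameter.\<close>

lemma equicontinuous_convergent_subsequence:
 fixes F :: "nat => 'g => complex"
 assumes bound: "\<And>n x. norm (F n x) \<le> b"
  and equi: "\<And>x e. e > 0 ==> \<exists>X. open X \<and> x \<in> X \<and> (\<forall>n. \<forall>y\<in>X. dist (F n y) (F n x) \<le> e)"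
 shows "\<exists>r g. strict_mono (r :: nat => nat) \<and> cont g \<and>
  (\<forall>e>0. \<exists>N. \<forall>n\<ge>N. \<forall>x. dist (F (r n) x) (g x) \<le> e)"
proof -
 have cF: "cont (F n)" for n
  unfolding continuous_on_def
 proof (intro ballI tendstoI)
  fix x and e :: real assume "e > 0"
  hence "e / 2 > 0" by simp
  from equi[OF this, of x] obtain X where X: "open X" "x \<in> X" "\<forall>n. \<forall>y\<in>X. dist (F n y) (F n x) \<le> e / 2"
   by (elim exE conjE) (rule that)
  have "dist (F n y) (F n x) < e" if "y \<in> X" for y
   using X(3)[rule_format, OF that, of n] \<open>e > 0\<close> by linarith
  thus "\<forall>\<^sub>F y in at x within UNIV. dist (F n y) (F n x) < e"
   unfolding eventually_at_topological using X by (intro exI[of _ X]) simp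
 qed
 have bF: "F n \<in> bcontfun" for n
  unfolding bcontfun_def using cF[of n] bound by (auto simp: bounded_iff)
 define B where "B n = Bcontfun (F n)" for n
 have B: "apply_bcontfun (B n) = F n" for n
  unfolding B_def by (rule Bcontfun_inverse[OF bF])
 have tot: "\<exists>k. finite k \<and> range B \<subseteq> (\<Union>x\<in>k. ball x e)" if e: "e > 0" for e
 proof -
  \<comment> \<open>Two functions in one class differ by at most 4 d: an oscillation d for each, and
    a rounding error d for each.\<close>
  define d where "d = e / 8"
  have d: "d > 0" using e by (simp add: d_def)
  obtain X where X: "\<And>x. open (X x)" "\<And>x. x \<in> X x" "\<And>x n y. y \<in> X x ==> dist (F n y) (F n x) \<le> d"
   using equi[OF d] by metis
  obtain C where C: "finite C" "UNIV \<subseteq> (\<Union>x\<in>C. X x)"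
   by (rule compactE_image[OF compact_space, of UNIV X]) (use X(1,2) in auto)
  have "compact (cball (0::complex) b)" by simp
  then obtain k where k: "finite k" "cball (0::complex) b \<subseteq> (\<Union>z\<in>k. ball z d)"
   using d unfolding compact_eq_totally_bounded by blast
  have "\<exists>z\<in>k. dist z (F n x) < d" for n x
   using k(2) bound[of n x] by (auto simp: subset_iff)
  then obtain c where c: "\<And>n x. c n x \<in> k" "\<And>n x. dist (c n x) (F n x) < d" by metis
  define cls where "cls n = restrict (c n) C" for n
  have "range cls \<subseteq> Pi\<^sub>E C (%_. k)" using c(1) by (auto simp: cls_def)
  hence fin: "finite (range cls)" using finite_PiE[OF C(1), of "%_. k"] k(1) finite_subset by blast
  define rep where "rep v = (SOME n. cls n = v)" for v
  have rep: "cls (rep (cls n)) = cls n" for n unfolding rep_def by (rule someI) simp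
  have "dist (B n) (B (rep (cls n))) < e" for n
  proof -
   have "dist (F n y) (F (rep (cls n)) y) \<le> 4 * d" for y
   proof -
    obtain x where x: "x \<in> C" "y \<in> X x" using C(2) by blast
    have "c (rep (cls n)) x = c n x" using fun_cong[OF rep[of n], of x] x by (simp add: cls_def)
    hence "dist (F n x) (F (rep (cls n)) x) \<le> 2 * d"
     using c(2)[of n x] c(2)[of "rep (cls n)" x] dist_triangle3[of "F n x" "F (rep (cls n)) x" "c n x"]
     by simp
    moreover have "dist (F n y) (F n x) \<le> d" "dist (F (rep (cls n)) y) (F (rep (cls n)) x) \<le> d"
     using X(3)[OF x(2)] by blast+
    ultimately show ?thesis
     using dist_triangle[of "F n y" "F (rep (cls n)) y" "F n x"]
      dist_triangle2[of "F n x" "F (rep (cls n)) y" "F (rep (cls n)) x"] by linarith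
   qed
   hence "dist (B n) (B (rep (cls n))) \<le> 4 * d" by (intro dist_bound) (simp add: B)
   thus ?thesis using d by (simp add: d_def)
  qed
  hence "range B \<subseteq> (\<Union>x\<in>(%v. B (rep v)) ` range cls. ball x e)"
   by (force simp: dist_commute)
  thus ?thesis using fin by blast
 qed
 have "compact (closure (range B))"
  unfolding compact_eq_totally_bounded
 proof (intro conjI allI impI)
  show "complete (closure (range B))" by (rule complete_closed_subset[OF closed_closure subset_UNIV complete_bcontfun])
  fix e :: real assume "e > 0"
  hence "e / 2 > 0" by simp
  from tot[OF this] obtain k where k: "finite k" "range B \<subseteq> (\<Union>x\<in>k. ball x (e / 2))"
   by (elim exE conjE) (rule that)
  have "closure (range B) \<subseteq> (\<Union>x\<in>k. cball x (e / 2))"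
   by (rule closure_minimal[OF subset_trans[OF k(2)]])
    (use k(1) in \<open>auto intro!: UN_mono ball_subset_cball closed_UN\<close>)
  also have "... \<subseteq> (\<Union>x\<in>k. ball x e)"
  proof (rule UN_mono[OF subset_refl])
   show "cball x (e / 2) \<subseteq> ball x e" for x :: "'g \<Rightarrow>\<^sub>C complex" using \<open>e > 0\<close> by auto
  qed
  finally show "\<exists>k. finite k \<and> closure (range B) \<subseteq> (\<Union>x\<in>k. ball x e)" using k(1) by blast
 qed
 hence "seq_compact (closure (range B))" unfolding compact_eq_seq_compact_metric .
 moreover have "\<forall>n. B n \<in> closure (range B)" by (simp add: subsetD[OF closure_subset])
 ultimately obtain l r where lr: "l \<in> closure (range B)" "strict_mono r" "(B \<circ> r) \<longlonglongrightarrow> l"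
  by (rule seq_compactE)
 show ?thesis
 proof (intro exI[of _ r] exI[of _ "apply_bcontfun l"] conjI allI impI)
  show "cont (apply_bcontfun l)" using apply_bcontfun[of l] by (simp add: bcontfun_def)
  fix e :: real assume "e > 0"
  then obtain N where N: "\<forall>n\<ge>N. dist ((B \<circ> r) n) l < e" using lr(3) unfolding lim_sequentially by blast
  have "dist (F (r n) x) (apply_bcontfun l x) \<le> e" if "n \<ge> N" for n x
   using dist_bounded[of "B (r n)" x l] N that by (simp add: B) (smt (verit))
  thus "\<exists>N. \<forall>n\<ge>N. \<forall>x. dist (F (r n) x) (apply_bcontfun l x) \<le> e" by blast
 qed fact
qed

subsection \<open>Finite-dimensional translation-invariant spaces\<close>

definition invariant_space :: "('g => complex) set => bool" where
 "invariant_space V \<longleftrightarrow> (\<forall>v\<in>V. cont v) \<and> (%x. 0) \<in> V \<and> (\<forall>v\<in>V. \<forall>w\<in>V. (%x. v x + w x) \<in> V) \<and>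
   (\<forall>c. \<forall>v\<in>V. (%x. c * v x) \<in> V) \<and> (\<forall>a. \<forall>v\<in>V. (%x. v (x \<otimes> a)) \<in> V)"

text \<open>Dimension is expressed through the length of orthonormal families, the form in which
  Bessel's inequality yields finiteness.\<close>

definition dim_bounded :: "('g => complex) set => nat => bool" where
 "dim_bounded V N \<longleftrightarrow> (\<forall>n w. orthonormal n w \<longrightarrow> (\<forall>i<n. w i \<in> V) \<longrightarrow> n \<le> N)"

context
 fixes f :: "'g => complex" and x0 :: 'g
 assumes f: "cont f" and fx0: "f x0 \<noteq> 0"
begin

text \<open>The correlation operator with kernel f, which commutes with right translations;
  \<open>corr_adj\<close> is its adjoint. Equicontinuity of the images of the unit ball makes it
  compact, so \<open>corr_adj\<close> after \<open>corr\<close> is a positive compact operator whose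
  eigenspaces are invariant under right translation.\<close>

definition corr :: "('g => complex) => 'g => complex"
 where "corr u x = cmean (%z. u (z \<otimes> x) * cnj (f z))"

definition corr_adj :: "('g => complex) => 'g => complex"
 where "corr_adj w y = cmean (%z. w (inv z \<otimes> y) * f z)"

lemma cont_corr: "cont u ==> cont (corr u)"
proof -
 assume u: "cont u"
 have "cont (%p. u (snd p \<otimes> fst p) * cnj (f (snd p)))"
  by (intro continuous_intros continuous_on_compose2[OF u] continuous_on_compose2[OF f]) auto
 from continuous_on_cmean_param[OF this] show ?thesis by (simp add: corr_def[abs_def])
qed

lemma cont_corr_adj: "cont w ==> cont (corr_adj w)"
proof -
 assume w: "cont w"
 have "cont (%p. w (inv (snd p) \<otimes> fst p) * f (snd p))"
  by (intro continuous_intros continuous_on_compose2[OF w] continuous_on_compose2[OF f]) auto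
 from continuous_on_cmean_param[OF this] show ?thesis by (simp add: corr_adj_def[abs_def])
qed

lemma adjoint: assumes u: "cont u" and w: "cont w" shows "cip (corr u) w = cip u (corr_adj w)"
proof -
 have c1: "cont (%z. u (z \<otimes> x) * cnj (f z))" for x
  by (intro continuous_intros continuous_on_compose2[OF u] continuous_on_compose2[OF f]) auto
 have c2: "cont (%z. w (inv z \<otimes> y) * f z)" for y
  by (intro continuous_intros continuous_on_compose2[OF w] continuous_on_compose2[OF f]) auto
 have c3: "cont (%x. u x * cnj (w (inv z \<otimes> x) * f z))" for z
  by (intro continuous_intros continuous_on_compose2[OF w] u) auto
 have "cip (corr u) w = cmean (%x. cmean (%z. cnj (w x) * (u (z \<otimes> x) * cnj (f z))))"
  unfolding cip_def corr_def cmean_scale[OF c1] by (simp add: mult.commute)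
 also have "... = cmean (%z. cmean (%x. cnj (w x) * (u (z \<otimes> x) * cnj (f z))))"
 proof -
  have "cont (%p. cnj (w (fst p)) * (u (snd p \<otimes> fst p) * cnj (f (snd p))))"
   by (intro continuous_intros continuous_on_compose2[OF u] continuous_on_compose2[OF w]
    continuous_on_compose2[OF f]) auto
  from cmean_swap[OF this] show ?thesis by simp
 qed
 also have "... = cmean (%z. cmean (%x. u x * cnj (w (inv z \<otimes> x) * f z)))"
 proof (rule arg_cong[where f = cmean], rule ext)
  fix z
  show "cmean (%x. cnj (w x) * (u (z \<otimes> x) * cnj (f z))) = cmean (%x. u x * cnj (w (inv z \<otimes> x) * f z))"
   using cmean_left_invariant[OF c3, of z z] by (simp add: ac_simps)
 qed
 also have "... = cmean (%x. cmean (%z. u x * cnj (w (inv z \<otimes> x) * f z)))"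
 proof -
  have "cont (%p. u (snd p) * cnj (w (inv (fst p) \<otimes> snd p) * f (fst p)))"
   by (intro continuous_intros continuous_on_compose2[OF u] continuous_on_compose2[OF w]
    continuous_on_compose2[OF f]) auto
  from cmean_swap[OF this] show ?thesis by simp
 qed
 also have "... = cip u (corr_adj w)"
 proof -
  have "cmean (%z. u x * cnj (w (inv z \<otimes> x) * f z)) = u x * cnj (corr_adj w x)" for x
   using cmean_scale[OF continuous_on_cnj[OF c2], of "u x" x] cmean_cnj[OF c2, of x]
   by (simp add: corr_adj_def)
  thus ?thesis by (simp add: cip_def)
 qed
 finally show ?thesis .
qed

lemma corr_eq_cip: "cont u ==> corr u x = cip u (%z. f (z \<otimes> inv x))"
proof -
 assume u: "cont u"
 have "cont (%z. u z * cnj (f (z \<otimes> inv x)))"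
  by (intro continuous_intros u continuous_on_compose2[OF f]) auto
 from cmean_right_invariant[OF this, of x] show ?thesis by (simp add: corr_def cip_def m_assoc)
qed

lemma corr_translate: "corr (%x. u (x \<otimes> a)) = (%x. corr u (x \<otimes> a))"
 by (rule ext) (simp add: corr_def m_assoc)

lemma corr_adj_translate: "corr_adj (%x. u (x \<otimes> a)) = (%x. corr_adj u (x \<otimes> a))"
 by (rule ext) (simp add: corr_adj_def m_assoc)

lemma cont_shift: "cont (%z. f (z \<otimes> a))" using continuous_translate(2)[OF f] .

lemma corr_bound:
 assumes u: "cont u" and b: "\<And>x. norm (f x) \<le> b" shows "(norm (corr u x))\<^sup>2 \<le> nrm2 u * b\<^sup>2"
 unfolding corr_eq_cip[OF u]
 by (rule order.trans[OF cip_CauchySchwarz[OF u cont_shift]], rule mult_left_mono)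
  (auto intro: nrm2_le cont_shift b nrm2_nonneg u)

lemma corr_equicontinuous:
 assumes "e > 0"
 shows "\<exists>X. open X \<and> x \<in> X \<and> (\<forall>u. cont u \<longrightarrow> nrm2 u \<le> 1 \<longrightarrow> (\<forall>y\<in>X. dist (corr u y) (corr u x) \<le> e))"
proof -
 have "continuous_on (UNIV \<times> UNIV) (%p. f (snd p \<otimes> inv (fst p)))"
  by (intro continuous_on_compose2[OF f] continuous_intros) auto
 from continuous_on_prod_compactE[OF this compact_space UNIV_I assms, of x]
 obtain X where X: "x \<in> X" "open X"
  "\<forall>y\<in>X \<inter> UNIV. \<forall>t\<in>UNIV. dist (f (snd (y, t) \<otimes> inv (fst (y, t)))) (f (snd (x, t) \<otimes> inv (fst (x, t)))) \<le> e"
  by blast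
 have "dist (corr u y) (corr u x) \<le> e" if u: "cont u" "nrm2 u \<le> 1" and y: "y \<in> X" for u y
 proof -
  let ?h = "%z. f (z \<otimes> inv y) - f (z \<otimes> inv x)"
  have ch: "cont ?h" by (intro continuous_on_diff cont_shift)
  have "norm (?h z) \<le> e" for z using X(3) y by (simp add: dist_norm)
  hence h: "nrm2 ?h \<le> e\<^sup>2" by (rule nrm2_le[OF ch])
  have c: "cont (%x. u x * cnj (f (x \<otimes> inv a)))" for a
   by (intro continuous_intros u continuous_on_compose2[OF f]) auto
  have "corr u y - corr u x = cip u ?h"
   unfolding corr_eq_cip[OF u(1)] cip_def cmean_diff[OF c c, symmetric] by (simp add: algebra_simps)
  hence "(dist (corr u y) (corr u x))\<^sup>2 \<le> nrm2 u * nrm2 ?h"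
   using cip_CauchySchwarz[OF u(1) ch] by (simp add: dist_norm)
  also have "... \<le> 1 * e\<^sup>2" using u h nrm2_nonneg[OF ch] by (intro mult_mono) auto
  finally show ?thesis using assms by (simp add: power2_le_iff_abs_le)
 qed
 thus ?thesis using X by blast
qed

lemma corr_lin: "cont u ==> cont v ==> corr (%x. u x + c * v x) x = corr u x + c * corr v x"
proof -
 assume u: "cont u" and v: "cont v"
 note cv = continuous_on_mult[OF continuous_on_const[of UNIV c] v]
 show ?thesis
  using cip_add_left[OF u cv cont_shift] cip_scale_left[OF v cont_shift]
   continuous_on_add[OF u cv] by (simp add: corr_eq_cip u v cv)
qed

lemma corr_adj_lin: "cont u ==> cont v ==> corr_adj (%x. u x + c * v x) x = corr_adj u x + c * corr_adj v x"
proof -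
 assume u: "cont u" and v: "cont v"
 have c: "cont (%z. u (inv z \<otimes> x) * f z)" if "cont u" for u
  by (intro continuous_intros continuous_on_compose2[OF that] continuous_on_compose2[OF f]) auto
 have "corr_adj (%x. u x + c * v x) x = cmean (%z. u (inv z \<otimes> x) * f z + c * (v (inv z \<otimes> x) * f z))"
  by (simp add: corr_adj_def algebra_simps)
 also have "... = corr_adj u x + c * corr_adj v x"
  unfolding corr_adj_def using cmean_add[OF c[OF u] continuous_on_mult[OF continuous_on_const c[OF v]]] cmean_scale[OF c[OF v]]
  by simp
 finally show ?thesis .
qed

lemma corr_adj_bound: assumes w: "cont w" and b: "\<And>x. norm (f x) \<le> b" and d: "\<And>x. norm (w x) \<le> d"
 shows "norm (corr_adj w y) \<le> d * b"
 unfolding corr_adj_def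
proof (rule norm_cmean_bound)
 show "cont (%z. w (inv z \<otimes> y) * f z)"
  by (intro continuous_intros continuous_on_compose2[OF w] continuous_on_compose2[OF f]) auto
 show "norm (w (inv z \<otimes> y) * f z) \<le> d * b" for z
  unfolding norm_mult using b[of z] d[of "inv z \<otimes> y"] order.trans[OF norm_ge_zero d]
  by (intro mult_mono) auto
qed

text \<open>The spectral theorem for the top eigenvalue only: s is the squared norm of
  \<open>corr\<close>, and a maximizing sequence u has a subsequence for which \<open>corr u\<close>
  converges uniformly to some g. Near the maximum u almost satisfies the eigenvalue equation, so g
  is the image of an exact eigenfunction.\<close>

lemma eigenfunction:
 obtains s v where "s > 0" "cont v" "\<And>x. corr_adj (corr v) x = of_real s * v x" "\<exists>x. corr v x \<noteq> 0"
proof -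
 obtain b where b: "b > 0" "\<And>x. norm (f x) \<le> b" using bounded_continuous[OF f] by blast
 have bT: "norm (corr u x) \<le> b" if u: "cont u" "nrm2 u \<le> 1" for u x
 proof -
  have "(norm (corr u x))\<^sup>2 \<le> nrm2 u * b\<^sup>2" by (rule corr_bound[OF u(1) b(2)])
  also have "... \<le> 1 * b\<^sup>2" using u by (intro mult_right_mono) auto
  finally show ?thesis using b(1) by (simp add: power2_le_iff_abs_le)
 qed
 define Q where "Q = {nrm2 (corr u) | u. cont u \<and> nrm2 u \<le> 1}"
 have "q \<le> b\<^sup>2" if q: "q \<in> Q" for q
  using q bT unfolding Q_def by (auto intro!: nrm2_le cont_corr)
 hence bdd: "bdd_above Q" by (auto simp: bdd_above_def)
 define s where "s = Sup Q"
 have nf: "nrm2 f > 0" using nrm2_pos[OF f fx0] .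
 have max: "nrm2 (corr u) \<le> s * nrm2 u" if u: "cont u" for u
 proof (cases "nrm2 u = 0")
  case True
  hence "u x = 0" for x using nrm2_eq_0[OF u] by blast
  thus ?thesis using True by (simp add: corr_def nrm2_def)
 next
  case False
  hence p: "nrm2 u > 0" using nrm2_nonneg[OF u] by simp
  define c where "c = complex_of_real (1 / sqrt (nrm2 u))"
  have nc: "(norm c)\<^sup>2 = 1 / nrm2 u" using p by (simp add: c_def norm_divide power_divide)
  have cu: "cont (%x. c * u x)" using u by (intro continuous_intros)
  have "nrm2 (%x. c * u x) \<le> 1" using nrm2_scale[OF u, of c] nc p by simp
  hence "nrm2 (corr (%x. c * u x)) \<in> Q" using cu by (auto simp: Q_def)
  hence "nrm2 (corr (%x. c * u x)) \<le> s" unfolding s_def using bdd by (rule cSup_upper)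
  moreover have "corr (%x. c * u x) = (%x. c * corr u x)"
   using corr_lin[OF continuous_on_const u, of 0 c] by (simp add: corr_def[of "%_. 0"] fun_eq_iff)
  ultimately have "(1 / nrm2 u) * nrm2 (corr u) \<le> s" using nrm2_scale[OF cont_corr[OF u], of c] nc by simp
  thus ?thesis using p by (simp add: field_simps)
 qed
 have "corr f \<one> = of_real (nrm2 f)" unfolding corr_def cip_self[symmetric] cip_def by simp
 hence "nrm2 (corr f) > 0" using nf by (intro nrm2_pos[OF cont_corr[OF f], of "\<one>"]) simp
 hence s: "s > 0" using max[OF f] nf by (smt (verit) mult_nonpos_nonneg)
 \<comment> \<open>An operator and its adjoint have the same norm: apply the Cauchy-Schwarz
   inequality to the product of w with \<open>corr (corr_adj w)\<close>.\<close>
 have maxs: "nrm2 (corr_adj w) \<le> s * nrm2 w" if w: "cont w" for w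
 proof -
  note cw = cont_corr_adj[OF w]
  have "cip (corr_adj w) (corr_adj w) = cip (corr (corr_adj w)) w" using adjoint[OF cw w] by simp
  hence "(nrm2 (corr_adj w))\<^sup>2 \<le> nrm2 (corr (corr_adj w)) * nrm2 w"
   using cip_CauchySchwarz[OF cont_corr[OF cw] w] unfolding cip_self[symmetric]
   by (metis (no_types, lifting) cip_self norm_of_real power2_abs)
  also have "... \<le> s * nrm2 (corr_adj w) * nrm2 w" by (intro mult_right_mono max cw nrm2_nonneg w)
  finally have "nrm2 (corr_adj w) * nrm2 (corr_adj w) \<le> nrm2 (corr_adj w) * (s * nrm2 w)"
   by (simp add: power2_eq_square ac_simps)
  thus ?thesis
   using nrm2_nonneg[OF cw] nrm2_nonneg[OF w] s
   by (cases "nrm2 (corr_adj w) = 0") (auto simp: mult_le_cancel_left)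
 qed
 have "cont (%_. 0)" "nrm2 (%_. 0) \<le> 1" by (simp_all add: nrm2_def)
 hence Qne: "Q \<noteq> {}" unfolding Q_def by blast
 have "\<exists>u. cont u \<and> nrm2 u \<le> 1 \<and> nrm2 (corr u) > s - inverse (real (Suc n))" for n
 proof -
  have "s - inverse (real (Suc n)) < Sup Q" by (simp add: s_def)
  from less_cSupE[OF this Qne] show ?thesis unfolding Q_def by blast
 qed
 then obtain u where u: "\<And>n. cont (u n)" "\<And>n. nrm2 (u n) \<le> 1"
  "\<And>n. nrm2 (corr (u n)) > s - inverse (real (Suc n))" by metis
 have equi: "\<exists>X. open X \<and> x \<in> X \<and> (\<forall>n. \<forall>y\<in>X. dist (corr (u n) y) (corr (u n) x) \<le> e)" if "e > 0" for x e
  using corr_equicontinuous[OF that, of x] u(1,2) by blast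
 have "\<exists>r g. strict_mono (r :: nat => nat) \<and> cont g \<and> (\<forall>e>0. \<exists>N. \<forall>n\<ge>N. \<forall>x. dist (corr (u (r n)) x) (g x) \<le> e)"
  by (rule equicontinuous_convergent_subsequence[where F = "%n. corr (u n)"], rule bT[OF u(1,2)], rule equi)
 then obtain r :: "nat => nat" and g where r: "strict_mono r" and g: "cont g"
  and lim: "\<forall>e>0. \<exists>N. \<forall>n\<ge>N. \<forall>x. dist (corr (u (r n)) x) (g x) \<le> e"
  by (elim exE conjE) (rule that)
 \<comment> \<open>The functions u (r n) need not converge, only their images do. The eigenvalue
   equation u = \<open>corr_adj (corr u)\<close> / s tells what their limit should be, and this is
   expressed through g.\<close>
 define v where "v x = of_real (1 / s) * corr_adj g x" for x
 have cv: "cont v" unfolding v_def using cont_corr_adj[OF g] by (intro continuous_intros)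
 have close: "norm (corr v x - g x) \<le> e" if e: "e > 0" for x e
 proof -
  \<comment> \<open>The distance from \<open>corr v\<close> to g is split into three parts: e/4 for
    replacing v by S, which forces d b^2 / s <= e/4; e/4 for replacing S by U, which dictates the
    bound e^2 / (16 b^2) below; and e/2 for \<open>corr U\<close> against g.\<close>
  define d where "d = min (e / 2) (e * s / (4 * b\<^sup>2))"
  have d: "d > 0" "d \<le> e / 2" "d * b\<^sup>2 * 4 \<le> e * s" using e s b(1) by (auto simp: d_def min_def field_simps)
  obtain N where N: "\<forall>n\<ge>N. \<forall>x. dist (corr (u (r n)) x) (g x) \<le> d" using lim d(1) by blast
  obtain n0 :: nat where n0: "n0 > 0" "inverse (real n0) < s * (e\<^sup>2 / (16 * b\<^sup>2))"
   using ex_inverse_of_nat_less[of "s * (e\<^sup>2 / (16 * b\<^sup>2))"] s e b(1) by auto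
  define n where "n = max N n0"
  define U where "U = u (r n)"
  have U: "cont U" "nrm2 U \<le> 1" using u by (auto simp: U_def)
  have "inverse (real (Suc (r n))) \<le> inverse (real n0)"
   using seq_suble[OF r, of n] n0(1) by (intro le_imp_inverse_le) (auto simp: n_def)
  hence nU: "s - nrm2 (corr U) \<le> s * (e\<^sup>2 / (16 * b\<^sup>2))"
   using u(3)[of "r n"] n0(2) by (simp add: U_def)
  have TU: "dist (corr U x) (g x) \<le> d" for x using N by (simp add: U_def n_def)
  note cTU = cont_corr[OF U(1)]
  note cTT = cont_corr_adj[OF cTU]
  define S where "S x = of_real (1 / s) * corr_adj (corr U) x" for x
  have cS: "cont S" unfolding S_def using cTT by (intro continuous_intros)
  \<comment> \<open>Expanding the square: the square norm of S and its product with U are at most,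
    respectively equal to, \<open>nrm2 (corr U)\<close> / s, and that of U is at most 1. What
    remains is (s - \<open>nrm2 (corr U)\<close>) / s, the defect of maximality.\<close>
  have "nrm2 (%x. S x - U x) \<le> e\<^sup>2 / (16 * b\<^sup>2)"
  proof -
   have "cip S U = of_real (1 / s) * cip (corr_adj (corr U)) U" unfolding S_def by (rule cip_scale_left[OF cTT U(1)])
   also have "cip (corr_adj (corr U)) U = cnj (cip U (corr_adj (corr U)))" using cip_cnj[OF U(1) cTT] .
   also have "cip U (corr_adj (corr U)) = of_real (nrm2 (corr U))" using adjoint[OF U(1) cTU] by (simp add: cip_self)
   finally have 1: "Re (cip S U) = nrm2 (corr U) / s" by simp
   have "nrm2 S = (1 / s)\<^sup>2 * nrm2 (corr_adj (corr U))"
    unfolding S_def nrm2_scale[OF cTT] using s by (simp add: norm_divide power_divide)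
   also have "... \<le> (1 / s)\<^sup>2 * (s * nrm2 (corr U))" by (intro mult_left_mono maxs cTU) simp
   finally have 2: "nrm2 S \<le> nrm2 (corr U) / s" using s by (simp add: power2_eq_square)
   have "nrm2 (%x. S x - U x) \<le> nrm2 (corr U) / s - 2 * (nrm2 (corr U) / s) + 1"
    unfolding nrm2_diff[OF cS U(1)] 1 using 2 U(2) by simp
   also have "... = (s - nrm2 (corr U)) / s" using s by (simp add: field_simps)
   also have "... \<le> e\<^sup>2 / (16 * b\<^sup>2)" using nU s by (simp add: field_simps)
   finally show ?thesis .
  qed
  note SU = this
  have "(norm (corr (%x. S x - U x) x))\<^sup>2 \<le> nrm2 (%x. S x - U x) * b\<^sup>2"
   by (rule corr_bound[OF continuous_on_diff[OF cS U(1)] b(2)])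
  also have "... \<le> e\<^sup>2 / (16 * b\<^sup>2) * b\<^sup>2" by (rule mult_right_mono[OF SU]) simp
  also have "... = (e / 4)\<^sup>2" using b(1) by (simp add: power_divide)
  finally have "(norm (corr (%x. S x - U x) x))\<^sup>2 \<le> (e / 4)\<^sup>2" .
  hence 3: "norm (corr (%x. S x - U x) x) \<le> e / 4" using e by (simp add: power2_le_iff_abs_le)
  have "norm (v x - S x) \<le> 1 / s * (d * b)" for x
  proof -
   have "corr_adj (%x. g x + - 1 * corr U x) x = corr_adj g x - corr_adj (corr U) x" using corr_adj_lin[OF g cTU, of "- 1"] by simp
   moreover have "norm (corr_adj (%x. g x + - 1 * corr U x) x) \<le> d * b"
    using TU g cTU by (intro corr_adj_bound b continuous_intros) (auto simp: dist_norm norm_minus_commute)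
   moreover have "v x - S x = of_real (1 / s) * (corr_adj g x - corr_adj (corr U) x)" by (simp add: v_def S_def algebra_simps)
   ultimately show ?thesis using s by (simp add: norm_mult norm_divide divide_right_mono)
  qed
  hence "nrm2 (%x. v x - S x) \<le> (1 / s * (d * b))\<^sup>2" by (intro nrm2_le continuous_on_diff cv cS)
  note vS = this
  have "(norm (corr (%x. v x - S x) x))\<^sup>2 \<le> nrm2 (%x. v x - S x) * b\<^sup>2"
   by (rule corr_bound[OF continuous_on_diff[OF cv cS] b(2)])
  also have "... \<le> (1 / s * (d * b))\<^sup>2 * b\<^sup>2" by (rule mult_right_mono[OF vS]) simp
  also have "... = (d * b\<^sup>2 / s)\<^sup>2" by (simp add: power2_eq_square)
  also have "... \<le> (e / 4)\<^sup>2" using d s by (intro power_mono) (auto simp: field_simps)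
  finally have 4: "norm (corr (%x. v x - S x) x) \<le> e / 4" using e by (simp add: power2_le_iff_abs_le)
  have 5: "corr v x - g x = corr (%x. v x - S x) x + corr (%x. S x - U x) x + (corr U x - g x)"
   using corr_lin[OF cv cS, of "- 1" x] corr_lin[OF cS U(1), of "- 1" x] by simp
  have "norm (corr v x - g x) \<le> e / 4 + e / 4 + e / 2"
   unfolding 5 using 3 4 TU[of x] d(2) by (intro norm_triangle_mono) (auto simp: dist_norm)
  thus ?thesis by simp
 qed
 have Tv: "corr v x = g x" for x
 proof -
  have "norm (corr v x - g x) \<le> 0 + e" if "e > 0" for e using close[OF that, of x] by simp
  hence "norm (corr v x - g x) \<le> 0" by (rule field_le_epsilon)
  thus ?thesis by simp
 qed
 hence "corr v = g" by blast
 have ng: "\<exists>x. g x \<noteq> 0"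
 proof (rule ccontr)
  assume "\<not> ?thesis"
  hence g0: "g x = 0" for x by blast
  have "sqrt (s / 4) > 0" using s by simp
  from lim[rule_format, OF this] obtain N where N: "\<forall>n\<ge>N. \<forall>x. dist (corr (u (r n)) x) (g x) \<le> sqrt (s / 4)" by blast
  obtain n0 :: nat where n0: "n0 > 0" "inverse (real n0) < s / 2"
   using ex_inverse_of_nat_less[of "s / 2"] s by auto
  define n where "n = max N n0"
  have "inverse (real (Suc (r n))) \<le> inverse (real n0)"
   using seq_suble[OF r, of n] n0(1) by (intro le_imp_inverse_le) (auto simp: n_def)
  hence "nrm2 (corr (u (r n))) > s / 2" using u(3)[of "r n"] n0(2) by simp
  moreover have "nrm2 (corr (u (r n))) \<le> (sqrt (s / 4))\<^sup>2"
   using N by (intro nrm2_le cont_corr u) (simp add: g0 n_def)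
  ultimately show False using s by simp
 qed
 show ?thesis
 proof (rule that[of s v])
  show "corr_adj (corr v) x = of_real s * v x" for x using s \<open>corr v = g\<close> by (simp add: v_def)
  show "\<exists>x. corr v x \<noteq> 0" using ng Tv by simp
 qed (use s cv in auto)
qed

text \<open>Finite dimension: for orthonormal w i in the eigenspace every \<open>corr (w i)\<close>
  has square norm s, while at each point x the values \<open>corr (w i) x\<close> are conjugates of
  coefficients of a translate of f, so by Bessel their squares add up to at most b^2. Taking the
  mean gives n s <= b^2. If the eigenspace were orthogonal to f, then so would be all translates of
  an eigenfunction v, and \<open>corr v\<close> would vanish.\<close>

lemma eigenspace:
 obtains V N where "invariant_space V" "dim_bounded V N" "\<exists>v\<in>V. cip v f \<noteq> 0"
proof -
 obtain s v where s: "s > 0" and v: "cont v" "\<And>x. corr_adj (corr v) x = of_real s * v x" "\<exists>x. corr v x \<noteq> 0"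
  using eigenfunction by blast
 obtain b where b: "b > 0" "\<And>x. norm (f x) \<le> b" using bounded_continuous[OF f] by blast
 define V where "V = {v. cont v \<and> (\<forall>x. corr_adj (corr v) x = of_real s * v x)}"
 have T0: "corr (%x. 0) = (%x. 0)" "corr_adj (%x. 0) = (%x. 0)" by (auto simp: corr_def corr_adj_def)
 have lin: "(%x. v x + c * w x) \<in> V" if "v \<in> V" "w \<in> V" for v w c
 proof -
  have c: "cont v" "cont w" using that by (auto simp: V_def)
  have "corr (%x. v x + c * w x) = (%x. corr v x + c * corr w x)" using corr_lin[OF c] by blast
  hence "corr_adj (corr (%x. v x + c * w x)) x = of_real s * (v x + c * w x)" for x
   using corr_adj_lin[OF cont_corr[OF c(1)] cont_corr[OF c(2)], of c x] that by (simp add: V_def algebra_simps)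
  thus ?thesis using c by (auto simp: V_def intro!: continuous_intros)
 qed
 have V0: "(%x. 0) \<in> V" using T0 by (auto simp: V_def)
 have inv: "invariant_space V"
  unfolding invariant_space_def
 proof (intro conjI ballI allI)
  show "(%x. v x + w x) \<in> V" if "v \<in> V" "w \<in> V" for v w using lin[OF that, of 1] by simp
  show "(%x. c * v x) \<in> V" if "v \<in> V" for c v using lin[OF V0 that, of c] by simp
  show "(%x. v (x \<otimes> a)) \<in> V" if "v \<in> V" for a v
   using that continuous_translate(2)[of v a] by (simp add: V_def corr_translate corr_adj_translate)
 qed (use V0 in \<open>auto simp: V_def\<close>)
 have dim: "dim_bounded V (nat \<lceil>b\<^sup>2 / s\<rceil>)"
  unfolding dim_bounded_def
 proof (intro allI impI)
  fix n w assume w: "orthonormal n w" and wV: "\<forall>i<n. w i \<in> V"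
  have cw: "cont (w i)" if "i < n" for i using w that by (simp add: orthonormal_def)
  have nT: "nrm2 (corr (w i)) = s" if i: "i < n" for i
  proof -
   have "of_real (nrm2 (corr (w i))) = cip (w i) (corr_adj (corr (w i)))"
    using adjoint[OF cw[OF i] cont_corr[OF cw[OF i]]] by (simp add: cip_self)
   also have "corr_adj (corr (w i)) = (%x. of_real s * w i x)" using wV i by (auto simp: V_def)
   also have "cip (w i) (%x. of_real s * w i x) = of_real s"
    using cip_scale_right[OF cw[OF i] cw[OF i], of "of_real s"] w i by (simp add: orthonormal_def)
   finally show ?thesis by (simp only: of_real_eq_iff)
  qed
  have pt: "(\<Sum>i<n. (norm (corr (w i) x))\<^sup>2) \<le> b\<^sup>2" for x
  proof -
   have "(\<Sum>i<n. (norm (corr (w i) x))\<^sup>2) = (\<Sum>i<n. (norm (cip (%z. f (z \<otimes> inv x)) (w i)))\<^sup>2)"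
    using corr_eq_cip[OF cw] cip_cnj[OF cw cont_shift] by (intro sum.cong refl) simp
   also have "... \<le> nrm2 (%z. f (z \<otimes> inv x))" by (rule Bessel[OF w cont_shift])
   also have "... \<le> b\<^sup>2" by (rule nrm2_le[OF cont_shift b(2)])
   finally show ?thesis .
  qed
  have ci: "cont (%x. (norm (corr (w i) x))\<^sup>2)" if "i < n" for i
   using cont_corr[OF cw[OF that]] by (intro continuous_intros)
  have "n * s = (\<Sum>i<n. nrm2 (corr (w i)))" using nT by simp
  also have "... = mean (%x. \<Sum>i<n. (norm (corr (w i) x))\<^sup>2)"
   unfolding nrm2_def by (rule mean_sum[symmetric]) (use ci in auto)
  also have "... \<le> mean (%x. b\<^sup>2)"
   using pt ci by (intro mean_mono continuous_on_sum continuous_on_const) auto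
  finally have "n \<le> b\<^sup>2 / s" using s by (simp add: field_simps)
  hence "real n \<le> real (nat \<lceil>b\<^sup>2 / s\<rceil>)"
   using real_nat_ceiling_ge[of "b\<^sup>2 / s"] by linarith
  thus "n \<le> nat \<lceil>b\<^sup>2 / s\<rceil>" by simp
 qed
 have "\<exists>v\<in>V. cip v f \<noteq> 0"
 proof (rule ccontr)
  assume "\<not> ?thesis"
  hence 0: "cip w f = 0" if "w \<in> V" for w using that by blast
  have "corr v x = 0" for x
  proof -
   have "v \<in> V" using v by (simp add: V_def)
   hence "(%z. v (z \<otimes> x)) \<in> V" using inv by (simp add: invariant_space_def)
   from 0[OF this] show ?thesis by (simp add: corr_def cip_def)
  qed
  thus False using v(3) by simp
 qed
 with that inv dim show ?thesis by blast
qed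

end

end

subsection \<open>Unitary representations\<close>

lemma mat_adjoint_carrier: "A \<in> carrier_mat n m ==> mat_adjoint A \<in> carrier_mat m n"
 unfolding mat_adjoint_def by auto

lemma mat_adjoint_index:
 "i < dim_col A ==> j < dim_row A ==> mat_adjoint A $$ (i, j) = conjugate (A $$ (j, i))"
 unfolding mat_adjoint_def by (simp add: mat_of_rows_index)

lemma mat_mult_index:
 assumes "A \<in> carrier_mat n m" "B \<in> carrier_mat m k" "i < n" "j < k"
 shows "(A * B) $$ (i, j) = (\<Sum>l<m. A $$ (i, l) * B $$ (l, j))"
 using assms by (simp add: scalar_prod_def lessThan_atLeast0)

lemma mat_adjoint_mult:
 fixes A B :: "complex mat"
 assumes A: "A \<in> carrier_mat n m" and B: "B \<in> carrier_mat m k"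
 shows "mat_adjoint (A * B) = mat_adjoint B * mat_adjoint A"
proof (rule eq_matI)
 note cA = mat_adjoint_carrier[OF A] and cB = mat_adjoint_carrier[OF B]
  and cAB = mat_adjoint_carrier[OF mult_carrier_mat[OF A B]]
 fix i j assume "i < dim_row (mat_adjoint B * mat_adjoint A)" "j < dim_col (mat_adjoint B * mat_adjoint A)"
 hence ij: "i < k" "j < n" using cA cB by auto
 have "mat_adjoint (A * B) $$ (i, j) = cnj (\<Sum>l<m. A $$ (j, l) * B $$ (l, i))"
  using ij A B by (simp add: mat_adjoint_index mat_mult_index[OF A B ij(2,1)] del: index_mult_mat(1))
 also have "... = (\<Sum>l<m. mat_adjoint B $$ (i, l) * mat_adjoint A $$ (l, j))"
  using ij A B by (simp add: mat_adjoint_index mult.commute)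
 also have "... = (mat_adjoint B * mat_adjoint A) $$ (i, j)"
  using mat_mult_index[OF cB cA ij] by simp
 finally show "mat_adjoint (A * B) $$ (i, j) = (mat_adjoint B * mat_adjoint A) $$ (i, j)" .
qed (use A B mat_adjoint_carrier[OF A] mat_adjoint_carrier[OF B] mat_adjoint_carrier[OF mult_carrier_mat[OF A B]] in auto)

lemma mat_adjoint_adjoint: "mat_adjoint (mat_adjoint A) = (A :: complex mat)"
proof (rule eq_matI)
 have A: "A \<in> carrier_mat (dim_row A) (dim_col A)" by simp
 note c = mat_adjoint_carrier[OF A]
 show "mat_adjoint (mat_adjoint A) $$ (i, j) = A $$ (i, j)" if "i < dim_row A" "j < dim_col A" for i j
  using that c by (simp add: mat_adjoint_index)
 show "dim_row (mat_adjoint (mat_adjoint A)) = dim_row A" "dim_col (mat_adjoint (mat_adjoint A)) = dim_col A"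
  using mat_adjoint_carrier[OF c] by auto
qed

lemma invertible_matE:
 fixes A :: "complex mat"
 assumes "A \<in> carrier_mat d d" "invertible_mat A"
 obtains B where "B \<in> carrier_mat d d" "A * B = 1\<^sub>m d" "B * A = 1\<^sub>m d"
proof -
 obtain B where B: "inverts_mat A B" "inverts_mat B A" using assms(2) by (auto simp: invertible_mat_def)
 have "dim_row B = d" "dim_col B = d"
  using B assms(1) unfolding inverts_mat_def
  by (metis carrier_matD(1) carrier_matD(2) index_mult_mat(2) index_mult_mat(3) index_one_mat(2) index_one_mat(3))+
 thus ?thesis using that[of B] B assms(1) by (auto simp: inverts_mat_def)
qed

lemma invertible_matI:
 fixes A :: "complex mat"
 assumes "A \<in> carrier_mat d d" "B \<in> carrier_mat d d" "A * B = 1\<^sub>m d" "B * A = 1\<^sub>m d"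
 shows "invertible_mat A"
 using assms unfolding invertible_mat_def inverts_mat_def by auto

context compact_topological_group
begin

context
 fixes d :: nat and \<xi> :: "'g rep"
 assumes \<xi>: "unitary_rep G d \<xi>"
begin

lemma rep_carrier: "\<xi> x \<in> carrier_mat d d"
 using \<xi> by (simp add: unitary_rep_def)

lemma rep_adjoint_mult: "mat_adjoint (\<xi> x) * \<xi> x = 1\<^sub>m d"
 using \<xi> by (simp add: unitary_rep_def)

lemma rep_mult: "\<xi> (x \<otimes> y) = \<xi> x * \<xi> y"
 using \<xi> by (simp add: unitary_rep_def)

lemma rep_cont: "i < d ==> j < d ==> cont (coef \<xi> i j)"
 using \<xi> by (simp add: unitary_rep_def)

lemma rep_one: "\<xi> \<one> = 1\<^sub>m d"
proof -
 note c = rep_carrier[of "\<one>"] and ca = mat_adjoint_carrier[OF rep_carrier[of "\<one>"]]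
 have "\<xi> \<one> = (mat_adjoint (\<xi> \<one>) * \<xi> \<one>) * \<xi> \<one>" using c by (simp add: rep_adjoint_mult)
 also have "... = mat_adjoint (\<xi> \<one>) * (\<xi> \<one> * \<xi> \<one>)" by (rule assoc_mult_mat[OF ca c c])
 also have "... = mat_adjoint (\<xi> \<one>) * \<xi> \<one>" unfolding rep_mult[symmetric] by simp
 finally show ?thesis by (simp add: rep_adjoint_mult)
qed

lemma rep_inv: "\<xi> (inv x) = mat_adjoint (\<xi> x)"
proof -
 note c = rep_carrier and ca = mat_adjoint_carrier[OF rep_carrier[of x]]
 have "mat_adjoint (\<xi> x) = mat_adjoint (\<xi> x) * (\<xi> x * \<xi> (inv x))"
  using ca by (simp add: rep_mult[symmetric] rep_one)
 also have "... = (mat_adjoint (\<xi> x) * \<xi> x) * \<xi> (inv x)" by (rule assoc_mult_mat[symmetric, OF ca c c])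
 finally show ?thesis using c[of "inv x"] by (simp add: rep_adjoint_mult)
qed

lemma rep_mult_index:
 "i < d ==> j < d ==> \<xi> (x \<otimes> y) $$ (i, j) = (\<Sum>k<d. \<xi> x $$ (i, k) * \<xi> y $$ (k, j))"
 unfolding rep_mult by (rule mat_mult_index[OF rep_carrier rep_carrier])

lemma rep_inv_index: "i < d ==> j < d ==> \<xi> (inv x) $$ (i, j) = cnj (\<xi> x $$ (j, i))"
 unfolding rep_inv using rep_carrier[of x] by (simp add: mat_adjoint_index)

lemma rep_one_index: "i < d ==> j < d ==> \<xi> \<one> $$ (i, j) = (if i = j then 1 else 0)"
 unfolding rep_one by simp

lemma rep_cols_orthonormal:
 "i < d ==> j < d ==> (\<Sum>k<d. cnj (\<xi> x $$ (k, i)) * \<xi> x $$ (k, j)) = (if i = j then 1 else 0)"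
 using rep_mult_index[of i j "inv x" x] rep_one_index by (simp add: rep_inv_index)

lemma rep_rows_orthonormal:
 "i < d ==> j < d ==> (\<Sum>k<d. \<xi> x $$ (i, k) * cnj (\<xi> x $$ (j, k))) = (if i = j then 1 else 0)"
 using rep_mult_index[of i j x "inv x"] rep_one_index by (simp add: rep_inv_index)

lemma rep_row_norm: "i < d ==> (\<Sum>k<d. (norm (\<xi> x $$ (i, k)))\<^sup>2) = 1"
proof -
 assume i: "i < d"
 have "complex_of_real (\<Sum>k<d. (norm (\<xi> x $$ (i, k)))\<^sup>2) = (\<Sum>k<d. \<xi> x $$ (i, k) * cnj (\<xi> x $$ (i, k)))"
  unfolding of_real_sum complex_norm_square ..
 also have "... = of_real 1" using rep_rows_orthonormal[OF i i, of x] by simp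
 finally show ?thesis by (simp only: of_real_eq_iff)
qed

lemma rep_norm_le: "i < d ==> j < d ==> norm (\<xi> x $$ (i, j)) \<le> 1"
proof -
 assume i: "i < d" and j: "j < d"
 have "(norm (\<xi> x $$ (i, j)))\<^sup>2 \<le> (\<Sum>k<d. (norm (\<xi> x $$ (i, k)))\<^sup>2)"
  using j by (intro member_le_sum) auto
 thus ?thesis using rep_row_norm[OF i] by (simp add: abs_square_le_1)
qed

lemma rep_dim_eq: "rep_dim G \<xi> = d"
 using rep_carrier[of "\<one>"] by (simp add: rep_dim_def)

end

lemma irreducible_unitary: "irrep G d \<xi> ==> unitary_rep G d \<xi>"
 by (simp add: irreducible_unitary_rep_def)

lemma irreps_dim: "\<xi> \<in> irreps G \<longleftrightarrow> irrep G (rep_dim G \<xi>) \<xi>"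
 using rep_dim_eq[OF irreducible_unitary] by (auto simp: irreps_def)

section \<open>Schur's lemma and the orthogonality relations\<close>

lemma mat_eq_smult_one:
 fixes A :: "complex mat"
 assumes A: "A \<in> carrier_mat d d" and "\<And>w. w \<in> carrier_vec d ==> A *\<^sub>v w = c \<cdot>\<^sub>v w"
 shows "A = c \<cdot>\<^sub>m 1\<^sub>m d"
proof (rule eq_matI)
 fix i j assume "i < dim_row (c \<cdot>\<^sub>m 1\<^sub>m d :: complex mat)" "j < dim_col (c \<cdot>\<^sub>m 1\<^sub>m d :: complex mat)"
 hence ij: "i < d" "j < d" by auto
 have "A $$ (i, j) = vec_index (A *\<^sub>v unit_vec d j) i"
  using ij A by (simp add: mult_mat_vec_def scalar_prod_def unit_vec_def if_distrib sum.delta cong: if_cong)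
 also have "... = vec_index (c \<cdot>\<^sub>v unit_vec d j) i" using assms(2)[of "unit_vec d j"] by simp
 finally show "A $$ (i, j) = (c \<cdot>\<^sub>m 1\<^sub>m d) $$ (i, j)" using ij by (simp add: unit_vec_def)
qed (use A in auto)

lemma Schur_scalar:
 assumes \<xi>: "irrep G d \<xi>" and A: "A \<in> carrier_mat d d"
  and comm: "\<And>x. A * \<xi> x = \<xi> x * A"
 shows "\<exists>c. A = c \<cdot>\<^sub>m 1\<^sub>m d"
proof -
 note u = irreducible_unitary[OF \<xi>]
 have "d > 0" using \<xi> by (simp add: irreducible_unitary_rep_def)
 then obtain c where "eigenvalue A c"
  using spectrum_non_empty[OF A] unfolding spectrum_def by blast
 then obtain v where v: "v \<in> carrier_vec d" "v \<noteq> 0\<^sub>v d" "A *\<^sub>v v = c \<cdot>\<^sub>v v"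
  using A unfolding eigenvalue_def eigenvector_def by auto
 define W where "W = {w \<in> carrier_vec d. A *\<^sub>v w = c \<cdot>\<^sub>v w}"
 have "invariant_subspace G d \<xi> W"
  unfolding invariant_subspace_def
 proof (intro conjI ballI allI)
  show "W \<subseteq> carrier_vec d" by (auto simp: W_def)
  show "0\<^sub>v d \<in> W" using A by (auto simp: W_def)
  show "w1 + w2 \<in> W" if "w1 \<in> W" "w2 \<in> W" for w1 w2
   using that A by (auto simp: W_def mult_add_distrib_mat_vec smult_add_distrib_vec)
  show "b \<cdot>\<^sub>v w \<in> W" if "w \<in> W" for b w
   using that A by (auto simp: W_def mult_mat_vec smult_smult_assoc mult.commute)
  show "\<xi> x *\<^sub>v w \<in> W" if w: "w \<in> W" for x w
  proof -
   have cw: "w \<in> carrier_vec d" "A *\<^sub>v w = c \<cdot>\<^sub>v w" using w by (auto simp: W_def)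
   note cx = rep_carrier[OF u, of x]
   have "A *\<^sub>v (\<xi> x *\<^sub>v w) = (A * \<xi> x) *\<^sub>v w" by (rule assoc_mult_mat_vec[symmetric, OF A cx cw(1)])
   also have "... = \<xi> x *\<^sub>v (A *\<^sub>v w)" unfolding comm by (rule assoc_mult_mat_vec[OF cx A cw(1)])
   also have "... = c \<cdot>\<^sub>v (\<xi> x *\<^sub>v w)" unfolding cw(2) by (rule mult_mat_vec[OF cx cw(1)])
   finally show ?thesis using mult_mat_vec_carrier[OF cx cw(1)] by (simp add: W_def)
  qed
 qed
 moreover have "W \<noteq> {0\<^sub>v d}" using v by (auto simp: W_def)
 ultimately have "W = carrier_vec d" using \<xi> by (auto simp: irreducible_unitary_rep_def)
 hence "A *\<^sub>v w = c \<cdot>\<^sub>v w" if "w \<in> carrier_vec d" for w using that by (auto simp: W_def)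
 from mat_eq_smult_one[OF A this] show ?thesis by blast
qed

text \<open>With B the adjoint of A, both B A and A B commute with a representation and are scalars
  a and b. They agree since A (B A) = (A B) A and A is nonzero, and a is nonzero because the
  diagonal of B A consists of sums of squares. Adding the squares of all entries by columns and by
  rows gives d a = d' a.\<close>

lemma Schur_intertwiner:
 assumes \<xi>: "irrep G d \<xi>" and \<eta>: "irrep G d' \<eta>"
  and A: "A \<in> carrier_mat d' d" and comm: "\<And>x. A * \<xi> x = \<eta> x * A" and nz: "A \<noteq> 0\<^sub>m d' d"
 shows "d = d' \<and> invertible_mat A"
proof -
 note u = irreducible_unitary[OF \<xi>] and u' = irreducible_unitary[OF \<eta>]
 note cx = rep_carrier[OF u] and cy = rep_carrier[OF u']
 define B where "B = mat_adjoint A"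
 have B: "B \<in> carrier_mat d d'" unfolding B_def by (rule mat_adjoint_carrier[OF A])
 have commB: "\<xi> x * B = B * \<eta> x" for x
 proof -
  have "mat_adjoint (A * \<xi> (inv x)) = \<xi> x * B"
   using mat_adjoint_mult[OF A cx, of "inv x"] rep_inv[OF u, of x] by (simp add: B_def mat_adjoint_adjoint)
  moreover have "mat_adjoint (\<eta> (inv x) * A) = B * \<eta> x"
   using mat_adjoint_mult[OF cy A, of "inv x"] rep_inv[OF u', of x] by (simp add: B_def mat_adjoint_adjoint)
  ultimately show ?thesis by (simp add: comm)
 qed
 have "(B * A) * \<xi> x = \<xi> x * (B * A)" for x
 proof -
  have "(B * A) * \<xi> x = B * (\<eta> x * A)" unfolding comm[symmetric] by (rule assoc_mult_mat[OF B A cx])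
  also have "... = (\<xi> x * B) * A" unfolding commB by (rule assoc_mult_mat[symmetric, OF B cy A])
  finally show ?thesis using assoc_mult_mat[OF cx B A] by simp
 qed
 from Schur_scalar[OF \<xi> mult_carrier_mat[OF B A] this] obtain a where a: "B * A = a \<cdot>\<^sub>m 1\<^sub>m d" by blast
 have "(A * B) * \<eta> x = \<eta> x * (A * B)" for x
 proof -
  have "(A * B) * \<eta> x = A * (\<xi> x * B)" unfolding commB by (rule assoc_mult_mat[OF A B cy])
  also have "... = (\<eta> x * A) * B" unfolding comm[symmetric] by (rule assoc_mult_mat[symmetric, OF A cx B])
  finally show ?thesis using assoc_mult_mat[OF cy A B] by simp
 qed
 from Schur_scalar[OF \<eta> mult_carrier_mat[OF A B] this] obtain b where b: "A * B = b \<cdot>\<^sub>m 1\<^sub>m d'" by blast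
 obtain i j where ij: "i < d'" "j < d" "A $$ (i, j) \<noteq> 0"
 proof (rule ccontr)
  assume "\<not> thesis"
  hence "A $$ (i, j) = 0" if "i < d'" "j < d" for i j using that \<open>\<And>j i. \<lbrakk>i < d'; j < d; A $$ (i, j) \<noteq> 0\<rbrakk> \<Longrightarrow> thesis\<close> by blast
  hence "A = 0\<^sub>m d' d" using A by (intro eq_matI) auto
  thus False using nz by blast
 qed
 have "A * (B * A) = (A * B) * A" by (rule assoc_mult_mat[symmetric, OF A B A])
 hence "a \<cdot>\<^sub>m A = b \<cdot>\<^sub>m A"
  unfolding a b using A by (simp add: mult_smult_distrib[OF A one_carrier_mat] mult_smult_assoc_mat[OF one_carrier_mat A])
 hence "a * A $$ (i, j) = b * A $$ (i, j)" using ij A by (metis carrier_matD index_smult_mat(1))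
 hence ab: "a = b" using ij by simp
 have BA: "(B * A) $$ (j, j) = of_real (\<Sum>k<d'. (norm (A $$ (k, j)))\<^sup>2)" if "j < d" for j
  unfolding of_real_sum complex_norm_square mat_mult_index[OF B A that that]
  using that A by (intro sum.cong refl) (simp add: B_def mat_adjoint_index mult.commute)
 have AB: "(A * B) $$ (k, k) = of_real (\<Sum>j<d. (norm (A $$ (k, j)))\<^sup>2)" if "k < d'" for k
  unfolding of_real_sum complex_norm_square mat_mult_index[OF A B that that]
  using that A by (intro sum.cong refl) (simp add: B_def mat_adjoint_index)
 have a1: "a = of_real (\<Sum>k<d'. (norm (A $$ (k, j)))\<^sup>2)" if "j < d" for j
  using BA[OF that] that unfolding a by simp
 have a2: "a = of_real (\<Sum>j<d. (norm (A $$ (k, j)))\<^sup>2)" if "k < d'" for k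
  using AB[OF that] that unfolding b ab by simp
 have "(norm (A $$ (i, j)))\<^sup>2 \<le> (\<Sum>k<d'. (norm (A $$ (k, j)))\<^sup>2)"
  using ij by (intro member_le_sum) auto
 hence "(\<Sum>k<d'. (norm (A $$ (k, j)))\<^sup>2) > 0"
  using ij(3) by (smt (verit) zero_less_norm_iff zero_less_power)
 hence "a \<noteq> 0" unfolding a1[OF ij(2)] of_real_eq_0_iff by simp
 have "of_nat d * a = (\<Sum>j<d. a)" by simp
 also have "... = (\<Sum>j<d. of_real (\<Sum>k<d'. (norm (A $$ (k, j)))\<^sup>2))"
  by (rule sum.cong[OF refl], rule a1) simp
 also have "... = of_real (\<Sum>k<d'. \<Sum>j<d. (norm (A $$ (k, j)))\<^sup>2)"
  unfolding of_real_sum by (rule sum.swap)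
 also have "... = (\<Sum>k<d'. a)"
  unfolding of_real_sum[of "%k. \<Sum>j<d. (norm (A $$ (k, j)))\<^sup>2"]
  by (rule sum.cong[OF refl], rule a2[symmetric]) simp
 also have "... = of_nat d' * a" by simp
 finally have dd: "d = d'" using \<open>a \<noteq> 0\<close> by simp
 have AB1: "A * ((1 / a) \<cdot>\<^sub>m B) = 1\<^sub>m d"
  unfolding mult_smult_distrib[OF A B] b by (rule eq_matI) (use \<open>a \<noteq> 0\<close> ab dd in auto)
 have BA1: "((1 / a) \<cdot>\<^sub>m B) * A = 1\<^sub>m d"
  unfolding mult_smult_assoc_mat[OF B A] a by (rule eq_matI) (use \<open>a \<noteq> 0\<close> in auto)
 show ?thesis
  using dd A B invertible_matI[OF _ _ AB1 BA1] by auto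
qed

lemma equiv_rep_equiv: "equiv (irreps G) (rep_equiv G)"
proof (rule equivI)
 show "rep_equiv G \<subseteq> irreps G \<times> irreps G" by (auto simp: rep_equiv_def)
 show "refl_on (irreps G) (rep_equiv G)"
 proof (rule refl_onI)
  fix \<xi> assume "\<xi> \<in> irreps G"
  hence u: "unitary_rep G (rep_dim G \<xi>) \<xi>" by (simp add: irreps_dim irreducible_unitary)
  have "invertible_mat (1\<^sub>m (rep_dim G \<xi>) :: complex mat)"
   unfolding invertible_mat_def inverts_mat_def by (auto intro!: exI[of _ "1\<^sub>m (rep_dim G \<xi>)"])
  thus "(\<xi>, \<xi>) \<in> rep_equiv G"
   using \<open>\<xi> \<in> irreps G\<close>
   by (auto simp: rep_equiv_def left_mult_one_mat[OF rep_carrier[OF u]] right_mult_one_mat[OF rep_carrier[OF u]] intro!: bexI[of _ "1\<^sub>m (rep_dim G \<xi>)"])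
 qed
 show "sym (rep_equiv G)"
 proof (rule symI)
  fix \<xi> \<eta> assume r: "(\<xi>, \<eta>) \<in> rep_equiv G"
  define d where "d = rep_dim G \<xi>"
  have \<xi>: "irrep G d \<xi>" and \<eta>: "irrep G d \<eta>" and d: "rep_dim G \<eta> = d"
   using r by (auto simp: rep_equiv_def irreps_dim d_def)
  note cx = rep_carrier[OF irreducible_unitary[OF \<xi>]] and cy = rep_carrier[OF irreducible_unitary[OF \<eta>]]
  obtain T where T: "T \<in> carrier_mat d d" "invertible_mat T" "\<And>x. T * \<xi> x = \<eta> x * T"
   using r by (auto simp: rep_equiv_def d_def)
  obtain S where cS: "S \<in> carrier_mat d d" and TS: "T * S = 1\<^sub>m d" "S * T = 1\<^sub>m d"
   using invertible_matE[OF T(1,2)] .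
  have "S * \<eta> x = \<xi> x * S" for x
  proof -
   have "S * \<eta> x = (S * \<eta> x) * (T * S)" using cS cy[of x] by (simp add: TS)
   also have "... = ((S * \<eta> x) * T) * S" by (rule assoc_mult_mat[symmetric, OF mult_carrier_mat[OF cS cy] T(1) cS])
   also have "(S * \<eta> x) * T = S * (T * \<xi> x)" unfolding T(3) by (rule assoc_mult_mat[OF cS cy T(1)])
   also have "S * (T * \<xi> x) = (S * T) * \<xi> x" by (rule assoc_mult_mat[symmetric, OF cS T(1) cx])
   finally show ?thesis using cx[of x] by (simp add: TS)
  qed
  moreover have "invertible_mat S" by (rule invertible_matI[OF cS T(1) TS(2,1)])
  ultimately show "(\<eta>, \<xi>) \<in> rep_equiv G"
   using r cS d by (auto simp: rep_equiv_def d_def intro!: bexI[of _ S])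
 qed
 show "trans (rep_equiv G)"
 proof (rule transI)
  fix \<xi> \<eta> \<zeta> assume r: "(\<xi>, \<eta>) \<in> rep_equiv G" and r': "(\<eta>, \<zeta>) \<in> rep_equiv G"
  define d where "d = rep_dim G \<xi>"
  have d: "rep_dim G \<eta> = d" "rep_dim G \<zeta> = d" using r r' by (auto simp: rep_equiv_def d_def)
  have \<xi>: "irrep G d \<xi>" and \<eta>: "irrep G d \<eta>" and \<zeta>: "irrep G d \<zeta>"
   using r r' d by (auto simp: rep_equiv_def irreps_dim d_def)
  note cx = rep_carrier[OF irreducible_unitary[OF \<xi>]] and cy = rep_carrier[OF irreducible_unitary[OF \<eta>]]
   and cz = rep_carrier[OF irreducible_unitary[OF \<zeta>]]
  obtain T where T: "T \<in> carrier_mat d d" "invertible_mat T" "\<And>x. T * \<xi> x = \<eta> x * T"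
   using r by (auto simp: rep_equiv_def d_def)
  obtain S where S: "S \<in> carrier_mat d d" "invertible_mat S" "\<And>x. S * \<eta> x = \<zeta> x * S"
   using r' d by (auto simp: rep_equiv_def)
  have "(S * T) * \<xi> x = \<zeta> x * (S * T)" for x
  proof -
   have "(S * T) * \<xi> x = S * (\<eta> x * T)" unfolding T(3)[symmetric] by (rule assoc_mult_mat[OF S(1) T(1) cx])
   also have "... = (\<zeta> x * S) * T" unfolding S(3)[symmetric] by (rule assoc_mult_mat[symmetric, OF S(1) cy T(1)])
   finally show ?thesis using assoc_mult_mat[OF cz S(1) T(1)] by simp
  qed
  moreover have "invertible_mat (S * T)"
  proof -
   obtain S' where S': "S' \<in> carrier_mat d d" "S * S' = 1\<^sub>m d" "S' * S = 1\<^sub>m d"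
    using invertible_matE[OF S(1,2)] .
   obtain T' where T': "T' \<in> carrier_mat d d" "T * T' = 1\<^sub>m d" "T' * T = 1\<^sub>m d"
    using invertible_matE[OF T(1,2)] .
   show ?thesis
   proof (rule invertible_matI[of _ d "T' * S'"])
    have "(S * T) * (T' * S') = S * ((T * T') * S')"
     using S(1) T(1) S'(1) T'(1) by (simp add: assoc_mult_mat[of _ d d _ d _ d])
    thus "(S * T) * (T' * S') = 1\<^sub>m d" using S' T' by simp
    have "(T' * S') * (S * T) = T' * ((S' * S) * T)"
     using S(1) T(1) S'(1) T'(1) by (simp add: assoc_mult_mat[of _ d d _ d _ d])
    thus "(T' * S') * (S * T) = 1\<^sub>m d" using S' T' T(1) by simp
   qed (use S(1) T(1) S'(1) T'(1) in auto)
  qed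
  ultimately show "(\<xi>, \<zeta>) \<in> rep_equiv G"
   using r r' S(1) T(1) d by (auto simp: rep_equiv_def d_def intro!: bexI[of _ "S * T"])
 qed
qed

text \<open>Invariance of the mean under x -> g x carries the factor g from the first representation
  over to the second, so the matrix of inner products with j and l fixed is an intertwiner.\<close>

lemma Schur_orthogonality_aux:
 assumes \<xi>: "irrep G d \<xi>" and \<eta>: "irrep G d' \<eta>" and jl: "j < d" "l < d'"
 defines "A \<equiv> Matrix.mat d d' (%(i, k). cip (coef \<xi> i j) (coef \<eta> k l))"
 shows "A * \<eta> g = \<xi> g * A"
proof (rule eq_matI)
 note u = irreducible_unitary[OF \<xi>] and u' = irreducible_unitary[OF \<eta>]
 note cx = rep_carrier[OF u] and cy = rep_carrier[OF u']
 have A: "A \<in> carrier_mat d d'" by (simp add: A_def)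
 fix a k assume "a < dim_row (\<xi> g * A)" "k < dim_col (\<xi> g * A)"
 hence ak: "a < d" "k < d'" using cx[of g] A by auto
 have c1: "cont (coef \<xi> i j)" if "i < d" for i using rep_cont[OF u that jl(1)] .
 have c2: "cont (coef \<eta> i l)" if "i < d'" for i using rep_cont[OF u' that jl(2)] .
 have "(\<xi> g * A) $$ (a, k) = (\<Sum>i<d. \<xi> g $$ (a, i) * cip (coef \<xi> i j) (coef \<eta> k l))"
  unfolding mat_mult_index[OF cx A ak] using ak by (simp add: A_def)
 also have "... = cip (%x. \<Sum>i<d. \<xi> g $$ (a, i) * \<xi> x $$ (i, j)) (coef \<eta> k l)"
  using c1 c2[OF ak(2)] by (subst cip_sum_left) auto
 also have "... = cip (%x. \<xi> (g \<otimes> x) $$ (a, j)) (coef \<eta> k l)"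
  by (simp add: rep_mult_index[OF u ak(1) jl(1)])
 also have "... = cip (coef \<xi> a j) (%x. \<eta> (inv g \<otimes> x) $$ (k, l))"
 proof -
  have "cont (%x. \<xi> x $$ (a, j) * cnj (\<eta> (inv g \<otimes> x) $$ (k, l)))"
   using c1[OF ak(1)] continuous_translate(1)[OF c2[OF ak(2)], of "inv g"] by (rule cont_mult_cnj)
  from cmean_left_invariant[OF this, of g] show ?thesis by (simp add: cip_def)
 qed
 also have "... = cip (coef \<xi> a j) (%x. \<Sum>m<d'. \<eta> (inv g) $$ (k, m) * \<eta> x $$ (m, l))"
  by (simp add: rep_mult_index[OF u' ak(2) jl(2)])
 also have "... = (\<Sum>m<d'. cnj (\<eta> (inv g) $$ (k, m)) * cip (coef \<xi> a j) (coef \<eta> m l))"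
  using c1[OF ak(1)] c2 by (subst cip_sum_right) auto
 also have "... = (\<Sum>m<d'. A $$ (a, m) * \<eta> g $$ (m, k))"
  using ak by (intro sum.cong refl) (simp add: A_def rep_inv_index[OF u'])
 also have "... = (A * \<eta> g) $$ (a, k)" unfolding mat_mult_index[OF A cy ak] ..
 finally show "(A * \<eta> g) $$ (a, k) = (\<xi> g * A) $$ (a, k)" by simp
qed (use rep_carrier[OF irreducible_unitary[OF \<xi>], of g] rep_carrier[OF irreducible_unitary[OF \<eta>], of g] in \<open>auto simp: A_def\<close>)

lemma Schur_orthogonality_inequivalent:
 assumes \<xi>: "\<xi> \<in> irreps G" and \<eta>: "\<eta> \<in> irreps G" and ne: "(\<xi>, \<eta>) \<notin> rep_equiv G"
  and ij: "i < rep_dim G \<xi>" "j < rep_dim G \<xi>" and kl: "k < rep_dim G \<eta>" "l < rep_dim G \<eta>"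
 shows "cip (coef \<xi> i j) (coef \<eta> k l) = 0"
proof -
 let ?d = "rep_dim G \<xi>" and ?d' = "rep_dim G \<eta>"
 have I: "irrep G ?d \<xi>" "irrep G ?d' \<eta>" using \<xi> \<eta> by (simp_all add: irreps_dim)
 define A where "A = Matrix.mat ?d ?d' (%(i, k). cip (coef \<xi> i j) (coef \<eta> k l))"
 have A: "A \<in> carrier_mat ?d ?d'" by (simp add: A_def)
 have comm: "A * \<eta> g = \<xi> g * A" for g
  unfolding A_def by (rule Schur_orthogonality_aux[OF I ij(2) kl(2)])
 have "A = 0\<^sub>m ?d ?d'"
 proof (rule ccontr)
  assume "A \<noteq> 0\<^sub>m ?d ?d'"
  from Schur_intertwiner[OF I(2,1) A comm this]
  have "?d' = ?d" "invertible_mat A" by auto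
  hence "(\<eta>, \<xi>) \<in> rep_equiv G"
   using A comm \<xi> \<eta> by (auto simp: rep_equiv_def intro!: bexI[of _ A])
  hence "(\<xi>, \<eta>) \<in> rep_equiv G" using equiv_rep_equiv by (metis equivE symE)
  thus False using ne by blast
 qed
 hence "A $$ (i, k) = 0" using ij kl by simp
 thus ?thesis using ij kl by (simp add: A_def)
qed

lemma Schur_orthogonality:
 assumes \<xi>: "irrep G d \<xi>"
  and ij: "i < d" "j < d" and kl: "k < d" "l < d"
 shows "cip (coef \<xi> i j) (coef \<xi> k l) = (if i = k \<and> j = l then 1 / of_nat d else 0)"
proof -
 note u = irreducible_unitary[OF \<xi>]
 define A where "A = Matrix.mat d d (%(i, k). cip (coef \<xi> i j) (coef \<xi> k l))"
 have "A * \<xi> g = \<xi> g * A" for g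
  unfolding A_def by (rule Schur_orthogonality_aux[OF \<xi> \<xi> ij(2) kl(2)])
 from Schur_scalar[OF \<xi> _ this] obtain c where c: "A = c \<cdot>\<^sub>m 1\<^sub>m d" by (auto simp: A_def)
 have v: "cip (coef \<xi> a j) (coef \<xi> b l) = (if a = b then c else 0)" if "a < d" "b < d" for a b
 proof -
  have "A $$ (a, b) = (c \<cdot>\<^sub>m 1\<^sub>m d) $$ (a, b)" using c by simp
  thus ?thesis using that by (simp add: A_def)
 qed
 have cc: "cont (%x. \<xi> x $$ (a, j) * cnj (\<xi> x $$ (a, l)))" if "a < d" for a
  using rep_cont[OF u that ij(2)] rep_cont[OF u that kl(2)] by (rule cont_mult_cnj)
 \<comment> \<open>The scalar is read off from the trace, where orthonormality of the columns makes
   the averaged function constant.\<close>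
 have "of_nat d * c = (\<Sum>a<d. cip (coef \<xi> a j) (coef \<xi> a l))" using v by simp
 also have "... = cmean (%x. \<Sum>a<d. \<xi> x $$ (a, j) * cnj (\<xi> x $$ (a, l)))"
  unfolding cip_def by (rule cmean_sum[symmetric]) (use cc in auto)
 also have "... = (if l = j then 1 else 0)"
  using rep_cols_orthonormal[OF u kl(2) ij(2)] by (simp add: mult.commute)
 finally have "of_nat d * c = (if l = j then 1 else 0)" .
 hence "c = (if j = l then 1 / of_nat d else 0)" using ij by (auto simp: field_simps split: if_splits)
 thus ?thesis using v[OF ij(1) kl(1)] by auto
qed

subsection \<open>Completeness of the matrix coefficients\<close>

lemma invariant_spaceD:
 assumes "invariant_space V"
 shows invariant_space_cont: "v \<in> V ==> cont v"
  and invariant_space_add: "v \<in> V ==> w \<in> V ==> (%x. v x + w x) \<in> V"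
  and invariant_space_scale: "v \<in> V ==> (%x. c * v x) \<in> V"
 using assms by (simp_all add: invariant_space_def)

lemma invariant_space_lincomb:
 fixes n :: nat
 assumes V: "invariant_space V" and w: "\<And>i. i < n ==> w i \<in> V"
 shows "(%x. \<Sum>i<n. c i * w i x) \<in> V"
 using w
proof (induction n)
 case 0
 thus ?case using V by (simp add: invariant_space_def)
next
 case (Suc n)
 have "(%x. \<Sum>i<n. c i * w i x) \<in> V" using Suc by simp
 from invariant_space_add[OF V this invariant_space_scale[OF V Suc.prems[of n], of "c n"]]
 show ?case by simp
qed

text \<open>A nonzero remainder of v could be normalized and would prolong w to an orthonormal
  family of length n + 1 in V.\<close>

lemma orthonormal_complete:
 assumes V: "invariant_space V" and N: "dim_bounded V n" and w: "orthonormal n w" "\<forall>i<n. w i \<in> V"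
  and v: "v \<in> V"
 shows "v x = (\<Sum>i<n. cip v (w i) * w i x)"
proof (rule ccontr)
 assume ne: "v x \<noteq> (\<Sum>i<n. cip v (w i) * w i x)"
 define r where "r x = v x - (\<Sum>i<n. cip v (w i) * w i x)" for x
 have cv: "cont v" using V v by (simp add: invariant_space_def)
 have cw: "cont (w i)" if "i < n" for i using w(1) that by (simp add: orthonormal_def)
 have "(%x. \<Sum>i<n. cip v (w i) * w i x) \<in> V"
  by (rule invariant_space_lincomb[OF V]) (use w(2) in blast)
 from invariant_space_add[OF V v invariant_space_scale[OF V this, of "- 1"]]
 have rV: "r \<in> V" by (simp add: r_def[abs_def])
 hence cr: "cont r" using V by (simp add: invariant_space_def)
 have r0: "cip r (w i) = 0" if "i < n" for i
  unfolding r_def using orthonormal_residual(1)[OF w(1) cv that] .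
 have p: "nrm2 r > 0" using nrm2_pos[OF cr, of x] ne by (simp add: r_def)
 define c where "c = complex_of_real (1 / sqrt (nrm2 r))"
 define w' where "w' i = (if i < n then w i else (%x. c * r x))" for i
 have r1: "cip (%x. c * r x) (%x. c * r x) = 1"
  unfolding cip_self nrm2_scale[OF cr] using p by (simp add: c_def norm_divide power_divide)
 have r2: "cip (%x. c * r x) (w i) = 0" "cip (w i) (%x. c * r x) = 0" if "i < n" for i
  using cip_scale_left[OF cr cw[OF that], of c] cip_scale_right[OF cr cw[OF that], of c]
   cip_cnj[OF cr cw[OF that]] r0[OF that] by auto
 have "orthonormal (Suc n) w'"
  unfolding orthonormal_def w'_def using w(1) r1 r2 cw cr
  by (auto simp: less_Suc_eq orthonormal_def intro!: continuous_intros)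
 moreover have "\<forall>i<Suc n. w' i \<in> V"
  using w(2) rV V by (auto simp: w'_def invariant_space_def)
 ultimately have "Suc n \<le> n" using N unfolding dim_bounded_def by blast
 thus False by simp
qed

lemma dim_bounded_subset: "dim_bounded V n ==> W \<subseteq> V ==> dim_bounded W n"
 unfolding dim_bounded_def by blast

lemma maximal_orthonormal:
 assumes V: "invariant_space V" and N: "dim_bounded V N"
 obtains n w where "orthonormal n w" "\<And>i. i < n ==> w i \<in> V" "dim_bounded V n"
proof -
 let ?P = "%n. \<exists>w. orthonormal n w \<and> (\<forall>i<n. w i \<in> V)"
 have P0: "?P 0" by (simp add: orthonormal_def)
 have b: "\<forall>n. ?P n \<longrightarrow> n \<le> N" using N unfolding dim_bounded_def by blast
 define n where "n = Greatest ?P"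
 have Pn: "?P n" unfolding n_def using GreatestI_nat[of ?P 0 N] P0 b by blast
 have "m \<le> n" if "?P m" for m unfolding n_def using Greatest_le_nat[of ?P m N] that b by blast
 hence "dim_bounded V n" unfolding dim_bounded_def by blast
 thus ?thesis using that Pn by blast
qed

text \<open>An orthonormal family of length n inside W would by completeness span all of V. The
  conclusion n > 0 guards the truncated subtraction, so that the bound really drops.\<close>

lemma dim_bounded_proper:
 assumes V: "invariant_space V" and n: "dim_bounded V n" and W: "invariant_space W" "W \<subseteq> V" "W \<noteq> V"
 shows "dim_bounded W (n - 1) \<and> n > 0"
proof -
 have "m < n" if m: "orthonormal m w" "\<forall>i<m. w i \<in> W" for m w
 proof (rule ccontr)
  assume "\<not> m < n"
  moreover have "m \<le> n" using n m W(2) unfolding dim_bounded_def by blast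
  ultimately have mn: "m = n" by simp
  have "v \<in> W" if v: "v \<in> V" for v
  proof -
   have "v = (%x. \<Sum>i<n. cip v (w i) * w i x)"
    using orthonormal_complete[OF V n _ _ v, of w] m W(2) mn by blast
   thus ?thesis using invariant_space_lincomb[OF W(1), of n w] m mn by metis
  qed
  thus False using W by blast
 qed
 hence "dim_bounded W (n - 1)" unfolding dim_bounded_def by fastforce
 moreover have "n > 0"
  using \<open>\<And>m w. orthonormal m w ==> \<forall>i<m. w i \<in> W ==> m < n\<close>[of 0] by (simp add: orthonormal_def)
 ultimately show ?thesis by blast
qed

text \<open>Among the finite-dimensional invariant spaces that are not orthogonal to f, take one
  with the least dimension bound. Right translation on it is a unitary representation; it is
  irreducible, because a proper invariant subspace and its complement would both be orthogonal to f
  by minimality. Every function in the space is a combination of its matrix coefficients, so one of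
  these is not orthogonal to f.\<close>

lemma not_orthogonal_irreducible:
 assumes f: "cont f" and fx0: "f x0 \<noteq> 0"
 shows "\<exists>d \<xi> i j. irrep G d \<xi> \<and> i < d \<and> j < d \<and> cip (coef \<xi> i j) f \<noteq> 0"
proof -
 let ?P = "%n. \<exists>V. invariant_space V \<and> dim_bounded V n \<and> (\<exists>v\<in>V. cip v f \<noteq> 0)"
 have "\<exists>n. ?P n" using eigenspace[OF f fx0] by metis
 define n where "n = (LEAST n. ?P n)"
 have "?P n" unfolding n_def using \<open>\<exists>n. ?P n\<close> by (rule LeastI_ex)
 then obtain V where V: "invariant_space V" "dim_bounded V n" "\<exists>v\<in>V. cip v f \<noteq> 0" by blast
 have min: "n \<le> m" if "?P m" for m unfolding n_def using that by (rule Least_le)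
 have small: "cip u f = 0" if W: "invariant_space W" "W \<subseteq> V" "W \<noteq> V" "u \<in> W" for W u
 proof (rule ccontr)
  assume "cip u f \<noteq> 0"
  moreover have "dim_bounded W (n - 1)" "n > 0" using dim_bounded_proper[OF V(1,2) W(1-3)] by auto
  ultimately have "n \<le> n - 1" using W by (intro min) blast
  thus False using \<open>n > 0\<close> by simp
 qed
 obtain m w where w: "orthonormal m w" "\<And>i. i < m ==> w i \<in> V" "dim_bounded V m"
  using maximal_orthonormal[OF V(1,2)] by blast
 have cw: "cont (w i)" if "i < m" for i using w(1) that by (simp add: orthonormal_def)
 have cwt: "cont (%y. w i (y \<otimes> x))" if "i < m" for i x using continuous_translate(2)[OF cw[OF that]] .
 have exp: "v x = (\<Sum>i<m. cip v (w i) * w i x)" if "v \<in> V" for v x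
  by (rule orthonormal_complete[OF V(1) w(3) w(1) _ that]) (use w(2) in blast)
 have trV: "(%y. w j (y \<otimes> x)) \<in> V" if "j < m" for j x using V(1) w(2)[OF that] by (simp add: invariant_space_def)
 \<comment> \<open>Right translation in the basis w: column j holds the coordinates of the translate
   of w j.\<close>
 define \<xi> where "\<xi> x = Matrix.mat m m (%(i, j). cip (%y. w j (y \<otimes> x)) (w i))" for x
 have c\<xi>: "\<xi> x \<in> carrier_mat m m" for x by (simp add: \<xi>_def)
 have tr: "w j (y \<otimes> x) = (\<Sum>i<m. \<xi> x $$ (i, j) * w i y)" if "j < m" for j x y
  using exp[OF trV[OF that], of y x] that by (simp add: \<xi>_def)
 have onb: "cip (w i) (w j) = (if i = j then 1 else 0)" if "i < m" "j < m" for i j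
  using w(1) that by (simp add: orthonormal_def)
 have coeff: "cip (%x. \<Sum>i<m. c i * w i x) (w k) = c k" if "k < m" for c k
 proof -
  have "cip (%x. \<Sum>i<m. c i * w i x) (w k) = (\<Sum>i<m. c i * cip (w i) (w k))"
   using cw that by (subst cip_sum_left) auto
  also have "... = (\<Sum>i<m. if i = k then c i else 0)" using that onb by (intro sum.cong refl) auto
  finally show ?thesis using that by simp
 qed
 have unit: "unitary_rep G m \<xi>"
  unfolding unitary_rep_def
 proof (intro conjI ballI allI impI)
  fix x
  show "\<xi> x \<in> carrier_mat m m" by (rule c\<xi>)
  show "mat_adjoint (\<xi> x) * \<xi> x = 1\<^sub>m m"
  proof (rule eq_matI)
   fix j k assume "j < dim_row (1\<^sub>m m :: complex mat)" "k < dim_col (1\<^sub>m m :: complex mat)"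
   hence jk: "j < m" "k < m" by auto
   have "(mat_adjoint (\<xi> x) * \<xi> x) $$ (j, k) = (\<Sum>i<m. cnj (\<xi> x $$ (i, j)) * \<xi> x $$ (i, k))"
    unfolding mat_mult_index[OF mat_adjoint_carrier[OF c\<xi>] c\<xi> jk]
    using jk c\<xi>[of x] by (intro sum.cong refl) (simp add: mat_adjoint_index)
   also have "... = (\<Sum>i<m. cnj (\<xi> x $$ (i, j)) * cip (%y. w k (y \<otimes> x)) (w i))"
    using jk by (intro sum.cong refl) (simp add: \<xi>_def)
   also have "... = cip (%y. w k (y \<otimes> x)) (%y. \<Sum>i<m. \<xi> x $$ (i, j) * w i y)"
    using cw cwt[OF jk(2)] by (subst cip_sum_right) auto
   also have "... = cip (%y. w k (y \<otimes> x)) (%y. w j (y \<otimes> x))" by (simp add: tr[OF jk(1)])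
   also have "... = (if j = k then 1 else 0)" using cip_translate[OF cw cw, of k j x] jk onb by auto
   finally show "(mat_adjoint (\<xi> x) * \<xi> x) $$ (j, k) = 1\<^sub>m m $$ (j, k)" using jk by simp
  qed (use mat_adjoint_carrier[OF c\<xi>[of x]] c\<xi>[of x] in auto)
  show "\<xi> (x \<otimes> y) = \<xi> x * \<xi> y" for y
  proof (rule eq_matI)
   fix i j assume "i < dim_row (\<xi> x * \<xi> y)" "j < dim_col (\<xi> x * \<xi> y)"
   hence ij: "i < m" "j < m" using c\<xi>[of x] c\<xi>[of y] by auto
   have "\<xi> (x \<otimes> y) $$ (i, j) = cip (%z. w j ((z \<otimes> x) \<otimes> y)) (w i)"
    using ij by (simp add: \<xi>_def m_assoc)
   also have "... = cip (%z. \<Sum>k<m. \<xi> y $$ (k, j) * w k (z \<otimes> x)) (w i)" by (simp add: tr[OF ij(2), of _ y])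
   also have "... = (\<Sum>k<m. \<xi> y $$ (k, j) * cip (%z. w k (z \<otimes> x)) (w i))"
    using cwt cw[OF ij(1)] by (subst cip_sum_left) auto
   also have "... = (\<Sum>k<m. \<xi> x $$ (i, k) * \<xi> y $$ (k, j))"
    using ij by (intro sum.cong refl) (simp add: \<xi>_def[of x])
   finally show "\<xi> (x \<otimes> y) $$ (i, j) = (\<xi> x * \<xi> y) $$ (i, j)" unfolding mat_mult_index[OF c\<xi> c\<xi> ij] .
  qed (use c\<xi>[of x] c\<xi>[of y] c\<xi>[of "x \<otimes> y"] in auto)
  show "continuous_on (carrier G) (coef \<xi> i j)" if ij: "i < m" "j < m" for i j
  proof -
   have "cont (%p. w j (snd p \<otimes> fst p) * cnj (w i (snd p)))"
    by (intro continuous_intros continuous_on_compose2[OF cw[OF ij(1)]] continuous_on_compose2[OF cw[OF ij(2)]]) auto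
   from continuous_on_cmean_param[OF this] show ?thesis using ij by (simp add: \<xi>_def cip_def)
  qed
 qed
 obtain v where v: "v \<in> V" "cip v f \<noteq> 0" using V(3) by blast
 obtain j where j: "j < m" "cip (w j) f \<noteq> 0"
 proof (rule ccontr)
  assume "\<not> thesis"
  hence 0: "cip (w j) f = 0" if "j < m" for j using that \<open>\<And>j. \<lbrakk>j < m; cip (w j) f \<noteq> 0\<rbrakk> \<Longrightarrow> thesis\<close> by blast
  have "v = (%x. \<Sum>i<m. cip v (w i) * w i x)" by (rule ext) (rule exp[OF v(1)])
  hence "cip v f = (\<Sum>i<m. cip v (w i) * cip (w i) f)"
   using cip_sum_left[of "{..<m}" w f "%i. cip v (w i)"] cw f by auto
  thus False using 0 v(2) by simp
 qed
 have irr: "irrep G m \<xi>"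
  unfolding irreducible_unitary_rep_def
 proof (intro conjI allI impI unit)
  show "1 \<le> m" using j by simp
  fix W assume W: "invariant_subspace G m \<xi> W"
  show "W = {0\<^sub>v m} \<or> W = carrier_vec m"
  proof (rule ccontr)
   assume neg: "\<not> (W = {0\<^sub>v m} \<or> W = carrier_vec m)"
   define lc where "lc c = (%x. \<Sum>i<m. vec_index c i * w i x)" for c
   have lcV: "lc c \<in> V" for c unfolding lc_def by (rule invariant_space_lincomb[OF V(1) w(2)])
   have lc_coeff: "cip (lc c) (w k) = vec_index c k" if "k < m" for c k
    unfolding lc_def using coeff[OF that] .
   have lc_inj: "c = c'" if "lc c = lc c'" "c \<in> carrier_vec m" "c' \<in> carrier_vec m" for c c'
    using that lc_coeff[of _ c] lc_coeff[of _ c'] by (intro eq_vecI) auto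
   have Wc: "c \<in> carrier_vec m" if "c \<in> W" for c using W that by (auto simp: invariant_subspace_def)
   define V1 where "V1 = lc ` W"
   \<comment> \<open>V1 is the function space that belongs to W, and V2 its orthogonal complement in
     V. Both are proper and invariant, hence orthogonal to f, yet v is a sum of members of the
     two.\<close>
   define V2 where "V2 = {v \<in> V. \<forall>u\<in>V1. cip v u = 0}"
   have V1V: "V1 \<subseteq> V" using lcV by (auto simp: V1_def)
   have c1: "cont u" if "u \<in> V1" for u using V1V that V(1) by (auto simp: invariant_space_def)
   have c2: "cont u" if "u \<in> V" for u using that V(1) by (auto simp: invariant_space_def)
   have lct: "(%y. lc c (y \<otimes> a)) = lc (\<xi> a *\<^sub>v c)" if c: "c \<in> carrier_vec m" for c a
   proof
    fix y
    have "lc c (y \<otimes> a) = (\<Sum>j<m. \<Sum>i<m. vec_index c j * (\<xi> a $$ (i, j) * w i y))"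
     by (simp add: lc_def tr sum_distrib_left)
    also have "... = (\<Sum>i<m. \<Sum>j<m. vec_index c j * (\<xi> a $$ (i, j) * w i y))" by (rule sum.swap)
    also have "... = lc (\<xi> a *\<^sub>v c) y"
     unfolding lc_def using c c\<xi>[of a]
     by (intro sum.cong refl)
      (simp add: mult_mat_vec_def scalar_prod_def lessThan_atLeast0 sum_distrib_right sum_distrib_left ac_simps)
    finally show "lc c (y \<otimes> a) = lc (\<xi> a *\<^sub>v c) y" .
   qed
   have inv1: "invariant_space V1"
    unfolding invariant_space_def
   proof (intro conjI ballI allI)
    show "cont v" if "v \<in> V1" for v by (rule c1[OF that])
    have "lc (0\<^sub>v m) = (%x. 0)" by (simp add: lc_def)
    thus "(%x. 0) \<in> V1" using W unfolding invariant_subspace_def V1_def by (metis imageI)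
    show "(%x. v x + u x) \<in> V1" if "v \<in> V1" "u \<in> V1" for v u
    proof -
     obtain a b where ab: "a \<in> W" "b \<in> W" "v = lc a" "u = lc b" using \<open>v \<in> V1\<close> \<open>u \<in> V1\<close> by (auto simp: V1_def)
     have "(%x. v x + u x) = lc (a + b)"
      using Wc[OF ab(1)] Wc[OF ab(2)] by (auto simp: ab lc_def algebra_simps sum.distrib)
     moreover have "a + b \<in> W" using W ab by (simp add: invariant_subspace_def)
     ultimately show ?thesis by (simp add: V1_def)
    qed
    show "(%x. b * v x) \<in> V1" if "v \<in> V1" for b v
    proof -
     obtain a where ab: "a \<in> W" "v = lc a" using \<open>v \<in> V1\<close> by (auto simp: V1_def)
     have "(%x. b * v x) = lc (b \<cdot>\<^sub>v a)"
      using Wc[OF ab(1)] by (auto simp: ab lc_def sum_distrib_left mult.assoc)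
     moreover have "b \<cdot>\<^sub>v a \<in> W" using W ab by (simp add: invariant_subspace_def)
     ultimately show ?thesis by (simp add: V1_def)
    qed
    show "(%x. v (x \<otimes> a)) \<in> V1" if "v \<in> V1" for a v
    proof -
     obtain c where ab: "c \<in> W" "v = lc c" using \<open>v \<in> V1\<close> by (auto simp: V1_def)
     have "\<xi> a *\<^sub>v c \<in> W" using W ab by (simp add: invariant_subspace_def)
     thus ?thesis using lct[OF Wc[OF ab(1)]] by (simp add: V1_def ab)
    qed
   qed
   have inv2: "invariant_space V2"
    unfolding invariant_space_def
   proof (intro conjI ballI allI)
    show "cont v" if "v \<in> V2" for v using that c2 by (simp add: V2_def)
    show "(%x. 0) \<in> V2" using V(1) by (simp add: V2_def invariant_space_def cip_def)
    show "(%x. v x + u x) \<in> V2" if "v \<in> V2" "u \<in> V2" for v u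
     using that V(1) c1 c2 cip_add_left by (simp add: V2_def invariant_space_def)
    show "(%x. b * v x) \<in> V2" if "v \<in> V2" for b v
     using that V(1) c1 c2 cip_scale_left by (simp add: V2_def invariant_space_def)
    show "(%x. v (x \<otimes> a)) \<in> V2" if v: "v \<in> V2" for a v
    proof -
     have "cip (%x. v (x \<otimes> a)) u = 0" if u: "u \<in> V1" for u
     proof -
      have u': "(%x. u (x \<otimes> inv a)) \<in> V1" using inv1 u by (simp add: invariant_space_def)
      hence "cip v (%x. u (x \<otimes> inv a)) = 0" using v by (simp add: V2_def)
      thus ?thesis
       using cip_translate[OF c2 c1[OF u'], of v a] v by (simp add: V2_def m_assoc)
     qed
     thus ?thesis using v V(1) by (simp add: V2_def invariant_space_def)
    qed
   qed
   have "V1 \<noteq> V"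
   proof
    assume "V1 = V"
    have "c \<in> W" if c: "c \<in> carrier_vec m" for c
    proof -
     have "lc c \<in> V1" using lcV \<open>V1 = V\<close> by blast
     then obtain c' where "c' \<in> W" "lc c = lc c'" by (auto simp: V1_def)
     thus ?thesis using lc_inj[of c c'] c Wc by auto
    qed
    thus False using neg Wc by blast
   qed
   have "V2 \<noteq> V"
   proof
    assume "V2 = V"
    have "c = 0\<^sub>v m" if c: "c \<in> W" for c
    proof (rule lc_inj)
     have "lc c \<in> V1" using c by (simp add: V1_def)
     moreover have "lc c \<in> V2" using lcV \<open>V2 = V\<close> by blast
     ultimately have "cip (lc c) (lc c) = 0" by (simp add: V2_def)
     hence "nrm2 (lc c) = 0" by (simp add: cip_self)
     hence "lc c x = 0" for x using nrm2_eq_0[OF c2[OF lcV]] by blast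
     thus "lc c = lc (0\<^sub>v m)" by (auto simp: lc_def)
    qed (use Wc c in auto)
    moreover have "0\<^sub>v m \<in> W" using W by (simp add: invariant_subspace_def)
    ultimately show False using neg by blast
   qed
   obtain n1 e where e: "orthonormal n1 e" "\<And>i. i < n1 ==> e i \<in> V1" "dim_bounded V1 n1"
    using maximal_orthonormal[OF inv1 dim_bounded_subset[OF V(2) V1V]] by blast
   have ce: "cont (e i)" if "i < n1" for i using e(1) that by (simp add: orthonormal_def)
   define p where "p x = (\<Sum>i<n1. cip v (e i) * e i x)" for x
   have pV1: "p \<in> V1" unfolding p_def[abs_def] by (rule invariant_space_lincomb[OF inv1 e(2)])
   note cv = c2[OF v(1)] and cp = c1[OF pV1]
   from invariant_space_add[OF V(1) v(1) invariant_space_scale[OF V(1) subsetD[OF V1V pV1], of "- 1"]]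
   have rV: "(%x. v x - p x) \<in> V" by simp
   have rV2: "(%x. v x - p x) \<in> V2"
   proof -
    have "cip (%x. v x - p x) u = 0" if u: "u \<in> V1" for u
    proof -
     have "u = (%x. \<Sum>i<n1. cip u (e i) * e i x)"
      using orthonormal_complete[OF inv1 e(3) e(1) _ u] e(2) by blast
     hence "cip (%x. v x - p x) u = (\<Sum>i<n1. cnj (cip u (e i)) * cip (%x. v x - p x) (e i))"
      using cip_sum_right[of "{..<n1}" e "%x. v x - p x" "%i. cip u (e i)"] ce c2[OF rV] by auto
     moreover have "cip (%x. v x - p x) (e i) = 0" if "i < n1" for i
      unfolding p_def using orthonormal_residual(1)[OF e(1) cv that] .
     ultimately show ?thesis by simp
    qed
    thus ?thesis using rV by (simp add: V2_def)
   qed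
   have "cip p f = 0" using small[OF inv1 V1V \<open>V1 \<noteq> V\<close> pV1] .
   moreover have "cip (%x. v x - p x) f = 0"
    using small[OF inv2 _ \<open>V2 \<noteq> V\<close> rV2] by (auto simp: V2_def)
   ultimately show False using v(2) cip_diff_left[OF cv cp f] by simp
  qed
 qed
 \<comment> \<open>The relation \<open>tr\<close> at y = 1 recovers w j from column j of the
   representation.\<close>
 have "w j = (%x. \<Sum>i<m. w i \<one> * \<xi> x $$ (i, j))"
  using tr[OF j(1), of "\<one>"] by (simp add: mult.commute fun_eq_iff)
 hence "cip (w j) f = (\<Sum>i<m. w i \<one> * cip (coef \<xi> i j) f)"
  using cip_sum_left[of "{..<m}" "%i x. \<xi> x $$ (i, j)" f "%i. w i \<one>"] rep_cont[OF unit _ j(1)] f by auto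
 with j(2) obtain i where "i < m" "cip (coef \<xi> i j) f \<noteq> 0"
  by (metis (no_types, lifting) lessThan_iff mult_zero_right sum.neutral)
 thus ?thesis using irr j(1) by blast
qed

lemma unitary_dual_choice:
 assumes "c \<in> unitary_dual G" "\<rho> c \<in> c"
 shows "\<rho> c \<in> irreps G"
 using assms equiv_rep_equiv unfolding unitary_dual_def by (metis equiv_Eps_preserves in_quotient_imp_subset subsetD)

lemma unitary_dual_choice_inj:
 assumes "c \<in> unitary_dual G" "\<rho> c \<in> c" "c' \<in> unitary_dual G" "\<rho> c' \<in> c'" "(\<rho> c, \<rho> c') \<in> rep_equiv G"
 shows "c = c'"
 using assms quotient_eqI[OF equiv_rep_equiv] unfolding unitary_dual_def by blast

text \<open>The irreducible representation found above need not be a chosen one, but it is conjugate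
  to the representative of its class by an invertible T, so its entries are linear combinations of
  those of the representative.\<close>

theorem matrix_coefficients_complete:
 assumes \<rho>: "\<And>c. c \<in> unitary_dual G ==> \<rho> c \<in> c" and f: "cont f"
  and orth: "\<And>c i j. c \<in> unitary_dual G ==> i < rep_dim G (\<rho> c) ==> j < rep_dim G (\<rho> c)
   ==> cip (coef (\<rho> c) i j) f = 0"
 shows "f x = 0"
proof (rule ccontr)
 assume "f x \<noteq> 0"
 from not_orthogonal_irreducible[OF f this] obtain d \<xi> i j where
  \<xi>: "irrep G d \<xi>" and ij: "i < d" "j < d" and nz: "cip (coef \<xi> i j) f \<noteq> 0"
  by (elim exE conjE) (rule that)
 define c where "c = rep_equiv G `` {\<xi>}"
 have i\<xi>: "\<xi> \<in> irreps G" using \<xi> by (auto simp: irreps_def)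
 have c: "c \<in> unitary_dual G" unfolding c_def unitary_dual_def by (rule quotientI[OF i\<xi>])
 have "(\<xi>, \<rho> c) \<in> rep_equiv G" using \<rho>[OF c] by (auto simp: c_def)
 hence "(\<rho> c, \<xi>) \<in> rep_equiv G" using equiv_rep_equiv by (metis equivE symE)
 then obtain T where T: "T \<in> carrier_mat d d" "invertible_mat T" "\<And>x. T * \<rho> c x = \<xi> x * T"
  and d: "rep_dim G (\<rho> c) = d" "\<rho> c \<in> irreps G"
  using rep_dim_eq[OF irreducible_unitary[OF \<xi>]] by (auto simp: rep_equiv_def)
 have u: "unitary_rep G d (\<rho> c)" using d by (simp add: irreps_dim irreducible_unitary)
 note cx = rep_carrier[OF irreducible_unitary[OF \<xi>]] and cr = rep_carrier[OF u]
 obtain S where cS: "S \<in> carrier_mat d d" and TS: "T * S = 1\<^sub>m d"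
  using invertible_matE[OF T(1,2)] by blast
 have "\<xi> x = (T * \<rho> c x) * S" for x
  unfolding T(3) using assoc_mult_mat[OF cx T(1) cS, of x] cx[of x] by (simp add: TS)
 hence ent: "\<xi> x $$ (i, j) = (\<Sum>l<d. \<Sum>k<d. T $$ (i, k) * S $$ (l, j) * \<rho> c x $$ (k, l))" for x
  using mat_mult_index[OF mult_carrier_mat[OF T(1) cr] cS ij, of x]
  by (simp add: mat_mult_index[OF T(1) cr ij(1)] sum_distrib_right sum_distrib_left ac_simps del: index_mult_mat(1))
 have cc: "cont (coef (\<rho> c) k l)" if "k < d" "l < d" for k l using rep_cont[OF u that] .
 have 0: "cip (%x. \<Sum>k<d. T $$ (i, k) * S $$ (l, j) * \<rho> c x $$ (k, l)) f = 0" if "l < d" for l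
  using cc that f orth[OF c] d by (subst cip_sum_left) auto
 have "cip (coef \<xi> i j) f = cip (%x. \<Sum>l<d. 1 * (\<Sum>k<d. T $$ (i, k) * S $$ (l, j) * \<rho> c x $$ (k, l))) f"
  unfolding ent by simp
 also have "... = (\<Sum>l<d. 1 * cip (%x. \<Sum>k<d. T $$ (i, k) * S $$ (l, j) * \<rho> c x $$ (k, l)) f)"
  using cc f by (intro cip_sum_left) (auto intro!: continuous_intros)
 also have "... = 0" using 0 by simp
 finally show False using nz by simp
qed

end

subsection \<open>Partial derivatives and remainder estimates\<close>

lemma vector_derivative_bound:
 fixes h :: "real => 'b::real_normed_vector"
 assumes h: "\<And>t. t \<in> closed_segment a b ==> (h has_vector_derivative h' t) (at t)"
  and B: "\<And>t. t \<in> closed_segment a b ==> norm (h' t) \<le> B"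
 shows "norm (h b - h a) \<le> B * \<bar>b - a\<bar>"
proof -
 have "norm (h b - h a) \<le> B * norm (b - a)"
 proof (rule differentiable_bound[of "closed_segment a b"])
  show "(h has_derivative (%v. v *\<^sub>R h' t)) (at t within closed_segment a b)" if "t \<in> closed_segment a b" for t
   using h[OF that] by (auto simp: has_vector_derivative_def intro: has_derivative_at_withinI)
  show "onorm (%v. v *\<^sub>R h' t) \<le> B" if "t \<in> closed_segment a b" for t
  proof (rule onorm_bound)
   show "0 \<le> B" using B[OF that] norm_ge_zero order.trans by blast
   show "norm (x *\<^sub>R h' t) \<le> B * norm x" for x
    using mult_right_mono[OF B[OF that], of "\<bar>x\<bar>"] by (simp add: mult.commute)
  qed
 qed auto
 thus ?thesis by simp
qed

definition partial_t :: "('a \<times> real => complex) => 'a \<times> real => complex" where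
 "partial_t H = (%(x, t). vector_derivative (%t. H (x, t)) (at t))"

lemma prod_std_chart:
 fixes A :: "('g::topological_space, 'e::euclidean_space) atlas" and H :: "'g \<times> real => complex"
 assumes A: "smooth_atlas A" and H: "smooth_map (prod_atlas A std_atlas) std_atlas H" and U: "(U, \<phi>) \<in> A"
 shows "smooth_on (\<phi> ` U \<times> UNIV) (%z. H (inv_into U \<phi> (fst z), snd z))"
proof -
 have "(UNIV, id) \<in> real_atlas" by (simp add: std_atlas_def)
 from smooth_map_prod_chart[OF A smooth_atlas_std H U this] show ?thesis by (simp add: inv_id_eq)
qed

lemma has_vector_derivative_partial_t:
 fixes A :: "('g::topological_space, 'e::euclidean_space) atlas" and H :: "'g \<times> real => complex"
 assumes A: "smooth_atlas A" and H: "smooth_map (prod_atlas A std_atlas) std_atlas H"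
 shows "((%t. H (x, t)) has_vector_derivative partial_t H (x, t)) (at t)"
  and "smooth_map (prod_atlas A std_atlas) std_atlas (partial_t H)"
proof -
 have der: "((%t. H (x, t)) has_vector_derivative
   frechet_derivative (%z. H (inv_into U \<phi> (fst z), snd z)) (at (\<phi> x, t)) (0, 1)) (at t)"
  if U: "(U, \<phi>) \<in> A" "x \<in> U" for U \<phi> x t
 proof -
  note a = smooth_atlas_chart[OF A U(1)]
  let ?h = "%z. H (inv_into U \<phi> (fst z), snd z)"
  have 1: "((%t. (\<phi> x, t)) has_derivative (%s. (0, s))) (at t)"
   by (auto intro!: derivative_eq_intros)
  have 2: "(?h has_derivative frechet_derivative ?h (at (\<phi> x, t))) (at (\<phi> x, t))"
   using smooth_on_has_derivative[OF prod_std_chart[OF A H U(1)]] U by auto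
  have "(%s. frechet_derivative ?h (at (\<phi> x, t)) (0, s))
    = (%s. s *\<^sub>R frechet_derivative ?h (at (\<phi> x, t)) (0, 1))"
  proof
   show "frechet_derivative ?h (at (\<phi> x, t)) (0, s) = s *\<^sub>R frechet_derivative ?h (at (\<phi> x, t)) (0, 1)" for s
    using linear_cmul[OF has_derivative_linear[OF 2], of s "(0, 1)"] by simp
  qed
  with has_derivative_compose[OF 1 2]
  have "((%t. ?h (\<phi> x, t)) has_derivative (%s. s *\<^sub>R frechet_derivative ?h (at (\<phi> x, t)) (0, 1))) (at t)"
   by (simp only:)
  thus ?thesis
   using U(2) by (simp add: inv_into_f_f[OF a(3)] has_vector_derivative_def)
 qed
 show d: "((%t. H (x, t)) has_vector_derivative partial_t H (x, t)) (at t)" for x t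
 proof -
  obtain U \<phi> where U: "(U, \<phi>) \<in> A" "x \<in> U" using smooth_atlas_cover[OF A] .
  show ?thesis using der[OF U, of t] vector_derivative_at[OF der[OF U, of t]] by (simp add: partial_t_def)
 qed
 show "smooth_map (prod_atlas A std_atlas) std_atlas (partial_t H)"
  unfolding smooth_map_std_iff[OF smooth_atlas_prod[OF A smooth_atlas_std]]
 proof clarify
  fix W \<theta> assume "(W, \<theta>) \<in> prod_atlas A real_atlas"
  then obtain U \<phi> where U: "(U, \<phi>) \<in> A" and W: "W = U \<times> UNIV" "\<theta> = map_prod \<phi> id"
   by (auto simp: prod_atlas_def std_atlas_def)
  note a = smooth_atlas_chart[OF A U]
  let ?h = "%z. H (inv_into U \<phi> (fst z), snd z)"
  have im: "\<theta> ` W = \<phi> ` U \<times> UNIV"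
   using image_map_prod_Int[of \<phi> id U UNIV U UNIV] by (simp add: W)
  have "smooth_on (\<phi> ` U \<times> UNIV) (%z. frechet_derivative ?h (at z) (0, 1))"
   by (rule smooth_on_frechet_derivative[OF prod_std_chart[OF A H U]])
  thus "smooth_on (\<theta> ` W) (partial_t H \<circ> inv_into W \<theta>)"
   unfolding im
  proof (rule smooth_on_cong[OF open_Times[OF a(2) open_UNIV], THEN iffD1, rotated])
   fix z :: "'e \<times> real" assume "z \<in> \<phi> ` U \<times> UNIV"
   then obtain x t where z: "z = (\<phi> x, t)" "x \<in> U" by blast
   have "inv_into W \<theta> z = (x, t)"
    using inv_into_map_prod[OF a(3) inj_on_id[of UNIV], of "\<phi> x" t] z
    by (simp add: W inv_into_f_f[OF a(3)] inv_id_eq)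
   thus "frechet_derivative ?h (at z) (0, 1) = (partial_t H \<circ> inv_into W \<theta>) z"
    using vector_derivative_unique_at[OF der[OF U z(2)] d] z by simp
  qed
 qed
qed

text \<open>Since H vanishes on both axes, its size is governed by the mixed second derivative,
  which is bounded on the compact set of parameters. The mean value inequality is used once in each
  variable.\<close>

lemma product_estimate:
 fixes B :: "('p::topological_space, 'f::euclidean_space) atlas" and H :: "('p \<times> real) \<times> real => complex"
 assumes B: "smooth_atlas B" and cp: "compact (UNIV :: 'p set)"
  and H: "smooth_map (prod_atlas (prod_atlas B std_atlas) std_atlas) std_atlas H"
  and 0: "\<And>p t. H ((p, 0), t) = 0" "\<And>p s. H ((p, s), 0) = 0"
 obtains C where "C \<ge> 0" "\<And>p s t. \<bar>s\<bar> \<le> 1 ==> \<bar>t\<bar> \<le> 1 ==> norm (H ((p, s), t)) \<le> C * \<bar>s\<bar> * \<bar>t\<bar>"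
proof -
 note Bs = smooth_atlas_prod[OF B smooth_atlas_std]
 note Bss = smooth_atlas_prod[OF Bs smooth_atlas_std]
 note f1 = smooth_map_fst[OF Bs smooth_atlas_std] and s1 = smooth_map_snd[OF Bs smooth_atlas_std]
 have ff: "smooth_map (prod_atlas (prod_atlas B std_atlas) std_atlas) B (%q::('p \<times> real) \<times> real. fst (fst q))"
  by (rule smooth_map_compose[OF Bss Bs B f1 smooth_map_fst[OF B smooth_atlas_std]])
 have sf: "smooth_map (prod_atlas (prod_atlas B std_atlas) std_atlas) std_atlas (%q::('p \<times> real) \<times> real. snd (fst q))"
  by (rule smooth_map_compose[OF Bss Bs smooth_atlas_std f1 smooth_map_snd[OF B smooth_atlas_std]])
 have sw: "smooth_map (prod_atlas (prod_atlas B std_atlas) std_atlas) (prod_atlas (prod_atlas B std_atlas) std_atlas)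
   (%q::('p \<times> real) \<times> real. ((fst (fst q), snd q), snd (fst q)))"
  by (intro smooth_map_Pair Bss Bs B smooth_atlas_std ff sf s1)
 define D where "D = partial_t H"
 note D = has_vector_derivative_partial_t[OF Bs H, folded D_def]
 \<comment> \<open>\<open>partial_t\<close> differentiates in the last variable; exchanging s and t
   makes it act on s.\<close>
 define E where "E = (%q::('p \<times> real) \<times> real. D ((fst (fst q), snd q), snd (fst q)))"
 have "smooth_map (prod_atlas (prod_atlas B std_atlas) std_atlas) std_atlas E"
  unfolding E_def by (rule smooth_map_compose[OF Bss Bss smooth_atlas_std sw D(2)])
 note E = has_vector_derivative_partial_t[OF Bs this]
 have "compact ((UNIV :: 'p set) \<times> {-1..1::real})" by (rule compact_Times[OF cp compact_Icc])
 hence "compact (((UNIV :: 'p set) \<times> {-1..1::real}) \<times> {-1..1::real})" by (rule compact_Times[OF _ compact_Icc])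
 hence "bounded (partial_t E ` (((UNIV :: 'p set) \<times> {-1..1::real}) \<times> {-1..1::real}))"
  by (intro compact_imp_bounded compact_continuous_image smooth_map_continuous[OF E(2)])
 then obtain C where C: "C > 0" "\<And>q. q \<in> (UNIV \<times> {-1..1::real}) \<times> {-1..1::real} ==> norm (partial_t E q) \<le> C"
  unfolding bounded_pos by blast
 have seg: "\<bar>t'\<bar> \<le> 1 \<and> \<bar>t'\<bar> \<le> \<bar>t\<bar>" if "t' \<in> closed_segment 0 t" "\<bar>t\<bar> \<le> 1" for t t' :: real
  using that by (auto simp: closed_segment_eq_real_ivl split: if_splits)
 have D0: "D ((p, 0), t) = 0" for p t
 proof -
  have "((%t. 0) has_vector_derivative D ((p, 0), t)) (at t)" using D(1)[of "(p, 0)" t] by (simp add: 0)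
  thus ?thesis using vector_derivative_unique_at has_vector_derivative_const by blast
 qed
 have DC: "norm (D ((p, s), t)) \<le> C * \<bar>s\<bar>" if "\<bar>s\<bar> \<le> 1" "\<bar>t\<bar> \<le> 1" for p s t
 proof -
  have "norm (E ((p, t), s) - E ((p, t), 0)) \<le> C * \<bar>s - 0\<bar>"
  proof (rule vector_derivative_bound)
   show "((%s. E ((p, t), s)) has_vector_derivative partial_t E ((p, t), r)) (at r)" for r by (rule E(1))
   show "norm (partial_t E ((p, t), r)) \<le> C" if "r \<in> closed_segment 0 s" for r
    using seg[OF that \<open>\<bar>s\<bar> \<le> 1\<close>] \<open>\<bar>t\<bar> \<le> 1\<close> by (intro C(2)) (auto simp: abs_le_iff)
  qed
  thus ?thesis by (simp add: E_def D0)
 qed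
 have "norm (H ((p, s), t)) \<le> C * \<bar>s\<bar> * \<bar>t\<bar>" if "\<bar>s\<bar> \<le> 1" "\<bar>t\<bar> \<le> 1" for p s t
 proof -
  have "norm (H ((p, s), t) - H ((p, s), 0)) \<le> (C * \<bar>s\<bar>) * \<bar>t - 0\<bar>"
  proof (rule vector_derivative_bound)
   show "((%t. H ((p, s), t)) has_vector_derivative D ((p, s), r)) (at r)" for r by (rule D(1))
   show "norm (D ((p, s), r)) \<le> C * \<bar>s\<bar>" if "r \<in> closed_segment 0 t" for r
    using seg[OF that \<open>\<bar>t\<bar> \<le> 1\<close>] \<open>\<bar>s\<bar> \<le> 1\<close> by (intro DC) auto
  qed
  thus ?thesis by (simp add: 0)
 qed
 thus ?thesis using that[of C] C(1) by simp
qed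

subsection \<open>Smooth functions on a compact Lie group\<close>

sublocale compact_lie_group \<subseteq> compact_topological_group G
proof
 show "carrier G = UNIV" by (rule carrier_UNIV)
 show "compact (UNIV :: 'g set)" by (rule compact_UNIV)
 show "cont (%p. fst p \<otimes> snd p)"
  using smooth_map_continuous[OF smooth_mult, of UNIV] by (simp add: case_prod_beta)
 show "cont (%x. inv x)" by (rule smooth_map_continuous[OF smooth_inv])
qed

context compact_lie_group
begin

abbreviation smooth :: "('g => complex) => bool" where
 "smooth f \<equiv> smooth_map A std_atlas f"

lemma smooth_functions_iff: "f \<in> smooth_functions A \<longleftrightarrow> smooth f"
 by (simp add: smooth_functions_def)

lemma smooth_map_group_mult:
 "smooth_atlas M ==> smooth_map M A f ==> smooth_map M A g ==> smooth_map M A (%x. f x \<otimes> g x)"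
 using smooth_map_compose[OF _ smooth_atlas_prod[OF atlas atlas] atlas smooth_map_Pair[OF _ atlas atlas] smooth_mult]
 by simp

lemma smooth_map_group_inv: "smooth_atlas M ==> smooth_map M A f ==> smooth_map M A (%x. inv (f x))"
 by (rule smooth_map_compose[where g = "%x. inv x", OF _ atlas atlas _ smooth_inv])

lemma smooth_compose: "smooth_atlas M ==> smooth_map M A g ==> smooth f ==> smooth_map M std_atlas (%x. f (g x))"
 using smooth_map_compose[OF _ atlas smooth_atlas_std] by blast

lemma smooth_cont: "smooth f ==> cont f"
 by (rule smooth_map_continuous)

lemma smooth_left_translate: "smooth f ==> smooth (%x. f (a \<otimes> x))"
 by (rule smooth_compose[OF atlas smooth_map_group_mult[OF atlas smooth_map_const[OF atlas atlas] smooth_map_id[OF atlas]]])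

lemma smooth_right_translate: "smooth f ==> smooth (%x. f (x \<otimes> a))"
 by (rule smooth_compose[OF atlas smooth_map_group_mult[OF atlas smooth_map_id[OF atlas] smooth_map_const[OF atlas atlas]]])

lemma smooth_bump_at:
 assumes "open W" "x \<in> W"
 obtains f where "smooth f" "f x \<noteq> 0" "\<And>y. f y \<noteq> 0 ==> y \<in> W" "\<And>y. \<exists>r\<ge>0. f y = of_real r"
proof -
 obtain U \<phi> where U: "(U, \<phi>) \<in> A" "x \<in> U" using smooth_atlas_cover[OF atlas] .
 note a = smooth_atlas_chart[OF atlas U(1)]
 obtain r where r: "r > 0" "cball (\<phi> x) r \<subseteq> \<phi> ` (U \<inter> W)"
  by (rule chart_cball[OF atlas U assms])
 define f where "f y = (if y \<in> U then ball_bump (\<phi> x) r (\<phi> y) *\<^sub>R (1::complex) else 0)" for y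
 have "cball (\<phi> x) r \<subseteq> \<phi> ` U" by (rule order.trans[OF r(2) image_mono]) simp
 from chart_cutoff[OF atlas U(1) r(1) this smooth_on_const[OF a(2)]]
 have "smooth f" by (simp add: f_def[abs_def])
 moreover have "f x \<noteq> 0" using ball_bump_pos[OF r(1), of "\<phi> x" "\<phi> x"] r(1) U(2) by (simp add: f_def)
 moreover have "y \<in> W" if "f y \<noteq> 0" for y
 proof -
  have y: "y \<in> U" "ball_bump (\<phi> x) r (\<phi> y) \<noteq> 0" using that by (auto simp: f_def split: if_splits)
  hence "\<phi> y \<in> ball (\<phi> x) r" using ball_bump_nonneg[of "\<phi> x" r "\<phi> y"] ball_bump_pos[OF r(1)] by force
  hence "\<phi> y \<in> \<phi> ` (U \<inter> W)" using r(2) ball_subset_cball by blast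
  thus ?thesis using a(3) y(1) by (auto simp: inj_on_def)
 qed
 moreover have "\<exists>r\<ge>0. f y = of_real r" for y
  using ball_bump_nonneg[of "\<phi> x" r "\<phi> y"] by (cases "y \<in> U") (auto simp: f_def scaleR_conv_of_real)
 ultimately show ?thesis using that by blast
qed

lemma smooth_separates:
 assumes "\<And>f. smooth f ==> f x = f y" shows "x = y"
proof (rule ccontr)
 assume "x \<noteq> y"
 then obtain f where "smooth f" "f x \<noteq> 0" "\<And>z. f z \<noteq> 0 ==> z \<in> - {y}"
  using smooth_bump_at[of "- {y}" x] by (metis ComplI open_Compl closed_singleton singletonD)
 thus False using assms by (metis ComplD singletonI)
qed

lemma tendsto_if_smooth_tendsto:
 assumes "\<And>f. smooth f ==> ((%n. f (X n)) \<longlongrightarrow> f l) F"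
 shows "(X \<longlongrightarrow> l) F"
proof (rule topological_tendstoI)
 fix W assume W: "open W" "l \<in> W"
 obtain f where f: "smooth f" "f l \<noteq> 0" "\<And>y. f y \<noteq> 0 ==> y \<in> W" "\<And>y. \<exists>r\<ge>0. f y = of_real r"
  by (rule smooth_bump_at[OF W]) (rule that)
 have "open (- {0::complex})" by (rule open_Compl) simp
 from topological_tendstoD[OF assms[OF f(1)] this] f(2) have "\<forall>\<^sub>F n in F. f (X n) \<in> - {0}" by simp
 thus "\<forall>\<^sub>F n in F. X n \<in> W" by (rule eventually_mono) (use f(3) in auto)
qed

text \<open>Compactness provides a cluster point l. For each test function f the limit of f along
  the sequence must then be f l, and test functions determine the topology, so the whole sequence
  tends to l.\<close>

lemma convergent_if_smooth_Cauchy: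
 assumes "\<And>f. smooth f ==> Cauchy (%n. f (X n))"
 shows "\<exists>l. X \<longlonglongrightarrow> l"
proof -
 have "filtermap X sequentially \<noteq> bot" by (simp add: filtermap_bot_iff)
 hence "\<exists>l\<in>UNIV. inf (nhds l) (filtermap X sequentially) \<noteq> bot"
  using compact_UNIV unfolding compact_filter by simp
 then obtain l where l: "inf (nhds l) (filtermap X sequentially) \<noteq> bot" by blast
 have "X \<longlonglongrightarrow> l"
 proof (rule tendsto_if_smooth_tendsto)
  fix f assume f: "smooth f"
  obtain c where c: "(%n. f (X n)) \<longlonglongrightarrow> c"
   using assms[OF f] unfolding Cauchy_convergent_iff convergent_def by blast
  have "(f \<longlongrightarrow> f l) (nhds l)"
   using smooth_cont[OF f] by (simp add: continuous_on_def tendsto_at_iff_tendsto_nhds)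
  hence 1: "(f \<longlongrightarrow> f l) (inf (nhds l) (filtermap X sequentially))"
   by (rule tendsto_mono[rotated]) simp
  have "(f \<longlongrightarrow> c) (filtermap X sequentially)" using c by (simp add: filterlim_filtermap)
  hence "(f \<longlongrightarrow> c) (inf (nhds l) (filtermap X sequentially))"
   by (rule tendsto_mono[rotated]) simp
  hence "c = f l" using tendsto_unique[OF l _ 1] by blast
  thus "(%n. f (X n)) \<longlonglongrightarrow> f l" using c by simp
 qed
 thus ?thesis by blast
qed

subsection \<open>One-parameter subgroups\<close>

definition base_chart :: "'g set \<times> ('g => 'e)" where
 "base_chart = (SOME c. c \<in> A \<and> \<one> \<in> fst c)"

definition "U0 = fst base_chart"
definition "\<phi>0 = snd base_chart"
definition "\<psi>0 = inv_into U0 \<phi>0"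
definition "y0 = \<phi>0 \<one>"

lemma base_chart: "(U0, \<phi>0) \<in> A" "\<one> \<in> U0"
proof -
 obtain U \<phi> where "(U, \<phi>) \<in> A" "\<one> \<in> U" using smooth_atlas_cover[OF atlas] .
 hence "\<exists>c. c \<in> A \<and> \<one> \<in> fst c" by (intro exI[of _ "(U, \<phi>)"]) simp
 from someI_ex[OF this] show "(U0, \<phi>0) \<in> A" "\<one> \<in> U0"
  by (simp_all add: base_chart_def[symmetric] U0_def \<phi>0_def)
qed

lemmas base = smooth_atlas_chart[OF atlas base_chart(1)]

lemma psi0: "\<psi>0 y0 = \<one>" "x \<in> U0 ==> \<psi>0 (\<phi>0 x) = x" "y \<in> \<phi>0 ` U0 ==> \<phi>0 (\<psi>0 y) = y" "y \<in> \<phi>0 ` U0 ==> \<psi>0 y \<in> U0"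
 using base_chart(2) by (simp_all add: \<psi>0_def y0_def inv_into_f_f[OF base(3)] f_inv_into_f inv_into_into)

definition "R0 = (SOME r. r > 0 \<and> cball y0 r \<subseteq> \<phi>0 ` U0)"

lemma R0: "R0 > 0" "cball y0 R0 \<subseteq> \<phi>0 ` U0"
proof -
 obtain r where "r > 0" "cball y0 r \<subseteq> \<phi>0 ` (U0 \<inter> UNIV)"
  unfolding y0_def by (rule chart_cball[OF atlas base_chart open_UNIV UNIV_I])
 hence "\<exists>r. r > 0 \<and> cball y0 r \<subseteq> \<phi>0 ` U0" by auto
 from someI_ex[OF this] show "R0 > 0" "cball y0 R0 \<subseteq> \<phi>0 ` U0" by (simp_all add: R0_def)
qed

text \<open>The sine keeps the curve inside the chart for all times.\<close>

definition wiggle :: "'e => real => 'e" where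
 "wiggle v s = y0 + (sin ((norm v + 1) / R0 * s) * (R0 / (norm v + 1))) *\<^sub>R v"

definition curve :: "'e => real => 'g" where
 "curve v s = \<psi>0 (wiggle v s)"

lemma wiggle_in: "wiggle v s \<in> \<phi>0 ` U0"
proof -
 have "R0 / (norm v + 1) * norm v = R0 * (norm v / (norm v + 1))" by simp
 also have "... \<le> R0 * 1"
  using R0(1) by (intro mult_left_mono) (auto simp: divide_le_eq_1 add_nonneg_pos)
 finally have "\<bar>sin ((norm v + 1) / R0 * s)\<bar> * (R0 / (norm v + 1) * norm v) \<le> 1 * R0"
  using R0(1) by (intro mult_mono) auto
 hence "wiggle v s \<in> cball y0 R0" using R0(1) by (simp add: wiggle_def dist_norm abs_mult)
 thus ?thesis using R0(2) by blast
qed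

lemma wiggle_0: "wiggle v 0 = y0"
 by (simp add: wiggle_def)

lemma curve_0: "curve v 0 = \<one>"
 by (simp add: curve_def wiggle_0 psi0)

lemma smooth_wiggle: "smooth_on UNIV (wiggle v)"
 unfolding wiggle_def
 by (intro smooth_on_add smooth_on_const open_UNIV smooth_on_scaleR smooth_on_mult smooth_on_sin)

lemma wiggle_derivative: "(wiggle v has_derivative (%s. s *\<^sub>R v)) (at 0)"
proof -
 have "((%s. sin ((norm v + 1) / R0 * s) * (R0 / (norm v + 1))) has_real_derivative 1) (at 0)"
 proof -
  have "norm v + 1 \<noteq> 0" using norm_ge_zero[of v] by linarith
  thus ?thesis using R0(1) by (auto intro!: derivative_eq_intros)
 qed
 hence "((%s. sin ((norm v + 1) / R0 * s) * (R0 / (norm v + 1))) has_derivative (%s. s)) (at 0)"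
  unfolding has_field_derivative_def by (rule has_derivative_eq_rhs) auto
 hence "((%s. y0 + (sin ((norm v + 1) / R0 * s) * (R0 / (norm v + 1))) *\<^sub>R v) has_derivative (%s. 0 + s *\<^sub>R v)) (at 0)"
  by (intro has_derivative_add has_derivative_const has_derivative_scaleR_left)
 thus ?thesis by (simp add: wiggle_def[abs_def])
qed

lemma smooth_map_psi0:
 fixes M :: "('h::topological_space, 'f::euclidean_space) atlas"
 assumes M: "smooth_atlas M" and g: "smooth_map M std_atlas g" and im: "\<And>x. g x \<in> \<phi>0 ` U0"
 shows "smooth_map M A (%x. \<psi>0 (g x))"
proof (rule smooth_mapI[OF M atlas])
 show c: "cont (%x. \<psi>0 (g x))"
  using continuous_on_compose2[OF base(5) smooth_map_continuous[OF g]] im by (auto simp: \<psi>0_def)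
 fix V \<theta> U \<phi> x assume V: "(V, \<theta>) \<in> M" and U: "(U, \<phi>) \<in> A"
 note a = smooth_atlas_chart[OF atlas U]
 let ?T = "\<theta> ` (V \<inter> (%x. \<psi>0 (g x)) -` U)"
 have "smooth_on (\<theta> ` V) (g \<circ> inv_into V \<theta>)" using g V unfolding smooth_map_std_iff[OF M] by fast
 hence 1: "smooth_on ?T (g \<circ> inv_into V \<theta>)" by (rule smooth_on_subset) blast
 have "open ((%x. \<psi>0 (g x)) -` U)" using c a(1) by (auto intro: open_vimage)
 hence oT: "open ?T" by (rule open_chart_image[OF M V])
 have "(g \<circ> inv_into V \<theta>) (\<theta> x) \<in> \<phi>0 ` (U0 \<inter> U)" if "x \<in> V" "\<psi>0 (g x) \<in> U" for x
  by (rule image_eqI[of _ _ "\<psi>0 (g x)"])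
   (simp_all add: that im psi0(3,4) inv_into_f_f[OF smooth_atlas_chart(3)[OF M V]])
 hence "(g \<circ> inv_into V \<theta>) ` ?T \<subseteq> \<phi>0 ` (U0 \<inter> U)" by blast
 from smooth_on_compose[OF oT open_chart_image[OF atlas base_chart(1) a(1)] 1
   smooth_atlas_transition[OF atlas base_chart(1) U] this]
 show "\<exists>W. open W \<and> x \<in> W \<and> smooth_on (\<theta> ` (V \<inter> ((%x. \<psi>0 (g x)) -` U \<inter> W))) (\<phi> \<circ> (%x. \<psi>0 (g x)) \<circ> inv_into V \<theta>)"
  by (intro exI[of _ UNIV]) (simp add: comp_def \<psi>0_def)
qed

lemma smooth_curve: "smooth_map std_atlas A (curve v)"
 unfolding curve_def[abs_def]
 by (rule smooth_map_psi0[OF smooth_atlas_std])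
  (simp_all add: smooth_map_std_std smooth_wiggle wiggle_in)

section \<open>Left-invariant derivatives in the base chart\<close>

lemma smooth_chart0:
 assumes f: "smooth f" shows "smooth_on (\<phi>0 ` U0) (%y. f (x \<otimes> \<psi>0 y))"
proof -
 have "smooth (%z. f (x \<otimes> z))" using smooth_left_translate[OF f] .
 hence "smooth_on (\<phi>0 ` U0) ((%z. f (x \<otimes> z)) \<circ> inv_into U0 \<phi>0)"
  using base_chart(1) unfolding smooth_map_std_iff[OF atlas] by fast
 thus ?thesis by (simp add: comp_def \<psi>0_def)
qed

text \<open>The left-invariant field with value v at the identity, v being read in the base chart.
  In this form it is linear in v and available before the exponential map has been
  constructed.\<close>

definition dirD :: "'e => ('g => complex) => 'g => complex" where
 "dirD v f x = frechet_derivative (%y. f (x \<otimes> \<psi>0 y)) (at y0) v"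

lemma y0_in: "y0 \<in> \<phi>0 ` U0" using base_chart(2) by (simp add: y0_def)

lemma has_derivative_dirD: "smooth f ==> ((%y. f (x \<otimes> \<psi>0 y)) has_derivative (%v. dirD v f x)) (at y0)"
 unfolding dirD_def using smooth_on_has_derivative[OF smooth_chart0 y0_in] .

lemma linear_dirD: "smooth f ==> linear (%v. dirD v f x)"
 using has_derivative_linear[OF has_derivative_dirD] .

lemma dirD_along_curve:
 assumes f: "smooth f" and c: "c 0 = \<one>" "open T" "0 \<in> T" "\<And>t. t \<in> T ==> c t \<in> U0"
  and d: "((%t. \<phi>0 (c t)) has_derivative (%s. s *\<^sub>R v)) (at 0)"
 shows "((%t. f (x \<otimes> c t)) has_vector_derivative dirD v f x) (at 0)"
proof -
 have "((%y. f (x \<otimes> \<psi>0 y)) has_derivative (%v. dirD v f x)) (at (\<phi>0 (c 0)))"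
  using has_derivative_dirD[OF f] c(1) by (simp add: y0_def)
 from has_derivative_compose[OF d this]
 have "((%t. f (x \<otimes> \<psi>0 (\<phi>0 (c t)))) has_vector_derivative dirD v f x) (at 0)"
  by (simp add: has_vector_derivative_def linear_cmul[OF linear_dirD[OF f]])
 thus ?thesis
  by (rule has_vector_derivative_transform_within_open[where S = T]) (use c psi0(2) in auto)
qed

lemma dirD_curve: "smooth f ==> ((%t. f (x \<otimes> curve v t)) has_vector_derivative dirD v f x) (at 0)"
proof (rule dirD_along_curve[where T = UNIV])
 have "\<phi>0 (curve v t) = wiggle v t" for t by (simp add: curve_def psi0(3)[OF wiggle_in])
 thus "((%t. \<phi>0 (curve v t)) has_derivative (%s. s *\<^sub>R v)) (at 0)" using wiggle_derivative by simp
 show "curve v t \<in> U0" for t by (simp add: curve_def psi0(4)[OF wiggle_in])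
qed (auto simp: curve_0)

lemma smooth_mult_curve:
 assumes f: "smooth f"
 shows "smooth_map (prod_atlas A std_atlas) std_atlas (%p. f (fst p \<otimes> curve v (snd p)))"
proof -
 note M = smooth_atlas_prod[OF atlas smooth_atlas_std]
 have "smooth_map (prod_atlas A std_atlas) A (%p::'g \<times> real. curve v (snd p))"
  by (rule smooth_map_compose[OF M smooth_atlas_std atlas smooth_map_snd[OF atlas smooth_atlas_std] smooth_curve])
 from smooth_compose[OF M smooth_map_group_mult[OF M smooth_map_fst[OF atlas smooth_atlas_std] this] f]
 show ?thesis .
qed

lemma smooth_at_time:
 assumes "smooth_map (prod_atlas A std_atlas) std_atlas H" shows "smooth (%x. H (x, t :: real))"
 by (rule smooth_map_compose[OF atlas smooth_atlas_prod[OF atlas smooth_atlas_std] smooth_atlas_std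
    smooth_map_Pair[OF atlas atlas smooth_atlas_std smooth_map_id[OF atlas] smooth_map_const[OF atlas smooth_atlas_std]] assms])

lemma smooth_dirD: assumes f: "smooth f" shows "smooth (dirD v f)"
proof -
 let ?H = "%p::'g \<times> real. f (fst p \<otimes> curve v (snd p))"
 note h = has_vector_derivative_partial_t[OF atlas smooth_mult_curve[OF f, of v]]
 have "partial_t ?H (x, 0) = dirD v f x" for x
  using vector_derivative_unique_at[OF h(1)[of x 0]] dirD_curve[OF f, of x v] by simp
 thus ?thesis using smooth_at_time[OF h(2), of 0] by simp
qed

text \<open>The products \<open>curve v s \<otimes> curve v t\<close> and
  \<open>curve v (s + t)\<close> coincide for s = 0 and for t = 0, so their difference under f is
  O(|s| |t|). The constant is uniform in x and z since these range over a compact group.\<close>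

lemma curve_product_estimate:
 assumes f: "smooth f"
 obtains C where "C \<ge> 0" "\<And>x z s t. \<bar>s\<bar> \<le> 1 ==> \<bar>t\<bar> \<le> 1 ==>
  norm (f (x \<otimes> (curve v s \<otimes> curve v t) \<otimes> z) - f (x \<otimes> curve v (s + t) \<otimes> z)) \<le> C * \<bar>s\<bar> * \<bar>t\<bar>"
proof -
 let ?M = "prod_atlas (prod_atlas (prod_atlas A A) std_atlas) std_atlas :: ((('g \<times> 'g) \<times> real) \<times> real, (('e \<times> 'e) \<times> real) \<times> real) atlas"
 note AA = smooth_atlas_prod[OF atlas atlas]
 note AAs = smooth_atlas_prod[OF AA smooth_atlas_std]
 note M = smooth_atlas_prod[OF AAs smooth_atlas_std]
 have p1: "smooth_map ?M (prod_atlas (prod_atlas A A) std_atlas) fst" by (rule smooth_map_fst[OF AAs smooth_atlas_std])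
 have p2: "smooth_map ?M (prod_atlas A A) (%q. fst (fst q))"
  by (rule smooth_map_compose[OF M AAs AA p1 smooth_map_fst[OF AA smooth_atlas_std]])
 have px: "smooth_map ?M A (%q. fst (fst (fst q)))"
  by (rule smooth_map_compose[OF M AA atlas p2 smooth_map_fst[OF atlas atlas]])
 have pz: "smooth_map ?M A (%q. snd (fst (fst q)))"
  by (rule smooth_map_compose[OF M AA atlas p2 smooth_map_snd[OF atlas atlas]])
 have ps: "smooth_map ?M std_atlas (%q. snd (fst q))"
  by (rule smooth_map_compose[OF M AAs smooth_atlas_std p1 smooth_map_snd[OF AA smooth_atlas_std]])
 have pt: "smooth_map ?M std_atlas (%q. snd q)" by (rule smooth_map_snd[OF AAs smooth_atlas_std])
 have cv: "smooth_map ?M A (%q. curve v (g q))" if "smooth_map ?M std_atlas g" for g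
  by (rule smooth_map_compose[OF M smooth_atlas_std atlas that smooth_curve])
 have 1: "smooth_map ?M std_atlas (%q. f (fst (fst (fst q)) \<otimes> (curve v (snd (fst q)) \<otimes> curve v (snd q)) \<otimes> snd (fst (fst q))))"
  by (rule smooth_compose[OF M smooth_map_group_mult[OF M smooth_map_group_mult[OF M px
     smooth_map_group_mult[OF M cv[OF ps] cv[OF pt]]] pz] f])
 have 2: "smooth_map ?M std_atlas (%q. f (fst (fst (fst q)) \<otimes> curve v (snd (fst q) + snd q) \<otimes> snd (fst (fst q))))"
  by (rule smooth_compose[OF M smooth_map_group_mult[OF M smooth_map_group_mult[OF M px
     cv[OF smooth_map_add[OF M ps pt]]] pz] f])
 let ?H = "%q. f (fst (fst (fst q)) \<otimes> (curve v (snd (fst q)) \<otimes> curve v (snd q)) \<otimes> snd (fst (fst q)))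
   + (- 1) * f (fst (fst (fst q)) \<otimes> curve v (snd (fst q) + snd q) \<otimes> snd (fst (fst q)))"
 have H: "smooth_map ?M std_atlas ?H"
  by (intro smooth_map_add[OF M 1] smooth_map_mult[OF M smooth_map_const[OF M smooth_atlas_std] 2])
 have "compact (UNIV :: ('g \<times> 'g) set)" using compact_Times[OF compact_UNIV compact_UNIV] by simp
 from product_estimate[OF AA this H] obtain C where C: "C \<ge> 0"
  "\<And>p s t. \<bar>s\<bar> \<le> 1 ==> \<bar>t\<bar> \<le> 1 ==> norm (?H ((p, s), t)) \<le> C * \<bar>s\<bar> * \<bar>t\<bar>"
  by (auto simp: curve_0)
 show ?thesis
  by (rule that[OF C(1)]) (use C(2)[of _ _ "(_, _)"] in \<open>simp add: algebra_simps\<close>)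
qed

text \<open>A telescoping sum: the factors are exchanged one at a time, which is why the hypothesis
  is uniform in what stands on either side.\<close>

lemma pow_replace:
 assumes "\<And>x z. norm (f (x \<otimes> g \<otimes> z) - f (x \<otimes> h \<otimes> z) :: complex) \<le> e"
 shows "norm (f (x \<otimes> g [^] n \<otimes> z) - f (x \<otimes> h [^] n \<otimes> z)) \<le> real n * e"
proof (induction n arbitrary: x z)
 case (Suc n)
 have "norm (f (x \<otimes> g [^] n \<otimes> (g \<otimes> z)) - f (x \<otimes> h [^] n \<otimes> (g \<otimes> z))) \<le> real n * e" by (rule Suc.IH)
 moreover have "norm (f ((x \<otimes> h [^] n) \<otimes> g \<otimes> z) - f ((x \<otimes> h [^] n) \<otimes> h \<otimes> z)) \<le> e" by (rule assms)
 ultimately have "norm (f (x \<otimes> g [^] n \<otimes> (g \<otimes> z)) - f (x \<otimes> h [^] n \<otimes> (g \<otimes> z))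
   + (f ((x \<otimes> h [^] n) \<otimes> g \<otimes> z) - f ((x \<otimes> h [^] n) \<otimes> h \<otimes> z))) \<le> real n * e + e"
  by (rule norm_triangle_mono)
 thus ?case by (simp add: m_assoc algebra_simps)
qed simp

text \<open>In the first estimate, going from n to n + 1 factors costs C |n a| |a|, and n^2 + n <=
  (n + 1)^2. The second applies the first to n blocks of m factors, each with error C (t/n)^2; it
  makes the powers a Cauchy sequence. The third cancels the factors for -a and a pairwise from the
  middle outwards; it gives the inverse of the limit.\<close>

lemma curve_pow_estimates:
 assumes f: "smooth f"
 obtains C where "C \<ge> 0"
  "\<And>x z a n. real n * \<bar>a\<bar> \<le> 1 ==> norm (f (x \<otimes> curve v a [^] n \<otimes> z) - f (x \<otimes> curve v (real n * a) \<otimes> z)) \<le> C * (real n * a)\<^sup>2"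
  "\<And>x z t n m. \<bar>t\<bar> \<le> real n ==> n > 0 ==> m > 0 ==>
   norm (f (x \<otimes> curve v (t / real (n * m)) [^] (n * m) \<otimes> z) - f (x \<otimes> curve v (t / real n) [^] n \<otimes> z)) \<le> C * t\<^sup>2 / real n"
  "\<And>x z t n. \<bar>t\<bar> \<le> real n ==> n > 0 ==>
   norm (f (x \<otimes> (curve v (- t / real n) [^] n \<otimes> curve v (t / real n) [^] n) \<otimes> z) - f (x \<otimes> z)) \<le> C * t\<^sup>2 / real n"
proof -
 let ?c = "curve v"
 obtain C where C: "C \<ge> 0" and est: "\<And>x z s t. \<bar>s\<bar> \<le> 1 ==> \<bar>t\<bar> \<le> 1 ==>
  norm (f (x \<otimes> (?c s \<otimes> ?c t) \<otimes> z) - f (x \<otimes> ?c (s + t) \<otimes> z)) \<le> C * \<bar>s\<bar> * \<bar>t\<bar>"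
  using curve_product_estimate[OF f, of v] by blast
 have A: "norm (f (x \<otimes> ?c a [^] n \<otimes> z) - f (x \<otimes> ?c (real n * a) \<otimes> z)) \<le> C * (real n * a)\<^sup>2"
  if "real n * \<bar>a\<bar> \<le> 1" for x z a n
  using that
 proof (induction n arbitrary: z)
  case 0
  thus ?case by (simp add: curve_0)
 next
  case (Suc n)
  show ?case
  proof (cases "n = 0")
   case True
   thus ?thesis using C by simp
  next
   case False
   have n1: "real n * \<bar>a\<bar> \<le> 1" "\<bar>a\<bar> \<le> 1"
    using Suc.prems False mult_right_mono[of 1 "real n" "\<bar>a\<bar>"] by (auto simp: algebra_simps)
   have "norm (f (x \<otimes> ?c a [^] n \<otimes> (?c a \<otimes> z)) - f (x \<otimes> ?c (real n * a) \<otimes> (?c a \<otimes> z))) \<le> C * (real n * a)\<^sup>2"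
    by (rule Suc.IH[OF n1(1)])
   moreover have "norm (f (x \<otimes> (?c (real n * a) \<otimes> ?c a) \<otimes> z) - f (x \<otimes> ?c (real n * a + a) \<otimes> z)) \<le> C * \<bar>real n * a\<bar> * \<bar>a\<bar>"
    using n1 by (intro est) (auto simp: abs_mult)
   ultimately have "norm (f (x \<otimes> ?c a [^] n \<otimes> (?c a \<otimes> z)) - f (x \<otimes> ?c (real n * a) \<otimes> (?c a \<otimes> z))
     + (f (x \<otimes> (?c (real n * a) \<otimes> ?c a) \<otimes> z) - f (x \<otimes> ?c (real n * a + a) \<otimes> z)))
     \<le> C * (real n * a)\<^sup>2 + C * \<bar>real n * a\<bar> * \<bar>a\<bar>"
    by (rule norm_triangle_mono)
   also have "... = C * ((real n * (real n + 1)) * a\<^sup>2)" by (simp add: abs_mult power2_eq_square algebra_simps)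
   also have "... \<le> C * ((real (Suc n))\<^sup>2 * a\<^sup>2)"
    using C by (intro mult_left_mono mult_right_mono) (auto simp: power2_eq_square algebra_simps)
   also have "... = C * (real (Suc n) * a)\<^sup>2" by (simp only: power_mult_distrib)
   finally show ?thesis by (simp add: m_assoc algebra_simps)
  qed
 qed
 have B: "norm (f (x \<otimes> ?c (t / real (n * m)) [^] (n * m) \<otimes> z) - f (x \<otimes> ?c (t / real n) [^] n \<otimes> z)) \<le> C * t\<^sup>2 / real n"
  if t: "\<bar>t\<bar> \<le> real n" "n > 0" "m > 0" for x z t n m
 proof -
  have eq: "real m * (t / real (n * m)) = t / real n" using t(3) by simp
  have "real m * \<bar>t / real (n * m)\<bar> = \<bar>real m * (t / real (n * m))\<bar>" unfolding abs_mult by simp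
  also have "... \<le> 1" unfolding eq using t(1,2) by simp
  finally have "norm (f (x \<otimes> ?c (t / real (n * m)) [^] m \<otimes> z) - f (x \<otimes> ?c (t / real n) \<otimes> z)) \<le> C * (t / real n)\<^sup>2" for x z
   using A[of m "t / real (n * m)" x z] unfolding eq by blast
  from pow_replace[OF this, of x n z]
  have "norm (f (x \<otimes> (?c (t / real (n * m)) [^] m) [^] n \<otimes> z) - f (x \<otimes> ?c (t / real n) [^] n \<otimes> z)) \<le> real n * (C * (t / real n)\<^sup>2)" .
  thus ?thesis using t by (simp add: nat_pow_pow mult.commute power2_eq_square)
 qed
 have "norm (f (x \<otimes> (?c (- a) [^] n \<otimes> ?c a [^] n) \<otimes> z) - f (x \<otimes> z)) \<le> real n * (C * a\<^sup>2)" if "\<bar>a\<bar> \<le> 1" for x z a n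
 proof (induction n arbitrary: x z)
  case (Suc n)
  have "norm (f ((x \<otimes> ?c (- a) [^] n) \<otimes> (?c (- a) \<otimes> ?c a) \<otimes> (?c a [^] n \<otimes> z))
    - f ((x \<otimes> ?c (- a) [^] n) \<otimes> ?c (- a + a) \<otimes> (?c a [^] n \<otimes> z))) \<le> C * \<bar>- a\<bar> * \<bar>a\<bar>"
   using that by (intro est) auto
  hence "norm (f ((x \<otimes> ?c (- a) [^] n) \<otimes> (?c (- a) \<otimes> ?c a) \<otimes> (?c a [^] n \<otimes> z))
    - f (x \<otimes> (?c (- a) [^] n \<otimes> ?c a [^] n) \<otimes> z)) \<le> C * a\<^sup>2"
   by (simp add: curve_0 m_assoc power2_eq_square)
  from norm_triangle_mono[OF this Suc.IH[of x z]]
  show ?case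
   using nat_pow_Suc2[of "?c a" n] by (simp add: m_assoc algebra_simps)
 qed simp
 note D = this
 have D': "norm (f (x \<otimes> (?c (- t / real n) [^] n \<otimes> ?c (t / real n) [^] n) \<otimes> z) - f (x \<otimes> z)) \<le> C * t\<^sup>2 / real n"
  if "\<bar>t\<bar> \<le> real n" "n > 0" for x z t n
  using D[of "t / real n" x n z] that by (simp add: power2_eq_square)
 show ?thesis using that[OF C A B D'] by blast
qed

section \<open>The exponential map and its group law\<close>

definition expo :: "'e => real => 'g" where
 "expo v t = lim (%n. curve v (t / real n) [^] n)"

lemma expo_LIMSEQ: "(%n. curve v (t / real n) [^] n) \<longlonglongrightarrow> expo v t"
proof -
 let ?X = "%n. curve v (t / real n) [^] n"
 have "\<exists>l. ?X \<longlonglongrightarrow> l"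
 proof (rule convergent_if_smooth_Cauchy)
  fix f assume f: "smooth f"
  obtain C where C: "C \<ge> 0"
   "\<And>x z t n m. \<bar>t\<bar> \<le> real n ==> n > 0 ==> m > 0 ==>
    norm (f (x \<otimes> curve v (t / real (n * m)) [^] (n * m) \<otimes> z) - f (x \<otimes> curve v (t / real n) [^] n \<otimes> z)) \<le> C * t\<^sup>2 / real n"
   by (rule curve_pow_estimates[OF f, of v]) (rule that)
  show "Cauchy (%n. f (?X n))"
  proof (rule metric_CauchyI)
   fix e :: real assume e: "e > 0"
   obtain N :: nat where N: "real N \<ge> max (\<bar>t\<bar> + 1) (4 * (C * t\<^sup>2) / e)" using real_arch_simple by blast
   have small: "C * t\<^sup>2 / real n \<le> e / 4" if "n \<ge> N" for n
   proof -
    have "4 * (C * t\<^sup>2) / e \<le> real n" "real n > 0" using N that by linarith+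
    thus ?thesis using e by (simp add: field_simps)
   qed
   \<comment> \<open>Both terms are compared with the common refinement into n m factors.\<close>
   have "dist (f (?X m)) (f (?X n)) < e" if mn: "m \<ge> N" "n \<ge> N" for m n
   proof -
    have p: "\<bar>t\<bar> \<le> real m" "\<bar>t\<bar> \<le> real n" "m > 0" "n > 0"
     using N mn by (auto simp: max_def split: if_splits intro!: Nat.gr0I)
    have "norm (f (?X (n * m)) - f (?X n)) \<le> C * t\<^sup>2 / real n"
     using C(2)[OF p(2,4,3), of "\<one>" "\<one>"] by simp
    moreover have "norm (f (?X (n * m)) - f (?X m)) \<le> C * t\<^sup>2 / real m"
     using C(2)[OF p(1,3,4), of "\<one>" "\<one>"] by (simp add: mult.commute)
    ultimately have "dist (f (?X m)) (f (?X n)) \<le> e / 4 + e / 4"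
     using small[OF mn(1)] small[OF mn(2)] dist_triangle3[of "f (?X m)" "f (?X n)" "f (?X (n * m))"]
     unfolding dist_norm by linarith
    thus ?thesis using e by simp
   qed
   thus "\<exists>M. \<forall>m\<ge>M. \<forall>n\<ge>M. dist (f (?X m)) (f (?X n)) < e" by blast
  qed
 qed
 thus ?thesis unfolding expo_def by (simp add: convergent_def flip: convergent_LIMSEQ_iff)
qed

lemma continuous_mult_left: "cont (%y. x \<otimes> y \<otimes> z)"
 by (intro continuous_intros)

lemma expo_LIMSEQ_smooth:
 assumes "smooth f"
 shows "(%n. f (x \<otimes> curve v (t / real n) [^] n \<otimes> z)) \<longlonglongrightarrow> f (x \<otimes> expo v t \<otimes> z)"
proof -
 have "cont (%y. f (x \<otimes> y \<otimes> z))"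
  using continuous_on_compose2[OF smooth_cont[OF assms] continuous_mult_left[of x z]] by simp
 from continuous_on_tendsto_compose[OF this expo_LIMSEQ] show ?thesis by simp
qed

lemma tendsto_group_mult:
 assumes "(X \<longlongrightarrow> a) F" "(Y \<longlongrightarrow> b) F" shows "((%n. X n \<otimes> Y n) \<longlongrightarrow> a \<otimes> b) F"
 using continuous_on_tendsto_compose[OF continuous_mult tendsto_Pair[OF assms]] by simp

lemma tendsto_group_pow: "(X \<longlongrightarrow> a) F ==> ((%n. X n [^] (k::nat)) \<longlongrightarrow> a [^] k) F"
 by (induction k) (auto intro: tendsto_group_mult)

text \<open>Along multiples of m, the sequence that defines \<open>expo v (m t)\<close> consists of
  the m-th powers of the terms that define \<open>expo v t\<close>.\<close>

lemma expo_nat_mult: "expo v (real m * t) = expo v t [^] m"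
proof (cases "m = 0")
 case True
 have "(%n. curve v (0 / real n) [^] n) \<longlonglongrightarrow> \<one>" by (simp add: curve_0)
 thus ?thesis using True LIMSEQ_unique[OF expo_LIMSEQ[of v 0]] by simp
next
 case False
 hence "strict_mono (%n. n * m)" by (auto simp: strict_mono_def)
 from LIMSEQ_subseq_LIMSEQ[OF expo_LIMSEQ[of v "real m * t"] this]
 have "(%n. (curve v (t / real n) [^] n) [^] m) \<longlonglongrightarrow> expo v (real m * t)"
  using False by (simp add: comp_def nat_pow_pow)
 thus ?thesis using LIMSEQ_unique[OF _ tendsto_group_pow[OF expo_LIMSEQ]] by blast
qed

lemma expo_0: "expo v 0 = \<one>"
 using expo_nat_mult[of v 0 0] by simp

lemma expo_minus: "expo v (- t) = inv (expo v t)"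
proof -
 have "expo v (- t) \<otimes> expo v t = \<one>"
 proof (rule smooth_separates)
  fix f assume f: "smooth f"
  obtain C where C: "C \<ge> 0"
   "\<And>x z t n. \<bar>t\<bar> \<le> real n ==> n > 0 ==>
   norm (f (x \<otimes> (curve v (- t / real n) [^] n \<otimes> curve v (t / real n) [^] n) \<otimes> z) - f (x \<otimes> z)) \<le> C * t\<^sup>2 / real n"
   by (rule curve_pow_estimates[OF f, of v]) (rule that)
  let ?Y = "%n. curve v (- t / real n) [^] n \<otimes> curve v (t / real n) [^] n"
  have "(%n. f (?Y n)) \<longlonglongrightarrow> f (expo v (- t) \<otimes> expo v t)"
   by (rule continuous_on_tendsto_compose[OF smooth_cont[OF f] tendsto_group_mult[OF expo_LIMSEQ expo_LIMSEQ]]) auto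
  moreover have "(%n. f (?Y n)) \<longlonglongrightarrow> f \<one>"
  proof (rule Lim_transform_bound[where g = "%n. of_real (C * t\<^sup>2 / real n) :: real", THEN LIM_zero_cancel])
   show "(%n. of_real (C * t\<^sup>2 / real n) :: real) \<longlonglongrightarrow> 0"
    by (simp add: lim_const_over_n)
   obtain N :: nat where N: "real N \<ge> \<bar>t\<bar> + 1" using real_arch_simple by blast
   have "norm (f (?Y n) - f \<one>) \<le> norm (of_real (C * t\<^sup>2 / real n) :: real)" if "n \<ge> N" for n
   proof -
    have "\<bar>t\<bar> \<le> real n" "n > 0" using N that by (auto intro!: Nat.gr0I)
    from C(2)[OF this, of "\<one>" "\<one>"] show ?thesis using C(1) by simp
   qed
   thus "\<forall>\<^sub>F n in sequentially. norm (f (?Y n) - f \<one>) \<le> norm (of_real (C * t\<^sup>2 / real n) :: real)"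
    unfolding eventually_sequentially by blast
  qed
  ultimately show "f (expo v (- t) \<otimes> expo v t) = f \<one>" by (rule LIMSEQ_unique)
 qed
 thus ?thesis by (metis carrier_eq_UNIV UNIV_I inv_equality)
qed

lemma expo_int_mult: "expo v (real_of_int k * t) = expo v t [^] k"
proof (cases "k \<ge> 0")
 case True
 then obtain n where "k = int n" using nonneg_int_cases by blast
 thus ?thesis using expo_nat_mult[of v n t] by (simp add: int_pow_int)
next
 case False
 then obtain n where n: "k = - int n" by (metis nonneg_int_cases linear minus_minus neg_0_le_iff_le)
 thus ?thesis using expo_nat_mult[of v n t] expo_minus[of v "real n * t"] by (simp add: int_pow_neg_int)
qed

text \<open>Letting m tend to infinity in the second estimate of \<open>curve_pow_estimates\<close>
  bounds the distance to the limit by C t^2 / n, so after applying a test function the convergence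
  is locally uniform in t.\<close>

lemma continuous_expo: "cont (expo v)"
proof -
 have "((%t. expo v t) \<longlongrightarrow> expo v t0) (at t0)" for t0
 proof (rule tendsto_if_smooth_tendsto)
  fix f assume f: "smooth f"
  obtain C where C: "C \<ge> 0"
   "\<And>x z t n m. \<bar>t\<bar> \<le> real n ==> n > 0 ==> m > 0 ==>
    norm (f (x \<otimes> curve v (t / real (n * m)) [^] (n * m) \<otimes> z) - f (x \<otimes> curve v (t / real n) [^] n \<otimes> z)) \<le> C * t\<^sup>2 / real n"
   by (rule curve_pow_estimates[OF f, of v]) (rule that)
  have lim: "norm (f (expo v t) - f (curve v (t / real n) [^] n)) \<le> C * t\<^sup>2 / real n"
   if t: "\<bar>t\<bar> \<le> real n" "n > 0" for t n
  proof (rule LIMSEQ_le_const2)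
   have "strict_mono (%m. n * m)" using t(2) by (auto simp: strict_mono_def)
   from LIMSEQ_subseq_LIMSEQ[OF expo_LIMSEQ_smooth[OF f, of "\<one>" v t "\<one>"] this]
   have "(%m. f (curve v (t / real (n * m)) [^] (n * m))) \<longlonglongrightarrow> f (expo v t)" by (simp add: comp_def)
   thus "(%m. norm (f (curve v (t / real (n * m)) [^] (n * m)) - f (curve v (t / real n) [^] n)))
     \<longlonglongrightarrow> norm (f (expo v t) - f (curve v (t / real n) [^] n))"
    by (intro tendsto_intros)
   show "\<exists>N. \<forall>m\<ge>N. norm (f (curve v (t / real (n * m)) [^] (n * m)) - f (curve v (t / real n) [^] n)) \<le> C * t\<^sup>2 / real n"
    using C(2)[OF t, of _ "\<one>" "\<one>"] by (intro exI[of _ 1]) auto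
  qed
  have "continuous_on (ball t0 1) (%t. f (expo v t))"
  proof (rule uniform_limit_theorem[where F = sequentially and f = "%n t. f (curve v (t / real n) [^] n)"])
   show "\<forall>\<^sub>F n in sequentially. continuous_on (ball t0 1) (%t. f (curve v (t / real n) [^] n))"
   proof (rule always_eventually, rule allI)
    fix n
    have "cont (%t. curve v (t / real n) [^] k)" for k :: nat
    proof (induction k)
     case (Suc k)
     have "cont (%t. curve v (t / real n))"
      by (intro continuous_on_compose2[OF smooth_map_continuous[OF smooth_curve, of UNIV]])
       (auto simp: divide_inverse intro!: continuous_intros)
     with Suc show ?case by (simp add: continuous_on_group_mult)
    qed simp
    thus "continuous_on (ball t0 1) (%t. f (curve v (t / real n) [^] n))"
     using continuous_on_compose2[OF smooth_cont[OF f]] continuous_on_subset by blast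
   qed
   show "uniform_limit (ball t0 1) (%n t. f (curve v (t / real n) [^] n)) (%t. f (expo v t)) sequentially"
   proof (rule uniform_limitI)
    fix e :: real assume e: "e > 0"
    define b where "b = \<bar>t0\<bar> + 1"
    obtain N :: nat where N: "real N \<ge> max (b + 1) (2 * (C * b\<^sup>2) / e)" using real_arch_simple by blast
    have "dist (f (curve v (t / real n) [^] n)) (f (expo v t)) < e" if "n \<ge> N" "t \<in> ball t0 1" for n t
    proof -
     have tb: "\<bar>t\<bar> \<le> b" using that(2) by (auto simp: b_def dist_real_def)
     have n: "\<bar>t\<bar> \<le> real n" "n > 0" using N that(1) tb by (auto intro!: Nat.gr0I simp: b_def)
     have "t\<^sup>2 \<le> b\<^sup>2" using tb power_mono[of "\<bar>t\<bar>" b 2] by simp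
     hence "C * t\<^sup>2 / real n \<le> C * b\<^sup>2 / real n" using C(1) by (intro divide_right_mono mult_left_mono) auto
     also have "... \<le> e / 2"
     proof -
      have "2 * (C * b\<^sup>2) / e \<le> real n" using N that(1) by linarith
      thus ?thesis using e n by (simp add: field_simps)
     qed
     finally have "norm (f (expo v t) - f (curve v (t / real n) [^] n)) \<le> e / 2" using lim[OF n] by linarith
     thus ?thesis
      using e norm_minus_commute[of "f (expo v t)" "f (curve v (t / real n) [^] n)"] unfolding dist_norm by linarith
    qed
    thus "\<forall>\<^sub>F n in sequentially. \<forall>t\<in>ball t0 1. dist (f (curve v (t / real n) [^] n)) (f (expo v t)) < e"
     unfolding eventually_sequentially by blast
   qed
  qed simp
  thus "((%t. f (expo v t)) \<longlongrightarrow> f (expo v t0)) (at t0)"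
   by (simp add: continuous_on_eq_continuous_at isCont_def)
 qed
 thus ?thesis by (simp add: continuous_on_def)
qed

text \<open>For integer multiples of 1/n this is the law of integer powers. Real s and t are
  approximated by such multiples with a common denominator, and continuity does the rest.\<close>

lemma expo_add: "expo v (s + t) = expo v s \<otimes> expo v t"
proof -
 have fl: "(%n. real_of_int \<lfloor>real (Suc n) * s\<rfloor> / real (Suc n)) \<longlonglongrightarrow> s" for s
 proof (rule LIM_zero_cancel, rule Lim_null_comparison)
  show "(%n. inverse (real (Suc n))) \<longlonglongrightarrow> 0" by (rule LIMSEQ_inverse_real_of_nat)
  have "norm (real_of_int \<lfloor>real (Suc n) * s\<rfloor> / real (Suc n) - s) \<le> inverse (real (Suc n))" for n
  proof -
   have "real_of_int \<lfloor>real (Suc n) * s\<rfloor> / real (Suc n) - s = (real_of_int \<lfloor>real (Suc n) * s\<rfloor> - real (Suc n) * s) * inverse (real (Suc n))"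
    by (simp add: field_simps)
   also have "norm ... \<le> 1 * inverse (real (Suc n))"
    unfolding norm_mult by (intro mult_mono) (auto, linarith?)
   finally show ?thesis by simp
  qed
  thus "\<forall>\<^sub>F n in sequentially. norm (real_of_int \<lfloor>real (Suc n) * s\<rfloor> / real (Suc n) - s) \<le> inverse (real (Suc n))"
   by simp
 qed
 have lim: "(%n. expo v (X n)) \<longlonglongrightarrow> expo v l" if "X \<longlonglongrightarrow> l" for X l
  using continuous_on_tendsto_compose[OF continuous_expo that] by simp
 let ?a = "%s n. \<lfloor>real (Suc n) * s\<rfloor>"
 have "expo v (real_of_int (?a s n) / real (Suc n) + real_of_int (?a t n) / real (Suc n))
   = expo v (real_of_int (?a s n) / real (Suc n)) \<otimes> expo v (real_of_int (?a t n) / real (Suc n))" for n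
  using expo_int_mult[of v "?a s n" "1 / real (Suc n)"] expo_int_mult[of v "?a t n" "1 / real (Suc n)"]
   expo_int_mult[of v "?a s n + ?a t n" "1 / real (Suc n)"]
  by (simp add: int_pow_mult add_divide_distrib)
 thus ?thesis
  using LIMSEQ_unique[OF lim[OF tendsto_add[OF fl[of s] fl[of t]]]] tendsto_group_mult[OF lim[OF fl[of s]] lim[OF fl[of t]]]
  by simp
qed

text \<open>By the first estimate of \<open>curve_pow_estimates\<close>, \<open>expo v t\<close> and
  \<open>curve v t\<close> differ by O(t^2) under f, so the two curves have the same velocity at
  0.\<close>

lemma expo_derivative_0:
 assumes f: "smooth f"
 shows "((%t. f (x \<otimes> expo v t)) has_vector_derivative dirD v f x) (at 0)"
proof -
 obtain C where C: "C \<ge> 0"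
  "\<And>x z a n. real n * \<bar>a\<bar> \<le> 1 ==> norm (f (x \<otimes> curve v a [^] n \<otimes> z) - f (x \<otimes> curve v (real n * a) \<otimes> z)) \<le> C * (real n * a)\<^sup>2"
  by (rule curve_pow_estimates[OF f, of v]) (rule that)
 have close: "norm (f (x \<otimes> expo v t) - f (x \<otimes> curve v t)) \<le> C * t\<^sup>2" if t: "\<bar>t\<bar> \<le> 1" for t
 proof (rule LIMSEQ_le_const2)
  show "(%n. norm (f (x \<otimes> curve v (t / real n) [^] n) - f (x \<otimes> curve v t))) \<longlonglongrightarrow> norm (f (x \<otimes> expo v t) - f (x \<otimes> curve v t))"
   using expo_LIMSEQ_smooth[OF f, of x v t "\<one>"] by (intro tendsto_intros) simp
  have "norm (f (x \<otimes> curve v (t / real n) [^] n) - f (x \<otimes> curve v t)) \<le> C * t\<^sup>2" if "n \<ge> 1" for n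
   using C(2)[of n "t / real n" x "\<one>"] t that by simp
  thus "\<exists>N. \<forall>n\<ge>N. norm (f (x \<otimes> curve v (t / real n) [^] n) - f (x \<otimes> curve v t)) \<le> C * t\<^sup>2" by blast
 qed
 have "((%t. f (x \<otimes> expo v t) - f (x \<otimes> curve v t)) has_vector_derivative 0) (at 0)"
  unfolding has_vector_derivative_def has_derivative_at_alt
 proof (intro conjI allI impI)
  fix e :: real assume e: "e > 0"
  have "norm (f (x \<otimes> expo v t) - f (x \<otimes> curve v t)) \<le> e * norm t" if "norm t < min 1 (e / (C + 1))" for t
  proof -
   have "C * t\<^sup>2 = (C * \<bar>t\<bar>) * \<bar>t\<bar>" by (simp add: power2_eq_square)
   also have "... \<le> e * \<bar>t\<bar>"
   proof (rule mult_right_mono)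
    have "(C + 1) * \<bar>t\<bar> \<le> e" using that C(1) by (simp add: field_simps)
    thus "C * \<bar>t\<bar> \<le> e" by (simp add: algebra_simps)
   qed simp
   finally show ?thesis using close[of t] that by simp
  qed
  thus "\<exists>d>0. \<forall>y. norm (y - 0) < d \<longrightarrow> norm (f (x \<otimes> expo v y) - f (x \<otimes> curve v y)
    - (f (x \<otimes> expo v 0) - f (x \<otimes> curve v 0)) - (y - 0) *\<^sub>R 0) \<le> e * norm (y - 0)"
   using e C(1) by (intro exI[of _ "min 1 (e / (C + 1))"]) (auto simp: expo_0 curve_0)
 qed simp
 from has_vector_derivative_add[OF this dirD_curve[OF f, of x v]] show ?thesis by simp
qed

lemma expo_derivative:
 assumes f: "smooth f"
 shows "((%t. f (x \<otimes> expo v t)) has_vector_derivative dirD v f (x \<otimes> expo v t)) (at t)"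
proof -
 have "((%s. f ((x \<otimes> expo v t) \<otimes> expo v s)) has_vector_derivative dirD v f (x \<otimes> expo v t)) (at (t - t))"
  using expo_derivative_0[OF f, of "x \<otimes> expo v t" v] by simp
 moreover have "((%s. s - t) has_real_derivative 1) (at t)" by (auto intro!: derivative_eq_intros)
 ultimately have "(((%s. f ((x \<otimes> expo v t) \<otimes> expo v s)) \<circ> (%s. s - t)) has_vector_derivative 1 *\<^sub>R dirD v f (x \<otimes> expo v t)) (at t)"
  by (intro vector_diff_chain_at) (simp_all add: has_real_derivative_iff_has_vector_derivative)
 moreover have "expo v t \<otimes> expo v (s - t) = expo v s" for s using expo_add[of v t "s - t"] by simp
 ultimately show ?thesis by (simp add: comp_def m_assoc)
qed

text \<open>Smoothness is tested on smooth functions: the functions t -> g (expo v t) with g smooth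
  form a class closed under differentiation, which replaces g by \<open>dirD v g\<close>.\<close>

lemma one_parameter_subgroup_expo: "one_parameter_subgroup G A (expo v)"
 unfolding one_parameter_subgroup_def
proof (intro conjI allI expo_add)
 show "smooth_map std_atlas A (expo v)"
 proof (rule smooth_map_if_test_functions[OF smooth_atlas_std atlas continuous_expo])
  fix f assume "f \<in> smooth_functions A"
  hence f: "smooth f" by (simp add: smooth_functions_iff)
  have "smooth_on UNIV (%t. f (expo v t))"
  proof (rule smooth_on_real_coinduct[where P = "%F. \<exists>g. smooth g \<and> F = (%t. g (expo v t))"])
   show "\<exists>g. smooth g \<and> (%t. f (expo v t)) = (%t. g (expo v t))" using f by blast
   fix F assume "\<exists>g. smooth g \<and> F = (%t. g (expo v t))"
   then obtain g where g: "smooth g" "F = (%t. g (expo v t))" by blast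
   show "\<exists>f'. (\<forall>x\<in>UNIV. (F has_vector_derivative f' x) (at x)) \<and> (\<exists>g. smooth g \<and> f' = (%t. g (expo v t)))"
    using expo_derivative[OF g(1), of "\<one>" v] smooth_dirD[OF g(1), of v]
    by (intro exI[of _ "%t. dirD v g (expo v t)"]) (auto simp: g(2))
   show "\<exists>g. smooth g \<and> (%x. c *\<^sub>R F x) = (%t. g (expo v t))" for c
    using smooth_map_scaleR[OF atlas smooth_map_const[OF atlas smooth_atlas_std] g(1), of c]
    by (intro exI[of _ "%x. c *\<^sub>R g x"]) (simp add: g(2))
  qed simp
  thus "smooth_map std_atlas std_atlas (%x. f (expo v x))" by (simp add: smooth_map_std_std)
 qed
qed

section \<open>The Lie algebra as a linear image of the model space\<close>

definition vf :: "'e => 'g vf" where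
 "vf v f x = (if smooth f then dirD v f x else 0)"

lemma left_invariant_vf_expo: "left_invariant_vf G A (expo v) = vf v"
proof (intro ext)
 fix f x
 show "left_invariant_vf G A (expo v) f x = vf v f x"
  using vector_derivative_at[OF expo_derivative_0, of f x v]
  by (simp add: left_invariant_vf_def vf_def smooth_functions_iff)
qed

lemma one_parameter_subgroup_vf:
 assumes \<gamma>: "one_parameter_subgroup G A \<gamma>"
 obtains v where "left_invariant_vf G A \<gamma> = vf v"
  "\<And>f x t. smooth f ==> ((%t. f (x \<otimes> \<gamma> t)) has_vector_derivative dirD v f (x \<otimes> \<gamma> t)) (at t)"
proof -
 have sm: "smooth_map std_atlas A \<gamma>" and add: "\<And>s t. \<gamma> (s + t) = \<gamma> s \<otimes> \<gamma> t"
  using \<gamma> by (auto simp: one_parameter_subgroup_def)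
 have "\<gamma> 0 \<otimes> \<gamma> 0 = \<gamma> 0" using add[of 0 0] by simp
 hence g0: "\<gamma> 0 = \<one>" by (metis mult_inv_cancel(1) mult_inv_cancel(4))
 define T where "T = \<gamma> -` U0"
 have T: "open T" "0 \<in> T"
  using smooth_map_continuous[OF sm, of UNIV] base(1) base_chart(2) g0 by (auto simp: T_def intro: open_vimage)
 have "smooth_on (id ` (UNIV \<inter> \<gamma> -` U0)) (\<phi>0 \<circ> \<gamma> \<circ> inv_into UNIV id)"
  by (rule smooth_mapD[OF sm _ base_chart(1)]) (simp add: std_atlas_def)
 hence "smooth_on T (%t. \<phi>0 (\<gamma> t))" by (simp add: inv_id_eq comp_def T_def)
 from smooth_on_has_derivative[OF this T(2)]
 have d: "((%t. \<phi>0 (\<gamma> t)) has_derivative frechet_derivative (%t. \<phi>0 (\<gamma> t)) (at 0)) (at 0)" .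
 define v where "v = frechet_derivative (%t. \<phi>0 (\<gamma> t)) (at 0) 1"
 have "frechet_derivative (%t. \<phi>0 (\<gamma> t)) (at 0) = (%s. s *\<^sub>R v)"
 proof
  fix s :: real
  have "frechet_derivative (%t. \<phi>0 (\<gamma> t)) (at 0) (s *\<^sub>R 1) = s *\<^sub>R v"
   unfolding v_def by (rule linear_cmul[OF has_derivative_linear[OF d]])
  thus "frechet_derivative (%t. \<phi>0 (\<gamma> t)) (at 0) s = s *\<^sub>R v" by simp
 qed
 hence d': "((%t. \<phi>0 (\<gamma> t)) has_derivative (%s. s *\<^sub>R v)) (at 0)" using d by simp
 have der0: "((%t. f (x \<otimes> \<gamma> t)) has_vector_derivative dirD v f x) (at 0)" if f: "smooth f" for f x
  by (rule dirD_along_curve[OF f g0 T _ d']) (simp add: T_def)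
 have der: "((%t. f (x \<otimes> \<gamma> t)) has_vector_derivative dirD v f (x \<otimes> \<gamma> t)) (at t)" if f: "smooth f" for f x t
 proof -
  have "((%s. f ((x \<otimes> \<gamma> t) \<otimes> \<gamma> s)) has_vector_derivative dirD v f (x \<otimes> \<gamma> t)) (at (t - t))"
   using der0[OF f, of "x \<otimes> \<gamma> t"] by simp
  moreover have "((%s. s - t) has_real_derivative 1) (at t)" by (auto intro!: derivative_eq_intros)
  ultimately have "(((%s. f ((x \<otimes> \<gamma> t) \<otimes> \<gamma> s)) \<circ> (%s. s - t)) has_vector_derivative 1 *\<^sub>R dirD v f (x \<otimes> \<gamma> t)) (at t)"
   by (intro vector_diff_chain_at) (simp_all add: has_real_derivative_iff_has_vector_derivative)
  moreover have "\<gamma> t \<otimes> \<gamma> (s - t) = \<gamma> s" for s using add[of t "s - t"] by simp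
  ultimately show ?thesis by (simp add: comp_def m_assoc)
 qed
 have "left_invariant_vf G A \<gamma> = vf v"
 proof (intro ext)
  fix f x
  show "left_invariant_vf G A \<gamma> f x = vf v f x"
   using vector_derivative_at[OF der0, of f x]
   by (simp add: left_invariant_vf_def vf_def smooth_functions_iff)
 qed
 thus ?thesis using that der by blast
qed

text \<open>The inclusion from the right is what the exponential map was built for: every direction
  v generates a one-parameter subgroup. As a consequence the set \<open>lie_algebra\<close>, defined
  by generators, is a linear space of finite dimension.\<close>

lemma lie_algebra_eq: "lie_algebra G A = range vf"
proof
 show "lie_algebra G A \<subseteq> range vf"
 proof
  fix X assume "X \<in> lie_algebra G A"
  then obtain \<gamma> where "X = left_invariant_vf G A \<gamma>" "one_parameter_subgroup G A \<gamma>" by (auto simp: lie_algebra_def)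
  thus "X \<in> range vf" using one_parameter_subgroup_vf[of \<gamma>] by (metis rangeI)
 qed
 show "range vf \<subseteq> lie_algebra G A"
  using left_invariant_vf_expo one_parameter_subgroup_expo unfolding lie_algebra_def by (metis (mono_tags, lifting) image_subsetI mem_Collect_eq)
qed

end

context compact_lie_group
begin

subsection \<open>Derivations along left-invariant fields\<close>

lemma compact_functional_cmean:
 assumes k: "cont k" shows "compact_functional (%f. cmean (%g. f g * k g))"
proof -
 obtain b where b: "b > 0" "\<And>x. norm (k x) \<le> b" using bounded_continuous[OF k] by blast
 show ?thesis
  unfolding compact_functional_def
 proof (intro exI[of _ UNIV] exI[of _ b] conjI allI impI)
  fix f g :: "'g => complex" assume f: "cont f" and g: "cont g"
  show "cmean (%x. (f x + g x) * k x) = cmean (%x. f x * k x) + cmean (%x. g x * k x)"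
   using cmean_add[OF continuous_on_mult[OF f k] continuous_on_mult[OF g k]] by (simp add: distrib_right)
 next
  fix c and f :: "'g => complex" assume f: "cont f"
  show "cmean (%x. c * f x * k x) = c * cmean (%x. f x * k x)"
   using cmean_scale[OF continuous_on_mult[OF f k], of c] by (simp add: mult.assoc)
 next
  fix f :: "'g => complex" and d assume f: "cont f" and d: "\<forall>x\<in>UNIV. norm (f x) \<le> d"
  have "norm (f x * k x) \<le> d * b" for x
   unfolding norm_mult using d b order.trans[OF norm_ge_zero, of "f x" d] by (intro mult_mono) auto
  from norm_cmean_bound[OF continuous_on_mult[OF f k] this]
  show "norm (cmean (%x. f x * k x)) \<le> b * d" by (simp add: mult.commute)
 qed (use compact_UNIV b in auto)
qed

lemma dirD_left_translate: "dirD v (%x. f (a \<otimes> x)) x = dirD v f (a \<otimes> x)"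
 by (simp add: dirD_def m_assoc)

lemma dirD_add: "smooth f ==> smooth g ==> dirD v (%x. f x + g x) x = dirD v f x + dirD v g x"
 unfolding dirD_def
 using frechet_derivative_at[OF has_derivative_add[OF has_derivative_dirD[of f x] has_derivative_dirD[of g x]]]
 by (simp add: dirD_def fun_eq_iff)

lemma dirD_scale: "smooth f ==> dirD v (%x. c * f x) x = c * dirD v f x"
 unfolding dirD_def
 using frechet_derivative_at[OF has_derivative_mult_right[OF has_derivative_dirD[of f x], of c]]
 by (simp add: dirD_def fun_eq_iff)

lemma dirD_cnj: "smooth f ==> dirD v (%x. cnj (f x)) x = cnj (dirD v f x)"
 unfolding dirD_def
 using frechet_derivative_at[OF bounded_linear.has_derivative[OF bounded_linear_cnj has_derivative_dirD[of f x]]]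
 by (simp add: dirD_def fun_eq_iff)

lemma dirD_mult: "smooth f ==> smooth g ==> dirD v (%x. f x * g x) x = f x * dirD v g x + dirD v f x * g x"
 unfolding dirD_def
 using frechet_derivative_at[OF has_derivative_mult[OF has_derivative_dirD[of f x] has_derivative_dirD[of g x]]]
 by (simp add: dirD_def fun_eq_iff psi0)

lemma smooth_cnj: "smooth f ==> smooth (%x. cnj (f x))"
 by (rule smooth_map_linear[OF atlas _ bounded_linear_cnj])

lemma smooth_scale: "smooth f ==> smooth (%x. c * f x)"
 by (rule smooth_map_mult[OF atlas smooth_map_const[OF atlas smooth_atlas_std]])

lemma dirD_sum:
 "(\<And>i. i \<in> I ==> smooth (f i)) ==> dirD v (%x. \<Sum>i\<in>I. f i x) x = (\<Sum>i\<in>I. dirD v (f i) x)"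
proof (induction I rule: infinite_finite_induct)
 case (insert i I)
 have "smooth (%x. \<Sum>i\<in>I. f i x)" using insert.prems by (intro smooth_map_sum[OF atlas]) auto
 with dirD_add[of "f i" "%x. \<Sum>i\<in>I. f i x"] insert show ?case by simp
qed (simp_all add: dirD_def frechet_derivative_const)

text \<open>By right invariance the mean of x -> f (x \<otimes> expo v t) does not depend on t; it
  is differentiated at t = 0 under the mean.\<close>

lemma dirD_mean_zero:
 assumes f: "smooth f" shows "cmean (dirD v f) = 0"
proof -
 let ?h = "%p. f (snd p \<otimes> expo v (fst p))"
 have M: "smooth_atlas (prod_atlas real_atlas A)"
  by (rule smooth_atlas_prod[OF smooth_atlas_std atlas])
 have e: "smooth_map (prod_atlas real_atlas A) A (%p. expo v (fst p))"
  using one_parameter_subgroup_expo unfolding one_parameter_subgroup_def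
  by (intro smooth_map_compose[OF M smooth_atlas_std atlas smooth_map_fst[OF smooth_atlas_std atlas]]) blast
 have h: "smooth_map (prod_atlas real_atlas A) std_atlas ?h"
  by (rule smooth_compose[OF M smooth_map_group_mult[OF M smooth_map_snd[OF smooth_atlas_std atlas] e] f])
 have fam: "smooth_family UNIV A ?h"
  using smooth_family_chart_map[OF smooth_atlas_std atlas h, of UNIV id] by (simp add: std_atlas_def inv_id_eq)
 have "((%t. cmean (%x. ?h (t, x))) has_derivative (%s. cmean (%x. family_derivative ?h s (0, x)))) (at 0)"
  using has_derivative_functional[OF open_UNIV atlas fam UNIV_I compact_functional_cmean[OF continuous_on_const[of UNIV 1]], of 0] by simp
 moreover have "family_derivative ?h s (0, x) = s *\<^sub>R dirD v f x" for s x
 proof -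
  have 1: "((%t. ?h (t, x)) has_derivative (%s. family_derivative ?h s (0, x))) (at 0)"
   by (rule smooth_family_has_derivative[OF open_UNIV atlas fam UNIV_I])
  have 2: "((%t. ?h (t, x)) has_derivative (%s. s *\<^sub>R dirD v f x)) (at 0)"
   using expo_derivative_0[OF f, of x v] by (simp add: has_vector_derivative_def)
  show ?thesis by (rule fun_cong[OF has_derivative_unique[OF 1 2]])
 qed
 moreover have "cmean (%x. ?h (t, x)) = cmean f" for t
  using cmean_right_invariant[OF smooth_cont[OF f]] by simp
 ultimately have "((%t. cmean f) has_derivative (%s. cmean (%x. s *\<^sub>R dirD v f x))) (at (0::real))" by simp
 from fun_cong[OF has_derivative_unique[OF this has_derivative_const], of 1] show ?thesis by simp
qed

lemma cip_dirD:
 assumes f: "smooth f" and g: "smooth g"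
 shows "cip (dirD v f) g = - cip f (dirD v g)"
proof -
 have "cmean (dirD v (%x. f x * cnj (g x))) = cmean (%x. f x * cnj (dirD v g x) + dirD v f x * cnj (g x))"
  using dirD_mult[OF f smooth_cnj[OF g]] dirD_cnj[OF g] by (intro arg_cong[where f = cmean] ext) simp
 also have "... = cip f (dirD v g) + cip (dirD v f) g"
  unfolding cip_def
  by (intro cmean_add cont_mult_cnj smooth_cont f g smooth_dirD)
 finally show ?thesis
  using dirD_mean_zero[OF smooth_map_mult[OF atlas f smooth_cnj[OF g]]] by (simp add: eq_neg_iff_add_eq_0 add.commute)
qed

subsection \<open>Smoothness of irreducible representations\<close>

lemma smooth_convolution:
 assumes \<kappa>: "smooth \<kappa>" and k: "cont k"
 shows "smooth (%x. cmean (%g. \<kappa> (inv x \<otimes> g) * k g))"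
proof -
 note M = smooth_atlas_prod[OF atlas atlas]
 have "smooth_map (prod_atlas A A) std_atlas (%p. \<kappa> (inv (fst p) \<otimes> snd p))"
  by (rule smooth_compose[OF M smooth_map_group_mult[OF M smooth_map_group_inv[OF M smooth_map_fst[OF atlas atlas]]
    smooth_map_snd[OF atlas atlas]] \<kappa>])
 from smooth_map_functional[OF atlas atlas this compact_functional_cmean[OF k]] show ?thesis by simp
qed

text \<open>Garding's argument. The vectors w with smooth orbit x -> \<xi> x w form an invariant
  subspace, and it is nonzero because it contains the mean of \<kappa> g \<xi> g applied to the
  first basis vector, for a smooth bump \<kappa>: translation by x then acts on \<kappa>. By
  irreducibility it is the whole space.\<close>

lemma irreducible_smooth:
 assumes \<xi>: "irrep G d \<xi>" and ij: "i < d" "j < d"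
 shows "smooth (coef \<xi> i j)"
proof -
 note u = irreducible_unitary[OF \<xi>] and cx = rep_carrier[OF irreducible_unitary[OF \<xi>]]
 define W where "W = {w \<in> carrier_vec d. \<forall>i<d. smooth (%x. vec_index (\<xi> x *\<^sub>v w) i)}"
 have sub: "invariant_subspace G d \<xi> W"
  unfolding invariant_subspace_def
 proof (intro conjI ballI allI)
  show "W \<subseteq> carrier_vec d" by (auto simp: W_def)
  have "\<xi> x *\<^sub>v 0\<^sub>v d = 0\<^sub>v d" for x using cx[of x] by auto
  thus "0\<^sub>v d \<in> W" by (simp add: W_def smooth_map_const[OF atlas smooth_atlas_std])
  show "w1 + w2 \<in> W" if w: "w1 \<in> W" "w2 \<in> W" for w1 w2
  proof -
   have c: "w1 \<in> carrier_vec d" "w2 \<in> carrier_vec d" using w by (auto simp: W_def)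
   have "vec_index (\<xi> x *\<^sub>v (w1 + w2)) i = vec_index (\<xi> x *\<^sub>v w1) i + vec_index (\<xi> x *\<^sub>v w2) i" if "i < d" for x i
    using mult_add_distrib_mat_vec[OF cx c, of x] c cx[of x] that by simp
   thus ?thesis using w c by (simp add: W_def smooth_map_add[OF atlas])
  qed
  show "b \<cdot>\<^sub>v w \<in> W" if w: "w \<in> W" for b w
  proof -
   have c: "w \<in> carrier_vec d" using w by (auto simp: W_def)
   have "vec_index (\<xi> x *\<^sub>v (b \<cdot>\<^sub>v w)) i = b * vec_index (\<xi> x *\<^sub>v w) i" if "i < d" for x i
    using mult_mat_vec[OF cx c, of x b] cx[of x] that by simp
   thus ?thesis using w c by (simp add: W_def smooth_scale)
  qed
  show "\<xi> y *\<^sub>v w \<in> W" if w: "w \<in> W" for y w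
  proof -
   have c: "w \<in> carrier_vec d" using w by (auto simp: W_def)
   have "\<xi> x *\<^sub>v (\<xi> y *\<^sub>v w) = \<xi> (x \<otimes> y) *\<^sub>v w" for x
    unfolding rep_mult[OF u] using assoc_mult_mat_vec[OF cx cx c] by simp
   moreover have "smooth (%x. vec_index (\<xi> (x \<otimes> y) *\<^sub>v w) i)" if "i < d" for i
    using smooth_right_translate[of "%x. vec_index (\<xi> x *\<^sub>v w) i" y] w that by (simp add: W_def)
   ultimately show ?thesis using mult_mat_vec_carrier[OF cx c] by (simp add: W_def)
  qed
 qed
 have d: "0 < d" using ij by simp
 have c00: "cont (coef \<xi> 0 0)" using rep_cont[OF u d d] .
 \<comment> \<open>On the support of \<kappa> the corner entry has real part above 1/2, so the first
   component of the averaged vector has positive real part.\<close>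
 have "open ((%x. Re (\<xi> x $$ (0, 0))) -` {1/2<..})"
  using cont_Re_Im(1)[OF c00] by (intro open_vimage) auto
 moreover have "\<one> \<in> (%x. Re (\<xi> x $$ (0, 0))) -` {1/2<..}" using rep_one_index[OF u d d] by simp
 ultimately obtain \<kappa> where \<kappa>: "smooth \<kappa>" "\<kappa> \<one> \<noteq> 0"
  "\<And>y. \<kappa> y \<noteq> 0 ==> y \<in> (%x. Re (\<xi> x $$ (0, 0))) -` {1/2<..}" "\<And>y. \<exists>r\<ge>0. \<kappa> y = of_real r"
  by (rule smooth_bump_at) (rule that)
 note c\<kappa> = smooth_cont[OF \<kappa>(1)]
 define w where "w = vec d (%i. cmean (%g. \<kappa> g * \<xi> g $$ (i, 0)))"
 have ck: "cont (%g. \<kappa> g * \<xi> g $$ (i, 0))" if "i < d" for i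
  using continuous_on_mult[OF c\<kappa> rep_cont[OF u that d]] .
 have wW: "w \<in> W"
 proof -
  have "smooth (%x. vec_index (\<xi> x *\<^sub>v w) i)" if i: "i < d" for i
  proof -
   have "vec_index (\<xi> x *\<^sub>v w) i = cmean (%g. \<kappa> (inv x \<otimes> g) * \<xi> g $$ (i, 0))" for x
   proof -
    have "vec_index (\<xi> x *\<^sub>v w) i = (\<Sum>k<d. \<xi> x $$ (i, k) * cmean (%g. \<kappa> g * \<xi> g $$ (k, 0)))"
     using cx[of x] i by (simp add: w_def scalar_prod_def lessThan_atLeast0)
    also have "... = (\<Sum>k<d. cmean (%g. \<xi> x $$ (i, k) * (\<kappa> g * \<xi> g $$ (k, 0))))"
     by (intro sum.cong refl cmean_scale[symmetric] ck) simp
    also have "... = cmean (%g. \<Sum>k<d. \<xi> x $$ (i, k) * (\<kappa> g * \<xi> g $$ (k, 0)))"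
     by (intro cmean_sum[symmetric] continuous_on_mult[OF continuous_on_const ck]) simp
    also have "... = cmean (%g. \<kappa> g * \<xi> (x \<otimes> g) $$ (i, 0))"
     by (simp add: rep_mult_index[OF u i d] sum_distrib_left ac_simps)
    also have "... = cmean (%g. \<kappa> (inv x \<otimes> g) * \<xi> g $$ (i, 0))"
    proof -
     have "cont (%g. \<kappa> (inv x \<otimes> g) * \<xi> g $$ (i, 0))"
      by (rule continuous_on_mult[OF continuous_translate(1)[OF c\<kappa>] rep_cont[OF u i d]])
     from cmean_left_invariant[OF this, of x] show ?thesis by simp
    qed
    finally show ?thesis .
   qed
   thus ?thesis using smooth_convolution[OF \<kappa>(1) rep_cont[OF u i d]] by simp
  qed
  thus ?thesis by (simp add: W_def w_def)
 qed
 have "Re (vec_index w 0) > 0"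
 proof -
  have "mean (%g. Re (\<kappa> g * \<xi> g $$ (0, 0))) > 0"
  proof (rule mean_pos[of _ "\<one>"])
   show "cont (%g. Re (\<kappa> g * \<xi> g $$ (0, 0)))" by (rule cont_Re_Im(1)[OF ck[OF d]])
   have pos: "0 \<le> Re (\<kappa> g * \<xi> g $$ (0, 0)) \<and> (\<kappa> g \<noteq> 0 \<longrightarrow> 0 < Re (\<kappa> g * \<xi> g $$ (0, 0)))" for g
   proof (cases "\<kappa> g = 0")
    case False
    obtain r where "r \<ge> 0" "\<kappa> g = of_real r" using \<kappa>(4)[of g] by (elim exE conjE) (rule that)
    thus ?thesis using \<kappa>(3)[OF False] False by auto
   qed simp
   show "0 \<le> Re (\<kappa> g * \<xi> g $$ (0, 0))" for g using pos by blast
   show "0 < Re (\<kappa> \<one> * \<xi> \<one> $$ (0, 0))" using pos \<kappa>(2) by blast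
  qed
  thus ?thesis using d by (simp add: w_def cmean_def)
 qed
 hence "w \<noteq> 0\<^sub>v d" using d by auto
 hence "W = carrier_vec d" using sub wW \<xi> unfolding irreducible_unitary_rep_def by blast
 hence "unit_vec d j \<in> W" by simp
 hence "smooth (%x. vec_index (\<xi> x *\<^sub>v unit_vec d j) i)" using ij by (simp add: W_def)
 moreover have "vec_index (\<xi> x *\<^sub>v unit_vec d j) i = \<xi> x $$ (i, j)" for x
  using ij cx[of x] by (simp add: mult_mat_vec_def scalar_prod_def unit_vec_def if_distrib sum.delta cong: if_cong)
 ultimately show ?thesis by simp
qed

lemma dirD_rep:
 assumes \<xi>: "irrep G d \<xi>" and ij: "i < d" "j < d"
 shows "dirD v (coef \<xi> i j) x = (\<Sum>k<d. \<xi> x $$ (i, k) * dirD v (coef \<xi> k j) \<one>)"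
proof -
 note u = irreducible_unitary[OF \<xi>]
 have "dirD v (coef \<xi> i j) x = dirD v (%y. \<xi> (x \<otimes> y) $$ (i, j)) \<one>"
  using dirD_left_translate[of v "%x. \<xi> x $$ (i, j)" x "\<one>"] by simp
 also have "... = dirD v (%y. \<Sum>k<d. \<xi> x $$ (i, k) * \<xi> y $$ (k, j)) \<one>"
  by (simp add: rep_mult_index[OF u ij])
 also have "... = (\<Sum>k<d. dirD v (%y. \<xi> x $$ (i, k) * \<xi> y $$ (k, j)) \<one>)"
  using irreducible_smooth[OF \<xi> _ ij(2)] by (intro dirD_sum smooth_scale) simp
 also have "... = (\<Sum>k<d. \<xi> x $$ (i, k) * dirD v (coef \<xi> k j) \<one>)"
  using irreducible_smooth[OF \<xi> _ ij(2)] by (intro sum.cong refl dirD_scale) simp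
 finally show ?thesis .
qed

text \<open>The orthonormality of the columns is differentiated at the identity.\<close>

lemma dirD_rep_skew:
 assumes \<xi>: "irrep G d \<xi>" and ij: "i < d" "j < d"
 shows "dirD v (coef \<xi> i j) \<one> = - cnj (dirD v (coef \<xi> j i) \<one>)"
proof -
 note u = irreducible_unitary[OF \<xi>]
 note s = irreducible_smooth[OF \<xi>]
 have "dirD v (%x. \<Sum>k<d. cnj (\<xi> x $$ (k, i)) * \<xi> x $$ (k, j)) \<one> = 0"
  unfolding rep_cols_orthonormal[OF u ij] by (simp add: dirD_def frechet_derivative_const)
 moreover have "dirD v (%x. \<Sum>k<d. cnj (\<xi> x $$ (k, i)) * \<xi> x $$ (k, j)) \<one>
   = (\<Sum>k<d. dirD v (%x. cnj (\<xi> x $$ (k, i)) * \<xi> x $$ (k, j)) \<one>)"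
  using s ij by (intro dirD_sum smooth_map_mult[OF atlas] smooth_cnj) auto
 moreover have "... = (\<Sum>k<d. (if k = i then dirD v (coef \<xi> k j) \<one> else 0)
   + (if k = j then cnj (dirD v (coef \<xi> k i) \<one>) else 0))"
  using s ij by (intro sum.cong refl) (simp add: dirD_mult smooth_cnj dirD_cnj rep_one_index[OF u])
 ultimately have "dirD v (coef \<xi> i j) \<one> + cnj (dirD v (coef \<xi> j i) \<one>) = 0"
  using ij by (simp add: sum.distrib)
 thus ?thesis by (simp add: eq_neg_iff_add_eq_0)
qed

subsection \<open>Orthonormal bases of the Lie algebra\<close>

lemma vf_add: "vf (v + w) = vf v + vf w"
 by (intro ext) (simp add: vf_def linear_add[OF linear_dirD])

lemma vf_scale: "vf (r *\<^sub>R v) = r *\<^sub>R vf v"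
 by (intro ext) (simp add: vf_def linear_cmul[OF linear_dirD] scaleR_fun_def)

lemma linear_vf: "linear vf"
 by (rule linearI) (simp_all add: vf_add vf_scale)

end

text \<open>The Lie algebra is a small subspace of a huge function space, and \<open>ip\<close> has
  its properties only there. Orthonormal expansions and the Gram-Schmidt process are therefore
  carried out relative to V.\<close>

locale subspace_inner_product =
 fixes ip :: "'v::real_vector => 'v => real" and V :: "'v set"
 assumes sub: "real_vector.subspace V"
  and sym: "\<And>X Y. X \<in> V ==> Y \<in> V ==> ip X Y = ip Y X"
  and add: "\<And>X Y Z. X \<in> V ==> Y \<in> V ==> Z \<in> V ==> ip (X + Y) Z = ip X Z + ip Y Z"
  and scale: "\<And>r X Y. X \<in> V ==> Y \<in> V ==> ip (r *\<^sub>R X) Y = r * ip X Y"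
  and pos: "\<And>X. X \<in> V ==> X \<noteq> 0 ==> ip X X > 0"
begin

lemma ip_sum:
 assumes "\<And>E. E \<in> B ==> g E \<in> V" "Y \<in> V"
 shows "ip (\<Sum>E\<in>B. c E *\<^sub>R g E) Y = (\<Sum>E\<in>B. c E * ip (g E) Y)"
proof -
 have z: "ip 0 Y = 0" using scale[OF assms(2,2), of 0] by simp
 show ?thesis
  using assms(1)
 proof (induction B rule: infinite_finite_induct)
  case (insert E B)
  have "(\<Sum>E\<in>B. c E *\<^sub>R g E) \<in> V"
   using insert.prems by (intro subspace_sum[OF sub] subspace_scale[OF sub]) auto
  thus ?case using insert add[OF subspace_scale[OF sub] _ assms(2)] scale assms(2) by simp
 qed (simp_all add: z)
qed

lemma orthonormal_expansion:
 assumes B: "finite B" "B \<subseteq> V" "\<And>E F. E \<in> B ==> F \<in> B ==> ip E F = (if E = F then 1 else 0)"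
  and X: "X \<in> span B"
 shows "X = (\<Sum>E\<in>B. ip X E *\<^sub>R E)"
proof -
 obtain u where u: "X = (\<Sum>E\<in>B. u E *\<^sub>R E)" using X unfolding span_finite[OF B(1)] by blast
 have "ip X F = u F" if F: "F \<in> B" for F
 proof -
  have "ip X F = (\<Sum>E\<in>B. u E * ip E F)"
   unfolding u using B(2) F by (intro ip_sum[where g = "%E. E"]) auto
  also have "... = (\<Sum>E\<in>B. if E = F then u E else 0)" using B(3) F by (intro sum.cong refl) auto
  finally show ?thesis using F B(1) by simp
 qed
 thus ?thesis using u by simp
qed

lemma orthonormal_basis_exists:
 assumes T: "finite T" "T \<subseteq> V"
 shows "\<exists>B. finite B \<and> B \<subseteq> V \<and> (\<forall>E\<in>B. \<forall>F\<in>B. ip E F = (if E = F then 1 else 0)) \<and> T \<subseteq> span B"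
 using T
proof (induction T)
 case empty
 show ?case by (intro exI[of _ "{}"]) auto
next
 case (insert t T)
 then obtain B where B: "finite B" "B \<subseteq> V" "\<forall>E\<in>B. \<forall>F\<in>B. ip E F = (if E = F then 1 else 0)" "T \<subseteq> span B"
  by auto
 define p where "p = (\<Sum>E\<in>B. ip t E *\<^sub>R E)"
 have tV: "t \<in> V" using insert.prems by simp
 have pV: "p \<in> V" unfolding p_def using B(2) by (intro subspace_sum[OF sub] subspace_scale[OF sub]) auto
 have pB: "p \<in> span B" unfolding p_def by (intro span_sum span_scale span_base)
 define r where "r = t - p"
 have rV: "r \<in> V" unfolding r_def by (rule subspace_diff[OF sub tV pV])
 have tr: "t = 1 *\<^sub>R r + p" by (simp add: r_def)
 have r0: "ip r F = 0" if F: "F \<in> B" for F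
 proof -
  have FV: "F \<in> V" using B(2) F by blast
  have "ip p F = (\<Sum>E\<in>B. ip t E * ip E F)"
   unfolding p_def using B(2) FV by (intro ip_sum[where g = "%E. E"]) auto
  also have "... = (\<Sum>E\<in>B. if E = F then ip t E else 0)" using B(3) F by (intro sum.cong refl) auto
  finally have "ip p F = ip t F" using F B(1) by simp
  moreover have "ip t F = ip r F + ip p F" using add[OF rV pV FV] by (simp add: r_def)
  ultimately show ?thesis by simp
 qed
 show ?case
 proof (cases "r = 0")
  case True
  hence "t \<in> span B" using pB by (simp add: r_def)
  thus ?thesis using B by (intro exI[of _ B]) auto
 next
  case False
  define E where "E = (1 / sqrt (ip r r)) *\<^sub>R r"
  have rr: "ip r r > 0" using pos[OF rV False] .
  have EV: "E \<in> V" unfolding E_def by (rule subspace_scale[OF sub rV])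
  have EE: "ip E E = 1"
  proof -
   have "ip E E = (1 / sqrt (ip r r)) * ip r E" unfolding E_def using scale[OF rV EV] E_def by simp
   also have "ip r E = ip E r" by (rule sym[OF rV EV])
   also have "... = (1 / sqrt (ip r r)) * ip r r" unfolding E_def by (rule scale[OF rV rV])
   finally show ?thesis using rr by (simp add: field_simps)
  qed
  have EF: "ip E F = 0" "ip F E = 0" if F: "F \<in> B" for F
  proof -
   have FV: "F \<in> V" using B(2) F by blast
   show "ip E F = 0" unfolding E_def using scale[OF rV FV] r0[OF F] by simp
   thus "ip F E = 0" using sym[OF EV FV] by simp
  qed
  have "t \<in> span (insert E B)"
  proof -
   have "r = sqrt (ip r r) *\<^sub>R E" using rr by (simp add: E_def)
   hence "r \<in> span (insert E B)" by (metis span_scale span_base insertI1)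
   moreover have "p \<in> span (insert E B)" using pB span_mono[of B "insert E B"] by blast
   ultimately have "r + p \<in> span (insert E B)" by (rule span_add)
   thus ?thesis by (simp add: r_def)
  qed
  moreover have "T \<subseteq> span (insert E B)" using B(4) span_mono[of B "insert E B"] by blast
  moreover have "\<forall>F1\<in>insert E B. \<forall>F2\<in>insert E B. ip F1 F2 = (if F1 = F2 then 1 else 0)"
   using B(3) EE EF by auto
  ultimately show ?thesis using B EV by (intro exI[of _ "insert E B"]) auto
 qed
qed

lemma orthonormal_independent:
 assumes B: "finite B" "B \<subseteq> V" "\<And>E F. E \<in> B ==> F \<in> B ==> ip E F = (if E = F then 1 else 0)"
 shows "independent B"
proof (rule independent_if_scalars_zero[OF B(1)])
 fix u F assume 0: "(\<Sum>E\<in>B. u E *\<^sub>R E) = 0" and F: "F \<in> B"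
 have FV: "F \<in> V" using B(2) F by blast
 have "0 = ip (\<Sum>E\<in>B. u E *\<^sub>R E) F" using scale[OF FV FV, of 0] by (simp add: 0)
 also have "... = (\<Sum>E\<in>B. u E * ip E F)" using B(2) FV by (intro ip_sum[where g = "%E. E"]) auto
 also have "... = (\<Sum>E\<in>B. if E = F then u E else 0)" using B(3) F by (intro sum.cong refl) auto
 finally show "u F = 0" using F B(1) by simp
qed

end

subsection \<open>The Laplace-Beltrami operator\<close>

lemma fun_lincomb_apply:
 fixes g :: "'i => ('g => complex) => 'g => complex"
 shows "(\<Sum>i\<in>I. r i *\<^sub>R g i) f x = (\<Sum>i\<in>I. of_real (r i) * g i f x)"
 by (induction I rule: infinite_finite_induct) (simp_all add: scaleR_fun_def scaleR_conv_of_real)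

context compact_lie_group
begin

lemma lie_algebra_dirD: "X \<in> lie_algebra G A ==> \<exists>v. X = vf v \<and> (\<forall>f. smooth f \<longrightarrow> X f = dirD v f)"
 by (auto simp: lie_algebra_eq vf_def fun_eq_iff)

lemma lie_smooth: assumes "X \<in> lie_algebra G A" "smooth f" shows "smooth (X f)"
proof -
 obtain v where "X f = dirD v f" using lie_algebra_dirD[OF assms(1)] assms(2) by (elim exE conjE) (rule that, blast)
 thus ?thesis using smooth_dirD[OF assms(2)] by simp
qed

lemma lie_lincomb:
 assumes X: "X \<in> lie_algebra G A" and f: "\<And>i. i \<in> I ==> smooth (f i)"
 shows "X (%x. \<Sum>i\<in>I. c i * f i x) x = (\<Sum>i\<in>I. c i * X (f i) x)"
proof -
 obtain v where v: "\<And>f. smooth f ==> X f = dirD v f"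
  using lie_algebra_dirD[OF X] by (elim exE conjE) (rule that, blast)
 have "smooth (%x. \<Sum>i\<in>I. c i * f i x)" using f by (intro smooth_map_sum[OF atlas] smooth_scale)
 hence "X (%x. \<Sum>i\<in>I. c i * f i x) x = dirD v (%x. \<Sum>i\<in>I. c i * f i x) x" using v by simp
 also have "... = (\<Sum>i\<in>I. dirD v (%x. c i * f i x) x)" using f by (intro dirD_sum smooth_scale)
 also have "... = (\<Sum>i\<in>I. c i * X (f i) x)" using f v by (intro sum.cong refl) (simp add: dirD_scale)
 finally show ?thesis .
qed

lemma lie_left_translate:
 assumes "X \<in> lie_algebra G A" "smooth f" shows "X (%y. f (a \<otimes> y)) x = X f (a \<otimes> x)"
proof -
 obtain v where v: "\<And>f. smooth f ==> X f = dirD v f"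
  using lie_algebra_dirD[OF assms(1)] by (elim exE conjE) (rule that, blast)
 thus ?thesis using assms(2) smooth_left_translate[OF assms(2), of a] by (simp add: dirD_left_translate)
qed

lemma lie_cip:
 assumes "X \<in> lie_algebra G A" "smooth f" "smooth g" shows "cip (X f) g = - cip f (X g)"
proof -
 obtain v where v: "\<And>f. smooth f ==> X f = dirD v f"
  using lie_algebra_dirD[OF assms(1)] by (elim exE conjE) (rule that, blast)
 thus ?thesis using assms cip_dirD by simp
qed

lemma subspace_lie_algebra: "real_vector.subspace (lie_algebra G A)"
 unfolding lie_algebra_eq by (rule linear_subspace_image[OF linear_vf real_vector.subspace_UNIV])

lemma Ad_left_invariant_vf:
 "Ad G g (left_invariant_vf G A \<gamma>) = left_invariant_vf G A (%t. g \<otimes> \<gamma> t \<otimes> inv g)"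
proof (intro ext)
 fix f x
 have "smooth (%y. f (y \<otimes> inv g)) \<longleftrightarrow> smooth f"
  using smooth_right_translate[of f "inv g"] smooth_right_translate[of "%y. f (y \<otimes> inv g)" g] by (auto simp: m_assoc)
 thus "Ad G g (left_invariant_vf G A \<gamma>) f x = left_invariant_vf G A (%t. g \<otimes> \<gamma> t \<otimes> inv g) f x"
  by (simp add: Ad_def left_invariant_vf_def smooth_functions_iff m_assoc)
qed

lemma Ad_lie_algebra: assumes "X \<in> lie_algebra G A" shows "Ad G g X \<in> lie_algebra G A"
proof -
 obtain \<gamma> where \<gamma>: "X = left_invariant_vf G A \<gamma>" "one_parameter_subgroup G A \<gamma>"
  using assms by (auto simp: lie_algebra_def)
 have "smooth_map real_atlas A (%t. g \<otimes> \<gamma> t \<otimes> inv g)"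
  using \<gamma>(2) unfolding one_parameter_subgroup_def
  by (intro smooth_map_group_mult[OF smooth_atlas_std] smooth_map_const[OF smooth_atlas_std atlas]) auto
 hence "one_parameter_subgroup G A (%t. g \<otimes> \<gamma> t \<otimes> inv g)"
  using \<gamma>(2) unfolding one_parameter_subgroup_def by (simp add: m_assoc inv_solve_left)
 thus ?thesis unfolding \<gamma>(1) Ad_left_invariant_vf lie_algebra_def by blast
qed

lemma Ad_inv: "Ad G g (Ad G (inv g) X) = X"
 by (intro ext) (simp add: Ad_def m_assoc)

lemma linear_Ad: "linear (Ad G g)"
 by (rule linearI) (simp_all add: fun_eq_iff Ad_def scaleR_fun_def)

context
 fixes ip :: "'g vf => 'g vf => real"
 assumes kip: "killing_inner_product G A ip"
begin

lemma ip_axioms: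
 shows "\<And>X Y. X \<in> lie_algebra G A ==> Y \<in> lie_algebra G A ==> ip X Y = ip Y X"
  and "\<And>X Y Z. X \<in> lie_algebra G A ==> Y \<in> lie_algebra G A ==> Z \<in> lie_algebra G A ==> ip (X + Y) Z = ip X Z + ip Y Z"
  and "\<And>r X Y. X \<in> lie_algebra G A ==> Y \<in> lie_algebra G A ==> ip (r *\<^sub>R X) Y = r * ip X Y"
  and "\<And>X. X \<in> lie_algebra G A ==> X \<noteq> 0 ==> ip X X > 0"
  and "\<And>X Y. X \<in> lie_algebra G A ==> Y \<in> lie_algebra G A ==> ip (Ad G g X) (Ad G g Y) = ip X Y"
 using kip unfolding killing_inner_product_def carrier_UNIV by simp_all

lemma lie_inner_product: "subspace_inner_product ip (lie_algebra G A)"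
 using subspace_lie_algebra ip_axioms(1-4) by unfold_locales

definition ONB :: "'g vf set => bool" where
 "ONB B \<longleftrightarrow> finite B \<and> B \<subseteq> lie_algebra G A \<and> lie_algebra G A \<subseteq> span B \<and>
   (\<forall>E\<in>B. \<forall>F\<in>B. ip E F = (if E = F then 1 else 0))"

lemma ONB_expansion: "ONB B ==> X \<in> lie_algebra G A ==> X = (\<Sum>E\<in>B. ip X E *\<^sub>R E)"
 unfolding ONB_def by (intro subspace_inner_product.orthonormal_expansion[OF lie_inner_product]) auto

lemma ONB_apply:
 "ONB B ==> X \<in> lie_algebra G A ==> X f x = (\<Sum>E\<in>B. of_real (ip X E) * E f x)"
 unfolding fun_lincomb_apply[of "ip X" "%E. E" B f x, symmetric]
 by (rule arg_cong[where f = "%Y. Y f x", OF ONB_expansion])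

text \<open>The basis inside \<open>laplace_beltrami\<close> is selected by \<open>SOME\<close>; the
  Gram-Schmidt process shows that there is one to select. It is finite because it is independent and
  lies in the span of finitely many fields.\<close>

lemma ONB_laplace:
 obtains B where "ONB B" "\<And>f x. Lap G A ip f x = (\<Sum>E\<in>B. E (E f) x)"
proof -
 have fin: "finite (vf ` Basis)" by simp
 have sp: "lie_algebra G A = span (vf ` Basis)"
  unfolding lie_algebra_eq linear_span_image[OF linear_vf] by simp
 have "vf ` Basis \<subseteq> lie_algebra G A" unfolding lie_algebra_eq by blast
 from subspace_inner_product.orthonormal_basis_exists[OF lie_inner_product fin this]
 obtain B where B: "finite B" "B \<subseteq> lie_algebra G A" "\<forall>E\<in>B. \<forall>F\<in>B. ip E F = (if E = F then 1 else 0)"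
  "vf ` Basis \<subseteq> span B" by (elim exE conjE) (rule that)
 have "independent B" using B by (intro subspace_inner_product.orthonormal_independent[OF lie_inner_product]) auto
 moreover have "lie_algebra G A \<subseteq> span B" unfolding sp using B(4) by (rule real_vector.span_minimal[OF _ real_vector.subspace_span])
 ultimately have "orthonormal_basis ip (lie_algebra G A) B"
  using B unfolding orthonormal_basis_def is_basis_def by blast
 hence *: "orthonormal_basis ip (lie_algebra G A) (SOME B. orthonormal_basis ip (lie_algebra G A) B)"
  by (rule someI)
 define B' where "B' = (SOME B. orthonormal_basis ip (lie_algebra G A) B)"
 have B': "B' \<subseteq> lie_algebra G A" "independent B'" "lie_algebra G A \<subseteq> span B'"
  "\<forall>E\<in>B'. \<forall>F\<in>B'. ip E F = (if E = F then 1 else 0)"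
  using *[folded B'_def] unfolding orthonormal_basis_def is_basis_def by simp_all
 have "finite B'" using independent_span_bound[OF fin B'(2)] B'(1) sp by simp
 hence "ONB B'" using B' unfolding ONB_def by blast
 thus thesis by (rule that) (simp add: laplace_beltrami_def B'_def)
qed

text \<open>Each field E of B' is expanded in B twice; summing the products of the coefficients over
  B' gives the inner products of the members of B, and these remove the off-diagonal terms.\<close>

lemma laplace_ONB_independent:
 assumes B: "ONB B" and B': "ONB B'" and f: "smooth f"
 shows "(\<Sum>E\<in>B'. E (E f) x) = (\<Sum>E\<in>B. E (E f) x)"
proof -
 have fin: "finite B" "finite B'" and sub: "B \<subseteq> lie_algebra G A" "B' \<subseteq> lie_algebra G A"
  using B B' by (auto simp: ONB_def)
 have *: "E (E f) x = (\<Sum>F\<in>B. \<Sum>H\<in>B. of_real (ip E F * ip E H) * F (H f) x)" if E: "E \<in> lie_algebra G A" for E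
 proof -
  have "E f = (%x. \<Sum>H\<in>B. of_real (ip E H) * H f x)" by (rule ext) (rule ONB_apply[OF B E])
  hence EF: "F (E f) x = (\<Sum>H\<in>B. of_real (ip E H) * F (H f) x)" if "F \<in> B" for F
   using lie_lincomb[of F B "%H. H f" "%H. of_real (ip E H)" x] sub(1) that lie_smooth[OF _ f] by auto
  thus ?thesis
   unfolding ONB_apply[OF B E, of "E f" x]
   by (intro sum.cong refl) (simp only: EF sum_distrib_left mult.assoc of_real_mult)
 qed
 have P: "(\<Sum>E\<in>B'. ip E F * ip E H) = (if F = H then 1 else 0)" if FH: "F \<in> B" "H \<in> B" for F H
 proof -
  have V: "F \<in> lie_algebra G A" "H \<in> lie_algebra G A" using FH sub by auto
  have "ip F H = ip (\<Sum>E\<in>B'. ip F E *\<^sub>R E) H" by (rule arg_cong[where f = "%Y. ip Y H", OF ONB_expansion[OF B' V(1)]])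
  also have "... = (\<Sum>E\<in>B'. ip F E * ip E H)"
   using sub(2) by (intro subspace_inner_product.ip_sum[OF lie_inner_product _ V(2), where g = "%E. E"]) auto
  also have "... = (\<Sum>E\<in>B'. ip E F * ip E H)" using sub(2) V ip_axioms(1) by (intro sum.cong refl) auto
  finally show ?thesis using B FH by (auto simp: ONB_def)
 qed
 have "(\<Sum>E\<in>B'. E (E f) x) = (\<Sum>E\<in>B'. \<Sum>F\<in>B. \<Sum>H\<in>B. of_real (ip E F * ip E H) * F (H f) x)"
  using * sub(2) by (intro sum.cong refl) auto
 also have "... = (\<Sum>F\<in>B. \<Sum>H\<in>B. of_real (\<Sum>E\<in>B'. ip E F * ip E H) * F (H f) x)"
  unfolding of_real_sum sum_distrib_right sum.swap[of _ _ B'] ..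
 also have "... = (\<Sum>F\<in>B. \<Sum>H\<in>B. if F = H then F (H f) x else 0)"
  using P by (intro sum.cong refl) auto
 finally show ?thesis using fin(1) by simp
qed

text \<open>Right translation turns a left-invariant field E into its image under Ad, and Ad maps
  orthonormal bases to orthonormal bases because the inner product is invariant.\<close>

lemma laplace_right_translate:
 assumes f: "smooth f"
 shows "Lap G A ip (%y. f (y \<otimes> g)) x = Lap G A ip f (x \<otimes> g)"
proof -
 obtain B where B: "ONB B" and L: "\<And>f x. Lap G A ip f x = (\<Sum>E\<in>B. E (E f) x)"
  by (rule ONB_laplace) (rule that)
 let ?a = "Ad G (inv g)"
 have sub: "B \<subseteq> lie_algebra G A" using B by (simp add: ONB_def)
 have inv: "Ad G g (?a X) = X" "?a (Ad G g X) = X" for X using Ad_inv[of g X] Ad_inv[of "inv g" X] by simp_all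
 have inj: "inj_on ?a B" by (rule inj_on_inverseI[of B "Ad G g"]) (rule inv(1))
 have "ONB (?a ` B)"
  unfolding ONB_def
 proof (intro conjI ballI subsetI)
  show "finite (?a ` B)" using B by (simp add: ONB_def)
  show "X \<in> lie_algebra G A" if "X \<in> ?a ` B" for X using that sub Ad_lie_algebra by blast
  show "X \<in> span (?a ` B)" if "X \<in> lie_algebra G A" for X
  proof -
   have "Ad G g X \<in> span B" using Ad_lie_algebra[OF that] B by (auto simp: ONB_def)
   thus ?thesis unfolding linear_span_image[OF linear_Ad] using imageI[of _ _ ?a] inv(2)[of X] by fastforce
  qed
  show "ip E F = (if E = F then 1 else 0)" if EF: "E \<in> ?a ` B" "F \<in> ?a ` B" for E F
  proof -
   obtain E' F' where e: "E = ?a E'" "F = ?a F'" "E' \<in> B" "F' \<in> B" using EF by blast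
   hence "ip E F = ip E' F'" using ip_axioms(5) sub by auto
   moreover have "E = F \<longleftrightarrow> E' = F'" using e inj by (simp add: inj_on_eq_iff)
   ultimately show ?thesis using e B by (simp add: ONB_def)
  qed
 qed
 from laplace_ONB_independent[OF B this f, of "x \<otimes> g"]
 have "(\<Sum>E\<in>B. ?a E (?a E f) (x \<otimes> g)) = Lap G A ip f (x \<otimes> g)" by (simp add: sum.reindex[OF inj] L)
 moreover have "E (E (%y. f (y \<otimes> g))) x = ?a E (?a E f) (x \<otimes> g)" for E
  by (simp add: Ad_def m_assoc)
 ultimately show ?thesis by (simp add: L)
qed

lemma laplace_smooth: assumes f: "smooth f" shows "smooth (Lap G A ip f)"
proof -
 obtain B where B: "ONB B" and L: "\<And>f x. Lap G A ip f x = (\<Sum>E\<in>B. E (E f) x)"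
  by (rule ONB_laplace) (rule that)
 have "smooth (%x. \<Sum>E\<in>B. E (E f) x)"
  using B by (intro smooth_map_sum[OF atlas] lie_smooth[OF _ lie_smooth[OF _ f]]) (auto simp: ONB_def)
 thus ?thesis by (simp only: L[symmetric])
qed

lemma laplace_left_translate:
 assumes f: "smooth f"
 shows "Lap G A ip (%y. f (g \<otimes> y)) x = Lap G A ip f (g \<otimes> x)"
proof -
 obtain B where B: "ONB B" and L: "\<And>f x. Lap G A ip f x = (\<Sum>E\<in>B. E (E f) x)"
  by (rule ONB_laplace) (rule that)
 have "E (E (%y. f (g \<otimes> y))) x = E (E f) (g \<otimes> x)" if "E \<in> B" for E
 proof -
  have E: "E \<in> lie_algebra G A" using that B by (auto simp: ONB_def)
  have "E (%y. f (g \<otimes> y)) = (%y. E f (g \<otimes> y))" by (rule ext) (rule lie_left_translate[OF E f])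
  thus ?thesis using lie_left_translate[OF E lie_smooth[OF E f]] by simp
 qed
 thus ?thesis unfolding L by (intro sum.cong refl)
qed

lemma laplace_lincomb:
 assumes f: "\<And>i. i \<in> I ==> smooth (f i)"
 shows "Lap G A ip (%x. \<Sum>i\<in>I. c i * f i x) x = (\<Sum>i\<in>I. c i * Lap G A ip (f i) x)"
proof -
 obtain B where B: "ONB B" and L: "\<And>f x. Lap G A ip f x = (\<Sum>E\<in>B. E (E f) x)"
  by (rule ONB_laplace) (rule that)
 have "E (E (%x. \<Sum>i\<in>I. c i * f i x)) x = (\<Sum>i\<in>I. c i * E (E (f i)) x)" if "E \<in> B" for E
 proof -
  have E: "E \<in> lie_algebra G A" using that B by (auto simp: ONB_def)
  have "E (%x. \<Sum>i\<in>I. c i * f i x) = (%x. \<Sum>i\<in>I. c i * E (f i) x)" by (rule ext) (rule lie_lincomb[OF E f])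
  thus ?thesis using lie_lincomb[OF E lie_smooth[OF E f]] by simp
 qed
 thus ?thesis unfolding L sum_distrib_left sum.swap[of _ _ I] by (intro sum.cong refl)
qed

lemma laplace_cip:
 assumes f: "smooth f" and g: "smooth g"
 shows "cip (Lap G A ip f) g = cip f (Lap G A ip g)"
proof -
 obtain B where B: "ONB B" and L: "\<And>f. Lap G A ip f = (%x. \<Sum>E\<in>B. 1 * E (E f) x)"
  by (rule ONB_laplace) (rule that, assumption, rule ext, simp)
 have E: "E \<in> lie_algebra G A" if "E \<in> B" for E using that B by (auto simp: ONB_def)
 note s = smooth_cont[OF lie_smooth[OF E lie_smooth[OF E f]]] smooth_cont[OF lie_smooth[OF E lie_smooth[OF E g]]]
 have "cip (Lap G A ip f) g = (\<Sum>E\<in>B. 1 * cip (E (E f)) g)"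
  unfolding L using s by (intro cip_sum_left smooth_cont[OF g])
 also have "... = (\<Sum>E\<in>B. cnj 1 * cip f (E (E g)))"
  using lie_cip[OF E lie_smooth[OF E f] g] lie_cip[OF E f lie_smooth[OF E g]] by (intro sum.cong refl) auto
 also have "... = cip f (Lap G A ip g)"
  unfolding L using s by (intro cip_sum_right[symmetric] smooth_cont[OF f])
 finally show ?thesis .
qed

lemma lie_rep:
 assumes \<xi>: "irrep G d \<xi>" and E: "E \<in> lie_algebra G A" and ij: "i < d" "j < d"
 shows "E (coef \<xi> i j) x = (\<Sum>k<d. \<xi> x $$ (i, k) * E (coef \<xi> k j) \<one>)"
  and "E (coef \<xi> i j) \<one> = - cnj (E (coef \<xi> j i) \<one>)"
proof -
 obtain v where v: "\<And>f. smooth f ==> E f = dirD v f"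
  using lie_algebra_dirD[OF E] by (elim exE conjE) (rule that, blast)
 have *: "E (coef \<xi> i j) = dirD v (coef \<xi> i j)" if "i < d" "j < d" for i j
  using v irreducible_smooth[OF \<xi> that] by simp
 show "E (coef \<xi> i j) x = (\<Sum>k<d. \<xi> x $$ (i, k) * E (coef \<xi> k j) \<one>)"
  using dirD_rep[OF \<xi> ij, of v x] * ij by simp
 show "E (coef \<xi> i j) \<one> = - cnj (E (coef \<xi> j i) \<one>)"
  using dirD_rep_skew[OF \<xi> ij, of v] * ij by simp
qed

text \<open>Since the operator commutes with translations on both sides, its values on the
  coefficients at the identity form a matrix that commutes with \<xi>, hence a scalar by Schur. The
  scalar is minus a sum of squares of first derivatives, because these are skew-Hermitian at the
  identity: so \<nu> >= 0, and the contribution of each single field is at most \<nu>.\<close>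

lemma laplace_rep:
 assumes \<xi>: "irrep G d \<xi>"
 defines "\<nu> \<equiv> laplace_eigenvalue G A ip \<xi>"
 shows "i < d ==> j < d ==> Lap G A ip (coef \<xi> i j) x = - of_real \<nu> * \<xi> x $$ (i, j)"
  and "\<nu> \<ge> 0"
  and "ONB B ==> E \<in> B ==> j < d ==> (\<Sum>k<d. (norm (E (coef \<xi> k j) \<one>))\<^sup>2) \<le> \<nu>"
proof -
 note u = irreducible_unitary[OF \<xi>] and cx = rep_carrier[OF irreducible_unitary[OF \<xi>]]
 note sm = irreducible_smooth[OF \<xi>]
 have d: "0 < d" using \<xi> by (simp add: irreducible_unitary_rep_def)
 let ?L = "Lap G A ip"
 define C where "C = Matrix.mat d d (%(i, j). ?L (coef \<xi> i j) \<one>)"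
 have C: "C \<in> carrier_mat d d" by (simp add: C_def)
 have l: "?L (coef \<xi> i j) x = (\<Sum>k<d. \<xi> x $$ (i, k) * C $$ (k, j))" if ij: "i < d" "j < d" for i j x
 proof -
  have "?L (coef \<xi> i j) x = ?L (%y. \<Sum>k<d. \<xi> x $$ (i, k) * \<xi> y $$ (k, j)) \<one>"
   using laplace_left_translate[OF sm[OF ij], of x "\<one>"] by (simp add: rep_mult_index[OF u ij])
  also have "... = (\<Sum>k<d. \<xi> x $$ (i, k) * C $$ (k, j))"
   using ij sm by (subst laplace_lincomb) (simp_all add: C_def)
  finally show ?thesis .
 qed
 have r: "?L (coef \<xi> i j) x = (\<Sum>k<d. C $$ (i, k) * \<xi> x $$ (k, j))" if ij: "i < d" "j < d" for i j x
 proof -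
  have "?L (coef \<xi> i j) x = ?L (%y. \<Sum>k<d. \<xi> x $$ (k, j) * \<xi> y $$ (i, k)) \<one>"
   using laplace_right_translate[OF sm[OF ij], of x "\<one>"] by (simp add: rep_mult_index[OF u ij] mult.commute)
  also have "... = (\<Sum>k<d. \<xi> x $$ (k, j) * C $$ (i, k))"
   using ij sm by (subst laplace_lincomb) (simp_all add: C_def)
  finally show ?thesis by (simp add: mult.commute)
 qed
 have "C * \<xi> x = \<xi> x * C" for x
 proof (rule eq_matI)
  fix i j assume ij: "i < dim_row (\<xi> x * C)" "j < dim_col (\<xi> x * C)"
  hence ij: "i < d" "j < d" using cx[of x] C by auto
  show "(C * \<xi> x) $$ (i, j) = (\<xi> x * C) $$ (i, j)"
   using mat_mult_index[OF C cx ij] mat_mult_index[OF cx C ij] l[OF ij] r[OF ij] by simp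
 qed (use cx[of x] C in auto)
 from Schur_scalar[OF \<xi> C this] obtain c where c: "C = c \<cdot>\<^sub>m 1\<^sub>m d" by (elim exE)
 have lc: "?L (coef \<xi> i j) x = c * \<xi> x $$ (i, j)" if ij: "i < d" "j < d" for i j x
 proof -
  have "?L (coef \<xi> i j) x = (\<Sum>k<d. if k = j then c * \<xi> x $$ (i, k) else 0)"
   unfolding l[OF ij] c using ij by (intro sum.cong refl) auto
  thus ?thesis using ij by simp
 qed
 have pos: "- c = of_real (\<Sum>E\<in>B. \<Sum>k<d. (norm (E (coef \<xi> k j) \<one>))\<^sup>2)" if B: "ONB B" and j: "j < d" for B j
 proof -
  obtain B0 where B0: "ONB B0" and L: "\<And>f x. ?L f x = (\<Sum>E\<in>B0. E (E f) x)"
   by (rule ONB_laplace) (rule that)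
  have "c = ?L (coef \<xi> j j) \<one>" using lc[OF j j, of "\<one>"] rep_one_index[OF u j j] by simp
  also have "... = (\<Sum>E\<in>B. E (E (coef \<xi> j j)) \<one>)"
   unfolding L by (rule laplace_ONB_independent[OF B B0 sm[OF j j]])
  also have "... = (\<Sum>E\<in>B. \<Sum>k<d. - of_real ((norm (E (coef \<xi> k j) \<one>))\<^sup>2))"
  proof (rule sum.cong[OF refl])
   fix E assume "E \<in> B"
   hence E: "E \<in> lie_algebra G A" using B by (auto simp: ONB_def)
   have "E (coef \<xi> j j) = (%x. \<Sum>k<d. E (coef \<xi> k j) \<one> * \<xi> x $$ (j, k))"
    by (rule ext) (simp add: lie_rep(1)[OF \<xi> E j j] mult.commute)
   hence "E (E (coef \<xi> j j)) \<one> = (\<Sum>k<d. E (coef \<xi> k j) \<one> * E (coef \<xi> j k) \<one>)"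
    using lie_lincomb[OF E, of "{..<d}" "%k x. \<xi> x $$ (j, k)" "%k. E (coef \<xi> k j) \<one>" "\<one>"] sm j by simp
   also have "... = (\<Sum>k<d. - of_real ((norm (E (coef \<xi> k j) \<one>))\<^sup>2))"
    using lie_rep(2)[OF \<xi> E j] by (intro sum.cong refl) (simp only: complex_norm_square, simp)
   finally show "E (E (coef \<xi> j j)) \<one> = (\<Sum>k<d. - of_real ((norm (E (coef \<xi> k j) \<one>))\<^sup>2))" .
  qed
  finally show ?thesis by (simp add: sum_negf)
 qed
 obtain B1 where B1: "ONB B1" by (rule ONB_laplace) (rule that)
 have c\<nu>: "c = - of_real \<nu>"
 proof -
  define r where "r = (\<Sum>E\<in>B1. \<Sum>k<d. (norm (E (coef \<xi> k 0) \<one>))\<^sup>2)"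
  have c: "- c = of_real r" using pos[OF B1 d] by (simp add: r_def)
  have "laplace_eigenvalue G A ip \<xi> = r"
   unfolding laplace_eigenvalue_def rep_dim_eq[OF u]
  proof (rule the_equality)
   show "\<forall>i<d. \<forall>j<d. \<forall>x\<in>carrier G. - ?L (coef \<xi> i j) x = of_real r * \<xi> x $$ (i, j)"
    by (simp add: lc c[symmetric])
   fix r' assume "\<forall>i<d. \<forall>j<d. \<forall>x\<in>carrier G. - ?L (coef \<xi> i j) x = of_real r' * \<xi> x $$ (i, j)"
   hence "- ?L (coef \<xi> 0 0) \<one> = of_real r' * \<xi> \<one> $$ (0, 0)" using d by simp
   hence "- c = of_real r'" using lc[OF d d, of "\<one>"] rep_one_index[OF u d d] by simp
   thus "r' = r" using c by (simp add: of_real_eq_iff)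
  qed
  thus ?thesis unfolding \<nu>_def by (simp flip: c)
 qed
 show "?L (coef \<xi> i j) x = - of_real \<nu> * \<xi> x $$ (i, j)" if "i < d" "j < d" using lc[OF that] c\<nu> by simp
 have \<nu>: "\<nu> = (\<Sum>E\<in>B. \<Sum>k<d. (norm (E (coef \<xi> k j) \<one>))\<^sup>2)" if "ONB B" "j < d" for B j
  using pos[OF that] c\<nu> by (simp only: minus_minus of_real_eq_iff)
 show "\<nu> \<ge> 0" unfolding \<nu>[OF B1 d] by (intro sum_nonneg) simp
 show "(\<Sum>k<d. (norm (E (coef \<xi> k j) \<one>))\<^sup>2) \<le> \<nu>" if "ONB B" "E \<in> B" "j < d"
  unfolding \<nu>[OF that(1,3)] using that(1,2) by (intro member_le_sum) (auto simp: ONB_def intro!: sum_nonneg)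
qed

text \<open>A derivative of a coefficient at x is the product of a row of \<xi> x, of norm 1, with a
  column of derivatives at the identity, whose square norm is at most the eigenvalue. The constant K
  compares |v| with the coordinates of the field in an orthonormal basis.\<close>

lemma dirD_rep_bound:
 obtains K where "K > 0" "\<And>d \<xi> v i j x. irrep G d \<xi> ==> i < d ==> j < d ==>
  norm (dirD v (coef \<xi> i j) x) \<le> K * norm v * sqrt (laplace_eigenvalue G A ip \<xi>)"
proof -
 obtain B where B: "ONB B" by (rule ONB_laplace) (rule that)
 have fin: "finite B" and sub: "\<And>E. E \<in> B ==> E \<in> lie_algebra G A" using B by (auto simp: ONB_def)
 have V: "vf v \<in> lie_algebra G A" for v by (simp add: lie_algebra_eq)
 have "bounded_linear (%v. ip (vf v) E)" if "E \<in> B" for E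
  using V sub[OF that]
  by (intro linear_conv_bounded_linear[THEN iffD1] linearI) (simp_all only: vf_add vf_scale ip_axioms(2,3) real_scaleR_def)
 from bounded_linear.pos_bounded[OF this] have "\<forall>E\<in>B. \<exists>k>0. \<forall>v. \<bar>ip (vf v) E\<bar> \<le> norm v * k" by simp
 from bchoice[OF this] obtain k where k: "\<And>E v. E \<in> B ==> \<bar>ip (vf v) E\<bar> \<le> norm v * k E" "\<And>E. E \<in> B ==> k E > 0"
  by (elim exE) (rule that, blast+)
 show thesis
 proof (rule that[of "sum k B + 1"])
  show "sum k B + 1 > 0" using sum_nonneg[of B k] k(2) by (simp add: less_imp_le add_nonneg_pos)
  fix d \<xi> v i j x assume \<xi>: "irrep G d \<xi>" and ij: "i < d" "j < d"
  let ?s = "sqrt (laplace_eigenvalue G A ip \<xi>)"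
  have s0: "?s \<ge> 0" using laplace_rep(2)[OF \<xi>] by simp
  have E: "norm (E (coef \<xi> i j) x) \<le> ?s" if E: "E \<in> B" for E
  proof -
   have "norm (E (coef \<xi> i j) x) \<le> (\<Sum>k<d. \<bar>norm (\<xi> x $$ (i, k))\<bar> * \<bar>norm (E (coef \<xi> k j) \<one>)\<bar>)"
    unfolding lie_rep(1)[OF \<xi> sub[OF E] ij, of x] by (rule order.trans[OF norm_sum]) (simp add: norm_mult)
   also have "... \<le> L2_set (%k. norm (\<xi> x $$ (i, k))) {..<d} * L2_set (%k. norm (E (coef \<xi> k j) \<one>)) {..<d}"
    by (rule L2_set_mult_ineq)
   also have "... \<le> 1 * ?s"
    using rep_row_norm[OF irreducible_unitary[OF \<xi>] ij(1), of x] laplace_rep(3)[OF \<xi> B E ij(2)]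
    by (intro mult_mono) (auto simp: L2_set_def intro: sum_nonneg)
   finally show ?thesis by simp
  qed
  have "norm (dirD v (coef \<xi> i j) x) = norm (vf v (coef \<xi> i j) x)"
   using irreducible_smooth[OF \<xi> ij] by (simp add: vf_def)
  also have "... \<le> (\<Sum>E\<in>B. \<bar>ip (vf v) E\<bar> * norm (E (coef \<xi> i j) x))"
   unfolding ONB_apply[OF B V, of v _ x] by (rule order.trans[OF norm_sum]) (simp add: norm_mult)
  also have "... \<le> (\<Sum>E\<in>B. (norm v * k E) * ?s)"
   using k E by (intro sum_mono mult_mono) (auto simp: less_imp_le)
  also have "... = sum k B * norm v * ?s" by (simp add: sum_distrib_left sum_distrib_right ac_simps)
  also have "... \<le> (sum k B + 1) * norm v * ?s" using s0 by (intro mult_right_mono) auto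
  finally show "norm (dirD v (coef \<xi> i j) x) \<le> (sum k B + 1) * norm v * ?s" .
 qed
qed

end

end

subsection \<open>Growth of the unitary dual\<close>

lemma smooth_on_derivative_bound:
 fixes f :: "'a::euclidean_space => 'b::real_normed_vector"
 assumes f: "smooth_on S f" and K: "compact K" "K \<subseteq> S"
 obtains C where "C > 0" "\<And>p v. p \<in> K ==> norm (frechet_derivative f (at p) v) \<le> C * norm v"
proof -
 have "bounded ((%p. frechet_derivative f (at p) b) ` K)" for b
  by (rule compact_imp_bounded[OF compact_continuous_image[OF continuous_on_subset[OF
   smooth_on_continuous[OF smooth_on_frechet_derivative[OF f]] K(2)] K(1)]])
 hence "\<forall>b. \<exists>c. \<forall>p\<in>K. norm (frechet_derivative f (at p) b) \<le> c" unfolding bounded_iff by simp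
 from choice[OF this] obtain c where "\<forall>b. \<forall>p\<in>K. norm (frechet_derivative f (at p) b) \<le> c b" by (elim exE) (rule that)
 hence c: "norm (frechet_derivative f (at p) b) \<le> c b" if "p \<in> K" for b p using that by simp
 define C where "C = (\<Sum>b\<in>Basis. \<bar>c b\<bar>)"
 have C: "C \<ge> 0" unfolding C_def by (intro sum_nonneg) simp
 show thesis
 proof (rule that[of "C + 1"])
  fix p v assume p: "p \<in> K"
  have lin: "linear (frechet_derivative f (at p))"
   using has_derivative_linear[OF smooth_on_has_derivative[OF f subsetD[OF K(2) p]]] .
  have "norm (frechet_derivative f (at p) v) = norm (\<Sum>b\<in>Basis. inner v b *\<^sub>R frechet_derivative f (at p) b)"
   by (simp add: linear_sum[OF lin, symmetric] linear_cmul[OF lin, symmetric] euclidean_representation)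
  also have "... \<le> (\<Sum>b\<in>Basis. norm v * \<bar>c b\<bar>)"
  proof (rule order.trans[OF norm_sum sum_mono])
   fix b :: 'a assume "b \<in> Basis"
   have "norm (frechet_derivative f (at p) b) \<le> \<bar>c b\<bar>" using c[OF p, of b] by linarith
   thus "norm (inner v b *\<^sub>R frechet_derivative f (at p) b) \<le> norm v * \<bar>c b\<bar>"
    using Basis_le_norm[OF \<open>b \<in> Basis\<close>, of v] by (simp add: mult_mono)
  qed
  also have "... = C * norm v" by (simp add: C_def sum_distrib_left mult.commute)
  also have "... \<le> (C + 1) * norm v" by (simp add: mult_right_mono)
  finally show "norm (frechet_derivative f (at p) v) \<le> (C + 1) * norm v" .
 qed (use C in simp)
qed

lemma grid_cover:
 fixes a :: "'e::euclidean_space" and r e :: real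
 assumes r: "r > 0" and e: "0 < e" "e \<le> 1"
 obtains Y where "finite Y" "card Y \<le> ((2 * r * DIM('e) + 5) / e) ^ DIM('e)"
  "\<And>y. y \<in> cball a r ==> \<exists>z\<in>Y. norm (z - y) \<le> e"
proof -
 \<comment> \<open>Each coordinate is off by at most h, and the DIM('e) errors add up to e.\<close>
 define h where "h = e / DIM('e)"
 have h: "h > 0" using e by (simp add: h_def)
 define N where "N = \<lceil>r / h\<rceil> + 1"
 have N0: "N \<ge> 0" using ceiling_mono[of 0 "r / h"] r h by (simp add: N_def)
 let ?I = "Basis \<rightarrow>\<^sub>E {-N..N} :: ('e => int) set"
 let ?z = "%m :: 'e => int. a + (\<Sum>b\<in>Basis. (h * of_int (m b)) *\<^sub>R b)"
 show thesis
 proof (rule that[of "?z ` ?I"])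
  have fin: "finite ?I" by (intro finite_PiE) auto
  thus "finite (?z ` ?I)" by simp
  have "card (?z ` ?I) \<le> card ?I" by (rule card_image_le[OF fin])
  also have "card ?I = nat (2 * N + 1) ^ DIM('e)" using N0 by (simp add: card_PiE algebra_simps)
  finally have "real (card (?z ` ?I)) \<le> real (nat (2 * N + 1) ^ DIM('e))" by (simp only: of_nat_le_iff)
  also have "... = (2 * of_int N + 1) ^ DIM('e)" using N0 by simp
  also have "... \<le> ((2 * r * DIM('e) + 5) / e) ^ DIM('e)"
  proof (rule power_mono)
   \<comment> \<open>There are 2 N + 1 nodes per axis with N <= r / h + 2; together with e <= 1 this
     gives the constants 2 and 5.\<close>
   have "of_int N \<le> r * DIM('e) / e + 2" unfolding N_def h_def by simp linarith
   hence "(2 * of_int N + 1) * e \<le> (2 * (r * DIM('e) / e + 2) + 1) * e" using e by (intro mult_right_mono) auto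
   also have "... = 2 * r * DIM('e) + 5 * e" using e by (simp add: field_simps)
   also have "... \<le> 2 * r * DIM('e) + 5" using e by simp
   finally show "2 * of_int N + 1 \<le> (2 * r * DIM('e) + 5) / e" using e by (simp add: field_simps)
  qed (use N0 in simp)
  finally show "card (?z ` ?I) \<le> ((2 * r * DIM('e) + 5) / e) ^ DIM('e)" .
  fix y assume y: "y \<in> cball a r"
  define m where "m = (\<lambda>b\<in>Basis. \<lfloor>inner (y - a) b / h\<rfloor>)"
  have m: "\<bar>inner (y - a) b - h * of_int (m b)\<bar> \<le> h" if b: "b \<in> Basis" for b
  proof -
   have "\<bar>inner (y - a) b / h - of_int (m b)\<bar> \<le> 1" unfolding m_def using b by simp linarith
   hence "h * \<bar>inner (y - a) b / h - of_int (m b)\<bar> \<le> h * 1" using h by (intro mult_left_mono) auto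
   moreover have "inner (y - a) b - h * of_int (m b) = h * (inner (y - a) b / h - of_int (m b))"
    using h by (simp add: right_diff_distrib)
   ultimately show ?thesis using h by (simp only: abs_mult)
  qed
  have mI: "m \<in> ?I"
  proof (rule PiE_I)
   fix b :: 'e assume b: "b \<in> Basis"
   have "\<bar>inner (y - a) b\<bar> \<le> r" using Basis_le_norm[OF b, of "y - a"] y by (simp add: dist_norm norm_minus_commute)
   hence "\<bar>inner (y - a) b / h\<bar> \<le> r / h" using h by (simp add: divide_right_mono)
   moreover have mb: "m b = \<lfloor>inner (y - a) b / h\<rfloor>" using b by (simp add: m_def)
   ultimately have "real_of_int (m b) \<le> of_int N \<and> - of_int N \<le> real_of_int (m b)"
    using of_int_floor_le[of "inner (y - a) b / h"] real_of_int_floor_gt_diff_one[of "inner (y - a) b / h"]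
     le_of_int_ceiling[of "r / h"] unfolding mb N_def of_int_add of_int_1 by (intro conjI) argo+
   thus "m b \<in> {-N..N}" by (simp flip: of_int_minus)
  qed (simp add: m_def)
  have "norm (?z m - y) \<le> e"
  proof -
   have "?z m - y = (\<Sum>b\<in>Basis. (h * of_int (m b) - inner (y - a) b) *\<^sub>R b)"
    unfolding scaleR_diff_left sum_subtractf euclidean_representation by simp
   also have "norm ... \<le> (\<Sum>b\<in>(Basis :: 'e set). h)"
   proof (rule order.trans[OF norm_sum sum_mono])
    fix b :: 'e assume b: "b \<in> Basis"
    show "norm ((h * of_int (m b) - inner (y - a) b) *\<^sub>R b) \<le> h"
     using m[OF b] b by (simp add: abs_minus_commute)
   qed
   also have "... = e" by (simp add: h_def)
   finally show ?thesis .
  qed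
  thus "\<exists>z\<in>?z ` ?I. norm (z - y) \<le> e" by (rule bexI[OF _ imageI[OF mI]])
 qed
qed

section \<open>Means of small bumps at the identity\<close>

context compact_lie_group
begin

text \<open>Everything is read off from the smooth map (y, z) -> \<phi>0 (inv (\<psi>0 y) \<otimes>
  \<psi>0 z), which is constant on the diagonal. The Lipschitz bound compares quotients in the group
  with differences in the chart; the last property turns a derivative in the chart at y into a
  left-invariant derivative in a direction of comparable length.\<close>

lemma chart_division:
 obtains r K where "r > 0" "K > 0" "cball y0 r \<subseteq> \<phi>0 ` U0"
  "\<And>y z. y \<in> cball y0 r ==> z \<in> cball y0 r ==> inv (\<psi>0 y) \<otimes> \<psi>0 z \<in> U0"
  "\<And>y z. y \<in> cball y0 r ==> z \<in> cball y0 r ==> norm (\<phi>0 (inv (\<psi>0 y) \<otimes> \<psi>0 z) - y0) \<le> K * norm (z - y)"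
  "\<And>y f. y \<in> ball y0 r ==> smooth f ==> \<exists>D. (\<forall>w. norm (D w) \<le> K * norm w) \<and>
   ((%z. f (\<psi>0 z)) has_derivative (%w. dirD (D w) f (\<psi>0 y))) (at y)"
proof -
 note M = smooth_atlas_prod[OF atlas atlas]
 let ?m = "%p. inv (fst p) \<otimes> snd p"
 let ?S = "map_prod \<phi>0 \<phi>0 ` (U0 \<times> U0 \<inter> ?m -` U0)"
 define \<theta> where "\<theta> = (%p. \<phi>0 (inv (\<psi>0 (fst p)) \<otimes> \<psi>0 (snd p)))"
 have m: "smooth_map (prod_atlas A A) A ?m"
  by (rule smooth_map_group_mult[OF M smooth_map_group_inv[OF M smooth_map_fst[OF atlas atlas]] smooth_map_snd[OF atlas atlas]])
 have ch: "(U0 \<times> U0, map_prod \<phi>0 \<phi>0) \<in> prod_atlas A A" using base_chart(1) unfolding prod_atlas_def by blast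
 have S: "open ?S"
  by (rule open_chart_image[OF M ch]) (use open_vimage[OF base(1) smooth_map_continuous[OF m]] in simp)
 have inS: "fst p \<in> \<phi>0 ` U0" "snd p \<in> \<phi>0 ` U0" "inv (\<psi>0 (fst p)) \<otimes> \<psi>0 (snd p) \<in> U0" if "p \<in> ?S" for p
  using that by (auto simp: psi0)
 have "smooth_on ?S (\<phi>0 \<circ> ?m \<circ> inv_into (U0 \<times> U0) (map_prod \<phi>0 \<phi>0))"
  using smooth_mapD[OF m ch base_chart(1)] .
 moreover have "(\<phi>0 \<circ> ?m \<circ> inv_into (U0 \<times> U0) (map_prod \<phi>0 \<phi>0)) p = \<theta> p" if p: "p \<in> ?S" for p
  using inv_into_map_prod[OF base(3) base(3) inS(1,2)[OF p]] by (simp add: \<theta>_def \<psi>0_def)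
 ultimately have sm: "smooth_on ?S \<theta>" by (rule smooth_on_cong[OF S, THEN iffD1, rotated])
 have "(\<one>, \<one>) \<in> U0 \<times> U0 \<inter> ?m -` U0" using base_chart(2) by simp
 hence "map_prod \<phi>0 \<phi>0 (\<one>, \<one>) \<in> ?S" by (rule imageI)
 hence "(y0, y0) \<in> ?S" by (simp add: y0_def)
 from open_contains_cball_eq[OF S, rule_format, THEN iffD1, OF this]
 obtain R where R: "R > 0" "cball (y0, y0) R \<subseteq> ?S" by (elim exE conjE) (rule that)
 \<comment> \<open>The distance in the product space is at most the sum of the distances of the two
   components.\<close>
 define r where "r = R / 2"
 have sub: "cball y0 r \<times> cball y0 r \<subseteq> ?S"
 proof (rule order.trans[OF subsetI R(2)])
  fix p assume "p \<in> cball y0 r \<times> cball y0 r"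
  hence "dist y0 (fst p) \<le> r" "dist y0 (snd p) \<le> r" by auto
  hence "dist (y0, y0) p \<le> r + r"
   using sqrt_sum_squares_le_sum_abs[of "dist y0 (fst p)" "dist y0 (snd p)"] by (simp add: dist_prod_def)
  thus "p \<in> cball (y0, y0) R" by (simp add: r_def)
 qed
 have in2: "(y, z) \<in> ?S" if "y \<in> cball y0 r" "z \<in> cball y0 r" for y z using sub that by blast
 obtain K where K: "K > 0" "\<And>p v. p \<in> cball y0 r \<times> cball y0 r ==> norm (frechet_derivative \<theta> (at p) v) \<le> K * norm v"
  by (rule smooth_on_derivative_bound[OF sm compact_Times[OF compact_cball compact_cball] sub]) (rule that)
 have D: "((%z. \<theta> (y, z)) has_derivative (%w. frechet_derivative \<theta> (at (y, z)) (0, w))) (at z)"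
  if "y \<in> cball y0 r" "z \<in> cball y0 r" for y z
  by (rule has_derivative_compose[of "%z. (y, z)" _ z _ \<theta>, OF _ smooth_on_has_derivative[OF sm in2[OF that]]])
   (intro derivative_intros)
 have DK: "norm (frechet_derivative \<theta> (at (y, z)) (0, w)) \<le> K * norm w" if "y \<in> cball y0 r" "z \<in> cball y0 r" for y z w
  using K(2)[of "(y, z)" "(0, w)"] that by simp
 have \<theta>0: "\<theta> (y, y) = y0" if "y \<in> cball y0 r" for y by (simp add: \<theta>_def y0_def)
 have r: "r > 0" using R by (simp add: r_def)
 show thesis
 proof (rule that[OF r K(1)])
  show "cball y0 r \<subseteq> \<phi>0 ` U0" using inS(1)[OF in2] by auto
  fix y z assume y: "y \<in> cball y0 r"
  show "inv (\<psi>0 y) \<otimes> \<psi>0 z \<in> U0" if "z \<in> cball y0 r" using inS(3)[OF in2[OF y that]] by simp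
  have "norm (\<theta> (y, z) - \<theta> (y, y)) \<le> K * norm (z - y)" if z: "z \<in> cball y0 r"
   using D[OF y] DK[OF y] z y
   by (intro differentiable_bound[OF convex_cball has_derivative_at_withinI onorm_bound]) (use K in auto)
  thus "norm (\<phi>0 (inv (\<psi>0 y) \<otimes> \<psi>0 z) - y0) \<le> K * norm (z - y)" if "z \<in> cball y0 r"
   using that y \<theta>0 by (simp add: \<theta>_def)
 next
  fix y f assume y: "y \<in> ball y0 r" and f: "smooth f"
  hence yc: "y \<in> cball y0 r" by simp
  have "((%u. f (\<psi>0 y \<otimes> \<psi>0 u)) has_derivative (%v. dirD v f (\<psi>0 y))) (at (\<theta> (y, y)))"
   unfolding \<theta>0[OF yc] by (rule has_derivative_dirD[OF f])
  from has_derivative_compose[OF D[OF yc yc] this]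
  have "((%z. f (\<psi>0 z)) has_derivative (%w. dirD (frechet_derivative \<theta> (at (y, y)) (0, w)) f (\<psi>0 y))) (at y)"
  proof (rule has_derivative_transform_within_open[OF _ open_ball y])
   fix z assume "z \<in> ball y0 r"
   hence "(y, z) \<in> ?S" using in2[OF yc] by simp
   from inS(3)[OF this] show "f (\<psi>0 y \<otimes> \<psi>0 (\<theta> (y, z))) = f (\<psi>0 z)"
    by (simp add: \<theta>_def psi0(2) m_assoc[symmetric])
  qed
  thus "\<exists>D. (\<forall>w. norm (D w) \<le> K * norm w) \<and>
    ((%z. f (\<psi>0 z)) has_derivative (%w. dirD (D w) f (\<psi>0 y))) (at y)"
   using DK[OF yc yc] by (intro exI[of _ "%w. frechet_derivative \<theta> (at (y, y)) (0, w)"]) blast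
 qed
qed

text \<open>A bump of width e at the identity. Only the mean and Bessel's inequality are applied to
  it, so a piecewise linear profile serves.\<close>

definition tent :: "real => 'g => real" where
 "tent e x = (if x \<in> U0 then max 0 (1 - norm (\<phi>0 x - y0) / e) else 0)"

lemma tent_bounds: "e > 0 ==> 0 \<le> tent e x" "e > 0 ==> tent e x \<le> 1"
 "e > 0 ==> tent e x \<noteq> 0 ==> x \<in> U0 \<and> norm (\<phi>0 x - y0) < e" "tent e \<one> = 1"
 using base_chart(2) by (auto simp: tent_def y0_def max_def field_simps split: if_splits)

lemma continuous_on_tent:
 assumes e: "e > 0" "cball y0 e \<subseteq> \<phi>0 ` U0" shows "cont (tent e)"
proof -
 let ?K = "\<psi>0 ` cball y0 e"
 have "continuous_on (cball y0 e) \<psi>0" using base(5) e(2) by (auto simp: \<psi>0_def intro: continuous_on_subset)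
 hence K: "closed ?K" by (intro compact_imp_closed compact_continuous_image compact_cball)
 have "continuous_on U0 (%x. max 0 (1 - norm (\<phi>0 x - y0) / e))"
  using base(4) e(1) by (intro continuous_intros) auto
 hence 1: "continuous_on U0 (tent e)" by (rule continuous_on_eq) (simp add: tent_def)
 have "x \<in> ?K" if "tent e x \<noteq> 0" for x
 proof -
  from tent_bounds(3)[OF e(1) that] have "x \<in> U0" "\<phi>0 x \<in> cball y0 e" by (simp_all add: dist_norm norm_minus_commute)
  thus ?thesis using psi0(2)[of x] by (metis imageI)
 qed
 hence "continuous_on (- ?K) (tent e)" by (intro continuous_on_eq[OF continuous_on_const[of _ 0]]) auto
 from continuous_on_open_Un[OF base(1) _ 1 this] K have "continuous_on (U0 \<union> - ?K) (tent e)" by auto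
 moreover have "U0 \<union> - ?K = UNIV" using e(2) psi0(4) by auto
 ultimately show ?thesis by simp
qed

text \<open>Covering replaces a comparison with Lebesgue measure: about e^(-DIM('e)) right
  translates of the narrow tent, placed at the nodes of a grid in the chart, dominate half of a
  fixed bump \<beta>. All translates have the same mean, so it is at least of the order of
  e^DIM('e).\<close>

lemma mean_tent_lower_bound:
 obtains r C where "r > 0" "cball y0 r \<subseteq> \<phi>0 ` U0" "C > 0"
  "\<And>e. 0 < e ==> e \<le> r ==> e \<le> 1 ==> mean (tent e) \<ge> C * e ^ DIM('e)"
proof -
 obtain r K where r: "r > 0" and K: "K > 0" and sub: "cball y0 r \<subseteq> \<phi>0 ` U0"
  and U: "\<And>y z. y \<in> cball y0 r ==> z \<in> cball y0 r ==> inv (\<psi>0 y) \<otimes> \<psi>0 z \<in> U0"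
  and L: "\<And>y z. y \<in> cball y0 r ==> z \<in> cball y0 r ==> norm (\<phi>0 (inv (\<psi>0 y) \<otimes> \<psi>0 z) - y0) \<le> K * norm (z - y)"
  by (rule chart_division) (rule that)
 \<comment> \<open>The inverse makes x = inv (\<psi>0 y) on the support, so that translating x by
   \<psi>0 z gives a quotient to which the Lipschitz bound applies.\<close>
 define \<beta> where "\<beta> = (%x. tent (r / 2) (inv x))"
 have ct: "cont (tent e)" if "0 < e" "e \<le> r" for e
  using that sub by (intro continuous_on_tent order.trans[OF _ sub]) auto
 have c\<beta>: "cont \<beta>"
  unfolding \<beta>_def by (rule continuous_on_compose2[OF ct continuous_inv]) (use r in auto)
 have m\<beta>: "mean \<beta> > 0"
  by (rule mean_pos[OF c\<beta>, of "\<one>"]) (use r tent_bounds in \<open>auto simp: \<beta>_def\<close>)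
 \<comment> \<open>If a node z lies within k e of y, then K k <= 1/2 puts the quotient within e/2 of
   the identity in the chart, where the tent is at least 1/2; and k <= r/2 keeps the node in the
   ball where the estimates hold.\<close>
 define k where "k = min 1 (min (r / 2) (1 / (2 * K)))"
 have k: "k > 0" "k \<le> 1" "k \<le> r / 2" "K * k \<le> 1 / 2"
 proof -
  show "k > 0" "k \<le> 1" "k \<le> r / 2" using r K by (auto simp: k_def)
  have "K * k \<le> K * (1 / (2 * K))" using K by (intro mult_left_mono) (auto simp: k_def)
  thus "K * k \<le> 1 / 2" using K by simp
 qed
 define C where "C = mean \<beta> / 2 * (k / (r * DIM('e) + 5)) ^ DIM('e)"
 have q: "r * DIM('e) + 5 > 0" using r by (simp add: add_nonneg_pos)
 show thesis
 proof (rule that[OF r sub])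
  show "C > 0" using m\<beta> k q by (simp add: C_def)
  fix e :: real assume e: "0 < e" "e \<le> r" "e \<le> 1"
  have ke: "0 < k * e" "k * e \<le> 1" using k e mult_le_one[of k e] by auto
  obtain Y where Y: "finite Y" "card Y \<le> ((2 * (r / 2) * DIM('e) + 5) / (k * e)) ^ DIM('e)"
   "\<And>y. y \<in> cball y0 (r / 2) ==> \<exists>z\<in>Y. norm (z - y) \<le> k * e"
   by (rule grid_cover[OF half_gt_zero[OF r] ke, of y0]) (rule that)
  have tr: "cont (%x. tent e (x \<otimes> \<psi>0 z))" for z by (rule continuous_translate(2)[OF ct[OF e(1,2)]])
  have "1 / 2 * \<beta> x \<le> (\<Sum>z\<in>Y. tent e (x \<otimes> \<psi>0 z))" for x
  proof (cases "\<beta> x = 0")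
   case False
   define y where "y = \<phi>0 (inv x)"
   have ix: "inv x \<in> U0" "norm (y - y0) < r / 2"
    using tent_bounds(3)[of "r / 2" "inv x"] False r by (simp_all add: \<beta>_def y_def)
   hence y: "y \<in> cball y0 (r / 2)" by (simp add: dist_norm norm_minus_commute)
   obtain z where z: "z \<in> Y" "norm (z - y) \<le> k * e" using Y(3)[OF y] by blast
   have "k * e \<le> r / 2" using k(1,3) e mult_left_le[of e k] by linarith
   hence "norm (z - y0) \<le> r" using norm_triangle_ineq[of "z - y" "y - y0"] z ix by simp
   hence zr: "z \<in> cball y0 r" and yr: "y \<in> cball y0 r" using y r by (auto simp: dist_norm norm_minus_commute)
   have "x = inv (\<psi>0 y)" unfolding y_def psi0(2)[OF ix(1)] by simp
   hence 1: "x \<otimes> \<psi>0 z \<in> U0" and 2: "norm (\<phi>0 (x \<otimes> \<psi>0 z) - y0) \<le> K * norm (z - y)"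
    using U[OF yr zr] L[OF yr zr] by auto
   note 2
   also have "... \<le> K * (k * e)" using z(2) K by simp
   also have "... \<le> 1 / 2 * e" using mult_right_mono[OF k(4), of e] e(1) by (simp add: mult.assoc)
   finally have "1 / 2 \<le> tent e (x \<otimes> \<psi>0 z)" using 1 e(1) by (simp add: tent_def field_simps le_max_iff_disj)
   moreover have "tent e (x \<otimes> \<psi>0 z) \<le> (\<Sum>z\<in>Y. tent e (x \<otimes> \<psi>0 z))"
    using z(1) Y(1) tent_bounds(1)[OF e(1)] by (intro member_le_sum) auto
   moreover have "\<beta> x \<le> 1" using tent_bounds(2) r by (simp add: \<beta>_def)
   ultimately show ?thesis by linarith
  qed (use tent_bounds(1)[OF e(1)] in \<open>simp add: sum_nonneg\<close>)
  hence "mean (%x. 1 / 2 * \<beta> x) \<le> mean (%x. \<Sum>z\<in>Y. tent e (x \<otimes> \<psi>0 z))"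
   using c\<beta> tr by (intro mean_mono continuous_on_sum continuous_on_mult continuous_on_const) auto
  also have "... = card Y * mean (tent e)"
   using mean_right_invariant[OF ct[OF e(1,2)]] by (subst mean_sum[OF tr]) simp
  finally have "1 / 2 * mean \<beta> \<le> card Y * mean (tent e)" unfolding mean_scale[OF c\<beta>] .
  also have "... \<le> ((2 * (r / 2) * DIM('e) + 5) / (k * e)) ^ DIM('e) * mean (tent e)"
   using mean_bounds(1)[OF ct[OF e(1,2)], of 0 1] tent_bounds(1,2)[OF e(1)] by (intro mult_right_mono Y(2)) auto
  finally have "mean \<beta> / 2 \<le> ((r * DIM('e) + 5) / (k * e)) ^ DIM('e) * mean (tent e)" by simp
  from mult_right_mono[OF this, of "(k * e / (r * DIM('e) + 5)) ^ DIM('e)"]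
  have "mean \<beta> / 2 * (k * e / (r * DIM('e) + 5)) ^ DIM('e)
    \<le> mean (tent e) * ((r * DIM('e) + 5) / (k * e) * (k * e / (r * DIM('e) + 5))) ^ DIM('e)"
   unfolding power_mult_distrib using ke q by (simp only: mult.commute mult.left_commute) simp
  moreover have "(r * DIM('e) + 5) / (k * e) * (k * e / (r * DIM('e) + 5)) = 1" using k(1) e(1) q by simp
  moreover have "C * e ^ DIM('e) = mean \<beta> / 2 * (k * e / (r * DIM('e) + 5)) ^ DIM('e)"
   by (simp add: C_def power_mult_distrib power_divide)
  ultimately show "C * e ^ DIM('e) \<le> mean (tent e)" by simp
 qed
qed

lemma Bessel_finite:
 assumes I: "finite I" and w: "\<And>i. i \<in> I ==> cont (w i)"
  "\<And>i j. i \<in> I ==> j \<in> I ==> cip (w i) (w j) = (if i = j then 1 else 0)" and f: "cont f"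
 shows "(\<Sum>i\<in>I. (norm (cip f (w i)))\<^sup>2) \<le> nrm2 f"
proof -
 obtain h where h: "bij_betw h {..<card I} I"
  using ex_bij_betw_nat_finite[OF I] unfolding lessThan_atLeast0[symmetric] by (elim exE) (rule that)
 have "orthonormal (card I) (w \<circ> h)"
  unfolding orthonormal_def
  using w bij_betwE[OF h] bij_betw_imp_inj_on[OF h] by (auto simp: inj_on_eq_iff)
 from Bessel[OF this f] show ?thesis by (simp add: sum.reindex_bij_betw[OF h, symmetric])
qed

section \<open>Sums of squared dimensions up to a given weight\<close>

context
 fixes ip :: "'g vf => 'g vf => real" and \<rho> :: "'g rep set => 'g rep"
 assumes kip: "killing_inner_product G A ip" and \<rho>: "\<forall>c\<in>unitary_dual G. \<rho> c \<in> c"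
begin

abbreviation "dm c \<equiv> rep_dim G (\<rho> c)"

lemma choice_irreducible: "c \<in> unitary_dual G ==> irrep G (dm c) (\<rho> c)"
 using unitary_dual_choice \<rho> irreps_dim by blast

lemmas choice_unitary = irreducible_unitary[OF choice_irreducible]

lemma choice_orthogonality:
 assumes "c \<in> unitary_dual G" "c' \<in> unitary_dual G" "i < dm c" "j < dm c" "k < dm c'" "l < dm c'"
 shows "cip (coef (\<rho> c) i j) (coef (\<rho> c') k l) = (if c = c' \<and> i = k \<and> j = l then 1 / of_nat (dm c) else 0)"
proof (cases "c = c'")
 case True
 thus ?thesis using Schur_orthogonality[OF choice_irreducible[OF assms(1)]] assms by simp
next
 case False
 hence "(\<rho> c, \<rho> c') \<notin> rep_equiv G" using unitary_dual_choice_inj[of c \<rho> c'] \<rho> assms(1,2) by blast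
 thus ?thesis
  using Schur_orthogonality_inequivalent unitary_dual_choice \<rho> assms False by simp
qed

text \<open>Bessel's inequality is applied to a tent of width about 1/\<Lambda>. There every
  diagonal coefficient of a class of weight at most \<Lambda> stays within 1/2 of its value 1, so
  its normalized inner product with the tent has square at least dm c times (mean/2)^2. The dm c
  diagonal coefficients of each class contribute \<open>(dm c)\<^sup>2\<close>, and the square norm
  of the tent is at most its mean; what results is a bound 4 / mean for the sum.\<close>

lemma dimension_growth:
 "\<exists>C p. C > 0 \<and> (\<forall>J. \<forall>\<Lambda>\<ge>1. finite J \<longrightarrow> J \<subseteq> unitary_dual G \<longrightarrow> (\<forall>c\<in>J. weight G A ip (\<rho> c) \<le> \<Lambda>)
  \<longrightarrow> (\<Sum>c\<in>J. (real (dm c))\<^sup>2) \<le> C * \<Lambda> ^ p)"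
proof -
 obtain r1 C1 where r1: "r1 > 0" "cball y0 r1 \<subseteq> \<phi>0 ` U0" and C1: "C1 > 0"
  and m: "\<And>e. 0 < e ==> e \<le> r1 ==> e \<le> 1 ==> mean (tent e) \<ge> C1 * e ^ DIM('e)"
  by (rule mean_tent_lower_bound) (rule that)
 obtain r2 K where r2: "r2 > 0" and K: "K > 0"
  and D: "\<And>y f. y \<in> ball y0 r2 ==> smooth f ==> \<exists>D. (\<forall>w. norm (D w) \<le> K * norm w) \<and>
   ((%z. f (\<psi>0 z)) has_derivative (%w. dirD (D w) f (\<psi>0 y))) (at y)"
  by (rule chart_division) (rule that)
 obtain K' where K': "K' > 0" "\<And>d \<xi> v i j x. irrep G d \<xi> ==> i < d ==> j < d ==>
  norm (dirD v (coef \<xi> i j) x) \<le> K' * norm v * sqrt (laplace_eigenvalue G A ip \<xi>)"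
  by (rule dirD_rep_bound[OF kip]) (rule that)
 \<comment> \<open>The coefficient is followed along the straight segment in the chart from y0 to
   \<phi>0 x, starting from the value 1; \<open>chart_division\<close> and
   \<open>dirD_rep_bound\<close> bound its derivative.\<close>
 have lip: "norm (\<xi> x $$ (j, j) - 1) \<le> K' * K * norm (\<phi>0 x - y0) * sqrt (laplace_eigenvalue G A ip \<xi>)"
  if \<xi>: "irrep G d \<xi>" and j: "j < d" and x: "x \<in> U0" "norm (\<phi>0 x - y0) < r2" for \<xi> d j x
 proof -
  let ?f = "%x. \<xi> x $$ (j, j)" and ?s = "sqrt (laplace_eigenvalue G A ip \<xi>)"
  let ?u = "\<phi>0 x - y0"
  note f = irreducible_smooth[OF \<xi> j j]
  have s: "?s \<ge> 0" using laplace_rep(2)[OF kip \<xi>] by simp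
  have "\<forall>t\<in>closed_segment 0 (1::real). \<exists>h'. ((%t. ?f (\<psi>0 (y0 + t *\<^sub>R ?u))) has_vector_derivative h') (at t) \<and>
    norm h' \<le> K' * (K * norm ?u) * ?s"
  proof
   fix t :: real assume "t \<in> closed_segment 0 1"
   hence t: "0 \<le> t" "t \<le> 1" by (auto simp: closed_segment_eq_real_ivl)
   hence "norm (t *\<^sub>R ?u) \<le> norm ?u" by (simp add: mult_left_le_one_le)
   hence "y0 + t *\<^sub>R ?u \<in> ball y0 r2" using x(2) by (simp add: dist_norm)
   from D[OF this f] obtain D' where D': "\<forall>w. norm (D' w) \<le> K * norm w"
    "((%z. ?f (\<psi>0 z)) has_derivative (%w. dirD (D' w) ?f (\<psi>0 (y0 + t *\<^sub>R ?u)))) (at (y0 + t *\<^sub>R ?u))"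
    by (elim exE conjE) (rule that)
   have "((%t. y0 + t *\<^sub>R ?u) has_derivative (%s. s *\<^sub>R ?u)) (at t)" by (auto intro!: derivative_eq_intros)
   from has_derivative_compose[OF this D'(2)]
   have d: "((%t. ?f (\<psi>0 (y0 + t *\<^sub>R ?u))) has_derivative (%s. dirD (D' (s *\<^sub>R ?u)) ?f (\<psi>0 (y0 + t *\<^sub>R ?u)))) (at t)" .
   have "norm (dirD (D' ?u) ?f (\<psi>0 (y0 + t *\<^sub>R ?u))) \<le> K' * norm (D' ?u) * ?s" by (rule K'(2)[OF \<xi> j j])
   also have "... \<le> K' * (K * norm ?u) * ?s" using D'(1) K'(1) s by (intro mult_right_mono mult_left_mono) auto
   finally show "\<exists>h'. ((%t. ?f (\<psi>0 (y0 + t *\<^sub>R ?u))) has_vector_derivative h') (at t) \<and> norm h' \<le> K' * (K * norm ?u) * ?s"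
    using has_derivative_linear[OF d, THEN linear_cmul, of _ 1] d
    by (intro exI[of _ "dirD (D' ?u) ?f (\<psi>0 (y0 + t *\<^sub>R ?u))"]) (simp add: has_vector_derivative_def)
  qed
  from bchoice[OF this] obtain h' where h': "\<And>t. t \<in> closed_segment 0 1 ==> ((%t. ?f (\<psi>0 (y0 + t *\<^sub>R ?u))) has_vector_derivative h' t) (at t)"
   "\<And>t. t \<in> closed_segment 0 (1::real) ==> norm (h' t) \<le> K' * (K * norm ?u) * ?s" by (elim exE) (rule that, blast+)
  from vector_derivative_bound[where a = 0 and b = 1, OF h'] show ?thesis
   using rep_one_index[OF irreducible_unitary[OF \<xi>] j j] psi0(2)[OF x(1)] by (simp add: psi0(1) mult.assoc)
 qed
 \<comment> \<open>Besides keeping the tent inside the charts, k satisfies K' K k <= 1/2, so that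
   \<open>lip\<close> allows a deviation of at most 1/2 on a support of width k / \<Lambda>.\<close>
 define k where "k = min 1 (min (min r1 r2) (1 / (2 * (K' * K))))"
 have k: "k > 0" "k \<le> 1" "k \<le> r1" "k \<le> r2" "K' * K * k \<le> 1 / 2"
 proof -
  show "k > 0" "k \<le> 1" "k \<le> r1" "k \<le> r2" using r1 r2 K K' by (auto simp: k_def)
  have "K' * K * k \<le> K' * K * (1 / (2 * (K' * K)))" using K K' by (intro mult_left_mono) (auto simp: k_def)
  thus "K' * K * k \<le> 1 / 2" using K K' by simp
 qed
 show ?thesis
 proof (intro exI conjI allI impI)
  show "4 / (C1 * k ^ DIM('e)) > 0" using C1 k by simp
  fix J \<Lambda> assume \<Lambda>: "(\<Lambda>::real) \<ge> 1" and J: "finite J" "J \<subseteq> unitary_dual G"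
   and w: "\<forall>c\<in>J. weight G A ip (\<rho> c) \<le> \<Lambda>"
  define e where "e = k / \<Lambda>"
  have e: "0 < e" "e \<le> k" using k(1) \<Lambda> by (auto simp: e_def field_simps)
  let ?\<kappa> = "%x. complex_of_real (tent e x)"
  have ct: "cont (tent e)"
   by (rule continuous_on_tent[OF e(1)], rule order.trans[OF _ r1(2)]) (use e k in auto)
  have c\<kappa>: "cont ?\<kappa>" using ct by (intro continuous_intros)
  have mb: "mean (tent e) \<ge> C1 * e ^ DIM('e)" using e k by (intro m) auto
  hence mp: "mean (tent e) > 0" using C1 e by (intro less_le_trans[OF _ mb]) simp
  let ?I = "Sigma J (%c. {..<dm c})"
  \<comment> \<open>By Schur a diagonal coefficient has square norm 1 / dm c; the root normalizes
    it.\<close>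
  let ?w = "%(c, j) x. complex_of_real (sqrt (dm c)) * \<rho> c x $$ (j, j)"
  have cw: "cont (coef (\<rho> c) j j)" if "c \<in> J" "j < dm c" for c j
   using rep_cont[OF choice_unitary] that J by blast
  have "(\<Sum>i\<in>?I. (norm (cip ?\<kappa> (?w i)))\<^sup>2) \<le> nrm2 ?\<kappa>"
  proof (rule Bessel_finite[OF _ _ _ c\<kappa>])
   show "finite ?I" using J by simp
   show "cont (?w i)" if "i \<in> ?I" for i using that cw by (auto intro!: continuous_on_mult continuous_on_const)
   fix i i' assume ii: "i \<in> ?I" "i' \<in> ?I"
   obtain c j c' j' where i: "i = (c, j)" "i' = (c', j')" by (cases i, cases i')
   hence s: "c \<in> J" "c' \<in> J" "j < dm c" "j' < dm c'" using ii by auto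
   have "cip (?w i) (?w i') = of_real (sqrt (dm c)) * (cnj (of_real (sqrt (dm c'))) * cip (coef (\<rho> c) j j) (coef (\<rho> c') j' j'))"
    unfolding i prod.case
    using cw s by (subst cip_scale_left, simp_all add: continuous_on_mult cip_scale_right)
   also have "... = (if i = i' then 1 else 0)"

    unfolding choice_orthogonality[OF subsetD[OF J(2) s(1)] subsetD[OF J(2) s(2)] s(3) s(3) s(4) s(4)]
   proof (cases "i = i'")
    case True
    have "complex_of_real (sqrt (dm c)) * of_real (sqrt (dm c)) = of_nat (dm c)" by (simp flip: of_real_mult)
    thus "of_real (sqrt (dm c)) * (cnj (of_real (sqrt (dm c'))) * (if c = c' \<and> j = j' \<and> j = j' then 1 / of_nat (dm c) else 0)) = (if i = i' then 1 else 0 :: complex)"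
     using True s(3) by (simp add: i)
   qed (auto simp: i)
   finally show "cip (?w i) (?w i') = (if i = i' then 1 else 0)" .
  qed
  also have "nrm2 ?\<kappa> \<le> mean (tent e)"
  proof -
   have "(tent e x)\<^sup>2 \<le> tent e x" for x
    using tent_bounds(1,2)[OF e(1), of x] mult_left_le[of "tent e x" "tent e x"] by (simp add: power2_eq_square)
   thus ?thesis unfolding nrm2_def using ct by (intro mean_mono) (auto intro!: continuous_intros)
  qed
  also have "(\<Sum>i\<in>?I. (norm (cip ?\<kappa> (?w i)))\<^sup>2) = (\<Sum>c\<in>J. \<Sum>j<dm c. (norm (cip ?\<kappa> (?w (c, j))))\<^sup>2)"
   using J by (subst sum.Sigma) (auto intro!: sum.cong)
  also have "(\<Sum>c\<in>J. (real (dm c))\<^sup>2 * ((mean (tent e))\<^sup>2 / 4)) \<le> ..."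
  proof (rule sum_mono)
   fix c assume c: "c \<in> J"
   hence cd: "c \<in> unitary_dual G" using J by blast
   have "(real (dm c) * (mean (tent e))\<^sup>2 / 4) \<le> (norm (cip ?\<kappa> (?w (c, j))))\<^sup>2" if j: "j < dm c" for j
   proof -
    let ?f = "%x. \<rho> c x $$ (j, j)"
    have "1 / 2 * tent e x \<le> Re (?\<kappa> x * cnj (?f x))" for x
    proof (cases "tent e x = 0")
     case False
     from tent_bounds(3)[OF e(1) False] have x: "x \<in> U0" "norm (\<phi>0 x - y0) < e" by auto
     have "laplace_eigenvalue G A ip (\<rho> c) \<le> \<Lambda>\<^sup>2"
      using sqrt_le_D[OF bspec[OF w c, unfolded weight_def]] by simp
     hence "sqrt (laplace_eigenvalue G A ip (\<rho> c)) \<le> \<Lambda>" using \<Lambda> by (intro real_le_lsqrt) auto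
     moreover have "norm (?f x - 1) \<le> K' * K * norm (\<phi>0 x - y0) * sqrt (laplace_eigenvalue G A ip (\<rho> c))"
      using x e k by (intro lip[OF choice_irreducible[OF cd] j]) auto
     ultimately have "norm (?f x - 1) \<le> K' * K * e * \<Lambda>"
      using x(2) K K' \<Lambda> e laplace_rep(2)[OF kip choice_irreducible[OF cd]]
      by (elim order.trans) (intro mult_mono; simp)
     also have "... \<le> 1 / 2" using k(5) \<Lambda> by (simp add: e_def)
     finally have "1 / 2 \<le> Re (?f x)" using abs_Re_le_cmod[of "?f x - 1"] by simp
     hence "tent e x * (1 / 2) \<le> tent e x * Re (?f x)" using tent_bounds(1)[OF e(1)] by (intro mult_left_mono)
     thus ?thesis by simp
    qed simp
    hence "mean (%x. 1 / 2 * tent e x) \<le> mean (%x. Re (?\<kappa> x * cnj (?f x)))"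
     by (intro mean_mono cont_Re_Im(1)[OF cont_mult_cnj[OF c\<kappa> cw[OF c j]]] continuous_on_mult continuous_on_const ct)
    also have "... = Re (cip ?\<kappa> ?f)" by (simp add: cip_def cmean_def)
    also have "... \<le> norm (cip ?\<kappa> ?f)" by (rule complex_Re_le_cmod)
    finally have "(mean (tent e) / 2)\<^sup>2 \<le> (norm (cip ?\<kappa> ?f))\<^sup>2"
     using mp unfolding mean_scale[OF ct] by (intro power_mono) simp_all
    moreover have "(norm (cip ?\<kappa> (?w (c, j))))\<^sup>2 = dm c * (norm (cip ?\<kappa> ?f))\<^sup>2"
     using cip_scale_right[OF cw[OF c j] c\<kappa>, of "of_real (sqrt (dm c))"] by (simp add: norm_mult power_mult_distrib)
    ultimately show ?thesis using mult_left_mono[of "(mean (tent e) / 2)\<^sup>2" _ "real (dm c)"] by (simp add: power_divide)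
   qed
   hence "(\<Sum>j<dm c. (real (dm c) * (mean (tent e))\<^sup>2 / 4)) \<le> (\<Sum>j<dm c. (norm (cip ?\<kappa> (?w (c, j))))\<^sup>2)"
    by (intro sum_mono) simp
   thus "(real (dm c))\<^sup>2 * ((mean (tent e))\<^sup>2 / 4) \<le> (\<Sum>j<dm c. (norm (cip ?\<kappa> (?w (c, j))))\<^sup>2)"
    by (simp add: power2_eq_square mult.assoc)
  qed
  finally have "(\<Sum>c\<in>J. (real (dm c))\<^sup>2) * ((mean (tent e))\<^sup>2 / 4) \<le> mean (tent e)" by (simp only: sum_distrib_right)
  hence "(\<Sum>c\<in>J. (real (dm c))\<^sup>2) \<le> 4 / mean (tent e)" using mp by (simp add: power2_eq_square field_simps)
  also have "... \<le> 4 / (C1 * e ^ DIM('e))" using mb C1 e mp by (intro divide_left_mono) auto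
  also have "... = 4 / (C1 * k ^ DIM('e)) * \<Lambda> ^ DIM('e)" using \<Lambda> by (simp add: e_def power_divide)
  finally show "(\<Sum>c\<in>J. (real (dm c))\<^sup>2) \<le> 4 / (C1 * k ^ DIM('e)) * \<Lambda> ^ DIM('e)" .
 qed
qed

lemma weight_ge_1: "c \<in> unitary_dual G ==> weight G A ip (\<rho> c) \<ge> 1"
 using laplace_rep(2)[OF kip choice_irreducible] by (simp add: weight_def)

lemma dim_ge_1: "c \<in> unitary_dual G ==> dm c \<ge> 1"
 using choice_irreducible by (simp add: irreducible_unitary_rep_def)

lemma finite_bounded_weight: "finite {c \<in> unitary_dual G. weight G A ip (\<rho> c) < M}"
proof -
 obtain C p where "C > 0" and Cp: "\<forall>J. \<forall>\<Lambda>\<ge>1. finite J \<longrightarrow> J \<subseteq> unitary_dual G \<longrightarrow>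
  (\<forall>c\<in>J. weight G A ip (\<rho> c) \<le> \<Lambda>) \<longrightarrow> (\<Sum>c\<in>J. (real (dm c))\<^sup>2) \<le> C * \<Lambda> ^ p"
  using dimension_growth by (elim exE conjE) (rule that)
 have "card J \<le> nat \<lceil>C * (max 1 M) ^ p\<rceil>" if J: "J \<subseteq> {c \<in> unitary_dual G. weight G A ip (\<rho> c) < M}" "finite J" for J
 proof -
  have "real (card J) = (\<Sum>c\<in>J. 1)" by simp
  also have "... \<le> (\<Sum>c\<in>J. (real (dm c))\<^sup>2)"
   using J dim_ge_1 by (intro sum_mono one_le_power) auto
  also have "... \<le> C * (max 1 M) ^ p" using J by (intro Cp[rule_format]) auto
  finally show ?thesis by linarith
 qed
 thus ?thesis using finite_if_finite_subsets_card_bdd by blast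
qed

text \<open>The classes are grouped by the integer part m + 1 of their weight. By
  \<open>dimension_growth\<close> a group contributes at most C (2 (m + 1))^p to the numerators, and
  the exponent p + 2 leaves the summable factor 1 / (m + 1)^2.\<close>

lemma summable_weights:
 obtains r where "(%c. (real (dm c))\<^sup>2 / weight G A ip (\<rho> c) ^ r) summable_on unitary_dual G"
proof -
 let ?w = "%c. weight G A ip (\<rho> c)"
 obtain C p where C: "C > 0" and Cp: "\<forall>J. \<forall>\<Lambda>\<ge>1. finite J \<longrightarrow> J \<subseteq> unitary_dual G \<longrightarrow>
  (\<forall>c\<in>J. ?w c \<le> \<Lambda>) \<longrightarrow> (\<Sum>c\<in>J. (real (dm c))\<^sup>2) \<le> C * \<Lambda> ^ p"
  using dimension_growth by (elim exE conjE) (rule that)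
 have s: "summable (%n. C * 2 ^ p * (1 / real (Suc n) ^ 2))"
  using summable_Suc_iff[THEN iffD2, OF inverse_power_summable[of 2, where 'a = real]]
  by (intro summable_mult) (simp only: inverse_eq_divide order.refl)
 define T where "T = (\<Sum>n. C * 2 ^ p * (1 / real (Suc n) ^ 2))"
 show thesis
 proof (rule that[of "p + 2"], rule nonneg_bdd_above_summable_on)
  show "0 \<le> (real (dm c))\<^sup>2 / ?w c ^ (p + 2)" if "c \<in> unitary_dual G" for c using weight_ge_1[OF that] by simp
  show "bdd_above (sum (%c. (real (dm c))\<^sup>2 / ?w c ^ (p + 2)) ` {F. F \<subseteq> unitary_dual G \<and> finite F})"
  proof (rule bdd_aboveI2[where M = T], clarify)
   fix J assume J: "J \<subseteq> unitary_dual G" "finite J"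
   \<comment> \<open>Shifted by one, so that \<open>Suc (n c)\<close> is the integer part of the
     weight.\<close>
   define n where "n = (%c. nat \<lfloor>?w c\<rfloor> - 1)"
   have n: "real (Suc (n c)) \<le> ?w c" "?w c \<le> 2 * real (Suc (n c))" if "c \<in> J" for c
   proof -
    have "?w c \<ge> 1" using weight_ge_1[of c] that J(1) by blast
    hence "\<lfloor>?w c\<rfloor> \<ge> 1" by simp
    moreover from this have "Suc (n c) = nat \<lfloor>?w c\<rfloor>" by (simp add: n_def)
    ultimately have n: "real (Suc (n c)) = of_int \<lfloor>?w c\<rfloor>" "real_of_int \<lfloor>?w c\<rfloor> \<ge> 1" by simp_all
    show "real (Suc (n c)) \<le> ?w c" "?w c \<le> 2 * real (Suc (n c))"
     using real_of_int_floor_add_one_gt[of "?w c"] of_int_floor_le[of "?w c"] n(2) unfolding n(1) by argo+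
   qed
   have "(\<Sum>c\<in>J. (real (dm c))\<^sup>2 / ?w c ^ (p + 2))
     = (\<Sum>m\<in>n ` J. \<Sum>c\<in>{c\<in>J. n c = m}. (real (dm c))\<^sup>2 / ?w c ^ (p + 2))" by (rule sum.image_gen[OF J(2)])
   also have "... \<le> (\<Sum>m\<in>n ` J. C * 2 ^ p * (1 / real (Suc m) ^ 2))"
   proof (rule sum_mono)
    fix m
    have "(\<Sum>c\<in>{c\<in>J. n c = m}. (real (dm c))\<^sup>2 / ?w c ^ (p + 2)) \<le> (\<Sum>c\<in>{c\<in>J. n c = m}. (real (dm c))\<^sup>2 / real (Suc m) ^ (p + 2))"
     using n(1) by (intro sum_mono divide_left_mono power_mono mult_pos_pos zero_less_power) (force intro: less_le_trans[of 0 "real (Suc _)"])+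
    also have "... = (\<Sum>c\<in>{c\<in>J. n c = m}. (real (dm c))\<^sup>2) / real (Suc m) ^ (p + 2)" by (simp add: sum_divide_distrib)
    also have "... \<le> C * (2 * real (Suc m)) ^ p / real (Suc m) ^ (p + 2)"
     using J n(2) by (intro divide_right_mono Cp[rule_format]) auto
    also have "... = C * 2 ^ p * (1 / real (Suc m) ^ 2)" by (simp add: power_mult_distrib power_add power2_eq_square del: of_nat_Suc)
    finally show "(\<Sum>c\<in>{c\<in>J. n c = m}. (real (dm c))\<^sup>2 / ?w c ^ (p + 2)) \<le> C * 2 ^ p * (1 / real (Suc m) ^ 2)" .
   qed
   also have "... \<le> T" unfolding T_def using J C by (intro sum_le_suminf s) auto
   finally show "(\<Sum>c\<in>J. (real (dm c))\<^sup>2 / ?w c ^ (p + 2)) \<le> T" .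
  qed
 qed
qed

end

end

subsection \<open>The cohomological equation\<close>

context compact_lie_group
begin

text \<open>The bounds B i are summable, so the sum is again bounded in the sup norm. The geometric
  series and the Fourier series are both treated in this way.\<close>

lemma compact_functional_infsum:
 fixes L :: "'i => ('g => complex) => complex"
 assumes B: "B summable_on I"
  and add: "\<And>i f g. i \<in> I ==> cont f ==> cont g ==> L i (%x. f x + g x) = L i f + L i g"
  and scale: "\<And>i c f. i \<in> I ==> cont f ==> L i (%x. c * f x) = c * L i f"
  and bound: "\<And>i f b. i \<in> I ==> cont f ==> (\<And>x. norm (f x) \<le> b) ==> norm (L i f) \<le> B i * b"
 shows "cont f ==> (%i. L i f) summable_on I" and "compact_functional (%f. \<Sum>\<^sub>\<infinity>i\<in>I. L i f)"
proof -
 have abs: "(%i. norm (L i f)) summable_on I" if f: "cont f" for f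
 proof -
  obtain b where "b > 0" and b: "\<And>x. norm (f x) \<le> b" by (rule bounded_continuous[OF f]) (rule that)
  show ?thesis
   by (rule Infinite_Sum.abs_summable_on_comparison_test'[where g = "%i. B i * b"])
    (use B bound[OF _ f b] in \<open>auto intro: summable_on_cmult_left\<close>)
 qed
 show sm: "(%i. L i f) summable_on I" if "cont f" for f using abs_summable_summable[OF abs[OF that]] .
 have B0: "B i \<ge> 0" if "i \<in> I" for i
  using order.trans[OF norm_ge_zero bound[OF that, of "%_. 0" 1]] by simp
 show "compact_functional (%f. \<Sum>\<^sub>\<infinity>i\<in>I. L i f)"
  unfolding compact_functional_def
 proof (intro exI[of _ UNIV] exI[of _ "infsum B I"] conjI allI impI)
  fix f g :: "'g => complex" assume f: "cont f" and g: "cont g"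
  have "(\<Sum>\<^sub>\<infinity>i\<in>I. L i (%x. f x + g x)) = (\<Sum>\<^sub>\<infinity>i\<in>I. L i f + L i g)" using add f g by (intro infsum_cong)
  thus "(\<Sum>\<^sub>\<infinity>i\<in>I. L i (%x. f x + g x)) = (\<Sum>\<^sub>\<infinity>i\<in>I. L i f) + (\<Sum>\<^sub>\<infinity>i\<in>I. L i g)"
   using infsum_add[OF sm[OF f] sm[OF g]] by simp
 next
  fix c and f :: "'g => complex" assume f: "cont f"
  have "(\<Sum>\<^sub>\<infinity>i\<in>I. L i (%x. c * f x)) = (\<Sum>\<^sub>\<infinity>i\<in>I. c * L i f)" using scale f by (intro infsum_cong)
  thus "(\<Sum>\<^sub>\<infinity>i\<in>I. L i (%x. c * f x)) = c * (\<Sum>\<^sub>\<infinity>i\<in>I. L i f)"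
   using infsum_cmult_right[of c "%i. L i f" I] sm[OF f] by simp
 next
  fix f :: "'g => complex" and b assume f: "cont f" and b: "\<forall>x\<in>UNIV. norm (f x) \<le> b"
  have "norm (\<Sum>\<^sub>\<infinity>i\<in>I. L i f) \<le> (\<Sum>\<^sub>\<infinity>i\<in>I. norm (L i f))" by (rule norm_infsum_bound[OF abs[OF f]])
  also have "... \<le> (\<Sum>\<^sub>\<infinity>i\<in>I. B i * b)"
   using b bound[OF _ f, of _ b] by (intro infsum_mono abs[OF f] summable_on_cmult_left B) auto
  also have "... = infsum B I * b" by (rule infsum_cmult_left) (rule B)
  finally show "norm (\<Sum>\<^sub>\<infinity>i\<in>I. L i f) \<le> infsum B I * b" .
 qed (use compact_UNIV B0 in \<open>auto intro: infsum_nonneg\<close>)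
qed

lemma smooth_convolve_functional:
 assumes F: "smooth F" and L: "compact_functional L" shows "smooth (%x. L (%g. F (x \<otimes> g)))"
proof -
 note M = smooth_atlas_prod[OF atlas atlas]
 have "smooth_map (prod_atlas A A) std_atlas (%p. F (fst p \<otimes> snd p))"
  by (rule smooth_compose[OF M smooth_map_group_mult[OF M smooth_map_fst[OF atlas atlas] smooth_map_snd[OF atlas atlas]] F])
 from smooth_map_functional[OF atlas atlas this L] show ?thesis by simp
qed

text \<open>Solving for v at x h^(-1) repeatedly gives v(x) = F(x h^(-1)) + a F(x h^(-2)) + ...,
  hence the exponent Suc n. The series is a bounded functional of g -> F (x g), and this makes v
  smooth.\<close>

lemma cohomological_contraction:
 assumes F: "smooth F" and a: "norm a < 1"
 shows "\<exists>v. smooth v \<and> (\<forall>x. v (x \<otimes> h) - a * v x = F x)"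
proof -
 define L where "L n f = a ^ n * f (inv h [^] Suc n)" for n and f :: "'g => complex"
 have geo: "(%n. norm a ^ n) summable_on UNIV"
  using summable_geometric[of "norm a"] a by (intro norm_summable_imp_summable_on) (simp add: norm_power)
 have lin: "L n (%x. f x + g x) = L n f + L n g" "L n (%x. c * f x) = c * L n f" for n f g c
  by (simp_all only: L_def distrib_left mult.left_commute)
 have bd: "norm (L n f) \<le> norm a ^ n * b" if "n \<in> UNIV" "cont f" "\<And>x. norm (f x) \<le> b" for n f b
  using that(3) by (simp add: L_def norm_mult norm_power mult_left_mono del: nat_pow_Suc)
 have Ls: "(%n. L n f) summable_on UNIV" if "cont f" for f
  by (rule compact_functional_infsum(1)[of _ UNIV L, OF geo lin _ that]) (rule bd)
 have "compact_functional (%f. \<Sum>\<^sub>\<infinity>n\<in>UNIV. L n f)"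
  by (rule compact_functional_infsum(2)[of _ UNIV L, OF geo lin]) (rule bd)
 note Lc = smooth_convolve_functional[OF F this]
 define v where "v x = (\<Sum>\<^sub>\<infinity>n\<in>UNIV. L n (%g. F (x \<otimes> g)))" for x
 have s: "(%n. L n (%g. F (x \<otimes> g))) sums v x" for x
  unfolding v_def
  by (rule has_sum_imp_sums[OF has_sum_infsum[OF Ls[OF continuous_translate(1)[OF smooth_cont[OF F]]]]])
 have "v (x \<otimes> h) = a * v x + F x" for x
 proof (rule sums_unique2[OF s])
  let ?g = "%n. L n (%g. F (x \<otimes> h \<otimes> g))"
  have e: "x \<otimes> h \<otimes> inv h [^] Suc n = x \<otimes> inv h [^] n" for n
  proof -
   have "inv h [^] Suc n = inv h \<otimes> inv h [^] n" by (rule nat_pow_Suc2) simp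
   hence "x \<otimes> h \<otimes> inv h [^] Suc n = x \<otimes> (h \<otimes> inv h \<otimes> inv h [^] n)" by (simp only: m_assoc carrier_UNIV UNIV_I)
   thus ?thesis by (simp only: r_inv carrier_UNIV UNIV_I l_one)
  qed
  have "(%n. ?g (Suc n)) = (%n. a * L n (%g. F (x \<otimes> g)))"
   by (rule ext) (simp only: L_def e power_Suc mult.assoc)
  hence "(%n. ?g (Suc n)) sums (a * v x)" using sums_mult[OF s[of x], of a] by (simp only:)
  moreover have "?g 0 = F x" by (simp only: L_def e power_0 nat_pow_0) simp
  ultimately show "?g sums (a * v x + F x)" using sums_Suc[of ?g] by simp
 qed
 moreover have "smooth v" unfolding v_def[abs_def] by (rule Lc)
 ultimately show ?thesis by (intro exI[of _ v]) simp
qed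

text \<open>For |a| > 1 the equation is read backwards: divided by -a and shifted by h^(-1), it
  becomes a contracting equation for h^(-1) and 1/a.\<close>

lemma cohomological_hyperbolic:
 assumes F: "smooth F" and a: "norm a \<noteq> 1"
 shows "\<exists>v. smooth v \<and> (\<forall>x. v (x \<otimes> h) - a * v x = F x)"
proof (cases "norm a < 1")
 case False
 hence "norm a > 1" using a by linarith
 hence a1: "norm (1 / a) < 1" "a \<noteq> 0" by (auto simp: norm_divide divide_less_eq_1)
 have "smooth (%x. (- 1 / a) * F (x \<otimes> inv h))" by (rule smooth_scale[OF smooth_right_translate[OF F]])
 from cohomological_contraction[OF this a1(1), of "inv h"] obtain v where v: "smooth v"
  "\<forall>x. v (x \<otimes> inv h) - 1 / a * v x = - 1 / a * F (x \<otimes> inv h)" by (elim exE conjE) (rule that)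
 have "v (x \<otimes> h) - a * v x = F x" for x
 proof -
  have "a * v (x \<otimes> h) = a * (F x + a * v x)"
   using v(2)[rule_format, of "x \<otimes> h"] a1(2) by (simp add: m_assoc field_simps)
  thus ?thesis using a1(2) by simp
 qed
 thus ?thesis using v(1) by blast
qed (rule cohomological_contraction[OF F])

context
 fixes ip :: "'g vf => 'g vf => real" and \<rho> :: "'g rep set => 'g rep"
 assumes kip: "killing_inner_product G A ip" and \<rho>: "\<forall>c\<in>unitary_dual G. \<rho> c \<in> c"
begin

lemmas irr = choice_irreducible[OF kip \<rho>]
lemmas orth = choice_orthogonality[OF kip \<rho>]

lemma choice_smooth: "c \<in> unitary_dual G ==> i < dm \<rho> c ==> j < dm \<rho> c ==> smooth (coef (\<rho> c) i j)"
 using irreducible_smooth[OF irr] .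

lemmas choice_cont = smooth_cont[OF choice_smooth]

text \<open>F' is (1 - Laplace)^k F, and the square of the weight is the eigenvalue of 1 - Laplace.
  The operator is symmetric and commutes with left translation, so one F' serves all x.\<close>

lemma iterate_laplace:
 assumes F: "smooth F"
 obtains F' where "smooth F'" "\<And>c i j x. c \<in> unitary_dual G ==> i < dm \<rho> c ==> j < dm \<rho> c ==>
  cip (%g. F' (x \<otimes> g)) (coef (\<rho> c) i j) = weight G A ip (\<rho> c) ^ (2 * k) * cip (%g. F (x \<otimes> g)) (coef (\<rho> c) i j)"
proof -
 have "\<exists>F'. smooth F' \<and> (\<forall>c i j x. c \<in> unitary_dual G \<longrightarrow> i < dm \<rho> c \<longrightarrow> j < dm \<rho> c \<longrightarrow>
  cip (%g. F' (x \<otimes> g)) (coef (\<rho> c) i j) = weight G A ip (\<rho> c) ^ (2 * k) * cip (%g. F (x \<otimes> g)) (coef (\<rho> c) i j))"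
 proof (induction k)
  case 0
  show ?case using F by (intro exI[of _ F]) simp
 next
  case (Suc k)
  then obtain F' where F': "smooth F'" "\<forall>c i j x. c \<in> unitary_dual G \<longrightarrow> i < dm \<rho> c \<longrightarrow> j < dm \<rho> c \<longrightarrow>
   cip (%g. F' (x \<otimes> g)) (coef (\<rho> c) i j) = weight G A ip (\<rho> c) ^ (2 * k) * cip (%g. F (x \<otimes> g)) (coef (\<rho> c) i j)"
   by (elim exE conjE) (rule that)
  let ?L = "Lap G A ip"
  have L: "smooth (?L f)" if "smooth f" for f using laplace_smooth[OF kip that] .
  have D: "smooth (%x. F' x + - 1 * ?L F' x)" by (intro smooth_map_add[OF atlas] smooth_scale L F'(1))
  show ?case
  proof (intro exI[of _ "%x. F' x + - 1 * ?L F' x"] conjI D allI impI)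
   fix c i j x assume c: "c \<in> unitary_dual G" and ij: "i < dm \<rho> c" "j < dm \<rho> c"
   let ?r = "%g. \<rho> c g $$ (i, j)" and ?n = "laplace_eigenvalue G A ip (\<rho> c)"
   note r = choice_smooth[OF c ij] and t = smooth_left_translate[OF F'(1), of x]
   have Lr: "?L ?r = (%g. of_real (- ?n) * ?r g)" by (rule ext) (simp add: laplace_rep(1)[OF kip irr[OF c] ij])
   have "cip (?L (%g. F' (x \<otimes> g))) ?r = cnj (of_real (- ?n)) * cip (%g. F' (x \<otimes> g)) ?r"
    unfolding laplace_cip[OF kip t r] Lr by (rule cip_scale_right[OF smooth_cont[OF r] smooth_cont[OF t]])
   moreover have "(%g. ?L F' (x \<otimes> g)) = ?L (%g. F' (x \<otimes> g))"
    by (rule ext) (rule laplace_left_translate[OF kip F'(1), symmetric])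
   moreover have "cip (%g. F' (x \<otimes> g) + - 1 * ?L F' (x \<otimes> g)) ?r
     = cip (%g. F' (x \<otimes> g)) ?r + - 1 * cip (%g. ?L F' (x \<otimes> g)) ?r"
    using smooth_cont[OF r] smooth_cont[OF t] smooth_cont[OF smooth_left_translate[OF L[OF F'(1)], of x]]
    by (simp only: cip_add_left cip_scale_left continuous_on_mult continuous_on_const)
   ultimately have "cip (%g. F' (x \<otimes> g) + - 1 * ?L F' (x \<otimes> g)) ?r = (1 + of_real ?n) * cip (%g. F' (x \<otimes> g)) ?r"
    by (simp add: algebra_simps)
   also have "1 + of_real ?n = complex_of_real ((weight G A ip (\<rho> c))\<^sup>2)"
    using laplace_rep(2)[OF kip irr[OF c]] by (simp add: weight_def)
   finally show "cip (%g. F' (x \<otimes> g) + - 1 * ?L F' (x \<otimes> g)) ?r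
     = weight G A ip (\<rho> c) ^ (2 * Suc k) * cip (%g. F (x \<otimes> g)) ?r"
    using F'(2) c ij by (simp add: power_add power2_eq_square)
  qed
 qed
 thus thesis by (elim exE conjE) (rule that, assumption, blast)
qed

lemma cip_translate_rep:
 assumes c: "c \<in> unitary_dual G" and m: "m < dm \<rho> c" and F: "cont F"
 shows "cip (%g. F (x \<otimes> g)) (coef (\<rho> c) m m) = (\<Sum>k<dm \<rho> c. cip F (coef (\<rho> c) k m) * \<rho> c x $$ (k, m))"
proof -
 note u = irreducible_unitary[OF irr[OF c]]
 have "cip (%g. F (x \<otimes> g)) (coef (\<rho> c) m m) = cmean (%g. F (x \<otimes> g) * cnj (\<rho> c (inv x \<otimes> (x \<otimes> g)) $$ (m, m)))"
  by (simp add: cip_def m_assoc[symmetric])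
 also have "... = cip F (%g. \<rho> c (inv x \<otimes> g) $$ (m, m))"
  unfolding cip_def
  by (rule cmean_left_invariant[of "%g. F g * cnj (\<rho> c (inv x \<otimes> g) $$ (m, m))"])
   (rule cont_mult_cnj[OF F continuous_translate(1)[OF choice_cont[OF c m m]]])
 also have "... = cip F (%g. \<Sum>k<dm \<rho> c. \<rho> c (inv x) $$ (m, k) * \<rho> c g $$ (k, m))"
  by (simp only: rep_mult_index[OF u m m])
 also have "... = (\<Sum>k<dm \<rho> c. cnj (\<rho> c (inv x) $$ (m, k)) * cip F (coef (\<rho> c) k m))"
  using choice_cont[OF c _ m] F by (intro cip_sum_right) auto
 also have "... = (\<Sum>k<dm \<rho> c. cip F (coef (\<rho> c) k m) * \<rho> c x $$ (k, m))"
  using rep_inv_index[OF u m] by (intro sum.cong refl) (simp add: mult.commute)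
 finally show ?thesis .
qed

text \<open>The coefficients of v must be those of F divided by \<theta> - a. Replacing F by (1 -
  Laplace)^(N + r) F gains the power 2 (N + r) of the weight, which pays the power N for the small
  divisors and leaves more than the power r for the summation over classes with the factor
  \<open>(dm c)\<^sup>2\<close>. The resulting series of functionals is bounded in the sup norm, so
  v is smooth; the equation is then checked on coefficients.\<close>

lemma cohomological_Diophantine:
 assumes F: "smooth F"
  and diag: "\<And>c i j. c \<in> unitary_dual G ==> i < dm \<rho> c ==> j < dm \<rho> c ==> \<rho> c h $$ (i, j) = (if i = j then \<theta> c j else 0)"
  and dio: "\<kappa> > 0" "\<And>c m. c \<in> unitary_dual G ==> m < dm \<rho> c ==> norm (\<theta> c m - a) \<ge> \<kappa> / weight G A ip (\<rho> c) ^ N"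
 shows "\<exists>v. smooth v \<and> (\<forall>x. v (x \<otimes> h) - a * v x = F x)"
proof -
 let ?w = "%c. weight G A ip (\<rho> c)" and ?D = "unitary_dual G"
 note w1 = weight_ge_1[OF kip \<rho>]
 obtain r where r: "(%c. (real (dm \<rho> c))\<^sup>2 / ?w c ^ r) summable_on ?D"
  by (rule summable_weights[OF kip \<rho>]) (rule that)
 obtain F' where F': "smooth F'" and w: "\<And>c i j x. c \<in> ?D ==> i < dm \<rho> c ==> j < dm \<rho> c ==>
  cip (%g. F' (x \<otimes> g)) (coef (\<rho> c) i j) = ?w c ^ (2 * (N + r)) * cip (%g. F (x \<otimes> g)) (coef (\<rho> c) i j)"
  by (rule iterate_laplace[OF F, of "N + r"]) (rule that)
 let ?B = "%c. (real (dm \<rho> c))\<^sup>2 / ?w c ^ r / \<kappa>"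
 have B: "?B summable_on ?D" using summable_on_cmult_left[OF r, of "1 / \<kappa>"] by simp
 \<comment> \<open>By \<open>cip_translate_rep\<close> the diagonal coefficients of g -> F (x g),
   summed with weights dm c / (\<theta> - a), form the part of v(x) in class c. The power of the
   weight in the denominator compensates the passage from F to F'.\<close>
 define L where "L c f = of_nat (dm \<rho> c) / of_real (?w c ^ (2 * (N + r))) * (\<Sum>m<dm \<rho> c. 1 / (\<theta> c m - a) * cip f (coef (\<rho> c) m m))" for c f
 have Lb: "norm (L c f) \<le> ?B c * b" if c: "c \<in> ?D" and f: "cont f" and b: "\<And>x. norm (f x) \<le> b" for c f b
 proof -
  have b0: "b \<ge> 0" using b[of "\<one>"] norm_ge_zero order.trans by blast
  have "norm (1 / (\<theta> c m - a) * cip f (coef (\<rho> c) m m)) \<le> ?w c ^ N / \<kappa> * b" if m: "m < dm \<rho> c" for m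
  proof -
   have "norm (cip f (coef (\<rho> c) m m)) \<le> b"
    unfolding cip_def
   proof (rule norm_cmean_bound[OF cont_mult_cnj[OF f choice_cont[OF c m m]]])
    fix x
    have "norm (f x) * norm (\<rho> c x $$ (m, m)) \<le> b * 1"
     using b rep_norm_le[OF irreducible_unitary[OF irr[OF c]] m m] b0 by (intro mult_mono) auto
    thus "norm (f x * cnj (\<rho> c x $$ (m, m))) \<le> b" by (simp add: norm_mult)
   qed
   moreover have "1 / norm (\<theta> c m - a) \<le> 1 / (\<kappa> / ?w c ^ N)"
    using dio(1) dio(2)[OF c m] w1[OF c] by (intro divide_left_mono mult_pos_pos divide_pos_pos less_le_trans[OF _ dio(2)[OF c m]]) auto
   ultimately have "1 / norm (\<theta> c m - a) * norm (cip f (coef (\<rho> c) m m)) \<le> 1 / (\<kappa> / ?w c ^ N) * b"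
    using dio(1) w1[OF c] by (intro mult_mono) auto
   thus ?thesis by (simp add: norm_mult norm_divide)
  qed
  hence "norm (L c f) \<le> dm \<rho> c / ?w c ^ (2 * (N + r)) * (\<Sum>m<dm \<rho> c. ?w c ^ N / \<kappa> * b)"
   unfolding L_def norm_mult using w1[OF c]
   by (intro mult_mono order.trans[OF norm_sum sum_mono]) (auto simp: norm_divide norm_power intro!: sum_nonneg)
  also have "... = (real (dm \<rho> c))\<^sup>2 / ?w c ^ r / \<kappa> * b * (1 / ?w c ^ (N + r))"
  proof -
   have "?w c ^ (2 * (N + r)) = ?w c ^ N * ?w c ^ r * ?w c ^ (N + r)" by (simp only: mult_2 power_add)
   thus ?thesis using w1[OF c] by (simp add: power2_eq_square mult_ac)
  qed
  also have "... \<le> ?B c * b * 1"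
   using w1[OF c] dio(1) b0 by (intro mult_left_mono) (auto simp: one_le_power)
  finally show ?thesis by simp
 qed
 have Ladd: "L c (%x. f x + g x) = L c f + L c g" if "c \<in> ?D" "cont f" "cont g" for c f g
  using that choice_cont[OF that(1)] by (simp add: L_def cip_add_left ring_distribs sum.distrib add_divide_distrib)
 have Lsc: "L c (%x. s * f x) = s * L c f" if "c \<in> ?D" "cont f" for c f s
 proof -
  have "(\<Sum>m<dm \<rho> c. 1 / (\<theta> c m - a) * cip (%x. s * f x) (coef (\<rho> c) m m))
    = s * (\<Sum>m<dm \<rho> c. 1 / (\<theta> c m - a) * cip f (coef (\<rho> c) m m))"
   unfolding sum_distrib_left using choice_cont[OF that(1)] that(2) by (intro sum.cong refl) (simp add: cip_scale_left)
  thus ?thesis by (simp only: L_def mult.left_commute)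
 qed
 have Lf: "compact_functional (%f. \<Sum>\<^sub>\<infinity>c\<in>?D. L c f)"
  by (rule compact_functional_infsum(2)[of ?B ?D L, OF B]) (rule Ladd Lsc Lb; assumption)+
 define v where "v x = (\<Sum>\<^sub>\<infinity>c\<in>?D. L c (%g. F' (x \<otimes> g)))" for x
 have sv: "smooth v" unfolding v_def[abs_def] by (rule smooth_convolve_functional[OF F'(1) Lf])
 let ?b = "%c k m. cip F (coef (\<rho> c) k m)"
 \<comment> \<open>The powers of the weight cancel, and each term becomes a trigonometric polynomial
   with coefficients taken from F.\<close>
 have LV: "L c (%g. F' (x \<otimes> g)) = (\<Sum>(m, k)\<in>{..<dm \<rho> c} \<times> {..<dm \<rho> c}. of_nat (dm \<rho> c) / (\<theta> c m - a) * ?b c k m * \<rho> c x $$ (k, m))"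
  if c: "c \<in> ?D" for c x
 proof -
  have "L c (%g. F' (x \<otimes> g)) = of_nat (dm \<rho> c) * (\<Sum>m<dm \<rho> c. 1 / (\<theta> c m - a) * cip (%g. F (x \<otimes> g)) (coef (\<rho> c) m m))"
   using w1[OF c] by (simp add: L_def w[OF c] sum_distrib_left mult.left_commute)
  also have "... = (\<Sum>m<dm \<rho> c. \<Sum>k<dm \<rho> c. of_nat (dm \<rho> c) / (\<theta> c m - a) * ?b c k m * \<rho> c x $$ (k, m))"
   by (simp add: cip_translate_rep[OF c _ smooth_cont[OF F]] sum_distrib_left mult.assoc)
  finally show ?thesis by (simp add: sum.cartesian_product)
 qed
 have cV: "cont (%x. L c (%g. F' (x \<otimes> g)))" if c: "c \<in> ?D" for c
  unfolding LV[OF c] case_prod_beta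
  by (intro continuous_on_sum continuous_on_mult continuous_on_const choice_cont[OF c]) auto
 obtain b where "b > 0" and b: "\<And>x. norm (F' x) \<le> b" by (rule bounded_continuous[OF smooth_cont[OF F'(1)]]) (rule that)
 have ul: "uniform_limit UNIV (%J x. \<Sum>c\<in>J. L c (%g. F' (x \<otimes> g))) v (finite_subsets_at_top ?D)"
  unfolding v_def[abs_def]
  by (rule Weierstrass_m_test_general[where M = "%c. ?B c * b"])
   (rule Lb[OF _ continuous_translate(1)[OF smooth_cont[OF F']] b] summable_on_cmult_left[OF B]; assumption)+
 \<comment> \<open>Uniform convergence allows taking the inner product term by term; by
   orthogonality only the term of class c survives, so the net of partial sums is eventually
   constant.\<close>
 have coeff: "cip v (coef (\<rho> c) i j) = ?b c i j / (\<theta> c j - a)" if c: "c \<in> ?D" and ij: "i < dm \<rho> c" "j < dm \<rho> c" for c i j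
 proof (rule tendsto_unique[of "finite_subsets_at_top ?D"])
  let ?r = "%x. \<rho> c x $$ (i, j)"
  let ?V = "%J x. \<Sum>c\<in>J. 1 * L c (%g. F' (x \<otimes> g))"
  note cr = choice_cont[OF c ij]
  have cJ: "cont (?V J)" if "J \<subseteq> ?D" for J using that cV by (intro continuous_on_sum continuous_on_mult continuous_on_const) auto
  show "((%J. cip (?V J) ?r) \<longlongrightarrow> cip v ?r) (finite_subsets_at_top ?D)"
  proof (rule tendstoI)
   fix e :: real assume e: "e > 0"
   have "\<forall>\<^sub>F J in finite_subsets_at_top ?D. finite J \<and> J \<subseteq> ?D" by (rule eventually_finite_subsets_at_top_weakI) auto
   moreover have "\<forall>\<^sub>F J in finite_subsets_at_top ?D. \<forall>x\<in>UNIV. dist (\<Sum>c\<in>J. L c (%g. F' (x \<otimes> g))) (v x) < e / 2"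
    using ul[unfolded uniform_limit_iff, rule_format, of "e / 2"] e by (simp only: half_gt_zero)
   ultimately show "\<forall>\<^sub>F J in finite_subsets_at_top ?D. dist (cip (?V J) ?r) (cip v ?r) < e"
   proof eventually_elim
    case (elim J)
    have cd: "cont (%x. ?V J x - v x)" using elim by (intro continuous_on_diff cJ smooth_cont[OF sv]) simp
    have "norm (cip (%x. ?V J x - v x) ?r) \<le> e / 2"
     unfolding cip_def
    proof (rule norm_cmean_bound[OF cont_mult_cnj[OF cd cr]])
     fix x
     have "norm (?V J x - v x) * norm (?r x) \<le> e / 2 * 1"
      using elim rep_norm_le[OF irreducible_unitary[OF irr[OF c]] ij] e
      by (intro mult_mono) (auto simp: dist_norm less_imp_le)
     thus "norm ((?V J x - v x) * cnj (?r x)) \<le> e / 2" by (simp add: norm_mult)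
    qed
    also have "e / 2 < e" using e by simp
    finally show ?case using elim by (simp only: dist_norm cip_diff_left[OF cJ smooth_cont[OF sv] cr])
   qed
  qed
  have z: "cip (%x. L c' (%g. F' (x \<otimes> g))) ?r = (if c' = c then ?b c i j / (\<theta> c j - a) else 0)" if c': "c' \<in> ?D" for c'
  proof -
   have "cip (%x. L c' (%g. F' (x \<otimes> g))) ?r
     = (\<Sum>p\<in>{..<dm \<rho> c'} \<times> {..<dm \<rho> c'}. of_nat (dm \<rho> c') / (\<theta> c' (fst p) - a) * ?b c' (snd p) (fst p) * cip (%x. \<rho> c' x $$ (snd p, fst p)) ?r)"
    unfolding LV[OF c'] case_prod_beta using choice_cont[OF c'] cr by (intro cip_sum_left) auto
   also have "... = (\<Sum>p\<in>{..<dm \<rho> c'} \<times> {..<dm \<rho> c'}. if p = (j, i) then if c' = c then ?b c i j / (\<theta> c j - a) else 0 else 0)"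
   proof (intro sum.cong refl)
    fix p assume p: "p \<in> {..<dm \<rho> c'} \<times> {..<dm \<rho> c'}"
    have "cip (%x. \<rho> c' x $$ (snd p, fst p)) ?r = (if c' = c \<and> snd p = i \<and> fst p = j then 1 / of_nat (dm \<rho> c') else 0)"
     by (rule orth[OF c' c _ _ ij]) (use p in auto)
    thus "of_nat (dm \<rho> c') / (\<theta> c' (fst p) - a) * ?b c' (snd p) (fst p) * cip (%x. \<rho> c' x $$ (snd p, fst p)) ?r
      = (if p = (j, i) then if c' = c then ?b c i j / (\<theta> c j - a) else 0 else 0)"
     using ij by (cases "c' = c"; cases p) auto
   qed
   also have "... = (if c' = c then ?b c i j / (\<theta> c j - a) else 0)" using ij by (simp add: sum.delta)
   finally show ?thesis .
  qed
  have "\<forall>\<^sub>F J in finite_subsets_at_top ?D. cip (?V J) ?r = ?b c i j / (\<theta> c j - a)"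
   unfolding eventually_finite_subsets_at_top
  proof (intro exI[of _ "{c}"] conjI allI impI)
   fix J assume J: "finite J \<and> {c} \<subseteq> J \<and> J \<subseteq> ?D"
   hence "cip (?V J) ?r = (\<Sum>c'\<in>J. 1 * cip (%x. L c' (%g. F' (x \<otimes> g))) ?r)" using cV cr by (intro cip_sum_left) auto
   also have "... = (\<Sum>c'\<in>J. if c' = c then ?b c i j / (\<theta> c j - a) else 0)"
    unfolding mult_1 using J by (intro sum.cong refl z) blast
   finally show "cip (?V J) ?r = ?b c i j / (\<theta> c j - a)" using J by simp
  qed (use c in auto)
  thus "((%J. cip (?V J) ?r) \<longlongrightarrow> ?b c i j / (\<theta> c j - a)) (finite_subsets_at_top ?D)" by (rule tendsto_eventually)
 qed (rule finite_subsets_at_top_neq_bot)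
 note cv = smooth_cont[OF sv] and cvh = continuous_translate(2)[OF smooth_cont[OF sv], of h] and cF = smooth_cont[OF F]
 have "v (x \<otimes> h) - a * v x - F x = 0" for x
 proof (rule matrix_coefficients_complete[OF bspec[OF \<rho>], where f = "%x. v (x \<otimes> h) - a * v x - F x"])
  have cav: "cont (%x. a * v x)" using cv by (intro continuous_on_mult continuous_on_const)
  have cvv: "cont (%x. v (x \<otimes> h) - a * v x)" by (rule continuous_on_diff[OF cvh cav])
  show cg: "cont (%x. v (x \<otimes> h) - a * v x - F x)" by (rule continuous_on_diff[OF cvv cF])
  fix c i j assume c: "c \<in> ?D" and ij: "i < dm \<rho> c" "j < dm \<rho> c"
  let ?r = "%x. \<rho> c x $$ (i, j)"
  note cr = choice_cont[OF c ij] and u = irreducible_unitary[OF irr[OF c]]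
  have "?r (x \<otimes> h) = \<theta> c j * ?r x" for x
  proof -
   have "?r (x \<otimes> h) = (\<Sum>k<dm \<rho> c. if k = j then \<theta> c j * \<rho> c x $$ (i, k) else 0)"
    unfolding rep_mult_index[OF u ij] using diag[OF c _ ij(2)] by (intro sum.cong refl) auto
   thus ?thesis using ij by simp
  qed
  hence e1: "cip (%x. v (x \<otimes> h)) (%x. \<theta> c j * ?r x) = cip v ?r" using cip_translate[OF cv cr, of h] by simp
  \<comment> \<open>A diagonal unitary matrix has unimodular entries, so the conjugate factor
    produced by translating the coefficient is the inverse of \<theta>.\<close>
  have "(\<Sum>k<dm \<rho> c. (norm (\<rho> c h $$ (j, k)))\<^sup>2) = (\<Sum>k<dm \<rho> c. if k = j then (norm (\<theta> c j))\<^sup>2 else 0)"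
   using diag[OF c ij(2)] by (intro sum.cong refl) auto
  hence "(norm (\<theta> c j))\<^sup>2 = 1" using rep_row_norm[OF u ij(2), of h] ij(2) by simp
  hence "\<theta> c j * cnj (\<theta> c j) = 1" by (simp add: complex_norm_square[symmetric])
  hence e: "cip (%x. v (x \<otimes> h)) ?r = \<theta> c j * cip v ?r"
   unfolding e1[symmetric] cip_scale_right[OF cr cvh] by (simp add: mult.assoc[symmetric])
  have nz: "\<theta> c j - a \<noteq> 0" using dio(1) dio(2)[OF c ij(2)] w1[OF c] less_le_trans[of 0 "\<kappa> / ?w c ^ N" "norm (\<theta> c j - a)"] by auto
  have "cip (%x. v (x \<otimes> h) - a * v x - F x) ?r = \<theta> c j * cip v ?r - a * cip v ?r - ?b c i j"
   by (simp only: cip_diff_left[OF cvv cF cr] cip_diff_left[OF cvh cav cr] cip_scale_left[OF cv cr] e)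
  also have "... = (\<theta> c j - a) * (?b c i j / (\<theta> c j - a)) - ?b c i j" unfolding coeff[OF c ij] by (simp only: left_diff_distrib)
  also have "... = 0" using nz by simp
  finally show "cip ?r (%x. v (x \<otimes> h) - a * v x - F x) = 0" using cip_cnj[OF cg cr] by simp
 qed
 thus ?thesis using sv by (intro exI[of _ v]) simp
qed

end

end

subsection \<open>Equations along the characteristics\<close>

lemma has_vector_derivative_exp:
 fixes B :: "real => complex"
 assumes "(B has_vector_derivative b) (at t)"
 shows "((%t. exp (c * B t)) has_vector_derivative c * b * exp (c * B t)) (at t)"
proof -
 have "((%z. exp (c * z)) has_field_derivative c * exp (c * B t)) (at (B t))" by (auto intro!: derivative_eq_intros)
 from field_vector_diff_chain_at[OF assms this] show ?thesis by (simp add: comp_def mult_ac)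
qed

text \<open>The imaginary part of the principal logarithm represents x modulo 2 pi. Near 1 the
  logarithm is Lipschitz; away from 1 the norm is at least 1/2 and the imaginary part at most pi,
  which is where the factor 2 pi comes from.\<close>

lemma exp_ii_lower_bound:
 "\<exists>k::int. \<bar>x + 2 * pi * of_int k\<bar> \<le> 2 * pi * norm (exp (\<i> * of_real x) - 1)"
proof -
 define z where "z = exp (\<i> * complex_of_real x)"
 have z: "norm z = 1" "z \<noteq> 0" by (simp_all add: z_def)
 have "exp (\<i> * complex_of_real x) = exp (Ln z)" using z by (simp add: z_def[symmetric])
 then obtain n :: int where "\<i> * complex_of_real x = Ln z + (of_int (2 * n) * pi) * \<i>" unfolding exp_eq by (elim exE) (rule that)
 hence "Im (\<i> * complex_of_real x) = Im (Ln z + (of_int (2 * n) * pi) * \<i>)" by (simp only:)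
 hence e: "x + 2 * pi * of_int (- n) = Im (Ln z)" by simp
 have "\<bar>Im (Ln z)\<bar> \<le> 2 * pi * norm (z - 1)"
 proof (cases "norm (z - 1) < 1 / 2")
  case True
  have "\<bar>Im (Ln z)\<bar> \<le> norm (Ln (1 + (z - 1)))" using abs_Im_le_cmod[of "Ln z"] by simp
  also have "... \<le> 2 * norm (z - 1)" by (rule norm_Ln_le[OF True])
  also have "... \<le> 2 * pi * norm (z - 1)" using pi_gt3 by (intro mult_right_mono) auto
  finally show ?thesis .
 next
  case False
  have "\<bar>Im (Ln z)\<bar> \<le> pi" using mpi_less_Im_Ln[OF z(2)] Im_Ln_le_pi[OF z(2)] by linarith
  also have "... \<le> 2 * pi * norm (z - 1)" using False mult_left_mono[of "1 / 2" "norm (z - 1)" "2 * pi"] by simp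
  finally show ?thesis .
 qed
 hence "\<bar>x + 2 * pi * of_int (- n)\<bar> \<le> 2 * pi * norm (exp (\<i> * of_real x) - 1)" by (simp only: e z_def)
 thus ?thesis by (rule exI)
qed

context compact_lie_group
begin

abbreviation "RG \<equiv> prod_atlas real_atlas A"
abbreviation "smoothT u \<equiv> smooth_map RG (std_atlas :: (complex, complex) atlas) u"

lemma RG: "smooth_atlas RG"
 by (rule smooth_atlas_prod[OF smooth_atlas_std atlas])

lemmas RG_fst = smooth_map_fst[OF smooth_atlas_std atlas] and RG_snd = smooth_map_snd[OF smooth_atlas_std atlas]

lemma smoothT_time: "smooth_on UNIV (b :: real => complex) ==> smoothT (%p. b (fst p))"
 by (rule smooth_map_smooth_on[OF RG RG_fst])

lemma smoothT_space: "smooth f ==> smoothT (%p. f (snd p))"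
 by (rule smooth_compose[OF RG RG_snd])

lemma smoothT_at_time: "smoothT u ==> smooth (%x. u (t, x))"
 by (rule smooth_map_compose[OF atlas RG smooth_atlas_std
  smooth_map_Pair[OF atlas smooth_atlas_std atlas smooth_map_const[OF atlas smooth_atlas_std] smooth_map_id[OF atlas]]])

text \<open>The substitution J(t, x) = t times the integral of H(t s, x) over s in [0,1] fixes the
  domain of integration, so that joint smoothness in t and x follows from differentiating under a
  functional.\<close>

lemma antiderivative:
 assumes H: "smoothT H"
 shows "\<exists>J. smoothT J \<and> (\<forall>x. J (0, x) = 0) \<and> (\<forall>t x. ((%\<tau>. J (\<tau>, x)) has_vector_derivative H (t, x)) (at t))"
proof -
 let ?K = "%q::(real \<times> 'g) \<times> real. complex_of_real (fst (fst q)) * H (fst (fst q) * snd q, snd (fst q))"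
 let ?J = "%p. integral {0..1} (%s. ?K (p, s))"
 note S = smooth_atlas_std and M = smooth_atlas_prod[OF RG smooth_atlas_std]
 have ff: "smooth_map (prod_atlas RG std_atlas) std_atlas (%q::(real \<times> 'g) \<times> real. fst (fst q))"
  by (rule smooth_map_compose[OF M RG S smooth_map_fst[OF RG S] RG_fst])
 have sf: "smooth_map (prod_atlas RG std_atlas) A (%q::(real \<times> 'g) \<times> real. snd (fst q))"
  by (rule smooth_map_compose[OF M RG atlas smooth_map_fst[OF RG S] RG_snd])
 have "smooth_map (prod_atlas RG real_atlas) std_atlas ?K"
  by (intro smooth_map_mult[OF M] smooth_map_linear[OF M ff bounded_linear_of_real]
   smooth_map_compose[OF M RG S smooth_map_Pair[OF M S atlas smooth_map_mult[OF M ff smooth_map_snd[OF RG S]] sf] H])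
 moreover have "compact_functional (%f. integral {0..1::real} f)"
  unfolding compact_functional_def
 proof (intro exI[of _ "{0..1}"] exI[of _ 1] conjI allI impI)
  fix f g :: "real => complex" assume fg: "cont f" "cont g"
  have i: "h integrable_on {0..1}" if "cont h" for h :: "real => complex"
   using integrable_continuous_real[OF continuous_on_subset[OF that subset_UNIV]] .
  show "integral {0..1} (%p. f p + g p) = integral {0..1} f + integral {0..1} g" by (rule integral_add[OF i i]) (rule fg)+
 next
  fix f :: "real => complex" and b :: real assume f: "cont f" and b: "\<forall>p\<in>{0..1}. norm (f p) \<le> b"
  have "norm (integral {0..1} f) \<le> b * (1 - 0)"
   by (rule integral_bound) (use b continuous_on_subset[OF f] in auto)
  thus "norm (integral {0..1} f) \<le> 1 * b" by simp
 qed auto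
 ultimately have J: "smoothT ?J" by (rule smooth_map_functional[OF RG S])
 have "((%\<tau>. ?J (\<tau>, x)) has_vector_derivative H (t, x)) (at t)" for t x
 proof -
  \<comment> \<open>An interval that contains both 0 and t in its interior; the derivative is
    local.\<close>
  define R where "R = \<bar>t\<bar> + 1"
  have "continuous_on {-R..R} (%\<tau>. H (\<tau>, x))"
   by (rule continuous_on_compose2[OF smooth_map_continuous[OF H, of UNIV]])
    (auto intro!: continuous_on_Pair continuous_on_id continuous_on_const)
  then obtain \<Phi> where \<Phi>: "\<And>\<tau>. \<tau> \<in> {-R..R} ==> (\<Phi> has_vector_derivative H (\<tau>, x)) (at \<tau> within {-R..R})"
   by (rule antiderivative_continuous) (rule that)
  have eq: "\<Phi> \<tau> - \<Phi> 0 = ?J (\<tau>, x)" if "\<tau> \<in> {-R<..<R}" for \<tau>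
  proof -
   have "((%s. ?K ((\<tau>, x), s)) has_integral \<Phi> (\<tau> * 1) - \<Phi> (\<tau> * 0)) {0..1}"
   proof (rule fundamental_theorem_of_calculus)
    fix s :: real assume s: "s \<in> {0..1}"
    have \<tau>: "\<tau> \<in> {-R..R}" using that by simp
    have im: "\<tau> * s' \<in> {-R..R}" if "s' \<in> {0..1}" for s'
    proof -
     have "\<bar>\<tau> * s'\<bar> \<le> \<bar>\<tau>\<bar> * 1" unfolding abs_mult using that by (intro mult_left_mono) auto
     thus ?thesis using \<tau> by auto
    qed
    have "((%s. \<tau> * s) has_vector_derivative \<tau>) (at s within {0..1})" by (auto intro!: derivative_eq_intros)
    moreover have "(\<Phi> has_vector_derivative H (\<tau> * s, x)) (at (\<tau> * s) within (%s. \<tau> * s) ` {0..1})"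
     using im s by (intro has_vector_derivative_within_subset[OF \<Phi>]) auto
    ultimately have "((\<Phi> \<circ> (%s. \<tau> * s)) has_vector_derivative \<tau> *\<^sub>R H (\<tau> * s, x)) (at s within {0..1})"
     by (rule vector_diff_chain_within)
    thus "((%s. \<Phi> (\<tau> * s)) has_vector_derivative ?K ((\<tau>, x), s)) (at s within {0..1})"
     by (simp add: comp_def scaleR_conv_of_real)
   qed simp
   from integral_unique[OF this, symmetric] show ?thesis by (simp only: mult_1_right mult_zero_right)
  qed
  have "((%\<tau>. \<Phi> \<tau> - \<Phi> 0) has_vector_derivative H (t, x)) (at t)"
  proof -
   have "(\<Phi> has_vector_derivative H (t, x)) (at t within {-R<..<R})"
    by (rule has_vector_derivative_within_subset[OF \<Phi>]) (auto simp: R_def)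
   hence "(\<Phi> has_vector_derivative H (t, x)) (at t)"
    by (subst (asm) has_vector_derivative_within_open) (auto simp: R_def)
   thus ?thesis using has_vector_derivative_diff[OF _ has_vector_derivative_const, of \<Phi> "H (t, x)"] by simp
  qed
  thus ?thesis by (rule has_vector_derivative_transform_within_open[OF _ open_greaterThanLessThan _ eq]) (auto simp: R_def)
 qed
 thus ?thesis by (intro exI[of _ ?J] conjI allI J) simp_all
qed

lemma lie_algebra_flow:
 assumes "X \<in> lie_algebra G A"
 shows "\<exists>\<gamma>. one_parameter_subgroup G A \<gamma> \<and>
  (\<forall>f x t. smooth f \<longrightarrow> ((%t. f (x \<otimes> \<gamma> t)) has_vector_derivative X f (x \<otimes> \<gamma> t)) (at t))"
proof -
 obtain \<gamma> where \<gamma>: "X = left_invariant_vf G A \<gamma>" "one_parameter_subgroup G A \<gamma>"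
  using assms by (auto simp: lie_algebra_def)
 obtain v where v: "left_invariant_vf G A \<gamma> = vf v"
  "\<And>f x t. smooth f ==> ((%t. f (x \<otimes> \<gamma> t)) has_vector_derivative dirD v f (x \<otimes> \<gamma> t)) (at t)"
  by (rule one_parameter_subgroup_vf[OF \<gamma>(2)]) (rule that)
 show ?thesis
  using v(2) by (intro exI[of _ \<gamma>]) (simp add: \<gamma> v(1) vf_def)
qed

lemma one_parameter_subgroup_0: "one_parameter_subgroup G A \<gamma> ==> \<gamma> 0 = \<one>"
proof -
 assume "one_parameter_subgroup G A \<gamma>"
 hence "\<gamma> (0 + 0) = \<gamma> 0 \<otimes> \<gamma> 0" unfolding one_parameter_subgroup_def by blast
 thus ?thesis by simp
qed

lemma smooth_circle_lincomb:
 fixes c1 c2 c3 c4 :: complex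
 assumes y: "y1 \<in> smooth_circle_times A" "y2 \<in> smooth_circle_times A"
 shows "(%p. c1 * y1 p + c2 * cnj (y1 p) + (c3 * y2 p + c4 * cnj (y2 p))) \<in> smooth_circle_times A"
proof -
 have ys: "smoothT y1" "smoothT y2" using y by (auto simp: smooth_circle_times_def)
 have "smoothT (%p. c1 * y1 p + c2 * cnj (y1 p) + (c3 * y2 p + c4 * cnj (y2 p)))"
  by (intro smooth_map_add[OF RG] smooth_map_mult[OF RG] smooth_map_const[OF RG smooth_atlas_std] ys
   smooth_map_linear[OF RG _ bounded_linear_cnj])
 thus ?thesis using y by (auto simp: smooth_circle_times_def)
qed

context
 fixes X :: "'g vf" and \<gamma> :: "real => 'g"
 assumes X: "X \<in> lie_algebra G A" and \<gamma>: "one_parameter_subgroup G A \<gamma>"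
  and flow: "\<forall>f x t. smooth f \<longrightarrow> ((%t. f (x \<otimes> \<gamma> t)) has_vector_derivative X f (x \<otimes> \<gamma> t)) (at t)"
begin

lemma flow_add: "\<gamma> s \<otimes> \<gamma> t = \<gamma> (s + t)"
 using \<gamma> by (simp add: one_parameter_subgroup_def)

lemma flow_add': "x \<otimes> \<gamma> s \<otimes> \<gamma> t = x \<otimes> \<gamma> (s + t)"
 by (simp add: m_assoc flow_add)

lemma smoothT_shear: assumes u: "smoothT u" shows "smoothT (%p. u (fst p, snd p \<otimes> \<gamma> (r * fst p)))"
proof -
 have g: "smooth_map real_atlas A \<gamma>" using \<gamma> by (simp add: one_parameter_subgroup_def)
 have "smooth_map RG A (%p. \<gamma> (r * fst p))"
  by (rule smooth_map_compose[OF RG smooth_atlas_std atlas smooth_map_linear[OF RG RG_fst bounded_linear_mult_right] g])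
 thus ?thesis
  by (intro smooth_map_compose[OF RG RG smooth_atlas_std smooth_map_Pair[OF RG smooth_atlas_std atlas RG_fst
   smooth_map_group_mult[OF RG RG_snd]] u])
qed

text \<open>The chain rule for \<phi> (\<tau>, \<sigma>) = w (\<tau>, x \<otimes> \<gamma> \<sigma>)
  along \<sigma> = r \<tau>. Elements of the one-parameter subgroup commute, so differentiating
  first and translating by \<gamma> (r t) afterwards agrees with applying X to the translated
  function.\<close>

lemma transport:
 assumes w: "smoothT w" and d: "((%\<tau>. w (\<tau>, x \<otimes> \<gamma> (r * t))) has_vector_derivative W) (at t)"
 shows "((%\<tau>. w (\<tau>, x \<otimes> \<gamma> (r * \<tau>))) has_vector_derivative of_real r * X (%z. w (t, z \<otimes> \<gamma> (r * t))) x + W) (at t)"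
proof -
 note S = smooth_atlas_std
 have RR: "smooth_atlas (prod_atlas real_atlas real_atlas)"
  by (rule smooth_atlas_prod[OF S S])
 have g: "smooth_map real_atlas A \<gamma>" using \<gamma> by (simp add: one_parameter_subgroup_def)
 define \<phi> where "\<phi> = (%p::real \<times> real. w (fst p, x \<otimes> \<gamma> (snd p)))"
 have "smooth_map (prod_atlas std_atlas std_atlas) std_atlas \<phi>"
  unfolding \<phi>_def
  by (rule smooth_map_compose[OF RR RG S smooth_map_Pair[OF RR S atlas smooth_map_fst[OF S S]
   smooth_map_group_mult[OF RR smooth_map_const[OF RR atlas] smooth_map_compose[OF RR S atlas smooth_map_snd[OF S S] g]]] w])
 hence sm: "smooth_on UNIV \<phi>" unfolding prod_atlas_std smooth_map_std_std .
 define D where "D = frechet_derivative \<phi> (at (t, r * t))"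
 have D: "(\<phi> has_derivative D) (at (t, r * t))" unfolding D_def by (rule smooth_on_has_derivative[OF sm UNIV_I])
 note lin = has_derivative_linear[OF D]
 have "((%\<tau>. (\<tau>, r * t)) has_derivative (%s. (s, 0))) (at t)" by (auto intro!: derivative_eq_intros)
 from has_derivative_compose[OF this D] have "((%\<tau>. w (\<tau>, x \<otimes> \<gamma> (r * t))) has_derivative (%s. D (s, 0))) (at t)"
  by (simp add: \<phi>_def)
 from has_derivative_unique[OF this d[unfolded has_vector_derivative_def]] have 1: "D (1, 0) = W" by (simp add: fun_eq_iff)
 let ?x = "x \<otimes> \<gamma> (r * t)"
 have "((%\<sigma>. (t, \<sigma>)) has_derivative (%s. (0, s))) (at (r * t))" by (auto intro!: derivative_eq_intros)
 from has_derivative_compose[OF this D] have "((%\<sigma>. w (t, x \<otimes> \<gamma> \<sigma>)) has_derivative (%s. D (0, s))) (at (r * t))"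
  by (simp add: \<phi>_def)
 moreover have "((%\<sigma>. w (t, x \<otimes> \<gamma> \<sigma>)) has_derivative (%s. s *\<^sub>R X (%z. w (t, z)) ?x)) (at (r * t))"
  using flow[rule_format, OF smoothT_at_time[OF w]] unfolding has_vector_derivative_def .
 ultimately have "(%s. D (0, s)) = (%s. s *\<^sub>R X (%z. w (t, z)) ?x)" by (rule has_derivative_unique)
 from fun_cong[OF this, of 1] have 2: "D (0, 1) = X (%z. w (t, z)) ?x" by simp
 have f: "smooth (%z. w (t, z \<otimes> \<gamma> (r * t)))" by (rule smooth_right_translate[OF smoothT_at_time[OF w]])
 have "((%\<sigma>. w (t, x \<otimes> \<gamma> \<sigma> \<otimes> \<gamma> (r * t))) has_vector_derivative X (%z. w (t, z \<otimes> \<gamma> (r * t))) (x \<otimes> \<gamma> 0)) (at 0)"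
  by (rule flow[rule_format, OF f])
 moreover have "((%\<sigma>. w (t, ?x \<otimes> \<gamma> \<sigma>)) has_vector_derivative X (%z. w (t, z)) (?x \<otimes> \<gamma> 0)) (at 0)"
  by (rule flow[rule_format, OF smoothT_at_time[OF w]])
 moreover have "x \<otimes> \<gamma> \<sigma> \<otimes> \<gamma> (r * t) = ?x \<otimes> \<gamma> \<sigma>" for \<sigma> by (simp add: flow_add' add.commute)
 ultimately have 3: "X (%z. w (t, z \<otimes> \<gamma> (r * t))) x = X (%z. w (t, z)) ?x"
  using vector_derivative_unique_at by (simp add: one_parameter_subgroup_0[OF \<gamma>])
 have "((%\<tau>. (\<tau>, r * \<tau>)) has_derivative (%s. (s, r * s))) (at t)" by (auto intro!: derivative_eq_intros)
 from has_derivative_compose[OF this D] have "((%\<tau>. w (\<tau>, x \<otimes> \<gamma> (r * \<tau>))) has_derivative (%s. D (s, r * s))) (at t)"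
  by (simp add: \<phi>_def)
 moreover have "D (s, r * s) = s *\<^sub>R (of_real r * X (%z. w (t, z \<otimes> \<gamma> (r * t))) x + W)" for s
 proof -
  have "(s, r * s) = s *\<^sub>R (1, 0) + (s * r) *\<^sub>R (0, 1)" by simp
  hence "D (s, r * s) = s *\<^sub>R D (1, 0) + (s * r) *\<^sub>R D (0, 1)" by (simp only: linear_add[OF lin] linear_cmul[OF lin])
  thus ?thesis unfolding 1 2 3 by (simp add: scaleR_conv_of_real algebra_simps)
 qed
 ultimately show ?thesis by (simp add: has_vector_derivative_def)
qed

text \<open>With y(t, x) = w(t, x \<gamma>(p0 t)) the transport term disappears, and w(t, z) = exp
  (B t) (v(z) + J(t, z)) solves the remaining linear equation in t for every initial value v.
  Periodicity of y means w(t + 2 pi, z) = w(t, z h); for t = 0 this is the cohomological equation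
  for v.\<close>

lemma scalar_equation:
 fixes b :: "real => complex"
 assumes b: "smooth_on UNIV b" "\<And>t. b (t + 2 * pi) = b t"
  and coh: "\<And>F. smooth F ==> \<exists>v. smooth v \<and> (\<forall>x. v (x \<otimes> \<gamma> (- 2 * pi * p0)) - exp (integral {0..2 * pi} b) * v x = F x)"
  and g: "g \<in> smooth_circle_times A"
 shows "\<exists>y\<in>smooth_circle_times A. \<forall>t x.
  ((%\<tau>. y (\<tau>, x)) has_vector_derivative of_real p0 * X (%z. y (t, z)) x + (b t * y (t, x) + g (t, x))) (at t)"
proof -
 let ?h = "\<gamma> (- 2 * pi * p0)"
 have gs: "smoothT g" and gp: "\<And>t x. g (t + 2 * pi, x) = g (t, x)" using g by (auto simp: smooth_circle_times_def)
 obtain B0 where B0: "smoothT B0" "\<forall>x. B0 (0, x) = 0"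
  "\<forall>t x. ((%\<tau>. B0 (\<tau>, x)) has_vector_derivative b t) (at t)"
  using antiderivative[OF smoothT_time[OF b(1)]] unfolding fst_conv by (elim exE conjE) (rule that)
 define B where "B = (%t. B0 (t, \<one>))"
 have B: "B 0 = 0" "(B has_vector_derivative b t) (at t)" for t using B0 by (simp_all add: B_def)
 have Bs: "smooth_on UNIV B"
  using smooth_map_compose[OF smooth_atlas_std RG smooth_atlas_std smooth_map_Pair[OF smooth_atlas_std smooth_atlas_std atlas
   smooth_map_id[OF smooth_atlas_std] smooth_map_const[OF smooth_atlas_std atlas]] B0(1), of "\<one>"]
  unfolding smooth_map_std_std B_def .
 have "(b has_integral B (2 * pi) - B 0) {0..2 * pi}"
  by (rule fundamental_theorem_of_calculus) (auto intro: has_vector_derivative_at_within B(2))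
 hence B2: "integral {0..2 * pi} b = B (2 * pi)" using B(1) by (simp add: integral_unique)
 have expB: "smoothT (%p. exp (c * B (fst p)))" for c
  by (intro smoothT_time smooth_on_compose[OF open_UNIV open_UNIV _ smooth_on_exp]
   smooth_on_bounded_linear_compose[OF bounded_linear_mult_right] Bs) auto
 have "smoothT (%p. exp (- 1 * B (fst p)) * g (fst p, snd p \<otimes> \<gamma> (- p0 * fst p)))"
  by (rule smooth_map_mult[OF RG expB smoothT_shear[OF gs]])
 from antiderivative[OF this] obtain J where J: "smoothT J" "\<forall>x. J (0, x) = 0"
  "\<forall>t x. ((%\<tau>. J (\<tau>, x)) has_vector_derivative exp (- 1 * B t) * g (t, x \<otimes> \<gamma> (- p0 * t))) (at t)"
  unfolding fst_conv snd_conv by (elim exE conjE) (rule that)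
 have "smooth (%x. exp (B (2 * pi)) * J (2 * pi, x))" by (intro smooth_scale smoothT_at_time J(1))
 from coh[OF this] obtain v where v: "smooth v"
  "\<forall>x. v (x \<otimes> ?h) - exp (B (2 * pi)) * v x = exp (B (2 * pi)) * J (2 * pi, x)"
  unfolding B2 by (elim exE conjE) (rule that)
 define w where "w = (%p. exp (1 * B (fst p)) * (v (snd p) + J p))"
 have w: "smoothT w"
  unfolding w_def by (intro smooth_map_mult[OF RG] smooth_map_add[OF RG] expB J(1) smoothT_space v(1))
 have wd: "((%\<tau>. w (\<tau>, x)) has_vector_derivative b t * w (t, x) + g (t, x \<otimes> \<gamma> (- p0 * t))) (at t)" for t x
 proof -
  have "((%\<tau>. exp (1 * B \<tau>) * (v x + J (\<tau>, x))) has_vector_derivative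
    exp (1 * B t) * (0 + exp (- 1 * B t) * g (t, x \<otimes> \<gamma> (- p0 * t))) + 1 * b t * exp (1 * B t) * (v x + J (t, x))) (at t)"
   by (intro has_vector_derivative_mult has_vector_derivative_exp B(2) has_vector_derivative_add has_vector_derivative_const
    J(3)[rule_format])
  moreover have "exp (1 * B t) * (0 + exp (- 1 * B t) * c) = c" for c by (simp flip: mult.assoc exp_add)
  ultimately show ?thesis by (simp only: w_def fst_conv snd_conv mult_1 add.commute mult.assoc)
 qed
 define y where "y = (%p. w (fst p, snd p \<otimes> \<gamma> (p0 * fst p)))"
 \<comment> \<open>As functions of t both sides solve the same linear equation, since b and g are
   periodic. Hence exp(-B) times their difference is constant, and it vanishes at 0 by the choice of
   v.\<close>
 have per: "w (t + 2 * pi, z) = w (t, z \<otimes> ?h)" for t z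
 proof -
  let ?D = "%\<tau>. w (\<tau> + 2 * pi, z) - w (\<tau>, z \<otimes> ?h)"
  let ?E = "%\<tau>. exp (- 1 * B \<tau>) * ?D \<tau>"
  have "(?E has_derivative (%s. 0)) (at \<tau> within UNIV)" for \<tau>
  proof -
   have "((%\<tau>. \<tau> + 2 * pi) has_vector_derivative 1) (at \<tau>)" by (auto intro!: derivative_eq_intros)
   from vector_diff_chain_at[OF this wd]
   have "((%\<tau>. w (\<tau> + 2 * pi, z)) has_vector_derivative
     b \<tau> * w (\<tau> + 2 * pi, z) + g (\<tau>, z \<otimes> \<gamma> (- p0 * (\<tau> + 2 * pi)))) (at \<tau>)"
    by (simp add: comp_def b(2) gp)
   moreover have "z \<otimes> \<gamma> (- p0 * (\<tau> + 2 * pi)) = z \<otimes> ?h \<otimes> \<gamma> (- p0 * \<tau>)" by (simp add: flow_add' algebra_simps)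
   ultimately have "(?D has_vector_derivative b \<tau> * ?D \<tau>) (at \<tau>)"
    using has_vector_derivative_diff[OF _ wd[of "z \<otimes> ?h" \<tau>]] by (fastforce simp: algebra_simps)
   from has_vector_derivative_mult[OF has_vector_derivative_exp[OF B(2), of "- 1"] this]
   have "(?E has_vector_derivative 0) (at \<tau>)" by (simp add: mult_ac)
   thus ?thesis by (simp add: has_vector_derivative_def)
  qed
  from has_derivative_zero_unique[OF convex_UNIV this UNIV_I UNIV_I, of t 0]
  have "exp (- 1 * B t) * ?D t = ?D 0" by (simp add: B(1))
  also have "?D 0 = 0" using v(2)[rule_format, of z] J(2) by (simp add: w_def B(1) algebra_simps)
  finally show ?thesis by simp
 qed
 have "y (t + 2 * pi, x) = y (t, x)" for t x
 proof -
  have "x \<otimes> \<gamma> (p0 * (t + 2 * pi)) \<otimes> ?h = x \<otimes> \<gamma> (p0 * t)" by (simp add: flow_add' algebra_simps)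
  thus ?thesis by (simp only: y_def fst_conv snd_conv per)
 qed
 hence "y \<in> smooth_circle_times A"
  unfolding smooth_circle_times_def y_def using smoothT_shear[OF w] by simp
 moreover have "((%\<tau>. y (\<tau>, x)) has_vector_derivative
   of_real p0 * X (%z. y (t, z)) x + (b t * y (t, x) + g (t, x))) (at t)" for t x
  using transport[OF w wd[of "x \<otimes> \<gamma> (p0 * t)" t]] by (simp add: y_def flow_add' one_parameter_subgroup_0[OF \<gamma>])
 ultimately show ?thesis by blast
qed

lemma lie_real_lincomb:
 assumes f: "smooth f1" "smooth f2"
 shows "X (%x. c1 * f1 x + c2 * cnj (f1 x) + (c3 * f2 x + c4 * cnj (f2 x))) x
  = c1 * X f1 x + c2 * cnj (X f1 x) + (c3 * X f2 x + c4 * cnj (X f2 x))"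
proof -
 obtain v where v: "\<And>f. smooth f ==> X f = dirD v f"
  using lie_algebra_dirD[OF X] by (elim exE conjE) (rule that, blast)
 note s = smooth_scale smooth_cnj smooth_map_add[OF atlas] f
 have "smooth (%x. c1 * f1 x + c2 * cnj (f1 x) + (c3 * f2 x + c4 * cnj (f2 x)))" by (intro s)
 thus ?thesis using f by (simp add: v dirD_add dirD_scale dirD_cnj smooth_scale smooth_cnj smooth_map_add[OF atlas])
qed

text \<open>The operators d/dt and p0 X commute with conjugation, so on a real-linear combination of
  solutions the transport terms cancel and only an algebraic identity in the lower-order terms
  \<open>D1\<close> and \<open>D2\<close> is left to check.\<close>

lemma vekua_lincomb:
 fixes c1 c2 c3 c4 :: complex
 assumes y: "y1 \<in> smooth_circle_times A" "y2 \<in> smooth_circle_times A"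
  and d: "\<And>t x. ((%\<tau>. y1 (\<tau>, x)) has_vector_derivative of_real p0 * X (%z. y1 (t, z)) x + D1 t x) (at t)"
   "\<And>t x. ((%\<tau>. y2 (\<tau>, x)) has_vector_derivative of_real p0 * X (%z. y2 (t, z)) x + D2 t x) (at t)"
 defines "u \<equiv> %p. c1 * y1 p + c2 * cnj (y1 p) + (c3 * y2 p + c4 * cnj (y2 p))"
 shows "u \<in> smooth_circle_times A"
  and "vekua_op X p0 s \<delta> q \<alpha> u (t, x) = c1 * D1 t x + c2 * cnj (D1 t x) + (c3 * D2 t x + c4 * cnj (D2 t x))
   - (of_real (s t) + \<i> * of_real \<delta> * of_real (q t)) * u (t, x) - \<alpha> * of_real (q t) * cnj (u (t, x))"
proof -
 have ys: "smoothT y1" "smoothT y2" using y by (auto simp: smooth_circle_times_def)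
 show "u \<in> smooth_circle_times A" unfolding u_def by (rule smooth_circle_lincomb[OF y])
 let ?d = "%y D. of_real p0 * X (%z. y (t, z)) x + D t x"
 have cn: "((%\<tau>. cnj (y (\<tau>, x))) has_vector_derivative cnj (?d y D)) (at t)"
  if "((%\<tau>. y (\<tau>, x)) has_vector_derivative ?d y D) (at t)" for y and D :: "real => 'g => complex"
  using bounded_linear.has_vector_derivative[OF bounded_linear_cnj that] .
 have "((%\<tau>. u (\<tau>, x)) has_vector_derivative c1 * ?d y1 D1 + c2 * cnj (?d y1 D1) + (c3 * ?d y2 D2 + c4 * cnj (?d y2 D2))) (at t)"
  unfolding u_def by (intro has_vector_derivative_add has_vector_derivative_mult_right d cn)
 note vd = vector_derivative_at[OF this]
 have "X (%z. u (t, z)) x = c1 * X (%z. y1 (t, z)) x + c2 * cnj (X (%z. y1 (t, z)) x)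
   + (c3 * X (%z. y2 (t, z)) x + c4 * cnj (X (%z. y2 (t, z)) x))"
  unfolding u_def by (rule lie_real_lincomb[OF smoothT_at_time[OF ys(1)] smoothT_at_time[OF ys(2)]])
 thus "vekua_op X p0 s \<delta> q \<alpha> u (t, x) = c1 * D1 t x + c2 * cnj (D1 t x) + (c3 * D2 t x + c4 * cnj (D2 t x))
   - (of_real (s t) + \<i> * of_real \<delta> * of_real (q t)) * u (t, x) - \<alpha> * of_real (q t) * cnj (u (t, x))"
  unfolding vekua_op_def prod.case vd by (simp add: algebra_simps)
qed

end

end

subsection \<open>Solvability\<close>

context compact_lie_group
begin

context
 fixes ip :: "'g vf => 'g vf => real" and \<rho> :: "'g rep set => 'g rep" and X :: "'g vf" and \<gamma> :: "real => 'g"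
 assumes kip: "killing_inner_product G A ip" and diag: "diagonalizing_choice G X \<rho>"
  and X: "X \<in> lie_algebra G A" and \<gamma>: "one_parameter_subgroup G A \<gamma>"
  and flow: "\<forall>f x t. smooth f \<longrightarrow> ((%t. f (x \<otimes> \<gamma> t)) has_vector_derivative X f (x \<otimes> \<gamma> t)) (at t)"
begin

abbreviation "\<mu> c m \<equiv> symbol_freq G X (\<rho> c) m"

lemma \<rho>_in: "\<forall>c\<in>unitary_dual G. \<rho> c \<in> c"
 using diag by (simp add: diagonalizing_choice_def)

lemmas irr_choice = choice_irreducible[OF kip \<rho>_in]

lemma symbol_rep:
 assumes c: "c \<in> unitary_dual G" and ij: "i < dm \<rho> c" "j < dm \<rho> c"
 shows "X (coef (\<rho> c) i j) x = \<i> * of_real (\<mu> c j) * \<rho> c x $$ (i, j)"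
proof -
 let ?d = "dm \<rho> c"
 note u = irreducible_unitary[OF irr_choice[OF c]]
 have one: "X (coef (\<rho> c) k j) \<one> = (if k = j then \<i> * of_real (\<mu> c j) else 0)" if k: "k < ?d" for k
 proof -
  let ?M = "Matrix.mat ?d ?d (%(i, j). X (coef (\<rho> c) i j) \<one>)"
  have "vf_symbol G X (\<rho> c) $$ (k, j) = (\<Sum>l<?d. mat_adjoint (\<rho> c \<one>) $$ (k, l) * ?M $$ (l, j))"
   unfolding vf_symbol_def by (rule mat_mult_index[OF mat_adjoint_carrier[OF rep_carrier[OF u]] _ k ij(2)]) simp
  also have "... = (\<Sum>l<?d. if l = k then X (coef (\<rho> c) k j) \<one> else 0)"
   using rep_one_index[OF u] rep_carrier[OF u, of "\<one>"] k ij(2) by (intro sum.cong refl) (auto simp: mat_adjoint_index)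
  also have "... = X (coef (\<rho> c) k j) \<one>" using k by simp
  finally have "X (coef (\<rho> c) k j) \<one> = vf_symbol G X (\<rho> c) $$ (k, j)" by (rule sym)
  moreover have "vf_symbol G X (\<rho> c) = Matrix.mat ?d ?d (%(i, j). if i = j then \<i> * of_real (\<mu> c i) else 0)"
   using diag c unfolding diagonalizing_choice_def by blast
  ultimately show ?thesis using k ij(2) by simp
 qed
 have "X (coef (\<rho> c) i j) x = (\<Sum>k<?d. \<rho> c x $$ (i, k) * X (coef (\<rho> c) k j) \<one>)"
  by (rule lie_rep(1)[OF kip irr_choice[OF c] X ij])
 also have "... = (\<Sum>k<?d. if k = j then \<rho> c x $$ (i, k) * (\<i> * of_real (\<mu> c j)) else 0)"
  using one by (intro sum.cong refl) auto
 finally show ?thesis using ij by (simp add: mult_ac)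
qed

lemma rep_flow:
 assumes c: "c \<in> unitary_dual G" and ij: "i < dm \<rho> c" "j < dm \<rho> c"
 shows "\<rho> c (\<gamma> t) $$ (i, j) = (if i = j then exp (\<i> * of_real (\<mu> c j) * of_real t) else 0)"
proof -
 let ?r = "%x. \<rho> c x $$ (i, j)" and ?m = "\<i> * of_real (\<mu> c j)"
 let ?E = "%t. exp (- ?m * of_real t) * ?r (\<gamma> t)"
 have "(?E has_derivative (%s. 0)) (at t within UNIV)" for t
 proof -
  have "((%t. ?r (\<one> \<otimes> \<gamma> t)) has_vector_derivative X ?r (\<one> \<otimes> \<gamma> t)) (at t)"
   using flow irreducible_smooth[OF irr_choice[OF c] ij] by blast
  hence 1: "((%t. ?r (\<gamma> t)) has_vector_derivative ?m * ?r (\<gamma> t)) (at t)" by (simp add: symbol_rep[OF c ij])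
  have "((%t. complex_of_real t) has_vector_derivative 1) (at t)" by (auto intro!: derivative_eq_intros)
  from has_vector_derivative_mult[OF has_vector_derivative_exp[OF this, of "- ?m"] 1]
  have "(?E has_vector_derivative 0) (at t)" by (simp add: mult_ac)
  thus ?thesis by (simp add: has_vector_derivative_def)
 qed
 from has_derivative_zero_unique[OF convex_UNIV this UNIV_I UNIV_I, of t 0]
 have "?E t = (if i = j then 1 else 0)"
  using rep_one_index[OF irreducible_unitary[OF irr_choice[OF c]] ij] by (simp add: one_parameter_subgroup_0[OF \<gamma>])
 hence "exp (?m * of_real t) * ?E t = exp (?m * of_real t) * (if i = j then 1 else 0)" by simp
 moreover have "exp (?m * of_real t) * ?E t = ?r (\<gamma> t)" by (simp flip: mult.assoc exp_add)
 ultimately show ?thesis by auto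
qed

text \<open>X is skew and annihilates constants. If all frequencies were nonzero, the function 1
  would be orthogonal to every matrix coefficient, against completeness. The zero frequency stands
  in for the trivial representation.\<close>

lemma zero_frequency: "\<exists>c\<in>unitary_dual G. \<exists>j<dm \<rho> c. \<mu> c j = 0"
proof (rule ccontr)
 assume "\<not> ?thesis"
 hence ne: "\<mu> c j \<noteq> 0" if "c \<in> unitary_dual G" "j < dm \<rho> c" for c j using that by blast
 have one: "smooth (%x. 1)" by (rule smooth_map_const[OF atlas smooth_atlas_std])
 have X1: "X (%x. 1) = (%x. 0)"
  using lie_lincomb[OF X, of "{}" "%_ x. 1" "%_. 1"] lie_algebra_dirD[OF X] one
  by (auto simp: fun_eq_iff dirD_def frechet_derivative_const)
 have "(1 :: complex) = 0"
 proof (rule matrix_coefficients_complete[OF bspec[OF \<rho>_in], where f = "%x. 1" and x = "\<one>"])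
  fix c i j assume c: "c \<in> unitary_dual G" and ij: "i < dm \<rho> c" "j < dm \<rho> c"
  let ?r = "%x. \<rho> c x $$ (i, j)"
  note r = irreducible_smooth[OF irr_choice[OF c] ij]
  have "X ?r = (%x. \<i> * of_real (\<mu> c j) * ?r x)" by (rule ext) (rule symbol_rep[OF c ij])
  hence "cip (X ?r) (%x. 1) = \<i> * of_real (\<mu> c j) * cip ?r (%x. 1)"
   using cip_scale_left[OF smooth_cont[OF r] smooth_cont[OF one]] by simp
  moreover have "cip (X ?r) (%x. 1) = 0" using lie_cip[OF X r one] by (simp add: X1 cip_def)
  ultimately show "cip ?r (%x. 1) = 0" using ne[OF c ij(2)] by simp
 qed (auto intro: continuous_on_const)
 thus False by simp
qed

text \<open>The divisor |\<theta> - a| is the distance of two points on the unit circle, comparable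
  by \<open>exp_ii_lower_bound\<close> with the distance of the phases modulo 2 pi. For weights at
  least M the Diophantine condition bounds it; below M there are only finitely many divisors, and
  they are nonzero.\<close>

lemma cohomological_nonresonant:
 assumes nonres: "\<And>c m k. c \<in> unitary_dual G ==> m < dm \<rho> c ==> 2 * pi * of_int k + 2 * pi * \<mu> c m * p0 - r \<noteq> 0"
  and M: "\<forall>c\<in>unitary_dual G. weight G A ip (\<rho> c) \<ge> M \<longrightarrow> (\<forall>m<dm \<rho> c. \<forall>k::int.
   \<bar>2 * pi * of_int k + 2 * pi * \<mu> c m * p0 - r\<bar> \<ge> weight G A ip (\<rho> c) powr (- M))"
  and F: "smooth F"
 shows "\<exists>v. smooth v \<and> (\<forall>x. v (x \<otimes> \<gamma> (- 2 * pi * p0)) - exp (- \<i> * of_real r) * v x = F x)"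
proof -
 let ?w = "%c. weight G A ip (\<rho> c)" and ?a = "exp (- \<i> * complex_of_real r)"
 define \<theta> where "\<theta> c m = exp (\<i> * of_real (\<mu> c m) * of_real (- 2 * pi * p0))" for c m
 have lower: "\<exists>k::int. \<bar>2 * pi * of_int k + 2 * pi * \<mu> c m * p0 - r\<bar> \<le> 2 * pi * norm (\<theta> c m - ?a)" for c m
 proof -
  define x where "x = r - 2 * pi * \<mu> c m * p0"
  have "\<theta> c m = ?a * exp (\<i> * of_real x)"
   unfolding \<theta>_def exp_add[symmetric] x_def by (simp add: algebra_simps)
  hence "\<theta> c m - ?a = ?a * (exp (\<i> * of_real x) - 1)" by (simp add: algebra_simps)
  hence n: "norm (\<theta> c m - ?a) = norm (exp (\<i> * of_real x) - 1)" by (simp add: norm_mult)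
  obtain k :: int where k: "\<bar>x + 2 * pi * of_int k\<bar> \<le> 2 * pi * norm (exp (\<i> * of_real x) - 1)"
   using exp_ii_lower_bound[of x] by (elim exE) (rule that)
  have "\<bar>2 * pi * of_int (- k) + 2 * pi * \<mu> c m * p0 - r\<bar> = \<bar>x + 2 * pi * of_int k\<bar>" unfolding x_def by simp
  hence "\<bar>2 * pi * of_int (- k) + 2 * pi * \<mu> c m * p0 - r\<bar> \<le> 2 * pi * norm (\<theta> c m - ?a)" using k n by (simp only:)
  thus ?thesis by (rule exI)
 qed
 have pos: "norm (\<theta> c m - ?a) > 0" if "c \<in> unitary_dual G" "m < dm \<rho> c" for c m
 proof -
  obtain k :: int where "\<bar>2 * pi * of_int k + 2 * pi * \<mu> c m * p0 - r\<bar> \<le> 2 * pi * norm (\<theta> c m - ?a)"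
   using lower[of c m] by (elim exE) (rule that)
  with nonres[OF that, of k] have "0 < 2 * pi * norm (\<theta> c m - ?a)" by linarith
  thus ?thesis by (simp add: zero_less_mult_iff)
 qed
 \<comment> \<open>Weights are at least 1, so rounding the exponent M up only weakens the
   bound.\<close>
 define N where "N = nat \<lceil>M\<rceil>"
 define S where "S = (SIGMA c : {c \<in> unitary_dual G. ?w c < M}. {..<dm \<rho> c})"
 \<comment> \<open>The entry 1 / (2 pi) covers the classes of weight at least M, the other entries
   the finitely many remaining divisors.\<close>
 define \<kappa> where "\<kappa> = Min (insert (1 / (2 * pi)) ((%(c, m). norm (\<theta> c m - ?a)) ` S))"
 have "finite S" unfolding S_def using finite_bounded_weight[OF kip \<rho>_in] by (intro finite_SigmaI) auto
 hence fin: "finite (insert (1 / (2 * pi)) ((%(c, m). norm (\<theta> c m - ?a)) ` S))" by simp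
 have \<kappa>: "\<kappa> > 0" unfolding \<kappa>_def using pos by (subst Min_gr_iff[OF fin]) (auto simp: S_def)
 show ?thesis
 proof (rule cohomological_Diophantine[OF kip \<rho>_in F _ \<kappa>])
  show "\<rho> c (\<gamma> (- 2 * pi * p0)) $$ (i, j) = (if i = j then \<theta> c j else 0)"
   if "c \<in> unitary_dual G" "i < dm \<rho> c" "j < dm \<rho> c" for c i j
   unfolding \<theta>_def by (rule rep_flow[OF that])
  fix c m assume c: "c \<in> unitary_dual G" and m: "m < dm \<rho> c"
  have w1: "?w c \<ge> 1" by (rule weight_ge_1[OF kip \<rho>_in c])
  have wN: "?w c ^ N \<ge> 1" using w1 by (rule one_le_power)
  show "\<kappa> / ?w c ^ N \<le> norm (\<theta> c m - ?a)"
  proof (cases "?w c \<ge> M")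
   case True
   obtain k :: int where k: "\<bar>2 * pi * of_int k + 2 * pi * \<mu> c m * p0 - r\<bar> \<le> 2 * pi * norm (\<theta> c m - ?a)"
    using lower[of c m] by (elim exE) (rule that)
   have "?w c powr M \<le> ?w c powr real N"
    using w1 unfolding N_def by (intro powr_mono real_nat_ceiling_ge)
   hence "?w c powr M \<le> ?w c ^ N" using w1 by (simp add: powr_realpow)
   hence "1 / ?w c ^ N \<le> ?w c powr (- M)"
    using w1 unfolding powr_minus_divide by (intro divide_left_mono mult_pos_pos) auto
   also have "... \<le> 2 * pi * norm (\<theta> c m - ?a)"
    by (rule order.trans[OF M[rule_format, OF c True m] k])
   finally have "1 / (2 * pi) * (1 / ?w c ^ N) \<le> 1 / (2 * pi) * (2 * pi * norm (\<theta> c m - ?a))"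
    by (rule mult_left_mono) simp
   moreover have "\<kappa> \<le> 1 / (2 * pi)" unfolding \<kappa>_def by (rule Min_le[OF fin]) simp
   hence "\<kappa> * (1 / ?w c ^ N) \<le> 1 / (2 * pi) * (1 / ?w c ^ N)" using wN by (intro mult_right_mono) auto
   ultimately show ?thesis by simp
  next
   case False
   hence "(c, m) \<in> S" using c m by (simp add: S_def)
   hence "norm (\<theta> c m - ?a) \<in> (%(c, m). norm (\<theta> c m - ?a)) ` S" by (rule rev_image_eqI) simp
   hence "\<kappa> \<le> norm (\<theta> c m - ?a)" unfolding \<kappa>_def by (intro Min_le[OF fin]) simp
   moreover have "\<kappa> / ?w c ^ N \<le> \<kappa> / 1" using wN \<kappa> by (intro divide_left_mono) auto
   ultimately show ?thesis by simp
  qed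
 qed
qed

section \<open>Reduction of the coupled equation to scalar ones\<close>

context
 fixes p0 :: real and q s :: "real => real"
 assumes q: "q \<in> smooth_circle" and s: "s \<in> smooth_circle"
begin

lemma coupled_scalar_equation:
 fixes \<kappa> :: complex
 defines "a \<equiv> exp (of_real (integral {0..2 * pi} s) + \<kappa> * of_real (integral {0..2 * pi} q))"
 assumes g: "g \<in> smooth_circle_times A"
  and coh: "\<And>F. smooth F ==> \<exists>v. smooth v \<and> (\<forall>x. v (x \<otimes> \<gamma> (- 2 * pi * p0)) - a * v x = F x)"
 obtains y where "y \<in> smooth_circle_times A" "\<And>t x. ((%\<tau>. y (\<tau>, x)) has_vector_derivative
  of_real p0 * X (%z. y (t, z)) x + ((of_real (s t) + \<kappa> * of_real (q t)) * y (t, x) + g (t, x))) (at t)"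
proof -
 let ?b = "%t. of_real (s t) + \<kappa> * of_real (q t)"
 have i: "f integrable_on {0..2 * pi}" if "f \<in> smooth_circle" for f
  using that by (intro integrable_continuous_real continuous_on_subset[OF smooth_on_continuous]) (auto simp: smooth_circle_def)
 have "(?b has_integral of_real (integral {0..2 * pi} s) + \<kappa> * of_real (integral {0..2 * pi} q)) {0..2 * pi}"
  by (intro has_integral_add has_integral_mult_right has_integral_of_real integrable_integral i q s)
 hence a: "a = exp (integral {0..2 * pi} ?b)" by (simp only: a_def integral_unique)
 have "smooth_on UNIV (%t. complex_of_real (f t))" if "f \<in> smooth_circle" for f
  using that smooth_on_bounded_linear_compose[OF bounded_linear_of_real open_UNIV] by (auto simp: smooth_circle_def)
 note sm = this
 have "smooth_on UNIV ?b"
  by (intro smooth_on_add[OF open_UNIV] smooth_on_bounded_linear_compose[OF bounded_linear_mult_right open_UNIV] sm q s)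
 moreover have "?b (t + 2 * pi) = ?b t" for t using q s by (simp add: smooth_circle_def)
 ultimately have "\<exists>y\<in>smooth_circle_times A. \<forall>t x. ((%\<tau>. y (\<tau>, x)) has_vector_derivative
   of_real p0 * X (%z. y (t, z)) x + (?b t * y (t, x) + g (t, x))) (at t)"
  using scalar_equation[OF X \<gamma> flow, of ?b p0 g] coh g unfolding a by blast
 thus thesis by (elim bexE) (rule that, assumption, blast)
qed

text \<open>Since N^2 = \<Omega>^2, the maps \<Omega> + N and \<Omega> - N send the plane into the
  eigenspaces of N for \<Omega> and -\<Omega>. The solution is u = (\<Omega> + N) y1 + (\<Omega> -
  N) y2 with y1, y2 solving the scalar equations for kappa = \<Omega> and -\<Omega>; both may have
  the same right-hand side g = f / (2 \<Omega>), because the two maps add up to 2 \<Omega>. The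
  inequality for the integrals says that neither multiplier lies on the unit circle.\<close>

lemma solvable_if_alpha_large:
 fixes \<Omega> \<delta> :: real and \<alpha> :: complex
 assumes \<Omega>: "\<Omega> > 0" "\<Omega>\<^sup>2 = (norm \<alpha>)\<^sup>2 - \<delta>\<^sup>2"
  and ne: "\<bar>integral {0..2 * pi} s\<bar> \<noteq> \<Omega> * integral {0..2 * pi} q" and q0: "integral {0..2 * pi} q > 0"
  and f: "f \<in> smooth_circle_times A"
 shows "\<exists>u\<in>smooth_circle_times A. vekua_op X p0 s \<delta> q \<alpha> u = f"
proof -
 define L where "L = complex_of_real \<Omega>"
 have L: "L \<noteq> 0" "cnj L = L" using \<Omega> by (simp_all add: L_def)
 have "\<alpha> * cnj \<alpha> = of_real (\<Omega>\<^sup>2 + \<delta>\<^sup>2)" using \<Omega>(2) by (simp only: complex_norm_square[symmetric]) simp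
 hence aa: "\<alpha> * cnj \<alpha> = L * L + of_real \<delta> * of_real \<delta>" by (simp add: L_def power2_eq_square)
 define g where "g = (%p. 1 / (2 * L) * f p + 0 * cnj (f p) + (0 * f p + 0 * cnj (f p)))"
 have g: "g \<in> smooth_circle_times A" unfolding g_def by (rule smooth_circle_lincomb[OF f f])
 have gf: "2 * L * g p = f p" for p using L(1) by (simp add: g_def)
 have n: "norm (exp (complex_of_real (integral {0..2 * pi} s) + of_real k * of_real (integral {0..2 * pi} q))) \<noteq> 1"
  if "k = \<Omega> \<or> k = - \<Omega>" for k
 proof
  assume "norm (exp (complex_of_real (integral {0..2 * pi} s) + of_real k * of_real (integral {0..2 * pi} q))) = 1"
  hence "integral {0..2 * pi} s = - (k * integral {0..2 * pi} q)" by (simp add: norm_exp_eq_Re)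
  thus False using that ne mult_pos_pos[OF \<Omega>(1) q0] by auto
 qed
 obtain y1 where y1: "y1 \<in> smooth_circle_times A" "\<And>t x. ((%\<tau>. y1 (\<tau>, x)) has_vector_derivative
  of_real p0 * X (%z. y1 (t, z)) x + ((of_real (s t) + of_real \<Omega> * of_real (q t)) * y1 (t, x) + g (t, x))) (at t)"
  by (rule coupled_scalar_equation[OF g cohomological_hyperbolic[OF _ n[OF disjI1[OF refl]]]]) (assumption, rule that)
 obtain y2 where y2: "y2 \<in> smooth_circle_times A" "\<And>t x. ((%\<tau>. y2 (\<tau>, x)) has_vector_derivative
  of_real p0 * X (%z. y2 (t, z)) x + ((of_real (s t) + of_real (- \<Omega>) * of_real (q t)) * y2 (t, x) + g (t, x))) (at t)"
  by (rule coupled_scalar_equation[OF g cohomological_hyperbolic[OF _ n[OF disjI2[OF refl]]]]) (assumption, rule that)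
 let ?u = "%p. (L + \<i> * of_real \<delta>) * y1 p + \<alpha> * cnj (y1 p) + ((L - \<i> * of_real \<delta>) * y2 p + - \<alpha> * cnj (y2 p))"
 note v = vekua_lincomb[OF X \<gamma> flow y1(1) y2(1) y1(2) y2(2), where ?c1.0 = "L + \<i> * of_real \<delta>" and ?c2.0 = \<alpha>
  and ?c3.0 = "L - \<i> * of_real \<delta>" and ?c4.0 = "- \<alpha>"]
 \<comment> \<open>Primed letters stand for conjugates. Taken as independent variables they make the
   claim a polynomial identity, modulo the two relations for j and for the product of \<alpha> with
   its conjugate.\<close>
 have alg: "(L + j * d) * ((S + L * Q) * Y1 + h) + \<alpha> * ((S + L * Q) * Y1' + h')
   + ((L - j * d) * ((S + - L * Q) * Y2 + h) + - \<alpha> * ((S + - L * Q) * Y2' + h'))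
   - (S + j * d * Q) * ((L + j * d) * Y1 + \<alpha> * Y1' + ((L - j * d) * Y2 + - \<alpha> * Y2'))
   - \<alpha> * Q * ((L - j * d) * Y1' + \<alpha>' * Y1 + ((L + j * d) * Y2' + - \<alpha>' * Y2)) = 2 * L * h"
  (is "?l = _")
  if "j * j = - 1" "\<alpha> * \<alpha>' = L * L + d * d" for j d S Q Y1 Y1' Y2 Y2' h h' \<alpha>' :: complex
 proof -
  have "?l - 2 * L * h = Q * (Y1 - Y2) * (L * L - j * j * (d * d) - \<alpha> * \<alpha>')" by (simp add: algebra_simps)
  also have "... = 0" unfolding that by simp
  finally show ?thesis by simp
 qed
 have "vekua_op X p0 s \<delta> q \<alpha> ?u (t, x) = f (t, x)" for t x
  using v(2)[of s \<delta> q \<alpha> t x] alg[OF _ aa, of \<i> "of_real (s t)" "of_real (q t)" "y1 (t, x)" "g (t, x)" "cnj (y1 (t, x))" "cnj (g (t, x))"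
   "y2 (t, x)" "cnj (y2 (t, x))"] gf[of "(t, x)"] L(2) by (simp add: L_def)
 thus ?thesis using v(1) by (intro bexI[of _ ?u] ext) auto
qed

text \<open>The real-linear map y -> c y + \<alpha> cnj y with c = i (\<delta> - \<omega>) carries
  multiplication by -i \<omega> to the multiplication by i \<delta> combined with \<alpha> cnj. So a
  single complex equation, with kappa = -i \<omega>, solves the coupled one; this sign gives a = exp
  (-i \<omega> q0) for s0 = 0, as in the Diophantine condition.\<close>

lemma solvable_if_alpha_small:
 fixes \<omega> \<delta> :: real and \<alpha> :: complex
 assumes \<alpha>: "\<alpha> \<noteq> 0" and \<omega>: "\<omega> > 0" "\<omega>\<^sup>2 = \<delta>\<^sup>2 - (norm \<alpha>)\<^sup>2"
  and coh: "\<And>F. smooth F ==> \<exists>v. smooth v \<and> (\<forall>x. v (x \<otimes> \<gamma> (- 2 * pi * p0))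
   - exp (of_real (integral {0..2 * pi} s) + - \<i> * of_real \<omega> * of_real (integral {0..2 * pi} q)) * v x = F x)"
  and f: "f \<in> smooth_circle_times A"
 shows "\<exists>u\<in>smooth_circle_times A. vekua_op X p0 s \<delta> q \<alpha> u = f"
proof -
 define c where "c = \<i> * complex_of_real (\<delta> - \<omega>)"
 have cc: "cnj c = - c" by (simp add: c_def)
 have "\<alpha> * cnj \<alpha> = of_real (\<delta>\<^sup>2 - \<omega>\<^sup>2)" using \<omega>(2) by (simp only: complex_norm_square[symmetric]) simp
 hence aa: "\<alpha> * cnj \<alpha> = of_real \<delta> * of_real \<delta> - of_real \<omega> * of_real \<omega>" by (simp add: power2_eq_square)
 \<comment> \<open>The determinant of the real-linear map y -> c y + \<alpha> cnj y, as c is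
   imaginary. It equals 2 \<omega> (\<omega> - \<delta>), and \<omega> differs from \<delta> because
   \<alpha> is nonzero; so f has a preimage g.\<close>
 define N where "N = - (c * c) - \<alpha> * cnj \<alpha>"
 have Nr: "N = of_real (2 * \<omega> * (\<omega> - \<delta>))" unfolding N_def aa by (simp add: c_def algebra_simps power2_eq_square)
 have "\<omega> \<noteq> \<delta>" using \<omega>(2) \<alpha> by auto
 hence N: "N \<noteq> 0" "cnj N = N" using \<omega>(1) by (simp_all only: Nr complex_cnj_complex_of_real of_real_eq_0_iff) simp
 define g where "g = (%p. - c / N * f p + - \<alpha> / N * cnj (f p) + (0 * f p + 0 * cnj (f p)))"
 have g: "g \<in> smooth_circle_times A" unfolding g_def by (rule smooth_circle_lincomb[OF f f])
 have gf: "c * g p + \<alpha> * cnj (g p) = f p" for p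
 proof -
  have "c * g p + \<alpha> * cnj (g p) = (- (c * c) - \<alpha> * cnj \<alpha>) / N * f p"
   by (simp add: g_def N(2) cc add_divide_distrib diff_divide_distrib algebra_simps)
  thus ?thesis using N(1) unfolding N_def[symmetric] by simp
 qed
 obtain y where y: "y \<in> smooth_circle_times A" "\<And>t x. ((%\<tau>. y (\<tau>, x)) has_vector_derivative
  of_real p0 * X (%z. y (t, z)) x + ((of_real (s t) + - \<i> * of_real \<omega> * of_real (q t)) * y (t, x) + g (t, x))) (at t)"
  by (rule coupled_scalar_equation[OF g coh]) (assumption | rule that)+
 let ?u = "%p. c * y p + \<alpha> * cnj (y p) + (0 * y p + 0 * cnj (y p))"
 note v = vekua_lincomb[OF X \<gamma> flow y(1) y(1) y(2) y(2), where ?c1.0 = c and ?c2.0 = \<alpha> and ?c3.0 = 0 and ?c4.0 = 0]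
 have alg: "c * ((S + - j * w * Q) * Y + h) + \<alpha> * ((S + j * w * Q) * Y' + h')
   - (S + j * d * Q) * (c * Y + \<alpha> * Y') - \<alpha> * Q * (- c * Y' + \<alpha>' * Y) = c * h + \<alpha> * h'"
  (is "?l = ?r")
  if "j * j = - 1" "c = j * (d - w)" "\<alpha> * \<alpha>' = d * d - w * w" for j c d w S Q Y Y' h h' \<alpha>' :: complex
 proof -
  have "?l - ?r = Q * Y * (- (j * j) * (d * d - w * w) - \<alpha> * \<alpha>')" unfolding that(2) by (simp add: algebra_simps)
  also have "... = 0" unfolding that(1,3) by simp
  finally show ?thesis by simp
 qed
 have "vekua_op X p0 s \<delta> q \<alpha> ?u (t, x) = f (t, x)" for t x
  using v(2)[of s \<delta> q \<alpha> t x] alg[of \<i> c "of_real \<delta>" "of_real \<omega>" "cnj \<alpha>" "of_real (s t)" "of_real (q t)" "y (t, x)" "g (t, x)"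
   "cnj (y (t, x))" "cnj (g (t, x))"] gf[of "(t, x)"] aa cc by (simp add: c_def)
 thus ?thesis using v(1) by (intro bexI[of _ ?u] ext) auto
qed

end

end

end

theorem theorem5p1:
  fixes G :: "'g::t2_space monoid"
    and A :: "('g, 'e::euclidean_space) atlas"
    and ip :: "'g vf \<Rightarrow> 'g vf \<Rightarrow> real"
    and X :: "'g vf"
    and \<rho> :: "'g rep set \<Rightarrow> 'g rep"
    and p0 \<delta> s0 q0 :: real
    and \<alpha> A0 B0 :: complex
    and q s :: "real \<Rightarrow> real"
  assumes "compact_lie_group G A"
    and "killing_inner_product G A ip"
    and "X \<in> lie_algebra G A" and "vf_norm ip X = 1"
    and "diagonalizing_choice G X \<rho>"
    and "\<alpha> \<noteq> 0"
    and "q \<in> smooth_circle" and "s \<in> smooth_circle"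
    and "\<forall>t. q t \<ge> 0" and "\<exists>t. q t \<noteq> 0"
    and "s0 = integral {0..2 * pi} s" and "q0 = integral {0..2 * pi} q"
    and "A0 = of_real s0 + \<i> * of_real \<delta> * of_real q0" and "B0 = \<alpha> * of_real q0"
    and "cmod B0 > cmod A0
      \<or> (cmod B0 \<le> cmod A0 \<and> cmod \<alpha> > \<bar>\<delta>\<bar> \<and>
          (\<forall>c\<in>unitary_dual G. \<forall>m<rep_dim G (\<rho> c).
             \<not> (\<exists>k::int. resonant A0 B0 p0 (symbol_freq G X (\<rho> c) m) k)))
      \<or> (cmod \<alpha> < \<bar>\<delta>\<bar> \<and> s0 \<noteq> 0)
      \<or> (cmod \<alpha> < \<bar>\<delta>\<bar> \<and> s0 = 0 \<and>
          (\<forall>c\<in>unitary_dual G. \<forall>m<rep_dim G (\<rho> c).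
             \<not> (\<exists>k::int. resonant A0 B0 p0 (symbol_freq G X (\<rho> c) m) k)) \<and>
          (\<exists>M>0. \<forall>c\<in>unitary_dual G. weight G A ip (\<rho> c) \<ge> M \<longrightarrow>
             (\<forall>m<rep_dim G (\<rho> c). \<forall>k::int.
                \<bar>2 * pi * of_int k + 2 * pi * symbol_freq G X (\<rho> c) m * p0
                   - q0 * sqrt (\<delta>\<^sup>2 - (cmod \<alpha>)\<^sup>2)\<bar>
                \<ge> weight G A ip (\<rho> c) powr (- M))))"
  shows "\<forall>f\<in>smooth_circle_times A. \<exists>u\<in>smooth_circle_times A. vekua_op X p0 s \<delta> q \<alpha> u = f"
proof
 interpret compact_lie_group G A by fact
 let ?D = "unitary_dual G" and ?\<mu> = "%c m. symbol_freq G X (\<rho> c) m"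
 note kip = assms(2) and X = assms(3) and diag = assms(5) and s0 = assms(11) and q0 = assms(12)
 obtain \<gamma> where \<gamma>: "one_parameter_subgroup G A \<gamma>"
  and flow: "\<forall>f x t. smooth f \<longrightarrow> ((%t. f (x \<otimes>\<^bsub>G\<^esub> \<gamma> t)) has_vector_derivative X f (x \<otimes>\<^bsub>G\<^esub> \<gamma> t)) (at t)"
  using lie_algebra_flow[OF X] by (elim exE conjE) (rule that)
 \<comment> \<open>If the integral vanished, the continuous nonnegative q would be zero on one
   period, and by periodicity everywhere.\<close>
 have qp: "q0 > 0"
 proof -
  have qc: "continuous_on {0..2 * pi} q"
   using assms(7) continuous_on_subset[OF smooth_on_continuous] by (auto simp: smooth_circle_def)
  have "q0 \<noteq> 0"
  proof
   assume "q0 = 0"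
   hence z: "\<forall>t\<in>{0..2 * pi}. q t = 0" unfolding q0 using integral_eq_0_iff[OF qc] assms(9) by simp
   interpret periodic_fun_simple q "2 * pi" by unfold_locales (use assms(7) in \<open>simp add: smooth_circle_def\<close>)
   have "q t = 0" for t
   proof -
    define n where "n = \<lfloor>t / (2 * pi)\<rfloor>"
    have n: "of_int n * (2 * pi) \<le> t" "t < (of_int n + 1) * (2 * pi)"
     using floor_divide_lower[of "2 * pi" t] floor_divide_upper[of "2 * pi" t] by (simp_all add: n_def)
    have "q t = q (t - of_int n * (2 * pi))" by (rule minus_of_int[symmetric])
    also have "... = 0" using n by (intro bspec[OF z]) (auto simp: algebra_simps)
    finally show ?thesis .
   qed
   thus False using assms(10) by blast
  qed
  moreover have "q0 \<ge> 0" unfolding q0 using assms(9) by (intro integral_nonneg integrable_continuous_real qc) auto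
  ultimately show ?thesis by simp
 qed
 have A2: "(norm A0)\<^sup>2 = s0\<^sup>2 + (\<delta> * q0)\<^sup>2" unfolding assms(13) cmod_power2 by simp
 have B2: "norm B0 = norm \<alpha> * q0" using qp by (simp add: assms(14) norm_mult)
 fix f assume f: "f \<in> smooth_circle_times A"
 let ?goal = "\<exists>u\<in>smooth_circle_times A. vekua_op X p0 s \<delta> q \<alpha> u = f"
 \<comment> \<open>The link between the stated conditions and the multipliers: for |\<alpha>| >
   |\<delta>| the right-hand side vanishes exactly if |s0| = q0 sqrt (|\<alpha>|^2 - \<delta>^2),
   that is, if a multiplier is unimodular.\<close>
 have B_A: "(norm B0)\<^sup>2 - (norm A0)\<^sup>2 = ((norm \<alpha>)\<^sup>2 - \<delta>\<^sup>2) * q0\<^sup>2 - s0\<^sup>2"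
  unfolding A2 B2 by (simp add: power_mult_distrib algebra_simps)
 have large: ?goal if ad: "norm \<alpha> > \<bar>\<delta>\<bar>" and AB: "norm A0 \<noteq> norm B0"
 proof -
  have "\<delta>\<^sup>2 < (norm \<alpha>)\<^sup>2" using power_strict_mono[OF ad abs_ge_zero, of 2] by simp
  hence l: "sqrt ((norm \<alpha>)\<^sup>2 - \<delta>\<^sup>2) > 0" "(sqrt ((norm \<alpha>)\<^sup>2 - \<delta>\<^sup>2))\<^sup>2 = (norm \<alpha>)\<^sup>2 - \<delta>\<^sup>2" by simp_all
  have "\<bar>s0\<bar> \<noteq> sqrt ((norm \<alpha>)\<^sup>2 - \<delta>\<^sup>2) * q0"
  proof
   assume "\<bar>s0\<bar> = sqrt ((norm \<alpha>)\<^sup>2 - \<delta>\<^sup>2) * q0"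
   hence "s0\<^sup>2 = (sqrt ((norm \<alpha>)\<^sup>2 - \<delta>\<^sup>2) * q0)\<^sup>2" by (metis power2_abs)
   hence "(norm B0)\<^sup>2 = (norm A0)\<^sup>2" using B_A l(2) by (simp add: power_mult_distrib)
   thus False using AB by (simp add: power2_eq_iff_nonneg)
  qed
  thus ?thesis
   using qp unfolding s0 q0 by (intro solvable_if_alpha_large[OF kip diag X \<gamma> flow assms(7,8) l _ _ f])
 qed
 have small: ?goal if ad: "norm \<alpha> < \<bar>\<delta>\<bar>"
  and coh: "\<And>F. smooth F ==> \<exists>v. smooth v \<and> (\<forall>x. v (x \<otimes>\<^bsub>G\<^esub> \<gamma> (- 2 * pi * p0))
   - exp (of_real s0 + - \<i> * of_real (sqrt (\<delta>\<^sup>2 - (norm \<alpha>)\<^sup>2)) * of_real q0) * v x = F x)"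
 proof -
  have "(norm \<alpha>)\<^sup>2 < \<delta>\<^sup>2" using power_strict_mono[OF ad norm_ge_zero, of 2] by simp
  hence w: "sqrt (\<delta>\<^sup>2 - (norm \<alpha>)\<^sup>2) > 0" "(sqrt (\<delta>\<^sup>2 - (norm \<alpha>)\<^sup>2))\<^sup>2 = \<delta>\<^sup>2 - (norm \<alpha>)\<^sup>2" by simp_all
  show ?thesis
   by (rule solvable_if_alpha_small[OF kip diag X \<gamma> flow assms(7,8,6) w coh[unfolded s0 q0] f])
 qed
 from assms(15) show ?goal
 proof (elim disjE)
  assume 1: "norm B0 > norm A0"
  \<comment> \<open>|A0| is at least |\<delta>| q0, so |B0| > |A0| forces |\<alpha>| >
    |\<delta>|.\<close>
  have "(\<bar>\<delta>\<bar> * q0)\<^sup>2 \<le> (norm A0)\<^sup>2" unfolding A2 by (simp add: power_mult_distrib)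
  from power2_le_imp_le[OF this norm_ge_zero] have "\<bar>\<delta>\<bar> * q0 < norm \<alpha> * q0" using 1 B2 by linarith
  hence "norm \<alpha> > \<bar>\<delta>\<bar>" using qp by (simp only: mult_less_cancel_right_pos)
  thus ?thesis using 1 by (intro large) auto
 next
  assume 2: "norm B0 \<le> norm A0 \<and> norm \<alpha> > \<bar>\<delta>\<bar> \<and>
   (\<forall>c\<in>?D. \<forall>m<rep_dim G (\<rho> c). \<not> (\<exists>k::int. resonant A0 B0 p0 (?\<mu> c m) k))"
  \<comment> \<open>With frequency 0 and k = 0 the triple would be resonant if |A0| = |B0|, so
    absence of resonance excludes this equality.\<close>
  obtain c m where cm: "c \<in> ?D" "m < rep_dim G (\<rho> c)" "?\<mu> c m = 0"
   using zero_frequency[OF kip diag X \<gamma> flow] by (elim bexE exE conjE) (rule that)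
  have "norm A0 \<noteq> norm B0"
  proof
   assume "norm A0 = norm B0"
   hence "resonant A0 B0 p0 (?\<mu> c m) 0" by (simp add: resonant_def cm(3))
   thus False using 2 cm by blast
  qed
  with 2 show ?thesis by (intro large) auto
 next
  assume 3: "norm \<alpha> < \<bar>\<delta>\<bar> \<and> s0 \<noteq> 0"
  \<comment> \<open>Here the multiplier has modulus exp s0, which differs from 1.\<close>
  show ?thesis
   by (rule small[OF conjunct1[OF 3]], rule cohomological_hyperbolic) (use 3 in \<open>simp_all add: norm_exp_eq_Re\<close>)
 next
  assume 4: "norm \<alpha> < \<bar>\<delta>\<bar> \<and> s0 = 0 \<and>
   (\<forall>c\<in>?D. \<forall>m<rep_dim G (\<rho> c). \<not> (\<exists>k::int. resonant A0 B0 p0 (?\<mu> c m) k)) \<and>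
   (\<exists>M>0. \<forall>c\<in>?D. weight G A ip (\<rho> c) \<ge> M \<longrightarrow> (\<forall>m<rep_dim G (\<rho> c). \<forall>k::int.
    \<bar>2 * pi * of_int k + 2 * pi * ?\<mu> c m * p0 - q0 * sqrt (\<delta>\<^sup>2 - (norm \<alpha>)\<^sup>2)\<bar> \<ge> weight G A ip (\<rho> c) powr (- M)))"
  then obtain M where ad: "norm \<alpha> < \<bar>\<delta>\<bar>" and z: "s0 = 0" and nr: "\<forall>c\<in>?D. \<forall>m<rep_dim G (\<rho> c). \<not> (\<exists>k::int. resonant A0 B0 p0 (?\<mu> c m) k)"
   and M: "\<forall>c\<in>?D. weight G A ip (\<rho> c) \<ge> M \<longrightarrow> (\<forall>m<rep_dim G (\<rho> c). \<forall>k::int.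
    \<bar>2 * pi * of_int k + 2 * pi * ?\<mu> c m * p0 - q0 * sqrt (\<delta>\<^sup>2 - (norm \<alpha>)\<^sup>2)\<bar> \<ge> weight G A ip (\<rho> c) powr (- M))"
   by (elim conjE exE) (rule that)
  let ?r = "q0 * sqrt (\<delta>\<^sup>2 - (norm \<alpha>)\<^sup>2)"
  have "(norm \<alpha>)\<^sup>2 < \<delta>\<^sup>2" using power_strict_mono[OF ad norm_ge_zero, of 2] by simp
  hence r2: "?r\<^sup>2 = (norm A0)\<^sup>2 - (norm B0)\<^sup>2" using B_A z by (simp add: power_mult_distrib algebra_simps)
  \<comment> \<open>As s0 = 0, A0 is purely imaginary and the first half of the resonance condition
    holds for every k; a vanishing divisor would give the second half after squaring, by
    \<open>r2\<close>.\<close>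
  have nonres: "2 * pi * of_int k + 2 * pi * ?\<mu> c m * p0 - ?r \<noteq> 0" if c: "c \<in> ?D" "m < rep_dim G (\<rho> c)" for c m and k :: int
  proof
   assume "2 * pi * of_int k + 2 * pi * ?\<mu> c m * p0 - ?r = 0"
   hence "(2 * pi * (of_int k + ?\<mu> c m * p0))\<^sup>2 = ?r\<^sup>2" by (simp add: algebra_simps)
   hence "4 * pi\<^sup>2 * \<bar>of_int k + ?\<mu> c m * p0\<bar>\<^sup>2 = (norm A0)\<^sup>2 - (norm B0)\<^sup>2"
    unfolding r2 by (simp only: power_mult_distrib power2_abs) simp
   hence "resonant A0 B0 p0 (?\<mu> c m) k" by (simp add: resonant_def assms(13) z)
   thus False using nr c by blast
  qed
  have "exp (of_real s0 + - \<i> * of_real (sqrt (\<delta>\<^sup>2 - (norm \<alpha>)\<^sup>2)) * of_real q0) = exp (- \<i> * complex_of_real ?r)"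
   by (simp add: z mult_ac)
  thus ?thesis
   using small[OF ad] cohomological_nonresonant[OF kip diag X \<gamma> flow nonres M] by simp
 qed
qed

end
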